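(* Assume that $K_n\to\infty$ as $n\to\infty$, and let $\rho(X^n)$ be the spectral radius of $X^n$. Then $\rho(X^n)\to1$ in probability as $n\to\infty$.
   Context: Let $\chi$ be a complex-valued random variable with $\mathbb{E}\chi=0$ and $\mathbb{E}|\chi|^2=1$. For each $n\ge1$, $A^n=(A^n_{ij})_{i,j=1}^n$ is a random matrix with i.i.d. entries distributed as $\chi$. $(K_n)$ is a sequence of positive integers with $K_n\le n$; $B^n=(B^n_{ij})$ is an $n\times n$ matrix with i.i.d. Bernoulli ($\{0,1\}$-valued) entries with $\mathbb P(B^n_{11}=1)=K_n/n$, independent of $A^n$. The $n\times n$ matrix $X^n$ has entries $X^n_{ij}=\frac1{\sqrt{K_n}}B^n_{ij}A^n_{ij}$. *)

theory Defs
  imports "HOL-Probability.Probability" "Jordan_Normal_Form.Spectral_Radius"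
begin

(* The positions of an n x n matrix, with rows and columns numbered 0,...,n-1 as in Matrix. *)
definition positions :: "nat \<Rightarrow> (nat \<times> nat) set" where
  "positions n = {..<n} \<times> {..<n}"

definition sparse_matrix ::
    "nat \<Rightarrow> nat \<Rightarrow> (nat \<Rightarrow> nat \<Rightarrow> complex) \<Rightarrow> (nat \<Rightarrow> nat \<Rightarrow> complex) \<Rightarrow> complex mat" where
  "sparse_matrix n k a b =
     mat n n (\<lambda>(i, j). complex_of_real (1 / sqrt (real k)) * b i j * a i j)"

(* The variables may live on different spaces M n, as the limit is a constant.
   Measurability is part of the notion: the measure of a non-measurable set is 0 by
   convention, so the limit alone would say nothing about non-measurable Y n. *)
definition tendsto_in_probability ::
    "(nat \<Rightarrow> 'a measure) \<Rightarrow> (nat \<Rightarrow> 'a \<Rightarrow> real) \<Rightarrow> real \<Rightarrow> bool" where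
  "tendsto_in_probability M Y c \<longleftrightarrow>
     (\<forall>n. Y n \<in> borel_measurable (M n)) \<and>
     (\<forall>\<epsilon>>0. (\<lambda>n. measure (M n) {\<omega> \<in> space (M n). \<bar>Y n \<omega> - c\<bar> > \<epsilon>}) \<longlonglongrightarrow> 0)"

end

theory Submission
  imports Defs "HOL-Computational_Algebra.Formal_Power_Series"
begin

text \<open>
  For a set R of rows let Q_R(z) = det (1 - z D_R X), where D_R keeps the rows in R, read as a formal
  power series in z. Adding a row i to R changes Q_R by - z times a linear form in the entries of row i
  whose coefficients do not involve row i, so second moments can be computed by exposing the rows
  one at a time.

  Upper bound: truncating the entries changes each coefficient of Q only slightly in mean square, and for
  truncated entries a count of closed walks bounds the second moment of tr X^j by j + 2. Hence log Q,
  and with it 1/Q, has norm bounded in probability on |z| <= r for every r < 1, and a bounded 1/Q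
  excludes eigenvalues of modulus greater than 1/r.

  Lower bound: suppose that the spectral radius is at most 1 - eps and take m of order log n with
  (1 - eps)^m <= n^(-2). Then tr X^(m+1) is tiny, and comparing Q with its version Q_R without row 0 shows
  that the product of row 0 with W = (D_R X)^m e_0 lies close to a number independent of row 0.
  But W is not small: the soft norm, the sum over l of b (1 - exp (- |W_l|^2 / b)), loses at most a constant
  factor in each step, in mean by a Gaussian small ball estimate for a single row and with high probability by
  a variance bound. So W has a positive fraction of coordinates of order at least r^(m/2) / sqrt n, and since a row
  has about K_n nonzero entries and K_n tends to infinity, its product with W avoids small discs
  with high probability.
\<close>

section \<open>Characteristic series of a matrix restricted to a set of rows\<close>

text \<open>Only second moments are available, and K_n may grow arbitrarily slowly, so estimates of
  high moments or of smallest singular values are out of reach. Defining Q from traces by Newton's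
  identities makes the addition of a row a statement about logarithmic derivatives, and no
  determinant has to be expanded. The walk count comes with the constant (2 k)!, so it serves only
  boundedly many degrees; it yields a polynomial approximate inverse of Q, and the moment bounds for
  Q, uniform in the degree, do the rest. In the lower bound the small ball estimate for one row
  improves only as K_n grows, with no rate in n. It cannot be paid for in each of about log n steps
  and is used once, for row 0. The steps instead sum a bounded function over all rows; cutting off
  the vectors in a Lipschitz way makes the removal of a row change them by order 1/n in mean square,
  which yields concentration. The growth loses a factor r per step, with r so close to 1 that r^m is
  a small negative power of n; all error terms fit into the remaining room.\<close>

no_notation vec_index (infixl "$" 100)
unbundle no vec_syntax
unbundle fps_syntax

type_synonym entries = "nat => nat => complex"

abbreviation bmeas :: "'a measure => ('a => 'b :: topological_space) set" where "bmeas M == borel_measurable M"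

lemma sum_geometric_le:
fixes q :: real
assumes "0 <= q" "q < 1" "finite S"
shows "(SUM l:S. q ^ l) <= 1 / (1 - q)"
using sum_le_suminf[of "%l. q ^ l" S] assms by (simp add: summable_geometric suminf_geometric)

(* rpow n R x i k l is the (l, i) entry of (D_R x)^k; trs collects the traces, chs is det (1 - z D_R x)
   obtained from them by Newton's identities, ichs its inverse, and adj gives the entries of the adjugate. *)
fun rpow :: "nat => nat set => entries => nat => nat => nat => complex" where
"rpow n R x i 0 l = (if l = i then 1 else 0)"
| "rpow n R x i (Suc k) l = (if l : R then SUM m<n. x l m * rpow n R x i k m else 0)"

text \<open>Column \<open>i\<close> of the resolvent of D_R x, that is of (1 - z D_R x)^(-1), entry
  by entry as a formal power series.\<close>

definition resv :: "nat => nat set => entries => nat => nat => complex fps" where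
"resv n R x i l = Abs_fps (%k. rpow n R x i k l)"

definition lin_form :: "nat => (nat => complex) => (nat => complex fps) => complex fps" where
"lin_form n a F = (SUM m<n. fps_const (a m) * F m)"

definition trs :: "nat => nat set => entries => complex fps" where
"trs n R x = Abs_fps (%k. if k = 0 then 0 else SUM l<n. rpow n R x l k l)"

fun newton :: "(nat => complex) => nat => complex" where
"newton t 0 = 1"
| "newton t (Suc k) = - (SUM j<=k. t (Suc j) * newton t (k - j)) / of_nat (Suc k)"

definition chs :: "nat => nat set => entries => complex fps" where
"chs n R x = Abs_fps (newton (fps_nth (trs n R x)))"

definition ichs :: "nat => nat set => entries => complex fps" where
"ichs n R x = Abs_fps (newton (%k. - trs n R x $ k))"

definition adj :: "nat => nat set => entries => nat => nat => complex fps" where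
"adj n R x i l = chs n R x * resv n R x i l"

text \<open>Newton's recursion is the equation z Q' = - T Q read coefficient by coefficient, so Q =
  exp (- sum t_k z^k / k). Determinant identities are thereby reduced to identities between
  logarithmic derivatives.\<close>

lemma newton_deriv:
fixes t :: "nat => complex"
assumes "t 0 = 0"
shows "fps_X * fps_deriv (Abs_fps (newton t)) = - (Abs_fps t * Abs_fps (newton t))"
proof (rule fps_ext)
fix k
show "(fps_X * fps_deriv (Abs_fps (newton t))) $ k = (- (Abs_fps t * Abs_fps (newton t))) $ k"
proof (cases k)
 case 0
 thus ?thesis using assms by simp
next
 case (Suc m)
 have "(SUM i=0..Suc m. t i * newton t (Suc m - i)) = (SUM j<=m. t (Suc j) * newton t (m - j))"
  using assms sum.atLeast0_atMost_Suc_shift[of "%i. t i * newton t (Suc m - i)" m]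
  by (simp add: atMost_atLeast0 del: sum.cl_ivl_Suc newton.simps)
 moreover have "newton t (Suc m) * of_nat (Suc m) = - (SUM j<=m. t (Suc j) * newton t (m - j))" by (simp del: of_nat_Suc)
 ultimately show ?thesis using Suc fps_mult_nth[of "Abs_fps t" "Abs_fps (newton t)" k]
  by (simp add: mult.commute del: newton.simps sum.cl_ivl_Suc of_nat_Suc)
qed
qed

text \<open>The difference h solves the same equation with h_0 = 0. Since T has no constant term, k
  h_k involves only earlier coefficients.\<close>

lemma fps_log_deriv_unique:
fixes f g T :: "complex fps"
assumes f: "fps_X * fps_deriv f = T * f" and g: "fps_X * fps_deriv g = T * g"
 and "T $ 0 = 0" and "f $ 0 = g $ 0"
shows "f = g"
proof -
define h where "h = f - g"
have h: "fps_X * fps_deriv h = T * h" by (simp add: h_def algebra_simps f g)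
have "h $ k = 0" for k
proof (induction k rule: less_induct)
 case (less k)
 show ?case
 proof (cases k)
  case 0
  thus ?thesis using assms by (simp add: h_def)
 next
  case (Suc m)
  have "(T * h) $ k = 0" unfolding fps_mult_nth
  proof (rule sum.neutral, safe)
   fix i assume "i : {0..k}"
   thus "T $ i * h $ (k - i) = 0" using less[of "k - i"] assms(3) Suc by (cases "i = 0") auto
  qed
  moreover have "(fps_X * fps_deriv h) $ k = of_nat k * h $ k" using Suc by simp
  ultimately show ?thesis using h Suc by (simp del: of_nat_Suc)
 qed
qed
thus ?thesis by (simp add: h_def fps_eq_iff)
qed

lemma trs_0 [simp]: "trs n R x $ 0 = 0" by (simp add: trs_def)

lemma chs_0 [simp]: "chs n R x $ 0 = 1" by (simp add: chs_def)

lemma ichs_0 [simp]: "ichs n R x $ 0 = 1" by (simp add: ichs_def)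

lemma chs_deriv: "fps_X * fps_deriv (chs n R x) = - trs n R x * chs n R x"
proof -
have "Abs_fps (fps_nth (trs n R x)) = trs n R x" by (rule fps_ext) simp
thus ?thesis unfolding chs_def by (subst newton_deriv) auto
qed

lemma ichs_deriv: "fps_X * fps_deriv (ichs n R x) = trs n R x * ichs n R x"
proof -
have "Abs_fps (%k. - trs n R x $ k) = - trs n R x" by (rule fps_ext) simp
thus ?thesis unfolding ichs_def by (subst newton_deriv) (simp_all del: fps_neg_nth, simp)
qed

lemma chs_mult_inv [simp]: "chs n R x * ichs n R x = 1"
proof (rule fps_log_deriv_unique[where T = 0])
show "fps_X * fps_deriv (chs n R x * ichs n R x) = 0 * (chs n R x * ichs n R x)"
proof -
 have "fps_X * fps_deriv (chs n R x * ichs n R x) = chs n R x * (fps_X * fps_deriv (ichs n R x)) +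
  (fps_X * fps_deriv (chs n R x)) * ichs n R x" by (simp add: algebra_simps)
 thus ?thesis by (simp add: chs_deriv ichs_deriv algebra_simps)
qed
qed auto

lemma chs_unique:
assumes "fps_X * fps_deriv f = - trs n R x * f" "f $ 0 = 1"
shows "f = chs n R x" using fps_log_deriv_unique[OF assms(1) chs_deriv] assms(2) by simp

lemma resv_eq: "resv n R x i l = (if l = i then 1 else 0) + (if l : R then fps_X * lin_form n (x l) (resv n R x i) else 0)"
proof (rule fps_ext)
fix k show "resv n R x i l $ k = ((if l = i then 1 else 0) + (if l : R then fps_X * lin_form n (x l) (resv n R x i) else 0)) $ k"
 by (cases k) (auto simp: resv_def lin_form_def fps_sum_nth)
qed

lemma lin_form_mult: "lin_form n a (%m. u * F m) = u * lin_form n a F" by (simp add: lin_form_def sum_distrib_left mult_ac)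

lemma lin_form_add: "lin_form n a (%m. F m + G m) = lin_form n a F + lin_form n a G" by (simp add: lin_form_def sum.distrib algebra_simps)

lemma lin_form_nth: "lin_form n a F $ k = (SUM m<n. a m * F m $ k)" by (simp add: lin_form_def fps_sum_nth)

text \<open>The factor \<open>fps_X\<close> makes coefficient k + 1 of a solution depend only on
  coefficients of degree k, and coefficient 0 is given by \<open>c\<close>.\<close>

lemma row_system_unique:
assumes F: "!!l. l < n ==> F l = c l + (if l : R then fps_X * lin_form n (x l) F else 0)"
 and G: "!!l. l < n ==> G l = c l + (if l : R then fps_X * lin_form n (x l) G else 0)"
 and "l < n"
shows "F l = G l"
proof (rule fps_ext)
fix k
show "F l $ k = G l $ k" using \<open>l < n\<close>
proof (induction k arbitrary: l)
 case 0
 thus ?case by (subst F, simp, subst G, simp, simp)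
next
 case (Suc k)
 thus ?case by (subst F, simp, subst G, simp) (simp add: lin_form_nth)
qed
qed

context
fixes n :: nat and R :: "nat set" and x :: "entries" and i :: nat
assumes i: "i ~: R" "i < n"
begin

text \<open>The Sherman-Morrison formula: activating row \<open>i\<close> adds the source
  \<open>Y\<close> at position \<open>i\<close>, and by linearity the response is \<open>Y\<close>
  times column \<open>i\<close> of the old resolvent. The right side still contains the new
  resolvent.\<close>

lemma resv_insert:
assumes "l < n"
shows "resv n (insert i R) x m l = resv n R x m l + resv n R x i l * (fps_X * lin_form n (x i) (resv n (insert i R) x m))"
proof -
define Y where "Y = fps_X * lin_form n (x i) (resv n (insert i R) x m)"
define c where "c = (%l. (if l = m then 1 else 0) + (if l = i then Y else 0))"
have "resv n (insert i R) x m l = resv n R x m l + Y * resv n R x i l"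
proof (rule row_system_unique[where c = c and R = R and n = n and x = x
   and F = "%l. resv n (insert i R) x m l"
   and G = "%l. resv n R x m l + Y * resv n R x i l"])
 fix l
 show "resv n (insert i R) x m l = c l + (if l : R then fps_X * lin_form n (x l) (resv n (insert i R) x m) else 0)"
  using i by (subst resv_eq) (auto simp: c_def Y_def)
 show "resv n R x m l + Y * resv n R x i l = c l +
   (if l : R then fps_X * lin_form n (x l) (%l. resv n R x m l + Y * resv n R x i l) else 0)"
  using i resv_eq[of n R x m l] resv_eq[of n R x i l] by (auto simp: c_def lin_form_add lin_form_mult algebra_simps)
qed fact
thus ?thesis by (simp add: Y_def mult_ac)
qed

text \<open>Applying row \<open>i\<close> to \<open>resv_insert\<close> leaves a scalar equation for
  the unknown form.\<close>

lemma lin_form_resv_insert: "(1 - fps_X * lin_form n (x i) (resv n R x i)) * lin_form n (x i) (resv n (insert i R) x m)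
  = lin_form n (x i) (resv n R x m)"
proof -
define Y where "Y = lin_form n (x i) (resv n (insert i R) x m)"
have "Y = lin_form n (x i) (%l. resv n R x m l + (fps_X * Y) * resv n R x i l)"
 unfolding Y_def by (subst lin_form_def, subst lin_form_def, rule sum.cong) (use resv_insert[of _ m] in \<open>auto simp: mult_ac\<close>)
also have "... = lin_form n (x i) (resv n R x m) + fps_X * Y * lin_form n (x i) (resv n R x i)" by (simp only: lin_form_add lin_form_mult)
finally have "Y = lin_form n (x i) (resv n R x m) + fps_X * Y * lin_form n (x i) (resv n R x i)" .
thus ?thesis unfolding Y_def[symmetric] by (simp add: algebra_simps)
qed

end

lemma rpow_add: "p < n ==> (SUM l<n. rpow n R x l a p * rpow n R x i b l) = rpow n R x i (a + b) p"
proof (induction a arbitrary: p)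
case 0
have "(SUM l<n. rpow n R x l 0 p * rpow n R x i b l) = (SUM l<n. if p = l then rpow n R x i b l else 0)" by (intro sum.cong refl) simp
thus ?case using 0 by simp
next
case (Suc a)
show ?case
proof (cases "p : R")
 case True
 have "(SUM l<n. rpow n R x l (Suc a) p * rpow n R x i b l) = (SUM l<n. SUM m<n. x p m * (rpow n R x l a m * rpow n R x i b l))"
  using True by (simp add: sum_distrib_right mult.assoc)
 also have "... = (SUM m<n. x p m * (SUM l<n. rpow n R x l a m * rpow n R x i b l))" by (subst sum.swap) (simp add: sum_distrib_left)
 also have "... = (SUM m<n. x p m * rpow n R x i (a + b) m)" using Suc.IH by simp
 finally show ?thesis using True by simp
qed simp
qed

text \<open>The k + 1 ways of splitting k into a + b all give the same power, so the square of the
  resolvent has the coefficients (k + 1) (D_R x)^k.\<close>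

lemma resv_square:
assumes "p < n"
shows "(SUM l<n. resv n R x l p * resv n R x i l) = fps_deriv (fps_X * resv n R x i p)"
proof (rule fps_ext)
fix k
have "(SUM l<n. resv n R x l p * resv n R x i l) $ k = (SUM l<n. SUM a=0..k. rpow n R x l a p * rpow n R x i (k - a) l)"
 by (simp add: fps_sum_nth fps_mult_nth resv_def)
also have "... = (SUM a=0..k. rpow n R x i (a + (k - a)) p)" by (subst sum.swap) (simp add: rpow_add assms)
also have "... = of_nat (Suc k) * rpow n R x i k p" by simp
finally show "(SUM l<n. resv n R x l p * resv n R x i l) $ k = fps_deriv (fps_X * resv n R x i p) $ k"
 by (simp only: fps_deriv_nth fps_mult_fps_X_commute fps_X_mult_nth) (simp add: resv_def)
qed

lemma trs_resv: "trs n R x = (SUM l<n. resv n R x l l) - of_nat n"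
proof (rule fps_ext)
fix k show "trs n R x $ k = ((SUM l<n. resv n R x l l) - of_nat n) $ k"
 by (cases k) (auto simp: trs_def fps_sum_nth resv_def fps_of_nat[symmetric])
qed

context
fixes n :: nat and R :: "nat set" and x :: "entries" and i :: nat
assumes i: "i ~: R" "i < n"
begin

text \<open>Divided by 1 - z g, the right side is minus z times the logarithmic derivative of 1 - z
  g. The trace of the rank one correction produces the square of the old resolvent, and
  \<open>resv_square\<close> turns it into a derivative.\<close>

lemma trs_insert:
defines "g \<equiv> lin_form n (x i) (resv n R x i)"
shows "(trs n (insert i R) x - trs n R x) * (1 - fps_X * g) = fps_X * fps_deriv (fps_X * g)"
proof -
define Y where "Y = (%m. lin_form n (x i) (resv n (insert i R) x m))"
have "trs n (insert i R) x - trs n R x = (SUM l<n. resv n R x i l * (fps_X * Y l))" unfolding trs_resv Y_def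
 by (simp add: sum_subtractf[symmetric]) (intro sum.cong refl, subst resv_insert[OF i], auto)
hence "(trs n (insert i R) x - trs n R x) * (1 - fps_X * g) = (SUM l<n. resv n R x i l * fps_X * ((1 - fps_X * g) * Y l))"
 by (simp only: sum_distrib_right mult.assoc mult.commute[of "Y _"])
also have "... = (SUM l<n. resv n R x i l * fps_X * lin_form n (x i) (resv n R x l))"
 unfolding Y_def g_def by (simp add: lin_form_resv_insert[OF i])
also have "... = (SUM l<n. SUM p<n. fps_X * (fps_const (x i p) * (resv n R x l p * resv n R x i l)))"
 by (simp add: lin_form_def sum_distrib_left mult_ac)
also have "... = (SUM p<n. fps_X * (fps_const (x i p) * (SUM l<n. resv n R x l p * resv n R x i l)))"
 by (subst sum.swap) (simp add: sum_distrib_left)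
also have "... = (SUM p<n. fps_X * (fps_const (x i p) * fps_deriv (fps_X * resv n R x i p)))" by (simp add: resv_square)
also have "... = fps_X * fps_deriv (fps_X * g)" unfolding g_def lin_form_def
 by (simp add: sum_distrib_left fps_deriv_sum algebra_simps sum.distrib)
finally show ?thesis .
qed

text \<open>The matrix determinant lemma, obtained by checking that the right side has the
  logarithmic derivative of the left side.\<close>

lemma chs_insert_factor: "chs n (insert i R) x = chs n R x * (1 - fps_X * lin_form n (x i) (resv n R x i))"
proof -
define g where "g = lin_form n (x i) (resv n R x i)"
let ?q = "chs n R x" and ?T = "trs n R x" and ?T' = "trs n (insert i R) x"
have "fps_X * fps_deriv (?q * (1 - fps_X * g)) = (fps_X * fps_deriv ?q) * (1 - fps_X * g) - ?q * (fps_X * fps_deriv (fps_X * g))"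
 by (simp add: algebra_simps)
also have "... = - ?T * ?q * (1 - fps_X * g) - ?q * ((?T' - ?T) * (1 - fps_X * g))"
 using trs_insert[folded g_def] by (simp only: chs_deriv)
also have "... = - ?T' * (?q * (1 - fps_X * g))" by (simp add: algebra_simps)
finally show ?thesis unfolding g_def[symmetric] by (intro chs_unique[symmetric]) auto
qed

lemma chs_insert: "chs n (insert i R) x = chs n R x - fps_X * lin_form n (x i) (adj n R x i)"
unfolding chs_insert_factor adj_def by (simp add: lin_form_mult algebra_simps)

text \<open>Multiplication by the determinant cancels the denominator 1 - z g, so the adjugate entry
  in the new row is linear in that row, with coefficients that do not see it.\<close>

lemma adj_insert:
assumes "m ~= i"
shows "adj n (insert i R) x m i = fps_X * lin_form n (x i) (adj n R x m)"
proof -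
have "resv n (insert i R) x m i = fps_X * lin_form n (x i) (resv n (insert i R) x m)" using assms by (subst resv_eq) auto
hence "adj n (insert i R) x m i = chs n R x * fps_X *
  ((1 - fps_X * lin_form n (x i) (resv n R x i)) * lin_form n (x i) (resv n (insert i R) x m))"
 unfolding adj_def chs_insert_factor by (simp only: mult_ac)
also have "... = chs n R x * fps_X * lin_form n (x i) (resv n R x m)" by (simp only: lin_form_resv_insert[OF i])
also have "... = fps_X * lin_form n (x i) (adj n R x m)" unfolding adj_def by (simp add: lin_form_mult mult_ac)
finally show ?thesis .
qed

end

lemma adj_diag: "i ~: R ==> adj n R x i i = chs n R x" unfolding adj_def by (subst resv_eq) simp

lemma adj_zero: "l ~: R ==> l ~= i ==> adj n R x i l = 0" unfolding adj_def by (subst resv_eq) simp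

lemma adj_row: "j : R ==> j < n ==> i ~= j ==> adj n R x i j = fps_X * lin_form n (x j) (adj n (R - {j}) x i)"
using adj_insert[of j "R - {j}" n i x] by (simp add: insert_absorb)

section \<open>Truncated weighted norms of power series\<close>

definition tnorm :: "real => nat => complex fps => real" where
"tnorm r d f = (SUM l<=d. cmod (f $ l) * r ^ l)"

lemma tnorm_nonneg [simp]: "r >= 0 ==> tnorm r d f >= 0" unfolding tnorm_def by (intro sum_nonneg) auto

lemma tnorm_0 [simp]: "tnorm r d 0 = 0" by (simp add: tnorm_def)

lemma tnorm_1 [simp]: "tnorm r d 1 = 1"
proof -
have "(SUM l<=d. cmod ((1::complex fps) $ l) * r ^ l) = (SUM l<=d. if l = 0 then 1 else 0)" by (intro sum.cong) auto
thus ?thesis by (simp add: tnorm_def)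
qed

lemma tnorm_minus [simp]: "tnorm r d (- f) = tnorm r d f" by (simp add: tnorm_def)

lemma tnorm_diff_commute: "tnorm r d (f - g) = tnorm r d (g - f)" using tnorm_minus[of r d "f - g"] by simp

lemma tnorm_triangle: "r >= 0 ==> tnorm r d (f + g) <= tnorm r d f + tnorm r d g"
unfolding tnorm_def sum.distrib[symmetric] distrib_right[symmetric] by (intro sum_mono mult_right_mono) (auto simp: norm_triangle_ineq)

lemma tnorm_triangle_diff: "r >= 0 ==> tnorm r d (f - g) <= tnorm r d f + tnorm r d g" using tnorm_triangle[of r d f "- g"] by simp

lemma tnorm_mult_nth:
assumes "r >= 0"
shows "cmod ((f * g) $ k) * r ^ k <= (SUM i<=k. (cmod (f $ i) * r ^ i) * (cmod (g $ (k - i)) * r ^ (k - i)))"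
proof -
have "cmod ((f * g) $ k) <= (SUM i<=k. cmod (f $ i) * cmod (g $ (k - i)))"
 unfolding fps_mult_nth atLeast0AtMost by (intro order.trans[OF norm_sum]) (simp add: norm_mult)
hence "cmod ((f * g) $ k) * r ^ k <= (SUM i<=k. cmod (f $ i) * cmod (g $ (k - i))) * r ^ k" using assms by (intro mult_right_mono) auto
also have "... = (SUM i<=k. (cmod (f $ i) * r ^ i) * (cmod (g $ (k - i)) * r ^ (k - i)))" unfolding sum_distrib_right
proof (intro sum.cong refl)
 fix i assume "i : {..k}"
 hence "r ^ k = r ^ i * r ^ (k - i)" by (simp add: power_add[symmetric])
 thus "cmod (f $ i) * cmod (g $ (k - i)) * r ^ k = cmod (f $ i) * r ^ i * (cmod (g $ (k - i)) * r ^ (k - i))" by simp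
qed
finally show ?thesis .
qed

lemma sum_convolution_le:
fixes a b :: "nat => real"
assumes "!!i. a i >= 0" "!!i. b i >= 0"
shows "(SUM k<=d. SUM i<=k. a i * b (k - i)) <= (SUM i<=d. a i) * (SUM j<=d. b j)"
proof -
have "(SUM k<=d. SUM i<=k. a i * b (k - i)) = (SUM (i,j) | i + j <= d. a i * b j)"
 by (simp add: sum.triangle_reindex_eq[of "%i j. a i * b j", symmetric])
also have "... <= (SUM (i,j) : {..d} \<times> {..d}. a i * b j)" using assms by (intro sum_mono2) auto
also have "... = (SUM i<=d. a i) * (SUM j<=d. b j)" by (simp add: sum_product sum.cartesian_product)
finally show ?thesis .
qed

text \<open>The constant is 1 at every truncation degree d, so inverses can be estimated degree by
  degree and no convergence has to be discussed.\<close>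

lemma tnorm_mult:
assumes "r >= 0"
shows "tnorm r d (f * g) <= tnorm r d f * tnorm r d g"
proof -
have "tnorm r d (f * g) <= (SUM k<=d. SUM i<=k. (cmod (f $ i) * r ^ i) * (cmod (g $ (k - i)) * r ^ (k - i)))"
 unfolding tnorm_def by (intro sum_mono tnorm_mult_nth assms)
also have "... <= tnorm r d f * tnorm r d g" unfolding tnorm_def using assms by (intro sum_convolution_le) auto
finally show ?thesis .
qed

lemma tnorm_nth: "r >= 0 ==> k <= d ==> cmod (f $ k) * r ^ k <= tnorm r d f" unfolding tnorm_def by (intro member_le_sum) auto

lemma tnorm_mono: "r >= 0 ==> d <= d' ==> tnorm r d f <= tnorm r d' f" unfolding tnorm_def by (intro sum_mono2) auto

lemma tnorm_mono_radius: "0 <= r ==> r <= s ==> tnorm r d f <= tnorm s d f"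
unfolding tnorm_def by (intro sum_mono mult_left_mono power_mono) auto

text \<open>An approximate inverse \<open>g\<close> controls the exact one: b = g - (q g - 1) b, and
  the last term is absorbed on the left.\<close>

lemma tnorm_inverse_le:
assumes "r >= 0" "q * b = 1" "tnorm r d (q * g - 1) <= 1/2"
shows "tnorm r d b <= 2 * tnorm r d g"
proof -
have "b = g - (q * g - 1) * b" using assms(2) by (simp add: algebra_simps)
hence "tnorm r d b <= tnorm r d g + tnorm r d (q * g - 1) * tnorm r d b" using tnorm_triangle_diff[OF assms(1), of d g "(q * g - 1) * b"]
  tnorm_mult[OF assms(1), of d "q * g - 1" b] by simp
also have "... <= tnorm r d g + 1/2 * tnorm r d b" using assms by (intro add_left_mono mult_right_mono) auto
finally show ?thesis by simp
qed

section \<open>Traces of powers, eigenvalues and the spectral radius\<close>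

definition mat_trace :: "complex mat => complex" where
"mat_trace A = (SUM i<dim_row A. A $$ (i, i))"

lemma mat_trace_comm:
assumes "A : carrier_mat n n" "B : carrier_mat n n"
shows "mat_trace (A * B) = mat_trace (B * A)"
proof -
have "mat_trace (A * B) = (SUM i<n. SUM j<n. A $$ (i, j) * B $$ (j, i))"
 using assms by (auto simp: mat_trace_def scalar_prod_def atLeast0LessThan intro!: sum.cong)
also have "... = (SUM j<n. SUM i<n. B $$ (j, i) * A $$ (i, j))" by (subst sum.swap) (simp add: mult.commute)
also have "... = mat_trace (B * A)" using assms by (auto simp: mat_trace_def scalar_prod_def atLeast0LessThan intro!: sum.cong)
finally show ?thesis .
qed

lemma upper_triangular_pow_diag:
fixes B :: "complex mat"
assumes B: "B : carrier_mat n n" "upper_triangular B"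
shows "upper_triangular (B ^\<^sub>m k) & (\<forall>i<n. (B ^\<^sub>m k) $$ (i, i) = (B $$ (i, i)) ^ k)"
proof (induction k)
case 0
thus ?case using B by auto
next
case (Suc k)
let ?C = "B ^\<^sub>m k"
have C: "?C : carrier_mat n n" using B by simp
have entry: "(?C * B) $$ (i, j) = (SUM m<n. ?C $$ (i, m) * B $$ (m, j))" if "i < n" "j < n" for i j
 using that B C by (auto simp: scalar_prod_def atLeast0LessThan intro!: sum.cong)
have low: "?C $$ (i, m) * B $$ (m, j) = 0" if "i < n" "m < n" "m < i | j < m" for i j m
proof (cases "m < i")
 case True
 hence "?C $$ (i, m) = 0" using Suc C that by (intro upper_triangularD) auto
 thus ?thesis by simp
next
 case False
 hence "B $$ (m, j) = 0" using B that by (intro upper_triangularD) auto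
 thus ?thesis by simp
qed
have "upper_triangular (?C * B)"
proof (rule upper_triangularI)
 fix i j assume ij: "j < i" "i < dim_row (?C * B)"
 hence "(?C * B) $$ (i, j) = (SUM m<n. ?C $$ (i, m) * B $$ (m, j))" using C by (intro entry) auto
 also have "... = 0" using ij C by (intro sum.neutral ballI low) auto
 finally show "(?C * B) $$ (i, j) = 0" .
qed
moreover have "(?C * B) $$ (i, i) = (B $$ (i, i)) ^ Suc k" if "i < n" for i
proof -
 have "(SUM m<n. ?C $$ (i, m) * B $$ (m, i)) = (SUM m:{i}. ?C $$ (i, m) * B $$ (m, i))"
  using that by (intro sum.mono_neutral_right ballI low) (auto simp: neq_iff)
 thus ?thesis using that Suc by (simp add: entry)
qed
ultimately show ?case by simp
qed

lemma rpow_pow_mat: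
assumes "i < n" "l < n"
shows "rpow n {..<n} x i k l = (mat n n (%(i, j). x i j) ^\<^sub>m k) $$ (l, i)" using assms
proof (induction k arbitrary: i l)
case 0
thus ?case by auto
next
case (Suc k)
let ?X = "mat n n (%(i, j). x i j)"
have rp1: "rpow n {..<n} x i 1 m = x m i" if "m < n" for m
proof -
 have "rpow n {..<n} x i 1 m = (SUM p<n. if i = p then x m p else 0)"
  using that unfolding One_nat_def rpow.simps by (simp only: lessThan_iff if_True) (intro sum.cong, auto)
 thus ?thesis using Suc.prems by simp
qed
have "rpow n {..<n} x i (Suc k) l = (SUM m<n. rpow n {..<n} x m k l * rpow n {..<n} x i 1 m)"
 using rpow_add[OF Suc.prems(2), of "{..<n}" x k i 1] by simp
also have "... = (SUM m<n. (?X ^\<^sub>m k) $$ (l, m) * ?X $$ (m, i))"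
 using Suc by (intro sum.cong) (auto simp: rp1[unfolded One_nat_def] simp del: rpow.simps)
also have "... = (?X ^\<^sub>m k * ?X) $$ (l, i)" using Suc.prems pow_carrier_mat[of ?X n k]
 by (auto simp: scalar_prod_def atLeast0LessThan intro!: sum.cong)
finally show ?case by simp
qed

text \<open>A Schur triangular form is used because the eigenvalues must be listed with
  multiplicity, which the set \<open>spectrum\<close> does not record.\<close>

lemma trace_power_eigenvalues:
fixes x :: "entries" and n :: nat
defines "X \<equiv> mat n n (%(i, j). x i j)"
obtains es where "length es = n" "set es = spectrum X" "!!k. (SUM l<n. rpow n {..<n} x l k l) = (\<Sum>e\<leftarrow>es. e ^ k)"
proof -
have X: "X : carrier_mat n n" by (simp add: X_def)
obtain es where es: "char_poly X = (\<Prod>a\<leftarrow>es. [:- a, 1:])" "length es = n" using char_poly_factorized[OF X] by blast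
obtain B P Q where schur: "schur_decomposition X es = (B, P, Q)" by (cases "schur_decomposition X es") auto
have wit: "similar_mat_wit X B P Q" and ut: "upper_triangular B" and diag: "diag_mat B = es"
 using schur_decomposition[OF X es(1) schur] by auto
note D = similar_mat_witD2[OF X wit]
have trace: "(SUM l<n. rpow n {..<n} x l k l) = (\<Sum>e\<leftarrow>es. e ^ k)" for k
proof -
 let ?C = "B ^\<^sub>m k"
 have C: "?C : carrier_mat n n" using D by simp
 have "(SUM l<n. rpow n {..<n} x l k l) = mat_trace (X ^\<^sub>m k)" unfolding mat_trace_def using pow_carrier_mat[OF X, of k]
  by (auto simp: rpow_pow_mat X_def intro!: sum.cong)
 also have "X ^\<^sub>m k = P * ?C * Q" by (rule similar_mat_wit_pow_id[OF wit])
 also have "mat_trace (P * ?C * Q) = mat_trace (Q * (P * ?C))" using D C by (intro mat_trace_comm) auto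
 also have "Q * (P * ?C) = (Q * P) * ?C" using D C by (subst assoc_mult_mat) auto
 also have "... = ?C" using D C by simp
 also have "mat_trace ?C = (SUM i<n. (B $$ (i, i)) ^ k)" unfolding mat_trace_def using upper_triangular_pow_diag[OF _ ut, of n k] D C
  by (auto intro!: sum.cong)
 also have "... = (\<Sum>e\<leftarrow>es. e ^ k)" using D unfolding diag[symmetric] diag_mat_def
  by (simp add: sum_list_distinct_conv_sum_set o_def atLeast0LessThan)
 finally show ?thesis .
qed
have "set es = spectrum X" unfolding spectrum_def using eigenvalue_root_char_poly[OF X] es(1)
 by (auto simp: poly_prod_list prod_list_zero_iff)
with es(2) trace show ?thesis using that by blast
qed

lemma norm_trs_le:
assumes "spectral_radius (mat n n (%(i, j). x i j)) <= rho" "n > 0"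
shows "cmod (trs n {..<n} x $ k) <= real n * rho ^ k"
proof -
let ?X = "mat n n (%(i, j). x i j)"
obtain es where es: "length es = n" "set es = spectrum ?X" "!!k. (SUM l<n. rpow n {..<n} x l k l) = (\<Sum>e\<leftarrow>es. e ^ k)"
 using trace_power_eigenvalues[of n x] by blast
have X: "?X : carrier_mat n n" by simp
have e: "cmod e <= rho" if "e : set es" for e
 using spectral_radius_mem_max(2)[OF X \<open>n > 0\<close>, of "cmod e"] that es(2) assms(1) by auto
have "es ~= []" using es(1) \<open>n > 0\<close> by auto
hence "rho >= 0" using e[of "hd es"] norm_ge_zero[of "hd es"] by (meson hd_in_set order.trans)
have "cmod (\<Sum>e\<leftarrow>es. e ^ k) <= real (length es) * rho ^ k" using e
proof (induction es)
 case (Cons a es)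
 have "cmod (a ^ k) <= rho ^ k" using Cons.prems[of a] by (auto simp: norm_power intro: power_mono)
 moreover have "cmod (\<Sum>e\<leftarrow>es. e ^ k) <= real (length es) * rho ^ k" using Cons by auto
 moreover have "cmod (a ^ k + (\<Sum>e\<leftarrow>es. e ^ k)) <= cmod (a ^ k) + cmod (\<Sum>e\<leftarrow>es. e ^ k)"
  by (rule norm_triangle_ineq)
 ultimately show ?case by (simp add: algebra_simps)
qed simp
thus ?thesis using es \<open>rho >= 0\<close> by (auto simp: trs_def)
qed

definition linear_factor :: "complex => complex fps" where
"linear_factor e = 1 - fps_const e * fps_X"

lemma linear_factor_geometric: "linear_factor e * Abs_fps (%k. e ^ k) = 1"
proof (rule fps_ext)
fix k show "(linear_factor e * Abs_fps (%k. e ^ k)) $ k = 1 $ k" by (cases k) (auto simp: linear_factor_def algebra_simps)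
qed

lemma prod_linear_factor_deriv: "fps_X * fps_deriv (\<Prod>e\<leftarrow>es. linear_factor e) =
  - Abs_fps (%k. if k = 0 then 0 else \<Sum>e\<leftarrow>es. e ^ k) * (\<Prod>e\<leftarrow>es. linear_factor e)"
proof (induction es)
case Nil
have "Abs_fps (%k. if k = 0 then 0 else \<Sum>e\<leftarrow>[]. e ^ k) = (0 :: complex fps)" by (rule fps_ext) auto
thus ?case by (simp only:) simp
next
case (Cons a es)
let ?q = "\<Prod>e\<leftarrow>es. linear_factor e"
let ?G = "Abs_fps (%k. if k = 0 then 0 else a ^ k)"
have G: "?G * linear_factor a = fps_const a * fps_X"
proof -
 have "?G = Abs_fps (%k. a ^ k) - 1" by (rule fps_ext) auto
 hence "?G * linear_factor a = 1 - linear_factor a"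
  using linear_factor_geometric[of a] by (simp only: right_diff_distrib mult.commute[of _ "linear_factor a"] mult_1_right)
 thus ?thesis by (simp add: linear_factor_def)
qed
have split: "Abs_fps (%k. if k = 0 then 0 else \<Sum>e\<leftarrow>(a # es). e ^ k) =
  ?G + Abs_fps (%k. if k = 0 then 0 else \<Sum>e\<leftarrow>es. e ^ k)" by (rule fps_ext) auto
have "fps_X * fps_deriv (linear_factor a * ?q) = linear_factor a * (fps_X * fps_deriv ?q) + fps_X * fps_deriv (linear_factor a) * ?q"
 by (simp add: algebra_simps)
also have "fps_X * fps_deriv (linear_factor a) = - (?G * linear_factor a)" unfolding G by (simp add: linear_factor_def)
finally show ?case unfolding split using Cons by (simp add: algebra_simps)
qed

lemma tnorm_prod_linear_factor:
assumes "r >= 0"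
shows "tnorm r d (\<Prod>e\<leftarrow>es. linear_factor e) <= (\<Prod>e\<leftarrow>es. 1 + cmod e * r)"
proof (induction es)
case (Cons a es)
have "tnorm r d (fps_const a * fps_X) <= cmod a * r"
proof -
 have "tnorm r d (fps_const a * fps_X) = (SUM l<=d. if l = 1 then cmod a * r else 0)" unfolding tnorm_def by (intro sum.cong) auto
 thus ?thesis using assms by auto
qed
hence "tnorm r d (linear_factor a) <= 1 + cmod a * r"
 unfolding linear_factor_def using tnorm_triangle_diff[OF assms, of d 1 "fps_const a * fps_X"] by simp
hence "tnorm r d (linear_factor a) * tnorm r d (\<Prod>e\<leftarrow>es. linear_factor e)
  <= (1 + cmod a * r) * (\<Prod>e\<leftarrow>es. 1 + cmod e * r)" using Cons assms by (intro mult_mono) auto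
thus ?case using order.trans[OF tnorm_mult[OF assms, of d "linear_factor a" "\<Prod>e\<leftarrow>es. linear_factor e"]] by simp
qed simp

text \<open>Dropping the factor 1 - e z from Q leaves a polynomial h with h / Q = sum e^k z^k. A
  bound on 1/Q that is uniform in the degree therefore bounds the powers (|e| r)^k, for an
  eigenvalue e of largest modulus.\<close>

lemma spectral_radius_le_inverse:
assumes bound: "!!d. tnorm r d (ichs n {..<n} x) <= L" and "r > 0" "n > 0"
shows "spectral_radius (mat n n (%(i, j). x i j)) <= 1 / r"
proof -
let ?X = "mat n n (%(i, j). x i j)"
obtain es where es: "length es = n" "set es = spectrum ?X" "!!k. (SUM l<n. rpow n {..<n} x l k l) = (\<Sum>e\<leftarrow>es. e ^ k)"
 using trace_power_eigenvalues[of n x] by blast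
have X: "?X : carrier_mat n n" by simp
obtain e where e: "e : set es" "cmod e = spectral_radius ?X" using spectral_radius_mem_max(1)[OF X \<open>n > 0\<close>] es(2) by auto
have char: "(\<Prod>e\<leftarrow>es. linear_factor e) = chs n {..<n} x"
proof (rule chs_unique)
 have "trs n {..<n} x = Abs_fps (%k. if k = 0 then 0 else \<Sum>e\<leftarrow>es. e ^ k)" by (rule fps_ext) (simp add: trs_def es(3))
 thus "fps_X * fps_deriv (\<Prod>e\<leftarrow>es. linear_factor e) = - trs n {..<n} x * (\<Prod>e\<leftarrow>es. linear_factor e)"
  by (simp only: prod_linear_factor_deriv)
 show "(\<Prod>e\<leftarrow>es. linear_factor e) $ 0 = 1" by (induction es) (auto simp: linear_factor_def)
qed
obtain es1 es2 where split: "es = es1 @ e # es2" using e(1) by (meson split_list)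
define h where "h = (\<Prod>e\<leftarrow>es1 @ es2. linear_factor e)"
have "linear_factor e * h * ichs n {..<n} x = 1" using chs_mult_inv[of n "{..<n}" x] unfolding char[symmetric] h_def split
 by (simp add: mult_ac)
hence "Abs_fps (%k. e ^ k) * (linear_factor e * h * ichs n {..<n} x) = Abs_fps (%k. e ^ k)" by simp
hence geo: "h * ichs n {..<n} x = Abs_fps (%k. e ^ k)"
 using linear_factor_geometric[of e] by (metis mult.assoc mult.commute mult.right_neutral)
define H where "H = (\<Prod>e\<leftarrow>es1 @ es2. 1 + cmod e * r)"
have "(cmod e * r) ^ k <= H * L" for k
proof -
 have "(cmod e * r) ^ k <= tnorm r k (h * ichs n {..<n} x)" using tnorm_nth[of r k k "h * ichs n {..<n} x"] \<open>r > 0\<close>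
  unfolding geo by (simp add: norm_power power_mult_distrib)
 also have "... <= tnorm r k h * tnorm r k (ichs n {..<n} x)" using \<open>r > 0\<close> by (intro tnorm_mult) simp
 also have "... <= H * L" unfolding h_def H_def using \<open>r > 0\<close> bound
  by (intro mult_mono tnorm_prod_linear_factor prod_list_nonneg) auto
 finally show ?thesis .
qed
hence "cmod e * r <= 1" by (meson not_le real_arch_pow[of "cmod e * r" "H * L"])
thus ?thesis using e(2) \<open>r > 0\<close> by (simp add: field_simps)
qed

section \<open>Exposing the rows one at a time\<close>

lemma measurable_fun_upd_PiM:
assumes "j : I"
shows "(%(x, y). x(j := y)) : measurable (PiM I M \<Otimes>\<^sub>M M j) (PiM I M)"
using measurable_add_dim[of j I M] assms by (simp add: insert_absorb)

text \<open>The old value of coordinate \<open>j\<close> is overwritten, so integrating it out first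
  changes nothing. This is the form in which conditioning on all rows but one is used below.\<close>

lemma distr_fun_upd_PiM:
fixes M :: "'i => 'a measure"
assumes "finite I" "j : I" and M: "!!i. prob_space (M i)"
shows "distr (PiM I M \<Otimes>\<^sub>M M j) (PiM I M) (%(x, y). x(j := y)) = PiM I M"
proof (rule measure_eqI)
interpret Mj: prob_space "M j" by (rule M)
interpret product_sigma_finite M by unfold_locales (intro sigma_finite_measure.sigma_finite_countable prob_space_imp_sigma_finite M)
let ?P = "PiM I M" and ?J = "I - {j}"
have I: "insert j ?J = I" using assms by auto
have fJ: "finite ?J" using assms by auto
note [measurable] = measurable_fun_upd_PiM[OF \<open>j : I\<close>, of M]
let ?a = "?P \<Otimes>\<^sub>M M j"
fix A assume "A : sets (distr ?a ?P (%(x, y). x(j := y)))"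
hence A[measurable]: "A : sets ?P" by simp
have "emeasure (distr ?a ?P (%(x, y). x(j := y))) A =
  (\<integral>\<^sup>+z. indicator A z \<partial>distr ?a ?P (%(x, y). x(j := y)))" by simp
also have "... = (\<integral>\<^sup>+z. indicator A (case z of (x, y) => x(j := y)) \<partial>?a)"
 by (subst nn_integral_distr) auto
also have "... = (\<integral>\<^sup>+x. \<integral>\<^sup>+y. indicator A (x(j := y)) \<partial>M j \<partial>?P)"
 by (subst Mj.nn_integral_fst[symmetric]) auto
also have "... = (\<integral>\<^sup>+x. \<integral>\<^sup>+y'. (\<integral>\<^sup>+y. indicator A ((x(j := y'))(j := y)) \<partial>M j) \<partial>M j \<partial>PiM ?J M)"
proof -
 have "(%x. \<integral>\<^sup>+y. indicator A (x(j := y)) \<partial>M j) : borel_measurable ?P"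
  by (rule Mj.borel_measurable_nn_integral) (use measurable_compose[OF measurable_fun_upd_PiM[OF \<open>j : I\<close>, of M] borel_measurable_indicator[OF A]] in \<open>simp add: split_beta'\<close>)
 thus ?thesis using product_nn_integral_insert[of ?J j "%x. \<integral>\<^sup>+y. indicator A (x(j := y)) \<partial>M j", unfolded I] fJ
  by simp
qed
also have "... = (\<integral>\<^sup>+x. (\<integral>\<^sup>+y. indicator A (x(j := y)) \<partial>M j) \<partial>PiM ?J M)"
 by (simp add: Mj.emeasure_space_1)
also have "... = (\<integral>\<^sup>+x. indicator A x \<partial>?P)"
 using product_nn_integral_insert[of ?J j "indicator A", unfolded I] fJ by simp
finally show "emeasure (distr ?a ?P (%(x, y). x(j := y))) A = emeasure ?P A" by simp
qed simp

lemma nn_integral_PiM_resample: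
fixes M :: "'i => 'a measure"
assumes "finite I" "j : I" and M: "!!i. prob_space (M i)" and F: "F : bmeas (PiM I M)"
shows "(\<integral>\<^sup>+x. F x \<partial>PiM I M) = (\<integral>\<^sup>+x. \<integral>\<^sup>+y. F (x(j := y)) \<partial>M j \<partial>PiM I M)"
proof -
interpret Mj: prob_space "M j" by (rule M)
note m = measurable_fun_upd_PiM[OF \<open>j : I\<close>, of M]
have "(\<integral>\<^sup>+x. F x \<partial>PiM I M) = (\<integral>\<^sup>+z. F (case z of (x, y) => x(j := y)) \<partial>(PiM I M \<Otimes>\<^sub>M M j))"
 by (subst distr_fun_upd_PiM[OF assms(1-3), symmetric], subst nn_integral_distr[OF m]) (use F in auto)
also have "... = (\<integral>\<^sup>+x. \<integral>\<^sup>+y. F (x(j := y)) \<partial>M j \<partial>PiM I M)"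
 using measurable_compose[OF m F] by (subst Mj.nn_integral_fst[symmetric]) auto
finally show ?thesis .
qed

lemma integral_PiM_resample:
fixes M :: "'i => 'a measure" and F :: "_ => real"
assumes "finite I" "j : I" and M: "!!i. prob_space (M i)" and F: "integrable (PiM I M) F"
shows "(\<integral>x. F x \<partial>PiM I M) = (\<integral>x. \<integral>y. F (x(j := y)) \<partial>M j \<partial>PiM I M)"
proof -
interpret Mj: prob_space "M j" by (rule M)
interpret P: prob_space "PiM I M" by (rule prob_space_PiM) (rule M)
interpret pair_sigma_finite "PiM I M" "M j" by unfold_locales
note m = measurable_fun_upd_PiM[OF \<open>j : I\<close>, of M]
have Fm: "F : bmeas (PiM I M)" using F by simp
let ?a = "PiM I M \<Otimes>\<^sub>M M j"
have d: "distr ?a (PiM I M) (%(x, y). x(j := y)) = PiM I M" by (rule distr_fun_upd_PiM[OF assms(1-3)])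
have "integrable ?a (%z. F (case z of (x, y) => x(j := y)))"
 using F integrable_distr_eq[OF m, of F] Fm d by simp
hence "(LINT z|?a. F (case z of (x, y) => x(j := y))) =
  (\<integral>x. \<integral>y. F (x(j := y)) \<partial>M j \<partial>PiM I M)" by (subst integral_fst'[symmetric]) (auto simp: split_beta')
moreover have "(\<integral>x. F x \<partial>PiM I M) = (LINT z|?a. F (case z of (x, y) => x(j := y)))"
 by (subst d[symmetric], subst integral_distr[OF m Fm]) simp
ultimately show ?thesis by simp
qed

lemma norm_square_add: "(cmod (a + b))^2 = (cmod a)^2 + (cmod b)^2 + 2 * Re (cnj a * b)"
unfolding cmod_power2 by (simp add: power2_eq_square algebra_simps)

lemma (in prob_space) integral_norm_square_add:
fixes h :: "'a => complex"
assumes h[measurable]: "h : bmeas M" and i2: "integrable M (%y. (cmod (h y))^2)" and mean: "(LINT y|M. h y) = 0"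
shows "(\<integral>\<^sup>+y. ennreal ((cmod (c + h y))^2) \<partial>M) = ennreal ((cmod c)^2 + (LINT y|M. (cmod (h y))^2))"
proof -
have i1: "integrable M h"
proof (rule Bochner_Integration.integrable_bound[where f = "%y. 1 + (cmod (h y))^2"])
 have "cmod (h y) <= 1 + (cmod (h y))^2" for y using zero_le_power2[of "cmod (h y) - 1/2"] by (simp add: power2_diff power_divide)
 thus "AE y in M. norm (h y) <= norm (1 + (cmod (h y))^2)" by (auto simp: abs_of_nonneg)
qed (use i2 in auto)
have eq: "(%y. (cmod (c + h y))^2) = (%y. (cmod c)^2 + (cmod (h y))^2 + 2 * Re (cnj c * h y))" by (simp add: norm_square_add)
have int: "integrable M (%y. (cmod (c + h y))^2)" unfolding eq using i1 i2 by auto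
have "(LINT y|M. (cmod (c + h y))^2) = (cmod c)^2 + (LINT y|M. (cmod (h y))^2) + 2 * Re (LINT y|M. cnj c * h y)"
 unfolding eq using i1 i2 by (simp add: prob_space)
also have "(LINT y|M. cnj c * h y) = 0" using mean i1 by simp
finally show ?thesis using int by (subst nn_integral_eq_integral) auto
qed

text \<open>Centred independent summands are orthogonal. The functions \<open>h m\<close> are
  arbitrary, so that a row form and its truncated counterpart can later be combined into one sum
  over the same entries.\<close>

lemma nn_integral_PiM_norm_square:
fixes M :: "complex measure" and h :: "nat => complex => complex"
assumes M: "prob_space M" and "finite I"
 and h: "!!m. m : I ==> h m : bmeas M"
 and i2: "!!m. m : I ==> integrable M (%y. (cmod (h m y))^2)"
 and mean: "!!m. m : I ==> (LINT y|M. h m y) = 0"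
shows "(\<integral>\<^sup>+y. ennreal ((cmod (c + (SUM m:I. h m (y m))))^2) \<partial>PiM I (%_. M)) =
  ennreal ((cmod c)^2 + (SUM m:I. (LINT y|M. (cmod (h m y))^2)))" using \<open>finite I\<close> h i2 mean
proof (induction I arbitrary: c rule: finite_induct)
case empty
thus ?case by (simp add: PiM_empty nn_integral_count_space_finite)
next
case (insert j I)
interpret P: prob_space "PiM I (%_. M)" by (rule prob_space_PiM) (rule M)
interpret product_sigma_finite "%_::nat. M"
 by unfold_locales (intro sigma_finite_measure.sigma_finite_countable prob_space_imp_sigma_finite M)
note [measurable] = insert.prems(1)
let ?s = "(LINT y|M. (cmod (h j y))^2)"
have "(\<integral>\<^sup>+y. ennreal ((cmod (c + (SUM m:insert j I. h m (y m))))^2) \<partial>PiM (insert j I) (%_. M)) =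
 (\<integral>\<^sup>+x. (\<integral>\<^sup>+y. ennreal ((cmod (c + (SUM m:insert j I. h m ((x(j := y)) m))))^2) \<partial>M) \<partial>PiM I (%_. M))"
 by (rule product_nn_integral_insert) (use insert in auto)
also have "... = (\<integral>\<^sup>+x. ennreal ((cmod (c + (SUM m:I. h m (x m))))^2 + ?s) \<partial>PiM I (%_. M))"
proof (rule nn_integral_cong)
 fix x
 have "c + (SUM m:insert j I. h m ((x(j := y)) m)) = (c + (SUM m:I. h m (x m))) + h j y" for y
 proof -
  have "(SUM m:I. h m ((x(j := y)) m)) = (SUM m:I. h m (x m))" using insert.hyps by (intro sum.cong) auto
  thus ?thesis using insert.hyps by (simp add: algebra_simps)
 qed
 thus "(\<integral>\<^sup>+y. ennreal ((cmod (c + (SUM m:insert j I. h m ((x(j := y)) m))))^2) \<partial>M) =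
   ennreal ((cmod (c + (SUM m:I. h m (x m))))^2 + ?s)"
  using prob_space.integral_norm_square_add[OF M, of "h j" "c + (SUM m:I. h m (x m))"] insert.prems by (simp only:) auto
qed
also have "... = (\<integral>\<^sup>+x. ennreal ((cmod (c + (SUM m:I. h m (x m))))^2) + ennreal ?s \<partial>PiM I (%_. M))"
 by (intro nn_integral_cong ennreal_plus) auto
also have "... = (\<integral>\<^sup>+x. ennreal ((cmod (c + (SUM m:I. h m (x m))))^2) \<partial>PiM I (%_. M)) + ennreal ?s"
 using insert.prems by (subst nn_integral_add) (auto simp: P.emeasure_space_1)
also have "... = ennreal ((cmod c)^2 + (SUM m:I. (LINT y|M. (cmod (h m y))^2))) + ennreal ?s" using insert.IH insert.prems by simp
finally show ?case using insert.hyps by (simp add: ennreal_plus[symmetric] sum_nonneg algebra_simps del: ennreal_plus)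
qed

lemma rpow_cong:
assumes "!!l m. l : R ==> m < n ==> x l m = x' l m"
shows "rpow n R x i k l = rpow n R x' i k l" by (induction k arbitrary: l) (auto simp: assms intro!: sum.cong)

lemma
assumes "!!l m. l : R ==> m < n ==> x l m = x' l m"
shows resv_cong: "resv n R x = resv n R x'"
 and trs_cong: "trs n R x = trs n R x'"
 and chs_cong: "chs n R x = chs n R x'"
 and ichs_cong: "ichs n R x = ichs n R x'"
 and adj_cong: "adj n R x = adj n R x'"
proof -
have [simp]: "rpow n R x = rpow n R x'" using rpow_cong[of R n x x', OF assms] by (intro ext) simp
show res: "resv n R x = resv n R x'" by (intro ext) (simp add: resv_def)
show tr [simp]: "trs n R x = trs n R x'" unfolding trs_def \<open>rpow n R x = rpow n R x'\<close> ..
show ch: "chs n R x = chs n R x'" by (simp add: chs_def)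
show "ichs n R x = ichs n R x'" by (simp add: ichs_def)
show "adj n R x = adj n R x'" by (intro ext) (simp add: adj_def ch res)
qed

text \<open>This invariance makes row \<open>j\<close> independent of every series over a set
  without \<open>j\<close>; as rewrite rules the equations erase a resampled row.\<close>

lemma series_upd [simp]:
assumes "j ~: R"
shows "chs n R (x(j := y)) = chs n R x" "ichs n R (x(j := y)) = ichs n R x" "adj n R (x(j := y)) = adj n R x"
 "trs n R (x(j := y)) = trs n R x" "resv n R (x(j := y)) = resv n R x"
using assms by (auto intro!: chs_cong ichs_cong adj_cong trs_cong resv_cong)

context
fixes g :: "'w => nat => nat => complex" and M :: "'w measure" and n :: nat and R :: "nat set"
assumes g: "!!l m. l : R ==> m < n ==> (%w. g w l m) : bmeas M"
begin

lemma measurable_rpow: "(%w. rpow n R (g w) i k l) : bmeas M"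
proof (induction k arbitrary: l)
case (Suc k)
thus ?case using g by (cases "l : R") auto
qed simp

lemma measurable_newton:
assumes "!!k. (%w. t w k) : bmeas M"
shows "(%w. newton (t w) k) : bmeas M"
proof (induction k rule: less_induct)
case (less k)
show ?case
proof (cases k)
 case (Suc m)
 thus ?thesis using less assms by auto
qed simp
qed

lemma measurable_trs: "(%w. trs n R (g w) $ k) : bmeas M" unfolding trs_def using measurable_rpow by simp

lemma measurable_resv: "(%w. resv n R (g w) i l $ k) : bmeas M" unfolding resv_def using measurable_rpow by simp

lemma measurable_chs: "(%w. chs n R (g w) $ k) : bmeas M" unfolding chs_def by (simp, intro measurable_newton measurable_trs)

lemma measurable_ichs: "(%w. ichs n R (g w) $ k) : bmeas M" unfolding ichs_def
by (simp del: fps_neg_nth, intro measurable_newton) (simp add: measurable_trs)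

lemma measurable_adj: "(%w. adj n R (g w) i l $ k) : bmeas M" unfolding adj_def fps_mult_nth
by (intro borel_measurable_sum borel_measurable_times measurable_chs measurable_resv)

end

definition row_law :: "complex measure => nat => (nat => complex) measure" where
"row_law mu n = PiM {..<n} (%_. mu)"

text \<open>The product is nested, first entries of a row and then rows of a matrix, so that a whole
  row is a single coordinate and can be resampled at once.\<close>

definition matrix_law :: "complex measure => nat => entries measure" where
"matrix_law mu n = PiM {..<n} (%_. row_law mu n)"

definition sqnorm :: "nat => (nat => complex) => real" where
"sqnorm n v = (SUM m<n. (cmod (v m))^2)"

lemma sqnorm_nonneg [simp]: "sqnorm n v >= 0" by (simp add: sqnorm_def sum_nonneg)

text \<open>One entry of the matrix of size \<open>n\<close>, scaled to variance 1/n. Sparsity is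
  invisible at this level; it enters through the tail and support conditions of
  \<open>sparse_laws\<close>.\<close>

locale entry_law =
fixes mu :: "complex measure" and n :: nat
assumes prob: "prob_space mu" and sets_mu: "sets mu = sets borel" and n_pos: "n > 0"
 and int_sq: "integrable mu (%y. (cmod y)^2)"
 and mean: "(LINT y|mu. y) = 0"
 and second: "(LINT y|mu. (cmod y)^2) = 1 / real n"
begin

abbreviation MX :: "entries measure" where "MX \<equiv> matrix_law mu n"
abbreviation RW :: "(nat => complex) measure" where "RW \<equiv> row_law mu n"
abbreviation MM :: "(complex \<times> complex) measure" where "MM \<equiv> mu \<Otimes>\<^sub>M mu"
abbreviation nn_expectation :: "(entries => real) => ennreal" (binder "NE " 10) where
"nn_expectation f \<equiv> \<integral>\<^sup>+x. ennreal (f x) \<partial>MX"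

lemma measurable_mu_borel: "measurable mu N = measurable borel N" by (rule measurable_cong_sets) (auto simp: sets_mu)

lemma prob_row: "prob_space RW" unfolding row_law_def by (rule prob_space_PiM) (rule prob)

sublocale mu: prob_space mu by (rule prob)

sublocale R: prob_space RW by (rule prob_row)

sublocale P: prob_space "MX" unfolding matrix_law_def by (rule prob_space_PiM) (rule prob_row)

lemma measurable_row_component [measurable]: "m < n ==> (%y. y m) : bmeas RW"
proof -
assume "m < n"
hence "(%y. y m) : measurable RW mu" unfolding row_law_def by (intro measurable_component_singleton) auto
thus ?thesis using measurable_cong_sets[OF refl sets_mu] by auto
qed

lemma measurable_row: "l < n ==> (%x. x l) : measurable MX RW" unfolding matrix_law_def by (rule measurable_component_singleton) auto

lemma measurable_entry [measurable]: "l < n ==> m < n ==> (%x. x l m) : bmeas MX"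
using measurable_compose[OF measurable_row measurable_row_component] by simp

lemma nn_integral_resample:
assumes "j < n" "F : bmeas MX"
shows "(\<integral>\<^sup>+x. F x \<partial>MX) = (\<integral>\<^sup>+x. \<integral>\<^sup>+y. F (x(j := y)) \<partial>RW \<partial>MX)"
using assms prob_row unfolding matrix_law_def by (intro nn_integral_PiM_resample) auto

lemma nn_integral_row_form:
assumes h: "!!m. m < n ==> h m : bmeas borel"
 and i2: "!!m. m < n ==> integrable mu (%y. (cmod (h m y))^2)"
 and mean: "!!m. m < n ==> (LINT y|mu. h m y) = 0"
shows "(\<integral>\<^sup>+y. ennreal ((cmod (c + (SUM m<n. h m (y m))))^2) \<partial>RW) =
  ennreal ((cmod c)^2 + (SUM m<n. (LINT y|mu. (cmod (h m y))^2)))" unfolding row_law_def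
by (rule nn_integral_PiM_norm_square[OF prob]) (use assms in \<open>auto simp: measurable_mu_borel\<close>)

lemma integrable_mu: "integrable mu (%y. y)"
proof (rule Bochner_Integration.integrable_bound[where f = "%y. 1 + (cmod y)^2"])
have "cmod y <= 1 + (cmod y)^2" for y using zero_le_power2[of "cmod y - 1/2"] by (simp add: power2_diff power_divide)
thus "AE y in mu. norm y <= norm (1 + (cmod y)^2)" by (auto simp: abs_of_nonneg)
show "integrable mu (%y. 1 + (cmod y)^2)" using int_sq by simp
qed (simp add: measurable_mu_borel)

lemma nn_integral_row_linear: "(\<integral>\<^sup>+y. ennreal ((cmod (c + (SUM m<n. y m * v m)))^2) \<partial>RW) =
  ennreal ((cmod c)^2 + sqnorm n v / real n)"
proof -
have "(LINT y|mu. (cmod (y * v m))^2) = (cmod (v m))^2 / real n" for m by (simp add: norm_mult power_mult_distrib second)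
moreover have "(LINT y|mu. y * v m) = 0" for m using integrable_mu mean by simp
ultimately show ?thesis using nn_integral_row_form[of "%m y. y * v m" c] int_sq
 by (simp add: norm_mult power_mult_distrib sqnorm_def sum_divide_distrib)
qed

definition char_mom :: "nat => nat set => ennreal" where
"char_mom k R = (NE x. (cmod (chs n R x $ k))^2)"

definition adj_mom :: "nat => nat set => nat => ennreal" where
"adj_mom k R i = (NE x. sqnorm n (%l. adj n R x i l $ k))"

lemma measurable_series [measurable]:
assumes "R <= {..<n}"
shows "(%x. chs n R x $ k) : bmeas MX" "(%x. ichs n R x $ k) : bmeas MX" "(%x. adj n R x i l $ k) : bmeas MX"
 "(%x. trs n R x $ k) : bmeas MX" "(%x. resv n R x i l $ k) : bmeas MX"
proof -
have g: "(%x. x l m) : bmeas MX" if "l : R" "m < n" for l m using assms that by (intro measurable_entry) auto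
show "(%x. chs n R x $ k) : bmeas MX" using measurable_chs[of R n "%x. x", OF g] by simp
show "(%x. ichs n R x $ k) : bmeas MX" using measurable_ichs[of R n "%x. x", OF g] by simp
show "(%x. adj n R x i l $ k) : bmeas MX" using measurable_adj[of R n "%x. x", OF g] by simp
show "(%x. trs n R x $ k) : bmeas MX" using measurable_trs[of R n "%x. x", OF g] by simp
show "(%x. resv n R x i l $ k) : bmeas MX" using measurable_resv[of R n "%x. x", OF g] by simp
qed

lemma measurable_sqnorm:
assumes "!!l. l < n ==> (%x. f x l) : bmeas M"
shows "(%x. sqnorm n (f x)) : bmeas M" unfolding sqnorm_def using assms by auto

text \<open>Exposing one row: the entries of that row are centred and independent of the rest.\<close>

lemma nn_integral_row_exposed:
assumes "j < n" "!!y. C : bmeas MX"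
 and V: "!!m. m < n ==> (%x. V x m) : bmeas MX"
 and inv: "!!x y. C (x(j := y)) = C x" "!!x y. V (x(j := y)) = V x"
shows "(NE x. (cmod (C x + (SUM m<n. x j m * V x m)))^2) = (NE x. (cmod (C x))^2) + ennreal (1 / real n) * (NE x. sqnorm n (V x))"
proof -
note [measurable] = assms(2) V measurable_entry[OF assms(1)] measurable_sqnorm
have "(NE x. (cmod (C x + (SUM m<n. x j m * V x m)))^2) =
 (\<integral>\<^sup>+x. \<integral>\<^sup>+y. ennreal ((cmod (C x + (SUM m<n. y m * V x m)))^2) \<partial>RW \<partial>MX)"
 by (subst nn_integral_resample[OF assms(1)]) (simp_all add: inv)
also have "... = (\<integral>\<^sup>+x. ennreal ((cmod (C x))^2) + ennreal (1 / real n) * ennreal (sqnorm n (V x)) \<partial>MX)"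
 unfolding nn_integral_row_linear by (intro nn_integral_cong) (simp add: ennreal_mult[symmetric] ennreal_plus)
also have "... = (NE x. (cmod (C x))^2) + ennreal (1 / real n) * (NE x. sqnorm n (V x))"
 by (subst nn_integral_add) (auto simp: nn_integral_cmult)
finally show ?thesis .
qed

lemma char_mom_insert:
assumes R: "R <= {..<n}" and i: "i ~: R" "i < n"
shows "char_mom (Suc k) (insert i R) = char_mom (Suc k) R + ennreal (1 / real n) * adj_mom k R i"
proof -
have "char_mom (Suc k) (insert i R) = (NE x. (cmod (chs n R x $ Suc k + (SUM m<n. x i m * - (adj n R x i m $ k))))^2)"
 unfolding char_mom_def by (simp add: chs_insert[OF i] lin_form_nth sum_negf)
also have "... = char_mom (Suc k) R + ennreal (1 / real n) * adj_mom k R i" unfolding char_mom_def adj_mom_def using R i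
 by (subst nn_integral_row_exposed) (auto simp: sqnorm_def)
finally show ?thesis .
qed

text \<open>Column \<open>i\<close> of the adjugate lives on \<open>insert i R\<close>: the diagonal
  entry is Q itself, and the entry in row \<open>j\<close> is a form in row \<open>j\<close> alone
  whose coefficients belong to R without \<open>j\<close> and to the previous degree. This gives the
  recursion of \<open>adj_mom_Suc\<close>.\<close>

lemma adj_sqnorm:
assumes R: "R <= {..<n}" and i: "i ~: R" "i < n"
shows "sqnorm n (%l. adj n R x i l $ Suc k) = (cmod (chs n R x $ Suc k))^2 +
  (SUM j:R. (cmod (SUM m<n. x j m * (adj n (R - {j}) x i m $ k)))^2)"
proof -
have "sqnorm n (%l. adj n R x i l $ Suc k) = (SUM l:insert i R. (cmod (adj n R x i l $ Suc k))^2)" unfolding sqnorm_def using R i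
 by (intro sum.mono_neutral_right) (auto simp: adj_zero)
also have "... = (cmod (chs n R x $ Suc k))^2 + (SUM j:R. (cmod (SUM m<n. x j m * (adj n (R - {j}) x i m $ k)))^2)"
proof -
 have "(cmod (adj n R x i l $ Suc k))^2 = (cmod (SUM m<n. x l m * (adj n (R - {l}) x i m $ k)))^2" if "l : R" for l
  using that R i by (subst adj_row) (auto simp: lin_form_nth)
 thus ?thesis using i finite_subset[OF R] by (simp add: adj_diag)
qed
finally show ?thesis .
qed

lemma adj_mom_Suc:
assumes R: "R <= {..<n}" and i: "i ~: R" "i < n"
shows "adj_mom (Suc k) R i = char_mom (Suc k) R + (SUM j:R. ennreal (1 / real n) * adj_mom k (R - {j}) i)"
proof -
have mj [measurable]: "(%x. SUM m<n. x j m * (adj n (R - {j}) x i m $ k)) : bmeas MX" if "j : R" for j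
 using R that by (intro borel_measurable_sum borel_measurable_times measurable_entry measurable_series) auto
have [measurable]: "(%x. chs n R x $ Suc k) : bmeas MX" using R by (rule measurable_series)
have "adj_mom (Suc k) R i = (\<integral>\<^sup>+x. ennreal ((cmod (chs n R x $ Suc k))^2) +
  (SUM j:R. ennreal ((cmod (SUM m<n. x j m * (adj n (R - {j}) x i m $ k)))^2)) \<partial>MX)"
 unfolding adj_mom_def adj_sqnorm[OF assms] by (simp add: ennreal_plus sum_nonneg sum_ennreal)
also have "... = char_mom (Suc k) R + (SUM j:R. (NE x. (cmod (SUM m<n. x j m * (adj n (R - {j}) x i m $ k)))^2))" unfolding char_mom_def
 using mj by (subst nn_integral_add) (auto simp del: sum_ennreal intro!: nn_integral_sum)
also have "... = char_mom (Suc k) R + (SUM j:R. ennreal (1 / real n) * adj_mom k (R - {j}) i)"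
proof (intro arg_cong2[where f = "(+)"] refl sum.cong)
 fix j assume j: "j : R"
 show "(NE x. (cmod (SUM m<n. x j m * (adj n (R - {j}) x i m $ k)))^2) = ennreal (1 / real n) * adj_mom k (R - {j}) i"
  using nn_integral_row_exposed[of j "%_. 0" "%x m. adj n (R - {j}) x i m $ k"] j R
   measurable_series(3)[of "R - {j}"] Diff_subset[of R "{j}"] unfolding adj_mom_def by (simp add: subset_iff)
qed
finally show ?thesis .
qed

text \<open>Coefficient k of Q is a signed sum of principal minors of order k. They are uncorrelated
  and each has second moment k! / n^k, which explains the size (card R / n)^k; the proof reaches it
  by adding the rows one at a time.\<close>

lemma char_adj_mom_bound:
assumes "R <= {..<n}"
shows "char_mom k R <= ennreal ((real (card R) / real n) ^ k)"
 and "i ~: R ==> i < n ==> adj_mom k R i <= ennreal ((real k + 1) * (real (card R) / real n) ^ k)"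
proof -
\<comment> \<open>The first two terms of the binomial expansion; with h = 1/n this is the passage
  from card S to card S + 1.\<close>
have power_step: "a ^ Suc k + (real k + 1) * h * a ^ k <= (a + h) ^ Suc k" if "a >= 0" "h >= 0" for a h :: real and k
proof (induction k)
 case (Suc k)
 have "a ^ Suc (Suc k) + (real (Suc k) + 1) * h * a ^ Suc k <= (a + h) * (a ^ Suc k + (real k + 1) * h * a ^ k)"
  using that by (simp add: algebra_simps)
 also have "... <= (a + h) * (a + h) ^ Suc k" using Suc that by (intro mult_left_mono) auto
 finally show ?case by simp
qed simp
have "char_mom k R <= ennreal ((real (card R) / real n) ^ k) &
  (\<forall>i. i ~: R --> i < n --> adj_mom k R i <= ennreal ((real k + 1) * (real (card R) / real n) ^ k))" using assms
proof (induction k arbitrary: R)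
 case 0
 have "char_mom 0 R <= 1" unfolding char_mom_def by (simp add: P.emeasure_space_1)
 moreover have "adj_mom 0 R i <= 1" if "i ~: R" "i < n" for i
 proof -
  have "adj n R x i l $ 0 = (if l = i then 1 else 0)" for x l by (simp add: adj_def resv_def)
  hence "sqnorm n (%l. adj n R x i l $ 0) = 1" for x
   using that by (simp add: sqnorm_def if_distrib[of cmod] if_distrib[of "%u. u^2"] cong: if_cong)
  thus ?thesis unfolding adj_mom_def by (simp add: P.emeasure_space_1)
 qed
 ultimately show ?case by simp
next
 case (Suc k)
 have char: "char_mom (Suc k) S <= ennreal ((real (card S) / real n) ^ Suc k)" if "S <= {..<n}" for S
  using finite_subset[OF that finite_lessThan] that
 proof (induction S rule: finite_induct)
  case empty
  have "trs n {} x = 0" for x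
  proof (rule fps_ext)
   fix k show "trs n {} x $ k = 0 $ k" by (cases k) (auto simp: trs_def)
  qed
  hence "chs n {} x = 1" for x by (intro chs_unique[symmetric]) auto
  thus ?case by (simp add: char_mom_def)
 next
  case (insert i S)
  have "char_mom (Suc k) (insert i S) <= ennreal ((real (card S) / real n) ^ Suc k) +
   ennreal (1 / real n) * ennreal ((real k + 1) * (real (card S) / real n) ^ k)"
   using insert Suc.IH[of S] by (subst char_mom_insert) (auto intro!: add_mono mult_left_mono)
  also have "... = ennreal ((real (card S) / real n) ^ Suc k + (real k + 1) * (1 / real n) * (real (card S) / real n) ^ k)"
   by (simp add: ennreal_mult[symmetric] ennreal_plus[symmetric] mult_ac del: ennreal_plus)
  also have "... <= ennreal ((real (card S) / real n + 1 / real n) ^ Suc k)" by (intro ennreal_leI power_step) auto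
  also have "real (card S) / real n + 1 / real n = real (card (insert i S)) / real n" using insert.hyps by (simp add: add_divide_distrib)
  finally show ?case .
 qed
 have "adj_mom (Suc k) R i <= ennreal ((real (Suc k) + 1) * (real (card R) / real n) ^ Suc k)" if i: "i ~: R" "i < n" for i
 proof -
  have fin: "finite R" using Suc.prems finite_subset by blast
  have "adj_mom (Suc k) R i <= ennreal ((real (card R) / real n) ^ Suc k) +
   (SUM j:R. ennreal (1 / real n) * ennreal ((real k + 1) * (real (card R) / real n) ^ k))" unfolding adj_mom_Suc[OF Suc.prems i]
  proof (intro add_mono char Suc.prems sum_mono mult_left_mono)
   fix j assume j: "j : R"
   have "adj_mom k (R - {j}) i <= ennreal ((real k + 1) * (real (card (R - {j})) / real n) ^ k)"
    using Suc.IH[of "R - {j}"] Suc.prems i by auto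
   also have "... <= ennreal ((real k + 1) * (real (card R) / real n) ^ k)"
    using j fin by (intro ennreal_leI mult_left_mono power_mono divide_right_mono) (auto simp: card_Diff1_le)
   finally show "adj_mom k (R - {j}) i <= ennreal ((real k + 1) * (real (card R) / real n) ^ k)" .
  qed auto
  also have "... = ennreal ((real (Suc k) + 1) * (real (card R) / real n) ^ Suc k)"
   by (simp add: ennreal_mult[symmetric] ennreal_plus[symmetric] ennreal_of_nat_eq_real_of_nat del: ennreal_plus)
     (simp add: field_simps add_divide_distrib[symmetric])
  finally show ?thesis .
 qed
 thus ?case using char Suc.prems by auto
qed
thus "char_mom k R <= ennreal ((real (card R) / real n) ^ k)"
 and "i ~: R ==> i < n ==> adj_mom k R i <= ennreal ((real k + 1) * (real (card R) / real n) ^ k)" by auto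
qed

end

lemma nn_integral_add_add_sum:
assumes "f : bmeas M" "g : bmeas M" "!!l. l : L ==> h l : bmeas M"
shows "(\<integral>\<^sup>+x. f x + (g x + (SUM l:L. h l x)) \<partial>M) =
 (\<integral>\<^sup>+x. f x \<partial>M) + ((\<integral>\<^sup>+x. g x \<partial>M) + (SUM l:L. \<integral>\<^sup>+x. h l x \<partial>M))"
using assms by (simp add: nn_integral_add nn_integral_sum)

context entry_law
begin

lemma char_mom_le_1: "R <= {..<n} ==> char_mom k R <= 1"
proof -
assume R: "R <= {..<n}"
have "(real (card R) / real n) ^ k <= 1" using card_mono[OF _ R] n_pos by (intro power_le_one) auto
thus ?thesis using order.trans[OF char_adj_mom_bound(1)[OF R] ennreal_leI] by fastforce
qed

lemma adj_mom_le: "R <= {..<n} ==> i ~: R ==> i < n ==> adj_mom k R i <= ennreal (real k + 1)"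
proof -
assume R: "R <= {..<n}" and i: "i ~: R" "i < n"
have "(real (card R) / real n) ^ k <= 1" using card_mono[OF _ R] n_pos by (intro power_le_one) auto
hence "(real k + 1) * (real (card R) / real n) ^ k <= real k + 1" by (simp add: mult_left_le)
thus ?thesis using order.trans[OF char_adj_mom_bound(2)[OF R i] ennreal_leI] by blast
qed

text \<open>Up to sign the difference is z times a single row form, so its second moment is 1/n
  times that of a column of the adjugate. The gain 1/n is what makes such errors summable over all
  rows.\<close>

lemma char_diff_mom:
assumes R: "R <= {..<n}" and j: "j : R"
shows "(NE x. (cmod ((chs n R x - chs n (R - {j}) x) $ k))^2) <= ennreal (real k / real n)"
proof (cases k)
case (Suc k')
have jn: "j < n" and ins: "insert j (R - {j}) = R" using R j by auto
have eq: "chs n R x - chs n (R - {j}) x = - fps_X * lin_form n (x j) (adj n (R - {j}) x j)" for x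
 using chs_insert[of j "R - {j}" n x] ins jn by simp
have "(NE x. (cmod ((chs n R x - chs n (R - {j}) x) $ k))^2) = (NE x. (cmod (0 + (SUM m<n. x j m * (adj n (R - {j}) x j m $ k'))))^2)"
 unfolding eq Suc by (simp add: lin_form_nth)
also have "... = ennreal (1 / real n) * adj_mom k' (R - {j}) j"
 unfolding adj_mom_def using jn measurable_series(3)[OF order.trans[OF Diff_subset R]] by (subst nn_integral_row_exposed) auto
also have "... <= ennreal (1 / real n) * ennreal (real k' + 1)" using R jn by (intro mult_left_mono adj_mom_le) auto
also have "... = ennreal (real k / real n)" using Suc by (simp add: ennreal_mult[symmetric] add.commute del: ennreal_plus)
finally show ?thesis .
qed simp

text \<open>The three terms have different sources: the diagonal entry is a difference of Q, entry
  \<open>j\<close> vanishes once row \<open>j\<close> is removed, and every other entry passes the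
  difference on to degree k.\<close>

lemma adj_diff_sqnorm:
assumes R: "R <= {..<n}" and i: "i ~: R" "i < n" and j: "j : R"
shows "sqnorm n (%l. (adj n R x i l - adj n (R - {j}) x i l) $ Suc k) = (cmod ((chs n R x - chs n (R - {j}) x) $ Suc k))^2 +
  (cmod (SUM m<n. x j m * (adj n (R - {j}) x i m $ k)))^2 +
  (SUM l:R - {j}. (cmod (SUM m<n. x l m * ((adj n (R - {l}) x i m - adj n (R - {l} - {j}) x i m) $ k)))^2)"
proof -
have fin: "finite R" using R finite_subset by blast
have "sqnorm n (%l. (adj n R x i l - adj n (R - {j}) x i l) $ Suc k) =
  (SUM l:insert i (insert j (R - {j})). (cmod ((adj n R x i l - adj n (R - {j}) x i l) $ Suc k))^2)"
 unfolding sqnorm_def using R i j by (intro sum.mono_neutral_right) (auto simp: adj_zero)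
also have "... = (cmod ((adj n R x i i - adj n (R - {j}) x i i) $ Suc k))^2 + ((cmod ((adj n R x i j - adj n (R - {j}) x i j) $ Suc k))^2 +
  (SUM l:R - {j}. (cmod ((adj n R x i l - adj n (R - {j}) x i l) $ Suc k))^2))"
 using i j fin by (subst sum.insert, simp, force, subst sum.insert, auto)
also have "adj n R x i i - adj n (R - {j}) x i i = chs n R x - chs n (R - {j}) x" using i by (simp add: adj_diag)
also have "(adj n R x i j - adj n (R - {j}) x i j) $ Suc k = (SUM m<n. x j m * (adj n (R - {j}) x i m $ k))"
proof -
 have "adj n (R - {j}) x i j = 0" using i j by (intro adj_zero) auto
 thus ?thesis using R i j by (subst adj_row) (auto simp: lin_form_nth)
qed
also have "(SUM l:R - {j}. (cmod ((adj n R x i l - adj n (R - {j}) x i l) $ Suc k))^2) =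
  (SUM l:R - {j}. (cmod (SUM m<n. x l m * ((adj n (R - {l}) x i m - adj n (R - {l} - {j}) x i m) $ k)))^2)"
proof (rule sum.cong[OF refl])
 fix l assume l: "l : R - {j}"
 have "adj n R x i l $ Suc k = (SUM m<n. x l m * (adj n (R - {l}) x i m $ k))" using R i l by (subst adj_row, auto simp: lin_form_nth)
 moreover have "adj n (R - {j}) x i l $ Suc k = (SUM m<n. x l m * (adj n (R - {j} - {l}) x i m $ k))"
  using R i l by (subst adj_row, auto simp: lin_form_nth)
 moreover have "R - {j} - {l} = R - {l} - {j}" by auto
 ultimately show "(cmod ((adj n R x i l - adj n (R - {j}) x i l) $ Suc k))^2 =
  (cmod (SUM m<n. x l m * ((adj n (R - {l}) x i m - adj n (R - {l} - {j}) x i m) $ k)))^2" by (simp add: algebra_simps sum_subtractf)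
qed
finally show ?thesis by simp
qed

lemma nn_integral_row_form_exposed:
assumes "j < n" and V: "!!m. m < n ==> (%x. V x m) : bmeas MX"
 and inv: "!!x y. V (x(j := y)) = V x"
shows "(NE x. (cmod (SUM m<n. x j m * V x m))^2) = ennreal (1 / real n) * (NE x. sqnorm n (V x))"
using nn_integral_row_exposed[of j "%_. 0" V] assms by simp

lemma adj_diff_mom:
assumes "R <= {..<n}" and "i ~: R" "i < n" and "j : R"
shows "(NE x. sqnorm n (%l. (adj n R x i l - adj n (R - {j}) x i l) $ k)) <= ennreal (real k * (real k + 1) / real n)" using assms
proof (induction k arbitrary: R)
case 0
have "(adj n R x i l - adj n (R - {j}) x i l) $ 0 = 0" for x l by (simp add: adj_def resv_def)
thus ?case by (simp add: sqnorm_def)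
next
case (Suc k)
note R = Suc.prems(1) and i = Suc.prems(2,3) and j = Suc.prems(4)
define D where "D = (%l x m. (adj n (R - {l}) x i m - adj n (R - {l} - {j}) x i m) $ k)"
have D: "(%x. D l x m) : bmeas MX" for l m unfolding D_def fps_sub_nth using R by (intro borel_measurable_diff measurable_series) auto
have DX [measurable]: "(%x. SUM m<n. x l m * D l x m) : bmeas MX" if "l : R - {j}" for l
 using R that by (intro borel_measurable_sum borel_measurable_times measurable_entry D) auto
have A: "(%x. adj n (R - {j}) x i m $ k) : bmeas MX" for m using R by (intro measurable_series) auto
have [measurable]: "(%x. SUM m<n. x j m * (adj n (R - {j}) x i m $ k)) : bmeas MX"
 using R j by (intro borel_measurable_sum borel_measurable_times measurable_entry A) auto
have [measurable]: "(%x. (chs n R x - chs n (R - {j}) x) $ Suc k) : bmeas MX"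
 unfolding fps_sub_nth using R by (intro borel_measurable_diff measurable_series) auto
have card: "card R <= n" using card_mono[OF _ R] by simp
let ?a = "ennreal (1 / real n)"
have "(NE x. sqnorm n (%l. (adj n R x i l - adj n (R - {j}) x i l) $ Suc k)) =
 (\<integral>\<^sup>+x. ennreal ((cmod ((chs n R x - chs n (R - {j}) x) $ Suc k))^2) +
  (ennreal ((cmod (SUM m<n. x j m * (adj n (R - {j}) x i m $ k)))^2) +
  (SUM l:R - {j}. ennreal ((cmod (SUM m<n. x l m * D l x m))^2))) \<partial>MX)" unfolding adj_diff_sqnorm[OF R i j] D_def
 by (simp add: ennreal_plus sum_nonneg sum_ennreal add.assoc)
also have "... = (NE x. (cmod ((chs n R x - chs n (R - {j}) x) $ Suc k))^2) +
  ((NE x. (cmod (SUM m<n. x j m * (adj n (R - {j}) x i m $ k)))^2) + (SUM l:R - {j}. (NE x. (cmod (SUM m<n. x l m * D l x m))^2)))"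
 using measurable_series(1)[OF R] measurable_series(1)[OF order.trans[OF Diff_subset R]] by (intro nn_integral_add_add_sum) (auto simp: DX)
also have "... <= ennreal (real (Suc k) / real n) + (?a * ennreal (real k + 1) +
  (SUM l:R - {j}. ?a * ennreal (real k * (real k + 1) / real n)))"
proof (intro add_mono char_diff_mom[OF R j] sum_mono)
 have "(NE x. (cmod (SUM m<n. x j m * (adj n (R - {j}) x i m $ k)))^2) = ?a * adj_mom k (R - {j}) i"
  unfolding adj_mom_def using A R j by (subst nn_integral_row_form_exposed) auto
 also have "... <= ?a * ennreal (real k + 1)" using R i by (intro mult_left_mono adj_mom_le) auto
 finally show "(NE x. (cmod (SUM m<n. x j m * (adj n (R - {j}) x i m $ k)))^2) <= ?a * ennreal (real k + 1)" .
next
 fix l assume l: "l : R - {j}"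
 have "(NE x. (cmod (SUM m<n. x l m * D l x m))^2) = ?a * (NE x. sqnorm n (D l x))"
 proof (rule nn_integral_row_form_exposed[OF _ D])
  show "l < n" using R l by auto
  show "D l (x(l := y)) = D l x" for x y unfolding D_def by (intro ext) simp
 qed
 also have "... <= ?a * ennreal (real k * (real k + 1) / real n)"
  using Suc.IH[of "R - {l}"] R i j l unfolding D_def by (intro mult_left_mono) auto
 finally show "(NE x. (cmod (SUM m<n. x l m * D l x m))^2) <= ?a * ennreal (real k * (real k + 1) / real n)" .
qed
also have "... = ennreal (real (Suc k) / real n + ((real k + 1) / real n +
  real (card (R - {j})) * (real k * (real k + 1) / real n) / real n))"
proof -
 have "(SUM l:R - {j}. ?a * ennreal (real k * (real k + 1) / real n)) =
  (SUM l:R - {j}. ennreal (real k * (real k + 1) / real n / real n))" by (intro sum.cong refl) (simp add: ennreal_mult[symmetric])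
 also have "... = ennreal (real (card (R - {j})) * (real k * (real k + 1) / real n) / real n)" by (subst sum_ennreal) auto
 finally have s: "(SUM l:R - {j}. ?a * ennreal (real k * (real k + 1) / real n)) =
  ennreal (real (card (R - {j})) * (real k * (real k + 1) / real n) / real n)" .
 have t: "?a * ennreal (real k + 1) = ennreal ((real k + 1) / real n)" by (subst ennreal_mult[symmetric]) auto
 show ?thesis unfolding s t by (subst ennreal_plus[symmetric], simp, simp)+ simp
qed
also have "... <= ennreal (real (Suc k) * (real (Suc k) + 1) / real n)"
proof (rule ennreal_leI)
 have "real (card (R - {j})) <= real n" using card card_Diff1_le[of R j] by linarith
 hence "real (card (R - {j})) * (real k * (real k + 1) / real n) / real n <= real n * (real k * (real k + 1) / real n) / real n"
  by (intro divide_right_mono mult_right_mono) auto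
 also have "... = real k * (real k + 1) / real n" using n_pos by simp
 finally have "real (card (R - {j})) * (real k * (real k + 1) / real n) / real n <= real k * (real k + 1) / real n" .
 moreover have "real (Suc k) / real n + ((real k + 1) / real n + real k * (real k + 1) / real n) =
  real (Suc k) * (real (Suc k) + 1) / real n" by (simp add: add_divide_distrib[symmetric] algebra_simps)
 ultimately show "real (Suc k) / real n + ((real k + 1) / real n +
  real (card (R - {j})) * (real k * (real k + 1) / real n) / real n) <= real (Suc k) * (real (Suc k) + 1) / real n" by linarith
qed
finally show ?case .
qed

section \<open>Comparison of the coefficients for truncated and untruncated entries\<close>

context
fixes f :: "complex => complex" and dl :: real
assumes f [measurable]: "f : bmeas borel"
 and f_sq: "integrable mu (%y. (cmod (f y))^2)" and f_mean: "(LINT y|mu. f y) = 0"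
 and f_second: "(LINT y|mu. (cmod (f y))^2) <= 1 / real n"
 and f_close: "(LINT y|mu. (cmod (y - f y))^2) <= dl / real n"
 and dl: "dl >= 0"
begin

lemma integrable_sq_form: "integrable mu (%y. (cmod (y * a - f y * b))^2)"
proof (rule Bochner_Integration.integrable_bound[where f = "%y. 2 * (cmod a)^2 * (cmod y)^2 + 2 * (cmod b)^2 * (cmod (f y))^2"])
have "(cmod (u - v))^2 <= 2 * (cmod u)^2 + 2 * (cmod v)^2" for u v
proof -
 have "(cmod (u - v))^2 <= (cmod u + cmod v)^2" by (intro power_mono norm_triangle_ineq4) auto
 also have "... <= 2 * (cmod u)^2 + 2 * (cmod v)^2"
  using zero_le_power2[of "cmod u - cmod v"] by (simp add: power2_eq_square algebra_simps)
 finally show ?thesis .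
qed
from this[of "_ * a" "f _ * b"] show "AE y in mu. norm ((cmod (y * a - f y * b))^2) <=
  norm (2 * (cmod a)^2 * (cmod y)^2 + 2 * (cmod b)^2 * (cmod (f y))^2)" by (auto simp: norm_mult power_mult_distrib mult_ac)
show "integrable mu (%y. 2 * (cmod a)^2 * (cmod y)^2 + 2 * (cmod b)^2 * (cmod (f y))^2)" using int_sq f_sq by simp
show "(%y. (cmod (y * a - f y * b))^2) : bmeas mu" unfolding measurable_mu_borel using f by measurable
qed

lemma integrable_f: "integrable mu f"
proof (rule Bochner_Integration.integrable_bound[where f = "%y. 1 + (cmod (f y))^2"])
have "cmod y <= 1 + (cmod y)^2" for y using zero_le_power2[of "cmod y - 1/2"] by (simp add: power2_diff power_divide)
thus "AE y in mu. norm (f y) <= norm (1 + (cmod (f y))^2)" by (auto simp: abs_of_nonneg)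
show "integrable mu (%y. 1 + (cmod (f y))^2)" using f_sq by simp
qed (simp add: measurable_mu_borel)

text \<open>Split y a - f y b = (y - f y) a + f y (a - b): the first part is small by truncation,
  the second is left to the induction on the degree.\<close>

lemma second_moment_form_le: "(LINT y|mu. (cmod (y * a - f y * b))^2) <= (2 * dl * (cmod a)^2 + 2 * (cmod (a - b))^2) / real n"
proof -
have le: "(cmod (y * a - f y * b))^2 <= 2 * (cmod a)^2 * (cmod (y - f y))^2 + 2 * (cmod (a - b))^2 * (cmod (f y))^2" for y
proof -
 have "y * a - f y * b = (y - f y) * a + f y * (a - b)" by (simp add: algebra_simps)
 hence "(cmod (y * a - f y * b))^2 <= (cmod ((y - f y) * a) + cmod (f y * (a - b)))^2"
  by (intro power_mono) (auto intro: norm_triangle_ineq)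
 also have "... <= 2 * (cmod ((y - f y) * a))^2 + 2 * (cmod (f y * (a - b)))^2"
  using zero_le_power2[of "cmod ((y - f y) * a) - cmod (f y * (a - b))"] by (simp add: power2_eq_square algebra_simps)
 finally show ?thesis by (simp add: norm_mult power_mult_distrib mult_ac)
qed
have int: "integrable mu (%y. (cmod (y - f y))^2)" using integrable_sq_form[of 1 1] by simp
have "(LINT y|mu. (cmod (y * a - f y * b))^2) <= (LINT y|mu. 2 * (cmod a)^2 * (cmod (y - f y))^2 + 2 * (cmod (a - b))^2 * (cmod (f y))^2)"
 using le int f_sq by (intro integral_mono integrable_sq_form) auto
also have "... = 2 * (cmod a)^2 * (LINT y|mu. (cmod (y - f y))^2) + 2 * (cmod (a - b))^2 * (LINT y|mu. (cmod (f y))^2)"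
 using int f_sq by simp
also have "... <= 2 * (cmod a)^2 * (dl / real n) + 2 * (cmod (a - b))^2 * (1 / real n)"
 using f_close f_second by (intro add_mono mult_left_mono) auto
finally show ?thesis by (simp add: add_divide_distrib mult_ac)
qed

lemma nn_integral_row_compare:
assumes "j < n" "C : bmeas MX"
 and V: "!!m. m < n ==> (%x. V x m) : bmeas MX"
 and W: "!!m. m < n ==> (%x. W x m) : bmeas MX"
 and inv: "!!x y. C (x(j := y)) = C x" "!!x y. V (x(j := y)) = V x" "!!x y. W (x(j := y)) = W x"
shows "(NE x. (cmod (C x + ((SUM m<n. x j m * V x m) - (SUM m<n. f (x j m) * W x m))))^2) <= (NE x. (cmod (C x))^2) +
  (ennreal (2 * dl / real n) * (NE x. sqnorm n (V x)) + ennreal (2 / real n) * (NE x. sqnorm n (%m. V x m - W x m)))"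
proof -
have S: "(%x. C x + (SUM m<n. x j m * V x m - f (x j m) * W x m)) : bmeas MX"
proof (intro borel_measurable_add borel_measurable_sum borel_measurable_diff borel_measurable_times)
 fix m assume m: "m : {..<n}"
 show "(%x. x j m) : bmeas MX" using m assms(1) by (intro measurable_entry) auto
 thus "(%x. f (x j m)) : bmeas MX" by (rule measurable_compose[OF _ f])
 show "(%x. V x m) : bmeas MX" "(%x. W x m) : bmeas MX" using m by (intro V W; simp)+
qed (rule assms(2))
have sq: "(%x. sqnorm n (V x)) : bmeas MX" "(%x. sqnorm n (%m. V x m - W x m)) : bmeas MX"
 by (intro measurable_sqnorm V W borel_measurable_diff; assumption)+
let ?a = "ennreal (2 * dl / real n)"
have "(NE x. (cmod (C x + ((SUM m<n. x j m * V x m) - (SUM m<n. f (x j m) * W x m))))^2) =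
 (NE x. (cmod (C x + (SUM m<n. x j m * V x m - f (x j m) * W x m)))^2)" by (simp only: sum_subtractf)
also have "... = (\<integral>\<^sup>+x. \<integral>\<^sup>+y. ennreal ((cmod (C x + (SUM m<n. y m * V x m - f (y m) * W x m)))^2) \<partial>RW \<partial>MX)"
proof -
 have "(%x. ennreal ((cmod (C x + (SUM m<n. x j m * V x m - f (x j m) * W x m)))^2)) : bmeas MX" by (rule measurable_compose[OF S]) simp
 from nn_integral_resample[OF assms(1) this] show ?thesis by (simp only: inv fun_upd_same)
qed
also have "... <= (\<integral>\<^sup>+x. ennreal ((cmod (C x))^2) + (?a * ennreal (sqnorm n (V x)) +
  ennreal (2 / real n) * ennreal (sqnorm n (%m. V x m - W x m))) \<partial>MX)"
proof (rule nn_integral_mono)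
 fix x
 have "(\<integral>\<^sup>+y. ennreal ((cmod (C x + (SUM m<n. y m * V x m - f (y m) * W x m)))^2) \<partial>RW) =
  ennreal ((cmod (C x))^2 + (SUM m<n. (LINT y|mu. (cmod (y * V x m - f y * W x m))^2)))"
 proof (rule nn_integral_row_form)
  fix m
  have [measurable]: "f : bmeas borel" by (rule f)
  show "(%y. y * V x m - f y * W x m) : bmeas borel" by simp
  show "integrable mu (%y. (cmod (y * V x m - f y * W x m))^2)" by (rule integrable_sq_form)
  show "(LINT y|mu. y * V x m - f y * W x m) = 0" using integrable_mu integrable_f mean f_mean by simp
 qed
 also have "... <= ennreal ((cmod (C x))^2 + (SUM m<n. (2 * dl * (cmod (V x m))^2 + 2 * (cmod (V x m - W x m))^2) / real n))"
  by (intro ennreal_leI add_left_mono sum_mono second_moment_form_le)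
 also have "... = ennreal ((cmod (C x))^2 + ((2 * dl / real n) * sqnorm n (V x) + (2 / real n) * sqnorm n (%m. V x m - W x m)))"
 proof -
  have "(SUM m<n. (2 * dl * (cmod (V x m))^2 + 2 * (cmod (V x m - W x m))^2) / real n) =
   (SUM m<n. (2 * dl / real n) * (cmod (V x m))^2 + (2 / real n) * (cmod (V x m - W x m))^2)"
   by (intro sum.cong refl) (simp add: add_divide_distrib)
  thus ?thesis unfolding sqnorm_def sum_distrib_left by (simp only: sum.distrib)
 qed
 also have "... = ennreal ((cmod (C x))^2) + (?a * ennreal (sqnorm n (V x)) +
  ennreal (2 / real n) * ennreal (sqnorm n (%m. V x m - W x m)))"
  using dl by (simp add: ennreal_mult[symmetric] ennreal_plus[symmetric] del: ennreal_plus)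
 finally show "(\<integral>\<^sup>+y. ennreal ((cmod (C x + (SUM m<n. y m * V x m - f (y m) * W x m)))^2) \<partial>RW) <=
  ennreal ((cmod (C x))^2) + (?a * ennreal (sqnorm n (V x)) +
  ennreal (2 / real n) * ennreal (sqnorm n (%m. V x m - W x m)))" .
qed
also have "... = (NE x. (cmod (C x))^2) + (?a * (NE x. sqnorm n (V x)) +
  ennreal (2 / real n) * (NE x. sqnorm n (%m. V x m - W x m)))"
proof -
 have C: "(%x. ennreal ((cmod (C x))^2)) : bmeas MX" using assms(2) by simp
 have V': "(%x. ennreal (sqnorm n (V x))) : bmeas MX" "(%x. ennreal (sqnorm n (%m. V x m - W x m))) : bmeas MX"
  by (rule measurable_compose[OF sq(1) measurable_ennreal], rule measurable_compose[OF sq(2) measurable_ennreal])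
 have V'': "(%x. ?a * ennreal (sqnorm n (V x))) : bmeas MX"
  "(%x. ennreal (2 / real n) * ennreal (sqnorm n (%m. V x m - W x m))) : bmeas MX"
  by (intro borel_measurable_times_ennreal V' borel_measurable_const)+
 show ?thesis unfolding nn_integral_add[OF C borel_measurable_add[OF V'']] nn_integral_add[OF V'']
   nn_integral_cmult[OF V'(1)] nn_integral_cmult[OF V'(2)] ..
qed
finally show ?thesis .
qed

end

end

text \<open>The recursion doubles 2 (k + 1) + 2 c, once for the coefficient of Q and once for the
  rows of the adjugate. Nothing depends on n, so the truncation level can be chosen after the degree
  has been fixed.\<close>

fun compare_const :: "nat => real" where
"compare_const 0 = 0"
| "compare_const (Suc k) = 4 * (real k + 1) + 4 * compare_const k"

lemma compare_const_nonneg [simp]: "compare_const k >= 0" by (induction k) auto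

abbreviation (input) mape :: "(complex => complex) => entries => nat => nat => complex" where "mape f x \<equiv> %i m. f (x i m)"

context entry_law
begin

context
fixes f :: "complex => complex" and dl :: real
assumes f: "f : bmeas borel"
 and f_sq: "integrable mu (%y. (cmod (f y))^2)" and f_mean: "(LINT y|mu. f y) = 0"
 and f_second: "(LINT y|mu. (cmod (f y))^2) <= 1 / real n"
 and f_close: "(LINT y|mu. (cmod (y - f y))^2) <= dl / real n"
 and dl: "dl >= 0"
begin

lemma measurable_series_mapf:
assumes "R <= {..<n}"
shows "(%x. chs n R (mape f x) $ k) : bmeas MX" "(%x. ichs n R (mape f x) $ k) : bmeas MX" "(%x. adj n R (mape f x) i l $ k) : bmeas MX"
 "(%x. trs n R (mape f x) $ k) : bmeas MX"
proof -
have g: "(%x. f (x l m)) : bmeas MX" if "l : R" "m < n" for l m using assms that by (intro measurable_compose[OF measurable_entry f]) auto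
show "(%x. chs n R (mape f x) $ k) : bmeas MX" by (rule measurable_chs) (rule g)
show "(%x. ichs n R (mape f x) $ k) : bmeas MX" by (rule measurable_ichs) (rule g)
show "(%x. adj n R (mape f x) i l $ k) : bmeas MX" by (rule measurable_adj) (rule g)
show "(%x. trs n R (mape f x) $ k) : bmeas MX" by (rule measurable_trs) (rule g)
qed

lemma series_mapf_upd:
assumes "j ~: R"
shows "chs n R (mape f (x(j := y))) = chs n R (mape f x)" "adj n R (mape f (x(j := y))) = adj n R (mape f x)"
proof -
have eq: "f ((x(j := y)) l m) = f (x l m)" if "l : R" for l m using that assms by auto
show "chs n R (mape f (x(j := y))) = chs n R (mape f x)" by (rule chs_cong) (rule eq)
show "adj n R (mape f (x(j := y))) = adj n R (mape f x)" by (rule adj_cong) (rule eq)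
qed

lemma nn_integral_row_compare_adj:
assumes R: "R <= {..<n}" and j: "j ~: R" "j < n" and i: "i ~: R" "i < n"
 and C: "C : bmeas MX" "!!x y. C (x(j := y)) = C x"
 and IH: "(NE x. sqnorm n (%l. (adj n R x i l - adj n R (mape f x) i l) $ k)) <= ennreal (dl * c)"
 and c: "c >= 0"
shows "(NE x. (cmod (C x + ((SUM m<n. x j m * (adj n R x i m $ k)) - (SUM m<n. f (x j m) * (adj n R (mape f x) i m $ k)))))^2) <=
  (NE x. (cmod (C x))^2) + ennreal (dl * (2 * (real k + 1) + 2 * c) / real n)"
proof -
have "(NE x. (cmod (C x + ((SUM m<n. x j m * (adj n R x i m $ k)) - (SUM m<n. f (x j m) * (adj n R (mape f x) i m $ k)))))^2) <=
  (NE x. (cmod (C x))^2) + (ennreal (2 * dl / real n) * adj_mom k R i +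
  ennreal (2 / real n) * (NE x. sqnorm n (%l. (adj n R x i l - adj n R (mape f x) i l) $ k)))" unfolding adj_mom_def fps_sub_nth
proof (rule nn_integral_row_compare[OF f f_sq f_mean f_second f_close dl j(2) C(1)])
 show "(%x. adj n R x i m $ k) : bmeas MX" for m by (rule measurable_series(3)[OF R])
 show "(%x. adj n R (mape f x) i m $ k) : bmeas MX" for m by (rule measurable_series_mapf(3)[OF R])
 show "C (x(j := y)) = C x" for x y by (rule C(2))
 show "(%m. adj n R (x(j := y)) i m $ k) = (%m. adj n R x i m $ k)" for x y using j by simp
 show "(%m. adj n R (mape f (x(j := y))) i m $ k) = (%m. adj n R (mape f x) i m $ k)" for x y using series_mapf_upd(2)[OF j(1)] by simp
qed
also have "... <= (NE x. (cmod (C x))^2) + (ennreal (2 * dl / real n) * ennreal (real k + 1) + ennreal (2 / real n) * ennreal (dl * c))"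
 using R i IH by (intro add_left_mono add_mono mult_left_mono adj_mom_le) auto
also have "ennreal (2 * dl / real n) * ennreal (real k + 1) + ennreal (2 / real n) * ennreal (dl * c) =
  ennreal (dl * (2 * (real k + 1) + 2 * c) / real n)"
proof -
 have a: "ennreal (2 * dl / real n) * ennreal (real k + 1) = ennreal (2 * dl / real n * (real k + 1))"
  using dl by (subst ennreal_mult[symmetric]) auto
 have b: "ennreal (2 / real n) * ennreal (dl * c) = ennreal (2 / real n * (dl * c))" using dl c by (subst ennreal_mult[symmetric]) auto
 have "2 * dl / real n * (real k + 1) + 2 / real n * (dl * c) = dl * (2 * (real k + 1) + 2 * c) / real n"
  by (simp add: add_divide_distrib[symmetric] algebra_simps)
 thus ?thesis unfolding a b using dl c by (subst ennreal_plus[symmetric]) auto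
qed
finally show ?thesis .
qed

lemma adj_compare_sqnorm:
assumes R: "R <= {..<n}" and i: "i ~: R" "i < n"
shows "sqnorm n (%l. (adj n R x i l - adj n R x' i l) $ Suc k) = (cmod ((chs n R x - chs n R x') $ Suc k))^2 +
  (SUM j:R. (cmod (0 + ((SUM m<n. x j m * (adj n (R - {j}) x i m $ k)) - (SUM m<n. x' j m * (adj n (R - {j}) x' i m $ k)))))^2)"
proof -
have "sqnorm n (%l. (adj n R x i l - adj n R x' i l) $ Suc k) = (SUM l:insert i R. (cmod ((adj n R x i l - adj n R x' i l) $ Suc k))^2)"
 unfolding sqnorm_def using R i by (intro sum.mono_neutral_right) (auto simp: adj_zero)
also have "... = (cmod ((chs n R x - chs n R x') $ Suc k))^2 + (SUM j:R. (cmod ((adj n R x i j - adj n R x' i j) $ Suc k))^2)"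
 using i finite_subset[OF R] by (simp add: adj_diag)
also have "(SUM j:R. (cmod ((adj n R x i j - adj n R x' i j) $ Suc k))^2) =
 (SUM j:R. (cmod (0 + ((SUM m<n. x j m * (adj n (R - {j}) x i m $ k)) - (SUM m<n. x' j m * (adj n (R - {j}) x' i m $ k)))))^2)"
proof (rule sum.cong[OF refl])
 fix l assume l: "l : R"
 have "adj n R z i l $ Suc k = (SUM m<n. z l m * (adj n (R - {l}) z i m $ k))" for z
  using R i l by (subst adj_row, auto simp: lin_form_nth)
 thus "(cmod ((adj n R x i l - adj n R x' i l) $ Suc k))^2 = (cmod (0 + ((SUM m<n. x l m * (adj n (R - {l}) x i m $ k)) -
   (SUM m<n. x' l m * (adj n (R - {l}) x' i m $ k)))))^2" by simp
qed
finally show ?thesis .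
qed

text \<open>Q and the adjugate are compared together, since each degree of Q needs the previous
  degree of the adjugate. Exposing one row costs a term of order 1/n, and there are at most n
  rows.\<close>

lemma compare_bound_aux:
assumes "R <= {..<n}"
shows "(NE x. (cmod ((chs n R x - chs n R (mape f x)) $ k))^2) <= ennreal (dl * compare_const k) &
 (\<forall>i. i ~: R --> i < n --> (NE x. sqnorm n (%l. (adj n R x i l - adj n R (mape f x) i l) $ k)) <= ennreal (dl * compare_const k))"
using assms
proof (induction k arbitrary: R)
case 0
have "(adj n R x i l - adj n R (mape f x) i l) $ 0 = 0" for x i l by (simp add: adj_def resv_def)
thus ?case by (simp add: sqnorm_def)
next
case (Suc k)
define c where "c = 2 * (real k + 1) + 2 * compare_const k"
have c: "c >= 0" by (simp add: c_def)
have card_le: "real (card S) / real n <= 1" if "S <= {..<n}" for S using card_mono[OF _ that] n_pos by simp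
let ?a = "ennreal (dl * c / real n)"
have char: "(NE x. (cmod ((chs n S x - chs n S (mape f x)) $ Suc k))^2)
  <= ennreal (dl * c * (real (card S) / real n))" if "S <= {..<n}" for S using finite_subset[OF that finite_lessThan] that
proof (induction S rule: finite_induct)
 case empty
 have "chs n {} x = chs n {} x'" for x x' by (rule chs_cong) simp
 hence "chs n {} x - chs n {} (mape f x) = 0" for x by (metis diff_self)
 thus ?case by simp
next
 case (insert j S)
 let ?C = "%x. - ((chs n S x - chs n S (mape f x)) $ Suc k)"
 have Cm: "?C : bmeas MX" unfolding fps_sub_nth
  by (intro borel_measurable_uminus borel_measurable_diff measurable_series(1) measurable_series_mapf(1)) (use insert in auto)
 have eq: "cmod ((chs n (insert j S) x - chs n (insert j S) (mape f x)) $ Suc k) =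
  cmod (?C x + ((SUM m<n. x j m * (adj n S x j m $ k)) - (SUM m<n. f (x j m) * (adj n S (mape f x) j m $ k))))" for x
 proof -
  have "(chs n (insert j S) x - chs n (insert j S) (mape f x)) $ Suc k =
   - (?C x + ((SUM m<n. x j m * (adj n S x j m $ k)) - (SUM m<n. f (x j m) * (adj n S (mape f x) j m $ k))))"
   using insert by (simp add: chs_insert lin_form_nth)
  thus ?thesis by (simp only: norm_minus_cancel)
 qed
 have "(NE x. (cmod ((chs n (insert j S) x - chs n (insert j S) (mape f x)) $ Suc k))^2)
  <= (NE x. (cmod (?C x))^2) + ?a" unfolding eq c_def
 proof (rule nn_integral_row_compare_adj[OF _ _ _ _ _ Cm])
  show "S <= {..<n}" "j ~: S" "j < n" using insert by auto
  thus "(NE x. sqnorm n (%l. (adj n S x j l - adj n S (mape f x) j l) $ k)) <= ennreal (dl * compare_const k)" using Suc.IH by blast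
  show "?C (x(j := y)) = ?C x" for x y using insert.hyps series_mapf_upd(1)[of j S] by simp
 qed (use insert in auto)
 also have "... <= ennreal (dl * c * (real (card S) / real n)) + ?a"
  unfolding norm_minus_cancel using insert.IH insert.prems by (intro add_right_mono) auto
 also have "... = ennreal (dl * c * (real (card (insert j S)) / real n))"
  using insert.hyps dl c by (subst ennreal_plus[symmetric]) (auto simp: add_divide_distrib algebra_simps)
 finally show ?case .
qed
have char1: "(NE x. (cmod ((chs n R x - chs n R (mape f x)) $ Suc k))^2) <= ennreal (dl * c)"
proof -
 have "dl * c * (real (card R) / real n) <= dl * c" using mult_left_le[OF card_le[OF Suc.prems], of "dl * c"] dl c by simp
 thus ?thesis using order.trans[OF char[OF Suc.prems] ennreal_leI] by blast
qed
have adj: "(NE x. sqnorm n (%l. (adj n R x i l - adj n R (mape f x) i l) $ Suc k))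
  <= ennreal (dl * compare_const (Suc k))" if i: "i ~: R" "i < n" for i
proof -
 let ?D = "%j x. 0 + ((SUM m<n. x j m * (adj n (R - {j}) x i m $ k)) - (SUM m<n. f (x j m) * (adj n (R - {j}) (mape f x) i m $ k)))"
 have Rj: "R - {j} <= {..<n}" for j using Suc.prems by auto
 have Dm: "?D j : bmeas MX" if "j : R" for j
 proof -
  have "j < n" using that Suc.prems by auto
  thus ?thesis by (intro borel_measurable_add borel_measurable_const borel_measurable_diff borel_measurable_sum borel_measurable_times
    measurable_entry measurable_compose[OF measurable_entry f] measurable_series(3) measurable_series_mapf(3) Rj) auto
 qed
 have Dm2: "(%x. ennreal ((cmod (?D j x))^2)) : bmeas MX" if "j : R" for j by (rule measurable_compose[OF Dm[OF that]]) simp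
 have Cm: "(%x. ennreal ((cmod ((chs n R x - chs n R (mape f x)) $ Suc k))^2)) : bmeas MX"
 proof (rule measurable_compose[where g = "%u. ennreal ((cmod u)^2)"])
  show "(%x. (chs n R x - chs n R (mape f x)) $ Suc k) : bmeas MX" unfolding fps_sub_nth
   by (intro borel_measurable_diff measurable_series(1) measurable_series_mapf(1) Suc.prems)
 qed simp
 have "(NE x. sqnorm n (%l. (adj n R x i l - adj n R (mape f x) i l) $ Suc k)) =
  (\<integral>\<^sup>+x. ennreal ((cmod ((chs n R x - chs n R (mape f x)) $ Suc k))^2) +
   (0 + (SUM j:R. ennreal ((cmod (?D j x))^2))) \<partial>MX)" unfolding adj_compare_sqnorm[OF Suc.prems i]
  by (intro nn_integral_cong) (simp only: add_0_left, subst sum_ennreal, simp, subst ennreal_plus, simp, intro sum_nonneg, simp, rule refl)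
 also have "... = (NE x. (cmod ((chs n R x - chs n R (mape f x)) $ Suc k))^2) +
   ((\<integral>\<^sup>+x. 0 \<partial>MX) + (SUM j:R. (NE x. (cmod (?D j x))^2)))" by (rule nn_integral_add_add_sum[OF Cm _ Dm2]) auto
 also have "... <= ennreal (dl * c) + (0 + (SUM j:R. ?a))"
 proof (intro add_mono sum_mono char1)
  fix j assume j: "j : R"
  have "(NE x. (cmod (?D j x))^2) <= (NE x. (cmod (0::complex))^2) + ?a" unfolding c_def
  proof (rule nn_integral_row_compare_adj[OF Rj])
   show "(NE x. sqnorm n (%l. (adj n (R - {j}) x i l - adj n (R - {j}) (mape f x) i l) $ k))
    <= ennreal (dl * compare_const k)" using Suc.IH[OF Rj] i by auto
  qed (use j i Suc.prems in auto)
  thus "(NE x. (cmod (?D j x))^2) <= ?a" by simp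
 qed simp
 also have "(SUM j:R. ?a) = ennreal (dl * c * (real (card R) / real n))"
  using dl c by (subst sum_ennreal) (auto simp: algebra_simps)
 also have "ennreal (dl * c) + (0 + ennreal (dl * c * (real (card R) / real n))) <= ennreal (dl * c) + ennreal (dl * c)"
  using mult_left_le[OF card_le[OF Suc.prems], of "dl * c"] dl c by (simp only: add_0) (intro add_left_mono ennreal_leI, simp)
 also have "... = ennreal (dl * compare_const (Suc k))" using dl c by (subst ennreal_plus[symmetric]) (auto simp: c_def algebra_simps)
 finally show ?thesis .
qed
have "dl * c <= dl * compare_const (Suc k)" using dl by (intro mult_left_mono) (auto simp: c_def)
thus ?case by (intro conjI allI impI adj order.trans[OF char1] ennreal_leI)
qed

lemma char_compare_mom:
assumes "R <= {..<n}"
shows "(NE x. (cmod ((chs n R x - chs n R (mape f x)) $ k))^2) <= ennreal (dl * compare_const k)"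
by (rule conjunct1[OF compare_bound_aux[OF assms]])

end

end

section \<open>Closed walks and the second moment of traces\<close>

lemma sum_PiE_insert:
fixes F :: "('a => 'b) => 'c::comm_monoid_add"
assumes "j ~: J"
shows "(SUM u:PiE (insert j J) A. F u) = (SUM u:PiE J A. SUM m:A j. F (u(j := m)))"
proof -
have "(SUM u:PiE (insert j J) A. F u) = (SUM z:A j \<times> PiE J A. F ((%(y, g). g(j := y)) z))"
 unfolding PiE_insert_eq using inj_combinator[OF assms, of A] by (subst sum.reindex) (auto simp: o_def)
also have "... = (SUM u:PiE J A. SUM m:A j. F (u(j := m)))" by (subst sum.swap) (simp add: sum.cartesian_product split_beta')
finally show ?thesis .
qed

text \<open>A new coordinate either repeats one of at most card J old values, at no cost, or takes
  one of at most n new values at the cost 1/n. It thus multiplies the sum by at most card J +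
  1.\<close>

lemma sum_inverse_power_card_image_le:
assumes "finite J" "n > 0"
shows "(SUM u:PiE J (%_. {..<n}). (1 / real n) ^ card (u ` J)) <= fact (card J)" using assms(1)
proof (induction J rule: finite_induct)
case (insert j J)
let ?a = "1 / real n"
have "(SUM u:PiE (insert j J) (%_. {..<n}). ?a ^ card (u ` insert j J)) =
 (SUM u:PiE J (%_. {..<n}). SUM m<n. ?a ^ card ((u(j := m)) ` insert j J))" by (rule sum_PiE_insert) fact
also have "... <= (SUM u:PiE J (%_. {..<n}). (real (card J) + 1) * ?a ^ card (u ` J))"
proof (rule sum_mono)
 fix u assume u: "u : PiE J (%_. {..<n})"
 let ?V = "u ` J"
 have V: "finite ?V" "?V <= {..<n}" using insert u by auto
 have im: "(u(j := m)) ` insert j J = insert m ?V" for m using insert.hyps by auto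
 have "(SUM m<n. ?a ^ card (insert m ?V)) =
  (SUM m:?V. ?a ^ card (insert m ?V)) + (SUM m:{..<n} - ?V. ?a ^ card (insert m ?V))"
  by (subst sum.subset_diff[OF V(2)]) (simp_all only: finite_lessThan add.commute)
 also have "(SUM m:?V. ?a ^ card (insert m ?V)) = real (card ?V) * ?a ^ card ?V" by (simp add: insert_absorb)
 also have "(SUM m:{..<n} - ?V. ?a ^ card (insert m ?V)) = real (card ({..<n} - ?V)) * ?a ^ Suc (card ?V)"
  using V by simp
 also have "... <= real n * ?a ^ Suc (card ?V)" using card_mono[of "{..<n}" "{..<n} - ?V"] by (intro mult_right_mono) auto
 also have "... = ?a ^ card ?V" using assms(2) by simp
 also have "real (card ?V) * ?a ^ card ?V + ?a ^ card ?V <=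
  real (card J) * ?a ^ card ?V + ?a ^ card ?V"
  using card_image_le[of J u] insert.hyps by (intro add_right_mono mult_right_mono) auto
 finally show "(SUM m<n. ?a ^ card ((u(j := m)) ` insert j J)) <= (real (card J) + 1) * ?a ^ card ?V"
  unfolding im by (simp add: algebra_simps)
qed
also have "... = (real (card J) + 1) * (SUM u:PiE J (%_. {..<n}). ?a ^ card (u ` J))" by (simp add: sum_distrib_left)
also have "... <= (real (card J) + 1) * fact (card J)" using insert.IH by (intro mult_left_mono) auto
finally show ?case using insert.hyps by (simp add: add.commute)
qed simp

definition walk_weight :: "entries => (nat => nat) => nat => nat => complex" where
"walk_weight x w k i = (PROD t<k. x (w t) (w (Suc t))) * x (w k) i"

lemma rpow_walks:
assumes "l < n" "i < n"
shows "rpow n {..<n} x i (Suc k) l = (SUM w:PiE {..<Suc k} (%_. {..<n}). if w 0 = l then walk_weight x w k i else 0)" using assms(2)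
proof (induction k arbitrary: i)
case 0
have "(SUM w:PiE {..<Suc 0} (%_. {..<n}). if w 0 = l then walk_weight x w 0 i else 0) =
 (SUM u:PiE {} (%_. {..<n}). SUM m<n. if m = l then x m i else 0)"
 unfolding lessThan_Suc lessThan_0 by (subst sum_PiE_insert) (auto simp: walk_weight_def)
moreover have "rpow n {..<n} x i (Suc 0) l = x l i"
proof -
 have "rpow n {..<n} x i (Suc 0) l = (SUM m<n. if i = m then x l m else 0)"
  unfolding rpow.simps using assms(1) by (simp only: lessThan_iff if_True) (intro sum.cong, auto)
 thus ?thesis using 0 by simp
qed
ultimately show ?case using assms(1) by simp
next
case (Suc k)
have r1: "rpow n {..<n} x i 1 m = x m i" if "m < n" for m
proof -
 have "rpow n {..<n} x i 1 m = (SUM p<n. if i = p then x m p else 0)"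
  unfolding One_nat_def rpow.simps using that by (simp only: lessThan_iff if_True) (intro sum.cong, auto)
 thus ?thesis using Suc.prems by simp
qed
have "rpow n {..<n} x i (Suc (Suc k)) l = (SUM m<n. rpow n {..<n} x m (Suc k) l * rpow n {..<n} x i 1 m)"
 using rpow_add[OF assms(1), of "{..<n}" x "Suc k" i 1] by simp
also have "... = (SUM m<n. (SUM w:PiE {..<Suc k} (%_. {..<n}). if w 0 = l then walk_weight x w k m else 0) * x m i)"
proof (rule sum.cong[OF refl])
 fix m assume "m : {..<n}"
 hence m: "m < n" by simp
 show "rpow n {..<n} x m (Suc k) l * rpow n {..<n} x i 1 m =
  (SUM w:PiE {..<Suc k} (%_. {..<n}). if w 0 = l then walk_weight x w k m else 0) * x m i" unfolding r1[OF m] Suc.IH[OF m] ..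
qed
also have "... = (SUM w:PiE {..<Suc k} (%_. {..<n}). SUM m<n. (if w 0 = l then walk_weight x w k m * x m i else 0))"
 by (simp add: sum_distrib_right sum.swap[of _ "{..<n}"] if_distrib[of "%u. u * _"] cong: if_cong)
also have "... = (SUM w:PiE {..<Suc k} (%_. {..<n}). SUM m<n. (if (w(Suc k := m)) 0 = l then walk_weight x (w(Suc k := m)) (Suc k) i else 0))"
proof (intro sum.cong refl)
 fix w m
 have "(PROD t<k. x ((w(Suc k := m)) t) ((w(Suc k := m)) (Suc t))) = (PROD t<k. x (w t) (w (Suc t)))" by (intro prod.cong) auto
 thus "(if w 0 = l then walk_weight x w k m * x m i else 0) =
  (if (w(Suc k := m)) 0 = l then walk_weight x (w(Suc k := m)) (Suc k) i else 0)" by (simp add: walk_weight_def)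
qed
also have "... = (SUM w:PiE {..<Suc (Suc k)} (%_. {..<n}). if w 0 = l then walk_weight x w (Suc k) i else 0)"
 unfolding lessThan_Suc[of "Suc k"] by (subst sum_PiE_insert) auto
finally show ?case .
qed

lemma trs_walks: "trs n {..<n} x $ (Suc k) = (SUM w:PiE {..<Suc k} (%_. {..<n}). PROD t<Suc k. x (w t) (w (Suc t mod Suc k)))"
proof -
have "trs n {..<n} x $ (Suc k) = (SUM l<n. SUM w:PiE {..<Suc k} (%_. {..<n}). if w 0 = l then walk_weight x w k l else 0)"
 by (simp add: trs_def rpow_walks del: rpow.simps)
also have "... = (SUM w:PiE {..<Suc k} (%_. {..<n}). SUM l<n. if w 0 = l then walk_weight x w k l else 0)" by (rule sum.swap)
also have "... = (SUM w:PiE {..<Suc k} (%_. {..<n}). walk_weight x w k (w 0))" by (intro sum.cong refl) (auto simp: PiE_def Pi_def)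
also have "... = (SUM w:PiE {..<Suc k} (%_. {..<n}). PROD t<Suc k. x (w t) (w (Suc t mod Suc k)))"
proof (intro sum.cong refl)
 fix w
 have "(PROD t<k. x (w t) (w (Suc t mod Suc k))) = (PROD t<k. x (w t) (w (Suc t)))" by (intro prod.cong) auto
 thus "walk_weight x w k (w 0) = (PROD t<Suc k. x (w t) (w (Suc t mod Suc k)))" by (simp add: walk_weight_def)
qed
finally show ?thesis .
qed

lemma add_mod_if:
fixes a b k :: nat
assumes "a < k" "b < k"
shows "(a + b) mod k = (if a + b < k then a + b else a + b - k)"
proof (cases "a + b < k")
case False
hence "(a + b) mod k = (a + b - k) mod k" by (intro le_mod_geq) simp
also have "... = a + b - k" using assms by (intro mod_less) linarith
finally show ?thesis using False by simp
qed simp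

(* A position (b, t) is step t of one of two closed walks of length k; the walk with b = True
   carries the conjugated entries. *)
definition next_pos :: "nat => bool \<times> nat => bool \<times> nat" where
"next_pos k p = (fst p, Suc (snd p) mod k)"

definition edge :: "nat => (bool \<times> nat => nat) => bool \<times> nat => nat \<times> nat" where
"edge k u p = (u p, u (next_pos k p))"

definition poss :: "nat => (bool \<times> nat) set" where
"poss k = UNIV \<times> {..<k}"

definition edge_mult :: "nat => (bool \<times> nat => nat) => nat \<times> nat => nat" where
"edge_mult k u e = card {p : poss k. edge k u p = e}"

lemma finite_poss [simp]: "finite (poss k)" by (simp add: poss_def)

lemma card_poss [simp]: "card (poss k) = 2 * k" by (simp add: poss_def card_cartesian_product)

lemma next_pos_in: "p : poss k ==> next_pos k p : poss k" by (auto simp: next_pos_def poss_def)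

lemma sum_edge_mult: "(SUM e:edge k u ` poss k. edge_mult k u e) = 2 * k"
proof -
have "(SUM e:edge k u ` poss k. edge_mult k u e) = (SUM e:edge k u ` poss k. SUM p:{p : poss k. edge k u p = e}. 1)"
 by (simp add: edge_mult_def)
also have "... = (SUM p:poss k. 1)" by (rule sum.image_gen[symmetric]) simp
finally show ?thesis by simp
qed

lemma card_vertices_le: "card (u ` poss k) <= card (edge k u ` poss k)"
proof -
have "u ` poss k = fst ` (edge k u ` poss k)" by (force simp: edge_def)
thus ?thesis by (metis card_image_le finite_imageI finite_poss)
qed

context
fixes k :: nat and u :: "bool \<times> nat => nat"
assumes k: "k > 0"
 and two: "!!e. e : edge k u ` poss k ==> edge_mult k u e >= 2"
 and E: "card (edge k u ` poss k) = k" and V: "card (u ` poss k) = k"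
begin

lemma edge_mult_eq_2: "e : edge k u ` poss k ==> edge_mult k u e = 2"
proof (rule ccontr)
assume e: "e : edge k u ` poss k" and "edge_mult k u e ~= 2"
hence "edge_mult k u e > 2" using two by fastforce
hence "(SUM e:edge k u ` poss k. 2) < (SUM e:edge k u ` poss k. edge_mult k u e)" using two e by (intro sum_strict_mono_ex1) auto
thus False using sum_edge_mult[of k u] E by simp
qed

text \<open>Every vertex starts an edge, and there are as many edges as vertices, so every vertex
  has exactly one outgoing edge. A walk is then determined by any of its vertices.\<close>

lemma next_determined:
assumes "p : poss k" "p' : poss k" "u p = u p'"
shows "edge k u p = edge k u p'"
proof -
have "u ` poss k = fst ` (edge k u ` poss k)" by (force simp: edge_def)
hence "card (fst ` (edge k u ` poss k)) = card (edge k u ` poss k)" using E V by simp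
hence "inj_on fst (edge k u ` poss k)" by (intro eq_card_imp_inj_on) auto
moreover have "fst (edge k u p) = fst (edge k u p')" using assms by (simp add: edge_def)
ultimately show ?thesis using assms by (meson imageI inj_onD)
qed

lemma fiber_eq: "p : poss k ==> {p' : poss k. u p' = u p} = {p' : poss k. edge k u p' = edge k u p}"
proof (rule Collect_cong, safe)
fix a b assume "p : poss k" "(a, b) : poss k" "u (a, b) = u p"
thus "edge k u (a, b) = edge k u p" by (intro next_determined)
next
fix a b assume "edge k u (a, b) = edge k u p"
thus "u (a, b) = u p" by (simp add: edge_def)
qed

lemma card_fiber: "p : poss k ==> card {p' : poss k. u p' = u p} = 2"
using edge_mult_eq_2[of "edge k u p"] by (simp add: fiber_eq edge_mult_def)

lemma no_three:
assumes "p : poss k" "p' : poss k" "p'' : poss k" "u p' = u p" "u p'' = u p" "p' ~= p" "p'' ~= p"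
shows "p'' = p'"
proof (rule ccontr)
assume "p'' ~= p'"
hence "card {p, p', p''} = 3" using assms by auto
moreover have "card {p, p', p''} <= card {q : poss k. u q = u p}" using assms by (intro card_mono) auto
ultimately show False using card_fiber[OF assms(1)] by simp
qed

lemma shift_equal:
assumes "s < k" "s' < k" "u (b, s) = u (b', s')"
shows "u (b, (s + t) mod k) = u (b', (s' + t) mod k)"
proof (induction t)
case 0
thus ?case using assms by simp
next
case (Suc t)
have "edge k u (b, (s + t) mod k) = edge k u (b', (s' + t) mod k)" using Suc k by (intro next_determined) (auto simp: poss_def)
thus ?case by (simp add: edge_def next_pos_def mod_Suc_eq)
qed

lemma partner:
assumes "p : poss k"
obtains p' where "p' : poss k" "p' ~= p" "u p' = u p"
proof -
have "{p' : poss k. u p' = u p} ~= {p}"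
proof
 assume "{p' : poss k. u p' = u p} = {p}"
 thus False using card_fiber[OF assms] by simp
qed
thus ?thesis using assms that by blast
qed

text \<open>The return after s steps repeats, so positions 0, s and 2 s carry the same vertex. A
  vertex occupies only two positions, hence 2 s = 0 modulo k.\<close>

lemma same_walk_half:
assumes "0 < s" "s < k" "u (b, s) = u (b, 0)"
shows "2 * s = k"
proof -
have "u (b, (s + s) mod k) = u (b, s)" using shift_equal[of s 0 b b s] assms by simp
hence eq: "u (b, (s + s) mod k) = u (b, 0)" using assms by simp
have "(s + s) mod k = 0"
proof (rule ccontr)
 assume "(s + s) mod k ~= 0"
 hence "(b, (s + s) mod k) = (b, s)" using eq assms k by (intro no_three[of "(b, 0)"]) (auto simp: poss_def)
 hence "(s + s) mod k = s" by simp
 thus False using assms add_mod_if[OF assms(2,2)] by (simp split: if_splits)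
qed
thus ?thesis using assms add_mod_if[OF assms(2,2)] by (simp split: if_splits)
qed

text \<open>The vertex at position 0 of the first walk recurs once more. If it recurs on the second
  walk, the walks agree up to rotation; if it recurs on the first, each walk runs twice around a
  cycle of half the length.\<close>

lemma good_cases:
shows "(\<exists>j<k. \<forall>t<k. u (True, t) = u (False, (t + j) mod k)) |
 (\<exists>h. 2 * h = k & (\<forall>b. \<forall>t<k. u (b, t) = u (b, t mod h)))"
proof -
have in0: "(b, 0) : poss k" for b using k by (simp add: poss_def)
obtain p' where p': "p' : poss k" "p' ~= (False, 0)" "u p' = u (False, 0)" by (rule partner[OF in0])
obtain b' s where bs: "p' = (b', s)" "s < k" using p' by (cases p') (auto simp: poss_def)
show ?thesis
proof (cases b')
 case True
 have "u (True, t) = u (False, (t + (k - s)) mod k)" if "t < k" for t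
 proof -
  have "u (True, (s + (t + (k - s))) mod k) = u (False, (0 + (t + (k - s))) mod k)" using p' bs True k by (intro shift_equal) auto
  moreover have "s + (t + (k - s)) = t + k" using bs by simp
  ultimately show ?thesis using that by simp
 qed
 moreover have "(t + (k - s)) mod k = (t + (k - s) mod k) mod k" for t by (simp add: mod_add_right_eq)
 ultimately show ?thesis using k by (intro disjI1 exI[of _ "(k - s) mod k"]) auto
next
 case False
 have s: "0 < s" "u (False, s) = u (False, 0)" using p' bs False by auto
 have half: "2 * s = k" using same_walk_half[of s False] s bs by simp
 obtain p'' where p'': "p'' : poss k" "p'' ~= (True, 0)" "u p'' = u (True, 0)" by (rule partner[OF in0])
 obtain c s' where cs: "p'' = (c, s')" "s' < k" using p'' by (cases p'') (auto simp: poss_def)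
 \<comment> \<open>If the second visit to the start of the second walk lay on the first walk, the
   half period of the first walk would produce a third visit.\<close>
 have c: "c"
 proof (rule ccontr)
  assume "~ c"
  hence a: "u (False, s') = u (True, 0)" using p'' cs by simp
  have "u (False, (s + s') mod k) = u (False, s')" using shift_equal[of s 0 False False s'] s bs cs k by simp
  hence b: "u (False, (s + s') mod k) = u (True, 0)" using a by simp
  have "(False, (s + s') mod k) = (False, s')" using a b cs k by (intro no_three[of "(True, 0)"]) (auto simp: poss_def)
  hence "(s + s') mod k = s'" by simp
  thus False using s bs add_mod_if[OF bs(2) cs(2)] by (simp split: if_splits)
 qed
 have s': "0 < s'" "u (True, s') = u (True, 0)" using p'' cs c by auto
 have half': "2 * s' = k" using same_walk_half[of s' True] s' cs by simp
 hence ss: "s' = s" using half by simp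
 have "u (b, t) = u (b, t mod s)" if "t < k" for b t
 proof (cases "t < s")
  case False
  have "u (b, (s + (t - s)) mod k) = u (b, (0 + (t - s)) mod k)"
  proof (rule shift_equal)
   show "u (b, s) = u (b, 0)" using s s' ss by (cases b) simp_all
  qed (use bs k in auto)
  moreover have "t mod s = t - s" using False that half by (simp add: mod_if)
  ultimately show ?thesis using that False by simp
 qed simp
 thus ?thesis using half by auto
qed
qed

end

definition good_walks :: "nat => nat => (bool \<times> nat => nat) set" where
"good_walks n k = {u : PiE (poss k) (%_. {..<n}). (\<forall>e\<in>edge k u ` poss k. edge_mult k u e >= 2) &
  card (edge k u ` poss k) = k & card (u ` poss k) = k}"

text \<open>A rotation and one walk give k n^k choices, two cycles of length k/2 give n^k. Since
  their weight is n^(-k), these are the walks that survive as n grows.\<close>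

lemma card_good_walks:
assumes "k > 0"
shows "card (good_walks n k) <= (k + 1) * n ^ k"
proof -
let ?W = "PiE {..<k} (%_. {..<n})"
let ?F1 = "%(j, w). restrict (%(b, t). if b then w ((t + j) mod k) else w t) (poss k)"
let ?P2 = "UNIV \<times> {..<k div 2} :: (bool \<times> nat) set"
let ?F2 = "%w. restrict (%(b, t). w (b, t mod (k div 2))) (poss k)"
let ?a = "PiE ?P2 (%_. {..<n})"
have finW: "finite ({..<k} \<times> ?W)" "finite ?a" by (auto intro!: finite_PiE)
have sub: "good_walks n k <= ?F1 ` ({..<k} \<times> ?W) \<union> (if even k then ?F2 ` ?a else {})"
proof
 fix u assume "u : good_walks n k"
 hence u: "u : PiE (poss k) (%_. {..<n})" and good: "!!e. e : edge k u ` poss k ==> edge_mult k u e >= 2"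
  "card (edge k u ` poss k) = k" "card (u ` poss k) = k" by (auto simp: good_walks_def)
 have ext: "u p = undefined" if "p ~: poss k" for p using PiE_arb[OF u that] .
 have lt: "u p < n" if "p : poss k" for p using u that by auto
 from good_cases[OF assms good] show "u : ?F1 ` ({..<k} \<times> ?W) \<union> (if even k then ?F2 ` ?a else {})"
 proof
  assume "\<exists>j<k. \<forall>t<k. u (True, t) = u (False, (t + j) mod k)"
  then obtain j where j: "j < k" "!!t. t < k ==> u (True, t) = u (False, (t + j) mod k)" by blast
  let ?w = "restrict (%t. u (False, t)) {..<k}"
  have w: "?w : ?W" using lt by (auto simp: poss_def)
  have "u = ?F1 (j, ?w)"
  proof
   fix p
   show "u p = ?F1 (j, ?w) p"
   proof (cases "p : poss k")
    case True
    then obtain b t where p: "p = (b, t)" "t < k" by (cases p) (auto simp: poss_def)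
    thus ?thesis using True j assms by (cases b) (auto simp: poss_def)
   qed (simp add: ext)
  qed
  hence "u : ?F1 ` ({..<k} \<times> ?W)" using j(1) w by blast
  thus ?thesis by simp
 next
  assume "\<exists>h. 2 * h = k & (\<forall>b. \<forall>t<k. u (b, t) = u (b, t mod h))"
  then obtain h where h: "2 * h = k" "!!b t. t < k ==> u (b, t) = u (b, t mod h)" by blast
  have kh: "k div 2 = h" "even k" "h > 0" using h(1) assms by auto
  let ?w = "restrict u ?P2"
  have w: "?w : ?a" using lt kh h(1) by (auto simp: poss_def)
  have "u = ?F2 ?w"
  proof
   fix p
   show "u p = ?F2 ?w p"
   proof (cases "p : poss k")
    case True
    then obtain b t where p: "p = (b, t)" "t < k" by (cases p) (auto simp: poss_def)
    thus ?thesis using True h(2)[of t b] kh by (simp add: poss_def)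
   qed (simp add: ext)
  qed
  hence "u : ?F2 ` ?a" using w by blast
  thus ?thesis using kh by simp
 qed
qed
have c2: "card (if even k then ?F2 ` ?a else {}) <= n ^ k"
proof (cases "even k")
 case True
 hence "card (?F2 ` ?a) <= n ^ (2 * (k div 2))"
  using card_image_le[OF finW(2), of ?F2] by (simp add: card_PiE card_cartesian_product)
 thus ?thesis using True by simp
qed simp
have "card (good_walks n k) <= card (?F1 ` ({..<k} \<times> ?W)) + card (if even k then ?F2 ` ?a else {})"
 using sub finW by (intro order.trans[OF card_mono card_Un_le]) auto
also have "... <= k * n ^ k + n ^ k"
 using card_image_le[OF finW(1), of ?F1] c2 by (intro add_mono) (auto simp: card_PiE card_cartesian_product)
finally show ?thesis by simp
qed

lemma prod_Times: "(PROD p:A \<times> B. F p) = (PROD a:A. PROD b:B. F (a, b))" by (simp add: prod.cartesian_product)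

lemma sum_Times: "(SUM p:A \<times> B. F p) = (SUM a:A. SUM b:B. F (a, b))" by (simp add: sum.cartesian_product)

text \<open>The bound for the expectation over a pair of walks: an edge used only once makes it
  vanish, every other edge contributes 1/n for two of its uses and \<open>tau\<close> for each
  further one.\<close>

definition walk_bound :: "nat => real => nat => (bool \<times> nat => nat) => real" where
"walk_bound n tau k u = (if \<forall>e\<in>edge k u ` poss k. edge_mult k u e >= 2
  then (1 / real n) ^ card (edge k u ` poss k) * tau ^ (2 * k - 2 * card (edge k u ` poss k)) else 0)"

text \<open>A good pair has weight n^(-k); with fewer than k edges at least two factors
  \<open>tau\<close> appear; with k edges but fewer vertices a factor 1/n is left over. In the last
  two cases the sum over the vertices costs a factorial.\<close>

lemma sum_walk_bound:
assumes "n > 0" "k > 0" "0 <= tau" "tau <= 1"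
shows "(SUM u:PiE (poss k) (%_. {..<n}). walk_bound n tau k u) <= real k + 1 + (tau^2 + 1 / real n) * fact (2 * k)"
proof -
let ?a = "good_walks n k"
let ?b = "PiE (poss k) (%_. {..<n})"
have le: "walk_bound n tau k u <= (if u : ?a then (1 / real n) ^ k else 0) +
  (tau^2 + 1 / real n) * (1 / real n) ^ card (u ` poss k)" if u: "u : ?b" for u
proof (cases "\<forall>e\<in>edge k u ` poss k. edge_mult k u e >= 2")
 case False
 hence "walk_bound n tau k u = 0" unfolding walk_bound_def by (simp only: if_False)
 thus ?thesis using assms by simp
next
 case True
 define e v where "e = card (edge k u ` poss k)" and "v = card (u ` poss k)"
 have "(SUM e:edge k u ` poss k. 2) <= (SUM e:edge k u ` poss k. edge_mult k u e)" using True by (intro sum_mono) auto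
 hence ek: "e <= k" using sum_edge_mult[of k u] by (simp add: e_def)
 have ve: "v <= e" unfolding e_def v_def by (rule card_vertices_le)
 have wb: "walk_bound n tau k u = (1 / real n) ^ e * tau ^ (2 * k - 2 * e)" using True by (simp add: walk_bound_def e_def)
 have mono: "(1 / real n) ^ e <= (1 / real n) ^ v" using ve assms by (intro power_decreasing) auto
 consider "u : ?a" | "e < k" | "e = k" "v < k"
 proof -
  have "u : ?a" if "~ e < k" "~ (e = k & v < k)"
  proof -
   have "e = k" "v = k" using that ek ve by linarith+
   thus ?thesis using True u unfolding good_walks_def e_def v_def by (intro CollectI conjI)
  qed
  thus ?thesis using that by blast
 qed
 thus ?thesis
 proof cases
  case 1
  hence "e = k" by (auto simp: good_walks_def e_def)
  thus ?thesis using 1 assms unfolding wb by simp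
 next
  case 2
  have "tau ^ (2 * k - 2 * e) <= tau^2" using 2 assms by (intro power_decreasing) auto
  hence "walk_bound n tau k u <= (1 / real n) ^ v * tau^2" unfolding wb using assms mono by (intro mult_mono) auto
  also have "... <= (tau^2 + 1 / real n) * (1 / real n) ^ v" by (simp add: algebra_simps)
  finally show ?thesis using assms unfolding v_def by (simp add: add_increasing)
 next
  case 3
  have "walk_bound n tau k u = (1 / real n) ^ k" unfolding wb 3 by simp
  also have "... <= (1 / real n) ^ Suc v" using 3 assms by (intro power_decreasing) auto
  also have "... <= (tau^2 + 1 / real n) * (1 / real n) ^ v" using assms by (simp add: algebra_simps)
  finally show ?thesis using assms unfolding v_def by (simp add: add_increasing)
 qed
qed
have fin: "finite ?b" by (intro finite_PiE) auto
have "(SUM u:PiE (poss k) (%_. {..<n}). walk_bound n tau k u) <=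
 (SUM u:PiE (poss k) (%_. {..<n}). (if u : ?a then (1 / real n) ^ k else 0)) +
 (SUM u:PiE (poss k) (%_. {..<n}). (tau^2 + 1 / real n) * (1 / real n) ^ card (u ` poss k))"
 unfolding sum.distrib[symmetric] by (rule sum_mono) (rule le)
also have "(SUM u:PiE (poss k) (%_. {..<n}). (if u : ?a then (1 / real n) ^ k else 0)) =
 real (card (?b \<inter> ?a)) * (1 / real n) ^ k"
 using fin by (subst sum.inter_restrict[symmetric]) auto
also have "... <= real ((k + 1) * n ^ k) * (1 / real n) ^ k"
proof -
 have "?b \<inter> ?a = ?a" by (auto simp: good_walks_def)
 hence "real (card (?b \<inter> ?a)) <= real ((k + 1) * n ^ k)"
  using card_good_walks[OF assms(2), of n] by (simp only: of_nat_le_iff)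
 thus ?thesis by (intro mult_right_mono) auto
qed
also have "... = (real k + 1) * (real n ^ k * (1 / real n) ^ k)" by (simp add: algebra_simps)
also have "... = real k + 1" using assms by (simp only: power_mult_distrib[symmetric]) simp
also have "(SUM u:PiE (poss k) (%_. {..<n}). (tau^2 + 1 / real n) * (1 / real n) ^ card (u ` poss k)) <=
 (tau^2 + 1 / real n) * fact (card (poss k))" unfolding sum_distrib_left[symmetric] using assms
 by (intro mult_left_mono sum_inverse_power_card_image_le) auto
finally show ?thesis by simp
qed

section \<open>Second moment of traces for bounded centred entries\<close>

context entry_law
begin

lemma matrix_entry_borel: "l < n ==> m < n ==> h : bmeas borel ==> (%x. h (x l m)) : bmeas MX"
by (rule measurable_compose[OF measurable_entry])

lemma integral_matrix_prod:
fixes h :: "nat => nat => complex => complex"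
assumes h: "!!i m. i < n ==> m < n ==> integrable mu (h i m)"
shows "(LINT x|MX. (PROD i<n. PROD m<n. h i m (x i m))) = (PROD i<n. PROD m<n. (LINT y|mu. h i m y))"
proof -
interpret row: product_sigma_finite "%_::nat. mu"
 by unfold_locales (intro sigma_finite_measure.sigma_finite_countable prob_space_imp_sigma_finite prob)
interpret mat: product_sigma_finite "%_::nat. RW"
 by unfold_locales (intro sigma_finite_measure.sigma_finite_countable prob_space_imp_sigma_finite prob_row)
have r: "(LINT y|RW. (PROD m<n. h i m (y m))) = (PROD m<n. (LINT y|mu. h i m y))" if "i < n" for i
 unfolding row_law_def using h that by (intro row.product_integral_prod) auto
have "(LINT x|MX. (PROD i<n. PROD m<n. h i m (x i m))) = (PROD i<n. (LINT y|RW. (PROD m<n. h i m (y m))))" unfolding matrix_law_def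
proof (rule mat.product_integral_prod)
 fix i assume "i : {..<n}"
 thus "integrable RW (%y. PROD m<n. h i m (y m))" unfolding row_law_def using h by (intro row.product_integrable_prod) auto
qed simp
thus ?thesis using r by simp
qed

context
fixes f :: "complex => complex" and tau :: real
assumes f: "f : bmeas borel" and f_mean: "(LINT y|mu. f y) = 0"
 and f_second: "(LINT y|mu. (cmod (f y))^2) <= 1 / real n"
 and f_bound: "!!y. cmod (f y) <= tau" and tau: "tau <= 1"
begin

text \<open>The flag lets the squared modulus of a trace be written as one product over the
  positions of both walks.\<close>

definition conj_if :: "bool => complex => complex" where
"conj_if b z = (if b then cnj z else z)"

lemma cmod_conj_if [simp]: "cmod (conj_if b z) = cmod z" by (simp add: conj_if_def)

lemma tau_nonneg: "0 <= tau" using f_bound[of 0] norm_ge_zero[of "f 0"] by linarith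

lemma f_le_1: "cmod (f y) <= 1" using f_bound[of y] tau by linarith

lemma measurable_conj_if: "(%y. conj_if b (f y)) : bmeas mu"
proof -
have "(%y. conj_if b (f y)) : bmeas borel"
 using f unfolding conj_if_def by (cases b) (auto intro!: borel_measurable_continuous_onI continuous_intros measurable_compose[OF f])
thus ?thesis by (simp add: measurable_mu_borel)
qed

lemma measurable_prod_conj_if: "(%y. PROD p:Q. conj_if (fst p) (f y)) : bmeas mu" by (intro borel_measurable_prod measurable_conj_if)

lemma integrable_prod_conj_if: "integrable mu (%y. PROD p:Q. conj_if (fst p) (f y))"
proof -
have "norm (PROD p:Q. conj_if (fst p) (f y)) <= 1" for y unfolding prod_norm[symmetric] by (intro prod_le_1) (simp add: f_le_1)
thus ?thesis by (intro mu.integrable_const_bound[where B = 1] measurable_prod_conj_if) auto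
qed

lemma norm_integral_prod_conj_if:
assumes "finite Q"
shows "cmod (LINT y|mu. (PROD p:Q. conj_if (fst p) (f y))) <=
 (if card Q = 0 then 1 else if card Q = 1 then 0 else tau ^ (card Q - 2) * (1 / real n))"
proof -
consider "card Q = 0" | "card Q = 1" | "card Q >= 2" by linarith
thus ?thesis
proof cases
 case 1
 thus ?thesis using assms by (simp add: mu.prob_space)
next
 case 2
 then obtain p where "Q = {p}" by (meson card_1_singletonE)
 hence "(LINT y|mu. (PROD p:Q. conj_if (fst p) (f y))) = (LINT y|mu. conj_if (fst p) (f y))" by simp
 also have "... = conj_if (fst p) (LINT y|mu. f y)" by (simp add: conj_if_def)
 also have "... = 0" using f_mean by (simp add: conj_if_def)
 finally show ?thesis using 2 by simp
next
 case 3
 have sq: "integrable mu (%y. (cmod (f y))^2)"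
 proof (rule mu.integrable_const_bound[where B = 1])
  have "(cmod (f y))^2 <= 1" for y using f_bound[of y] tau by (intro power_le_one) auto
  thus "AE y in mu. norm ((cmod (f y))^2) <= 1" by simp
  have "(%y. (cmod (f y))^2) : bmeas borel" using f by simp
  thus "(%y. (cmod (f y))^2) : bmeas mu" by (simp add: measurable_mu_borel)
 qed
 have pt: "cmod (PROD p:Q. conj_if (fst p) (f y)) <= tau ^ (card Q - 2) * (cmod (f y))^2" for y
 proof -
  have "cmod (PROD p:Q. conj_if (fst p) (f y)) = cmod (f y) ^ card Q" by (simp add: prod_norm[symmetric])
  also have "... = cmod (f y) ^ (card Q - 2) * (cmod (f y))^2" using 3 by (simp only: power_add[symmetric] le_add_diff_inverse2)
  also have "... <= tau ^ (card Q - 2) * (cmod (f y))^2" using f_bound by (intro mult_right_mono power_mono) auto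
  finally show ?thesis .
 qed
 have "cmod (LINT y|mu. (PROD p:Q. conj_if (fst p) (f y))) <= (LINT y|mu. cmod (PROD p:Q. conj_if (fst p) (f y)))"
  by (rule integral_norm_bound)
 also have "... <= (LINT y|mu. tau ^ (card Q - 2) * (cmod (f y))^2)"
  by (intro integral_mono integrable_norm integrable_prod_conj_if integrable_mult_right sq pt)
 also have "... <= tau ^ (card Q - 2) * (1 / real n)"
  using f_second tau_nonneg by (simp only: integral_mult_right_zero) (intro mult_left_mono, auto)
 finally show ?thesis using 3 by simp
qed
qed

text \<open>Grouping the positions by edges turns the expectation into a product over the matrix
  entries, by independence.\<close>

lemma norm_expectation_walk:
assumes u: "u : PiE (poss k) (%_. {..<n})"
shows "cmod (LINT x|MX. (PROD p:poss k. conj_if (fst p) (f (x (u p) (u (next_pos k p)))))) <= walk_bound n tau k u"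
proof -
let ?Q = "%e. {p : poss k. edge k u p = e}"
let ?E = "edge k u ` poss k"
let ?B = "%c::nat. if c = 0 then 1 else if c = 1 then 0 else tau ^ (c - 2) * (1 / real n)"
have sub: "?E <= {..<n} \<times> {..<n}" using u next_pos_in[of _ k] by (auto simp: edge_def)
have "(PROD p:poss k. conj_if (fst p) (f (x (u p) (u (next_pos k p))))) =
  (PROD i<n. PROD m<n. PROD p:?Q (i, m). conj_if (fst p) (f (x i m)))" for x
proof -
 have "(PROD p:poss k. conj_if (fst p) (f (x (u p) (u (next_pos k p))))) =
  (PROD e:{..<n} \<times> {..<n}. PROD p:?Q e. conj_if (fst p) (f (x (u p) (u (next_pos k p)))))"
  by (rule prod.group[symmetric]) (use sub in auto)
 also have "... = (PROD e:{..<n} \<times> {..<n}. PROD p:?Q e. conj_if (fst p) (f (x (fst e) (snd e))))"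
  by (intro prod.cong refl) (auto simp: edge_def)
 also have "... = (PROD i<n. PROD m<n. PROD p:?Q (i, m). conj_if (fst p) (f (x i m)))"
  by (subst prod.cartesian_product) (simp add: split_beta')
 finally show ?thesis .
qed
hence "(LINT x|MX. (PROD p:poss k. conj_if (fst p) (f (x (u p) (u (next_pos k p)))))) =
  (PROD i<n. PROD m<n. (LINT y|mu. (PROD p:?Q (i, m). conj_if (fst p) (f y))))"
 by (simp only: integral_matrix_prod[OF integrable_prod_conj_if])
also have "... = (PROD e:{..<n} \<times> {..<n}. (LINT y|mu. (PROD p:?Q e. conj_if (fst p) (f y))))"
 by (subst prod.cartesian_product) (simp add: split_beta')
finally have "cmod (LINT x|MX. (PROD p:poss k. conj_if (fst p) (f (x (u p) (u (next_pos k p)))))) =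
  (PROD e:{..<n} \<times> {..<n}. cmod (LINT y|mu. (PROD p:?Q e. conj_if (fst p) (f y))))" by (simp add: prod_norm)
also have "... <= (PROD e:{..<n} \<times> {..<n}. ?B (edge_mult k u e))"
proof (rule prod_mono)
 fix e assume "e : {..<n} \<times> {..<n}"
 have "finite (?Q e)" by simp
 thus "0 <= cmod (LINT y|mu. (PROD p:?Q e. conj_if (fst p) (f y))) &
  cmod (LINT y|mu. (PROD p:?Q e. conj_if (fst p) (f y))) <= ?B (edge_mult k u e)"
  unfolding edge_mult_def using norm_integral_prod_conj_if[of "?Q e"] by (intro conjI norm_ge_zero)
qed
also have "... = (PROD e:?E. ?B (edge_mult k u e))"
proof (rule prod.mono_neutral_right)
 show "\<forall>e\<in>{..<n} \<times> {..<n} - ?E. ?B (edge_mult k u e) = 1"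
 proof
  fix e assume "e : {..<n} \<times> {..<n} - ?E"
  hence "edge k u p ~= e" if "p : poss k" for p using that by blast
  hence "?Q e = {}" by blast
  thus "?B (edge_mult k u e) = 1" by (simp add: edge_mult_def)
 qed
qed (use sub in auto)
also have "... <= walk_bound n tau k u"
proof (cases "\<forall>e\<in>?E. edge_mult k u e >= 2")
 case True
 have "(PROD e:?E. ?B (edge_mult k u e)) = (PROD e:?E. tau ^ (edge_mult k u e - 2) * (1 / real n))" using True by (intro prod.cong) auto
 also have "... = tau ^ (SUM e:?E. edge_mult k u e - 2) * (1 / real n) ^ card ?E" by (simp only: prod.distrib power_sum prod_constant)
 also have "(SUM e:?E. edge_mult k u e - 2) = 2 * k - 2 * card ?E" using True sum_edge_mult[of k u] by (subst sum_subtractf_nat) auto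
 finally show ?thesis using True by (simp add: walk_bound_def mult.commute)
next
 case False
 then obtain e where e: "e : ?E" "edge_mult k u e < 2" by force
 have "?Q e ~= {}" using e(1) by auto
 hence "edge_mult k u e ~= 0" unfolding edge_mult_def by (simp add: card_eq_0_iff)
 hence "edge_mult k u e = 1" using e(2) by linarith
 hence "\<exists>e\<in>?E. ?B (edge_mult k u e) = 0" using e(1) by (intro bexI[of _ e]) auto
 hence "(PROD e:?E. ?B (edge_mult k u e)) = 0" by (intro prod_zero) auto
 moreover have "walk_bound n tau k u = 0" using False unfolding walk_bound_def by (simp only: if_False)
 ultimately show ?thesis by (simp only: order.refl)
qed
finally show ?thesis .
qed

lemma trace_second_moment:
assumes k: "k > 0"
shows "(NE x. (cmod (trs n {..<n} (mape f x) $ k))^2) <= ennreal (real k + 1 + (tau^2 + 1 / real n) * fact (2 * k))"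
proof -
let ?W = "PiE {..<k} (%_. {..<n})"
let ?T = "%x. trs n {..<n} (mape f x) $ k"
\<comment> \<open>A pair of walks becomes one function on \<open>poss k\<close>; injectivity is
  needed when the sum over pairs is enlarged to all such functions.\<close>
let ?u = "%(w, w'). restrict (%(b, t). if b then w' t else w t) (poss k)"
let ?G = "%x u. PROD p:poss k. conj_if (fst p) (f (x (u p) (u (next_pos k p))))"
have uin: "?u z : PiE (poss k) (%_. {..<n})" if "z : ?W \<times> ?W" for z
 using that by (auto simp: poss_def PiE_def Pi_def split: if_splits)
have inj: "inj_on ?u (?W \<times> ?W)"
proof (rule inj_onI)
 fix z z' assume z: "z : ?W \<times> ?W" "z' : ?W \<times> ?W" and "?u z = ?u z'"
 moreover obtain w w' where zw: "z = (w, w')" by (cases z)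
 moreover obtain v v' where zv: "z' = (v, v')" by (cases z')
 ultimately have w: "w : ?W" "w' : ?W" "v : ?W" "v' : ?W" and eq: "?u (w, w') = ?u (v, v')" by simp_all
 have "w t = v t" "w' t = v' t" if "t < k" for t
 proof -
  from fun_cong[OF eq, of "(False, t)"] show "w t = v t" using that by (simp add: poss_def)
  from fun_cong[OF eq, of "(True, t)"] show "w' t = v' t" using that by (simp add: poss_def)
 qed
 hence "w = v" "w' = v'" using PiE_ext[OF w(1,3)] PiE_ext[OF w(2,4)] by simp_all
 thus "z = z'" using zw zv by simp
qed
have T: "?T x * cnj (?T x) = (SUM z:?W \<times> ?W. ?G x (?u z))" for x
proof -
 obtain k' where k': "k = Suc k'" using k by (cases k) auto
 have t: "?T x = (SUM w:?W. PROD t<k. f (x (w t) (w (Suc t mod k))))" unfolding k' by (rule trs_walks)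
 have "(PROD t<k. f (x (w t) (w (Suc t mod k)))) * cnj (PROD t<k. f (x (w' t) (w' (Suc t mod k)))) = ?G x (?u (w, w'))" for w w'
 proof -
  have "?G x (?u (w, w')) = (PROD b:UNIV. PROD t<k. conj_if b (f (x (?u (w, w') (b, t)) (?u (w, w') (next_pos k (b, t))))))"
   unfolding poss_def by (subst prod_Times) simp
  also have "... = (PROD t<k. f (x (w t) (w (Suc t mod k)))) * (PROD t<k. cnj (f (x (w' t) (w' (Suc t mod k)))))"
  proof -
   have "(PROD t<k. conj_if False (f (x (?u (w, w') (False, t)) (?u (w, w') (next_pos k (False, t)))))) =
    (PROD t<k. f (x (w t) (w (Suc t mod k))))" using k by (intro prod.cong) (auto simp: poss_def next_pos_def conj_if_def)
   moreover have "(PROD t<k. conj_if True (f (x (?u (w, w') (True, t)) (?u (w, w') (next_pos k (True, t)))))) =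
    (PROD t<k. cnj (f (x (w' t) (w' (Suc t mod k)))))" using k by (intro prod.cong) (auto simp: poss_def next_pos_def conj_if_def)
   ultimately show ?thesis unfolding UNIV_bool by (simp add: mult.commute)
  qed
  finally show ?thesis by simp
 qed
 hence "?T x * cnj (?T x) = (SUM w:?W. SUM w':?W. ?G x (?u (w, w')))" unfolding t cnj_sum sum_product by simp
 thus ?thesis unfolding sum_Times .
qed
have Gm: "(%x. ?G x u) : bmeas MX" if "u : PiE (poss k) (%_. {..<n})" for u
proof (rule borel_measurable_prod)
 fix p assume p: "p : poss k"
 hence "u p < n" "u (next_pos k p) < n" using that next_pos_in[OF p] by auto
 moreover have "(%y. conj_if (fst p) (f y)) : bmeas borel" using measurable_conj_if by (simp add: measurable_mu_borel)
 ultimately show "(%x. conj_if (fst p) (f (x (u p) (u (next_pos k p))))) : bmeas MX" by (intro matrix_entry_borel)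
qed
have Gi: "integrable MX (%x. ?G x u)" if "u : PiE (poss k) (%_. {..<n})" for u
proof (rule P.integrable_const_bound[where B = 1])
 have "norm (?G x u) <= 1" for x unfolding prod_norm[symmetric] by (intro prod_le_1) (simp add: f_le_1)
 thus "AE x in MX. norm (?G x u) <= 1" by simp
qed (rule Gm[OF that])
have int: "integrable MX (%x. ?T x * cnj (?T x))" unfolding T by (intro Bochner_Integration.integrable_sum Gi uin)
have sq: "complex_of_real ((cmod (?T x))^2) = ?T x * cnj (?T x)" for x by (rule complex_norm_square)
have intr: "integrable MX (%x. (cmod (?T x))^2)"
proof -
 have "(%x. (cmod (?T x))^2) = (%x. Re (?T x * cnj (?T x)))" unfolding sq[symmetric] by simp
 thus ?thesis using int by (simp only: integrable_Re)
qed
have "complex_of_real (LINT x|MX. (cmod (?T x))^2) = (LINT x|MX. ?T x * cnj (?T x))" unfolding integral_complex_of_real[symmetric] sq ..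
also have "... = (SUM z:?W \<times> ?W. (LINT x|MX. ?G x (?u z)))" unfolding T by (intro Bochner_Integration.integral_sum Gi uin)
finally have cs: "complex_of_real (LINT x|MX. (cmod (?T x))^2) = (SUM z:?W \<times> ?W. (LINT x|MX. ?G x (?u z)))" .
have "(LINT x|MX. (cmod (?T x))^2) = Re (SUM z:?W \<times> ?W. (LINT x|MX. ?G x (?u z)))"
 unfolding cs[symmetric] by (simp only: Re_complex_of_real)
also have "... <= cmod (SUM z:?W \<times> ?W. (LINT x|MX. ?G x (?u z)))" by (rule complex_Re_le_cmod)
also have "... <= (SUM z:?W \<times> ?W. walk_bound n tau k (?u z))" by (intro order.trans[OF norm_sum] sum_mono norm_expectation_walk uin)
also have "... = (SUM u:?u ` (?W \<times> ?W). walk_bound n tau k u)" by (subst sum.reindex[OF inj]) simp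
also have "... <= (SUM u:PiE (poss k) (%_. {..<n}). walk_bound n tau k u)"
proof (rule sum_mono2)
 show "?u ` (?W \<times> ?W) <= PiE (poss k) (%_. {..<n})" using uin by blast
 show "0 <= walk_bound n tau k u" for u using tau_nonneg by (simp add: walk_bound_def)
qed (intro finite_PiE, auto)
also have "... <= real k + 1 + (tau^2 + 1 / real n) * fact (2 * k)" by (rule sum_walk_bound[OF n_pos k tau_nonneg tau])
finally have "(LINT x|MX. (cmod (?T x))^2) <= real k + 1 + (tau^2 + 1 / real n) * fact (2 * k)" .
moreover have "(NE x. (cmod (?T x))^2) = ennreal (LINT x|MX. (cmod (?T x))^2)" by (rule nn_integral_eq_integral[OF intr]) simp
ultimately show ?thesis by (simp only: ennreal_leI)
qed

end

end

section \<open>From traces to the inverse series 1/Q\<close>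

lemma log_deriv_majorant:
fixes b t :: "nat => real"
assumes b: "!!k. b k >= 0" "b 0 = 1" and t: "!!k. t k >= 0" and r: "r >= 0"
 and rec: "!!k. real (Suc k) * b (Suc k) <= (SUM j<=k. t (Suc j) * b (k - j))"
shows "(SUM k<=m. b k * r ^ k) <= exp (SUM j<m. t (Suc j) * r ^ Suc j / real (Suc j))"
proof -
define phi where "phi s = (SUM k<=m. b k * s ^ k)" for s
define tau where "tau s = (SUM j<m. t (Suc j) * s ^ Suc j / real (Suc j))" for s
define phi' where "phi' s = (SUM k<m. real (Suc k) * b (Suc k) * s ^ k)" for s
define tau' where "tau' s = (SUM j<m. t (Suc j) * s ^ j)" for s
have dphi: "(phi has_real_derivative phi' s) (at s)" for s
proof -
 have "((%s. SUM k<=m. b k * s ^ k) has_real_derivative (SUM k<=m. b k * (real k * s ^ (k - 1)))) (at s)"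
  by (auto intro!: derivative_eq_intros sum.cong)
 moreover have "(SUM k<=m. b k * (real k * s ^ (k - 1))) = phi' s"
  unfolding phi'_def lessThan_Suc_atMost[symmetric] sum.lessThan_Suc_shift by (simp add: mult_ac)
 ultimately show ?thesis unfolding phi_def by simp
qed
have dtau: "(tau has_real_derivative tau' s) (at s)" for s
proof -
 have "((%s. SUM j<m. t (Suc j) * s ^ Suc j / real (Suc j)) has_real_derivative
  (SUM j<m. t (Suc j) * (real (Suc j) * s ^ (Suc j - 1)) / real (Suc j))) (at s)"
  using DERIV_pow[of "Suc _" s] by (intro DERIV_sum DERIV_cdivide DERIV_cmult) simp
 moreover have "(SUM j<m. t (Suc j) * (real (Suc j) * s ^ (Suc j - 1)) / real (Suc j)) = tau' s"
  unfolding tau'_def by (intro sum.cong refl) simp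
 ultimately show ?thesis unfolding tau_def by simp
qed
\<comment> \<open>The coefficients are nonnegative, so the product of the truncated series contains
  every term of the truncated convolution. The resulting differential inequality says that phi exp
  (- tau) cannot increase.\<close>
have le: "phi' s <= tau' s * phi s" if "s >= 0" for s
proof (cases m)
 case 0
 thus ?thesis by (simp add: phi'_def tau'_def)
next
 case (Suc d)
 have "phi' s <= (SUM k<=d. SUM j<=k. (t (Suc j) * s ^ j) * (b (k - j) * s ^ (k - j)))" unfolding phi'_def Suc lessThan_Suc_atMost
 proof (rule sum_mono)
  fix k
  have "real (Suc k) * b (Suc k) * s ^ k <= (SUM j<=k. t (Suc j) * b (k - j)) * s ^ k" using rec that by (intro mult_right_mono) auto
  also have "... = (SUM j<=k. (t (Suc j) * s ^ j) * (b (k - j) * s ^ (k - j)))" unfolding sum_distrib_right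
  proof (intro sum.cong refl)
   fix j assume "j : {..k}"
   hence "s ^ k = s ^ j * s ^ (k - j)" by (simp add: power_add[symmetric])
   thus "t (Suc j) * b (k - j) * s ^ k = (t (Suc j) * s ^ j) * (b (k - j) * s ^ (k - j))" by simp
  qed
  finally show "real (Suc k) * b (Suc k) * s ^ k <= (SUM j<=k. (t (Suc j) * s ^ j) * (b (k - j) * s ^ (k - j)))" .
 qed
 also have "... <= (SUM j<=d. t (Suc j) * s ^ j) * (SUM i<=d. b i * s ^ i)" using that b t by (intro sum_convolution_le) auto
 also have "... <= tau' s * phi s" unfolding tau'_def phi_def Suc lessThan_Suc_atMost using that b t
  by (intro mult_left_mono sum_mono2 sum_nonneg) auto
 finally show ?thesis .
qed
have "phi r * exp (- tau r) <= phi 0 * exp (- tau 0)"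
proof (rule DERIV_nonpos_imp_nonincreasing[OF r])
 fix s assume s: "0 <= s" "s <= r"
 have "((%s. phi s * exp (- tau s)) has_real_derivative (phi' s - tau' s * phi s) * exp (- tau s)) (at s)"
  using dphi dtau by (auto intro!: derivative_eq_intros simp: algebra_simps)
 moreover have "(phi' s - tau' s * phi s) * exp (- tau s) <= 0" using le[OF s(1)] by (simp add: mult_le_0_iff)
 ultimately show "\<exists>y. ((%s. phi s * exp (- tau s)) has_real_derivative y) (at s) & y <= 0" by blast
qed
moreover have "phi 0 = 1"
proof -
 have "(SUM k<=m. b k * 0 ^ k) = (SUM k<=m. if k = 0 then b 0 else 0)" by (intro sum.cong) auto
 thus ?thesis unfolding phi_def using b(2) by simp
qed
moreover have "tau 0 = 0" unfolding tau_def by simp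
ultimately have "phi r * exp (- tau r) <= 1" by simp
thus ?thesis unfolding phi_def tau_def by (simp add: exp_minus field_simps)
qed

text \<open>Formally 1/Q = exp (sum tr_j z^j / j), and the majorant takes moduli in the exponent.
  Bounds on the traces thus become bounds on the inverse.\<close>

lemma tnorm_ichs_le:
assumes "r >= 0"
shows "tnorm r m (ichs n R x) <= exp (SUM j<m. cmod (trs n R x $ Suc j) * r ^ Suc j / real (Suc j))" unfolding tnorm_def
proof (rule log_deriv_majorant[OF _ _ _ assms])
let ?b = "ichs n R x" and ?T = "trs n R x"
fix k
have "of_nat (Suc k) * ?b $ Suc k = (fps_X * fps_deriv ?b) $ Suc k" by simp
also have "... = (SUM i=0..Suc k. ?T $ i * ?b $ (Suc k - i))" unfolding ichs_deriv by (simp add: fps_mult_nth)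
also have "... = (SUM j<=k. ?T $ Suc j * ?b $ (k - j))" using sum.atLeast0_atMost_Suc_shift[of "%i. ?T $ i * ?b $ (Suc k - i)" k]
 by (simp add: atMost_atLeast0 del: sum.cl_ivl_Suc)
finally have "real (Suc k) * cmod (?b $ Suc k) = cmod (SUM j<=k. ?T $ Suc j * ?b $ (k - j))" by (metis norm_mult norm_of_nat)
also have "... <= (SUM j<=k. cmod (?T $ Suc j) * cmod (?b $ (k - j)))" by (intro order.trans[OF norm_sum]) (simp add: norm_mult)
finally show "real (Suc k) * cmod (?b $ Suc k) <= (SUM j<=k. cmod (?T $ Suc j) * cmod (?b $ (k - j)))" .
qed auto

text \<open>Comparison of a series \<open>q\<close> with a nearby invertible series \<open>q'\<close> whose inverse \<open>b'\<close> is only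
controlled up to degree \<open>m\<close>: the larger radius \<open>s\<close> pays for the missing degrees.\<close>

lemma tnorm_approx_inverse:
fixes q q' b' :: "complex fps"
assumes r: "0 < r" "r < s" and inv: "q' * b' = 1" and bm: "tnorm s m b' <= B"
 and qs: "!!d. tnorm s d q <= Q" and diff: "tnorm r m (q - q') <= eta"
shows "tnorm r d (q * Abs_fps (%k. if k <= m then b' $ k else 0) - 1) <= eta * B + (r / s) ^ Suc m * (Q * B)"
proof -
let ?g = "Abs_fps (%k. if k <= m then b' $ k else 0)"
let ?h = "q * ?g - 1"
have s: "s > 0" using r by linarith
have B: "B >= 0" using order.trans[OF tnorm_nonneg bm] s by simp
have gB: "tnorm s d ?g <= B" for d
proof -
 have "tnorm s d ?g <= tnorm s (max d m) ?g" using s by (intro tnorm_mono) auto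
 also have "... = tnorm s m b'"
 proof -
  have "tnorm s (max d m) ?g = (SUM l<=m. cmod (?g $ l) * s ^ l)" unfolding tnorm_def by (rule sum.mono_neutral_right) auto
  also have "... = tnorm s m b'" unfolding tnorm_def by (intro sum.cong) auto
  finally show ?thesis .
 qed
 finally show ?thesis using bm by simp
qed
have low: "?h $ k = ((q - q') * b') $ k" if "k <= m" for k
proof -
 have "(q * ?g) $ k = (q * b') $ k" unfolding fps_mult_nth using that by (intro sum.cong) auto
 thus ?thesis using inv by (simp add: algebra_simps)
qed
have high: "cmod (?h $ k) * r ^ k <= (r / s) ^ Suc m * (cmod ((q * ?g) $ k) * s ^ k)" if "k > m" for k
proof -
 have "r ^ k = (r / s) ^ k * s ^ k" using s by (simp add: power_divide)
 also have "... <= (r / s) ^ Suc m * s ^ k" using r s that by (intro mult_right_mono power_decreasing) auto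
 finally have "cmod ((q * ?g) $ k) * r ^ k <= cmod ((q * ?g) $ k) * ((r / s) ^ Suc m * s ^ k)" by (intro mult_left_mono) auto
 moreover have "?h $ k = (q * ?g) $ k" using that by simp
 ultimately show ?thesis by (simp add: mult_ac)
qed
have "tnorm r d ?h <= tnorm r (max d m) ?h" using r by (intro tnorm_mono) auto
also have "... = (SUM k<=m. cmod (?h $ k) * r ^ k) + (SUM k:{m<..max d m}. cmod (?h $ k) * r ^ k)"
proof -
 have "{..max d m} = {..m} \<union> {m<..max d m}" by auto
 thus ?thesis unfolding tnorm_def by (simp only:) (intro sum.union_disjoint, auto)
qed
also have "(SUM k<=m. cmod (?h $ k) * r ^ k) = tnorm r m ((q - q') * b')"
 unfolding tnorm_def by (intro sum.cong refl arg_cong2[where f = "(*)"] arg_cong[where f = cmod] low) simp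
also have "... <= tnorm r m (q - q') * tnorm r m b'" using r by (intro tnorm_mult) auto
also have "... <= eta * B"
proof (intro mult_mono diff)
 show "tnorm r m b' <= B" using r order.trans[OF tnorm_mono_radius bm] by simp
 show "0 <= eta" using order.trans[OF tnorm_nonneg diff] r by simp
qed (use r in auto)
also have "(SUM k:{m<..max d m}. cmod (?h $ k) * r ^ k) <= (SUM k:{m<..max d m}. (r / s) ^ Suc m * (cmod ((q * ?g) $ k) * s ^ k))"
 by (intro sum_mono high) auto
also have "... <= (r / s) ^ Suc m * tnorm s (max d m) (q * ?g)" unfolding sum_distrib_left[symmetric] tnorm_def using r s
 by (intro mult_left_mono sum_mono2) auto
also have "... <= (r / s) ^ Suc m * (tnorm s (max d m) q * tnorm s (max d m) ?g)" using r s by (intro mult_left_mono tnorm_mult) auto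
also have "... <= (r / s) ^ Suc m * (Q * B)"
proof (intro mult_left_mono mult_mono qs gB)
 show "0 <= Q" using order.trans[OF tnorm_nonneg qs] s by simp
qed (use r s in auto)
finally show ?thesis by simp
qed

text \<open>Truncation destroys the mean zero property, so the mean is subtracted again; this at
  most doubles the sup norm.\<close>

definition truncate_law :: "complex measure => real => complex => complex" where
"truncate_law mu tau y = (if cmod y <= tau then y else 0) - (LINT z|mu. (if cmod z <= tau then z else 0))"

context entry_law
begin

lemma truncate_law_props:
assumes tau: "tau >= 0" and tail: "real n * (LINT y|mu. (if cmod y > tau then (cmod y)^2 else 0)) <= dl"
shows "truncate_law mu tau : bmeas borel"
 and "integrable mu (%y. (cmod (truncate_law mu tau y))^2)"
 and "(LINT y|mu. truncate_law mu tau y) = 0"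
 and "(LINT y|mu. (cmod (truncate_law mu tau y))^2) <= 1 / real n"
 and "cmod (truncate_law mu tau y) <= 2 * tau"
 and "(LINT y|mu. (cmod (y - truncate_law mu tau y))^2) <= dl / real n"
proof -
define s where "s y = (if cmod y <= tau then y else 0)" for y
define m where "m = (LINT y|mu. s y)"
have f: "truncate_law mu tau = (%y. s y - m)" by (rule ext) (simp add: truncate_law_def s_def m_def)
have sb: "s : bmeas borel" unfolding s_def by measurable
hence sm: "s : bmeas mu" by (simp add: measurable_mu_borel)
have sle: "cmod (s y) <= tau" for y using tau by (simp add: s_def)
have si: "integrable mu s" by (rule mu.integrable_const_bound[where B = tau]) (use sle sm in auto)
show "truncate_law mu tau : bmeas borel" unfolding f using sb by simp
have "cmod m <= tau"
proof -
 have "cmod m <= (LINT y|mu. cmod (s y))" unfolding m_def by (rule integral_norm_bound)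
 also have "... <= (LINT y|mu. tau)" using si sle by (intro integral_mono integrable_norm) auto
 finally show ?thesis by (simp add: mu.prob_space)
qed
hence fle: "cmod (truncate_law mu tau y) <= 2 * tau" for y unfolding f using norm_triangle_ineq4[of "s y" m] sle[of y] by linarith
thus "cmod (truncate_law mu tau y) <= 2 * tau" .
show "(LINT y|mu. truncate_law mu tau y) = 0" unfolding f using si by (simp add: m_def mu.prob_space)
have var: "(LINT y|mu. (cmod (h y - (LINT z|mu. h z)))^2) <= (LINT y|mu. (cmod (h y))^2)
  & integrable mu (%y. (cmod (h y - (LINT z|mu. h z)))^2)"
 if h: "h : bmeas mu" "integrable mu h" "integrable mu (%y. (cmod (h y))^2)" for h
proof -
 let ?c = "(LINT z|mu. h z)"
 have eq: "(%y. (cmod (h y - ?c))^2) = (%y. (cmod (h y))^2 + (cmod ?c)^2 - 2 * Re (cnj ?c * h y))"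
  using norm_square_add[of "- ?c" "h _"] by (intro ext) (simp add: algebra_simps)
 have "integrable mu (%y. (cmod (h y - ?c))^2)" unfolding eq using h by auto
 moreover have "(LINT y|mu. (cmod (h y - ?c))^2) = (LINT y|mu. (cmod (h y))^2) + (cmod ?c)^2 - 2 * Re (cnj ?c * ?c)"
  unfolding eq using h by (simp add: mu.prob_space)
 moreover have "Re (cnj ?c * ?c) = (cmod ?c)^2" unfolding cmod_power2 by (simp add: power2_eq_square)
 ultimately show ?thesis by (simp only:) simp
qed
have s2: "(cmod (s y))^2 <= (cmod y)^2" for y by (simp add: s_def)
have s2i: "integrable mu (%y. (cmod (s y))^2)" by (rule Bochner_Integration.integrable_bound[OF int_sq]) (use sm s2 in auto)
note vs = var[OF sm si s2i, folded m_def]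
show "integrable mu (%y. (cmod (truncate_law mu tau y))^2)" unfolding f using vs by simp
have "(LINT y|mu. (cmod (s y))^2) <= (LINT y|mu. (cmod y)^2)" using s2i int_sq s2 by (intro integral_mono) auto
thus "(LINT y|mu. (cmod (truncate_law mu tau y))^2) <= 1 / real n" unfolding f using vs second by linarith
define t where "t y = y - s y" for y
have tb: "t : bmeas mu" unfolding measurable_mu_borel t_def using sb by simp
have ti: "integrable mu t" unfolding t_def using si integrable_mu by simp
have t2: "(cmod (t y))^2 = (if cmod y > tau then (cmod y)^2 else 0)" for y by (simp add: t_def s_def)
have t2i: "integrable mu (%y. (cmod (t y))^2)"
proof (rule Bochner_Integration.integrable_bound[OF int_sq])
 show "(%y. (cmod (t y))^2) : bmeas mu" using tb by simp
 show "AE y in mu. norm ((cmod (t y))^2) <= norm ((cmod y)^2)" using t2 by simp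
qed
have tm: "(LINT y|mu. t y) = - m" unfolding t_def using si integrable_mu mean by (simp add: m_def)
have "y - truncate_law mu tau y = t y - (- m)" for y by (simp add: f t_def)
hence "(LINT y|mu. (cmod (y - truncate_law mu tau y))^2) <= (LINT y|mu. (cmod (t y))^2)" using var[OF tb ti t2i] unfolding tm by simp
also have "... <= dl / real n" using tail n_pos unfolding t2 by (simp add: field_simps)
finally show "(LINT y|mu. (cmod (y - truncate_law mu tau y))^2) <= dl / real n" .
qed

lemma prob_norm_gt_le:
assumes "X : bmeas MX"
 and "(NE x. (cmod (X x))^2) <= ennreal C" and "a > 0" "C >= 0"
shows "P.prob {x : space MX. cmod (X x) > a} <= C / a^2"
proof -
have "emeasure MX {x : space MX. cmod (X x) > a} <= emeasure MX {x : space MX. 1 <= ennreal (1 / a^2) * ennreal ((cmod (X x))^2)}"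
proof (rule emeasure_mono)
 show "{x : space MX. cmod (X x) > a} <= {x : space MX. 1 <= ennreal (1 / a^2) * ennreal ((cmod (X x))^2)}"
 proof safe
  fix x assume "a < cmod (X x)"
  hence "a^2 <= (cmod (X x))^2" using assms(3) by (intro power_mono) auto
  hence "1 <= 1 / a^2 * (cmod (X x))^2" using assms(3) by (simp add: field_simps)
  thus "1 <= ennreal (1 / a^2) * ennreal ((cmod (X x))^2)"
   by (subst ennreal_mult[symmetric]) (auto simp: ennreal_1[symmetric] simp del: ennreal_1)
 qed
qed (use assms(1) in measurable)
also have "... <= ennreal (1 / a^2) * (\<integral>\<^sup>+x. ennreal ((cmod (X x))^2) * indicator (space MX) x \<partial>MX)"
 by (rule order.trans[OF _ nn_integral_Markov_inequality[where A = "space MX"]])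
  (use assms(1) in \<open>auto simp: Collect_conj_eq Int_commute\<close>)
also have "... = ennreal (1 / a^2) * (NE x. (cmod (X x))^2)" by (intro arg_cong2[where f = "(*)"] nn_integral_cong) auto
also have "... <= ennreal (1 / a^2) * ennreal C" using assms(2) by (intro mult_left_mono) auto
also have "... = ennreal (C / a^2)" using assms(4) by (subst ennreal_mult[symmetric]) auto
finally show ?thesis using assms(4) by (simp add: P.emeasure_eq_measure)
qed

end

section \<open>Upper bound\<close>

text \<open>\<open>tail\<close> is the Lindeberg condition on the natural scale 1 / sqrt K_n of an
  entry, with A independent of n. \<open>support\<close> is the sparsity: on average a row has at
  most K_n nonzero entries.\<close>

locale sparse_laws =
fixes mu :: "nat => complex measure" and K :: "nat => nat"
assumes law: "!!n. n >= 1 ==> entry_law (mu n) n"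
 and K_pos: "!!n. n >= 1 ==> K n >= 1"
 and K_lim: "filterlim K at_top sequentially"
 and tail: "!!dl. dl > 0 ==> \<exists>A>0. \<forall>n\<ge>1.
  real n * (\<integral>y. (if cmod y > A / sqrt (real (K n)) then (cmod y)^2 else 0) \<partial>mu n) <= dl"
 and support: "!!n. n >= 1 ==> measure (mu n) {y. y ~= 0} <= real (K n) / real n"
begin

abbreviation Pr :: "nat => entries set => real" where "Pr n \<equiv> measure (matrix_law (mu n) n)"

abbreviation Om :: "nat => entries set" where "Om n \<equiv> space (matrix_law (mu n) n)"

end

context entry_law
begin

lemma prob_gt_le:
assumes X: "X : bmeas MX"
 and "(\<integral>\<^sup>+x. X x \<partial>MX) <= ennreal C" and a: "a > 0" and "C >= 0"
shows "P.prob {x : space MX. X x > ennreal a} <= C / a"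
proof -
let ?a = "ennreal (1 / a)"
have "emeasure MX {x : space MX. X x > ennreal a} <= emeasure MX {x : space MX. 1 <= ?a * X x}"
proof (rule emeasure_mono)
 show "{x : space MX. X x > ennreal a} <= {x : space MX. 1 <= ?a * X x}"
 proof safe
  fix x assume "ennreal a < X x"
  hence "?a * ennreal a <= ?a * X x" by (intro mult_left_mono) auto
  moreover have "?a * ennreal a = 1" using a by (subst ennreal_mult[symmetric]) auto
  ultimately show "1 <= ?a * X x" by simp
 qed
 show "{x : space MX. 1 <= ?a * X x} : P.events" using X by measurable
qed
also have "... <= ?a * (\<integral>\<^sup>+x. X x * indicator (space MX) x \<partial>MX)"
 using nn_integral_Markov_inequality[where A = "space MX" and c = "?a" and u = X and M = "MX"] X
 by (simp add: Collect_conj_eq Int_commute)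
also have "... = ?a * (\<integral>\<^sup>+x. X x \<partial>MX)"
 by (intro arg_cong2[where f = "(*)"] nn_integral_cong refl) simp
also have "... <= ?a * ennreal C" using assms(2) by (intro mult_left_mono) auto
also have "... = ennreal (C / a)" using assms(3,4) by (subst ennreal_mult[symmetric]) auto
finally show ?thesis using assms(3,4) by (simp add: P.emeasure_eq_measure)
qed

lemma nn_integral_norm_le:
assumes X: "X : bmeas MX" and c: "c > 0"
 and "(NE x. (cmod (X x))^2) <= ennreal C" and "C >= 0"
shows "(NE x. cmod (X x)) <= ennreal ((c + C / c) / 2)"
proof -
have le: "cmod z <= c / 2 + (1 / (2 * c)) * (cmod z)^2" for z
 using zero_le_power2[of "cmod z - c"] c by (simp add: field_simps power2_eq_square)
have m: "(%x. ennreal ((cmod (X x))^2)) : bmeas MX" using X by simp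
have "(NE x. cmod (X x)) <= (\<integral>\<^sup>+x. ennreal (c / 2) + ennreal (1 / (2 * c)) * ennreal ((cmod (X x))^2) \<partial>MX)"
proof (rule nn_integral_mono)
 fix x
 have "ennreal (cmod (X x)) <= ennreal (c / 2 + (1 / (2 * c)) * (cmod (X x))^2)" by (intro ennreal_leI le)
 also have "... = ennreal (c / 2) + ennreal (1 / (2 * c)) * ennreal ((cmod (X x))^2)"
  using c by (subst ennreal_mult[symmetric], simp, simp, subst ennreal_plus[symmetric]) auto
 finally show "ennreal (cmod (X x)) <= ennreal (c / 2) + ennreal (1 / (2 * c)) * ennreal ((cmod (X x))^2)" .
qed
also have "... = ennreal (c / 2) + ennreal (1 / (2 * c)) * (NE x. (cmod (X x))^2)"
 using m by (simp add: nn_integral_add nn_integral_cmult P.emeasure_space_1)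
also have "... <= ennreal (c / 2) + ennreal (1 / (2 * c)) * ennreal C" using assms(3) by (intro add_left_mono mult_left_mono) auto
also have "... = ennreal ((c + C / c) / 2)"
 using c assms(4) by (subst ennreal_mult[symmetric], simp, simp, subst ennreal_plus[symmetric]) (auto simp: field_simps)
finally show ?thesis .
qed

text \<open>The full weighted series, not only its truncations, has mean at most 1/(1 - s), so one
  application of Markov's inequality covers all d.\<close>

lemma prob_chs_large:
assumes s: "0 < s" "s < 1" and Q: "Q > 0"
shows "P.prob {x : space MX. \<exists>d. tnorm s d (chs n {..<n} x) > Q} <= 1 / ((1 - s) * Q)"
proof -
let ?G = "%x. \<Sum>l. ennreal (cmod (chs n {..<n} x $ l)) * ennreal (s ^ l)"
have cm: "(%x. ennreal (cmod (chs n {..<n} x $ l))) : bmeas MX" for l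
 by (rule measurable_compose[OF measurable_series(1)[OF order.refl]]) simp
have cm': "(%x. ennreal (cmod (chs n {..<n} x $ l)) * ennreal (s ^ l)) : bmeas MX" for l
 by (intro borel_measurable_times_ennreal cm borel_measurable_const)
have Gm: "?G : bmeas MX" by (rule borel_measurable_suminf_order) (rule cm')
have one: "(NE x. cmod (chs n {..<n} x $ l)) <= 1" for l
 using nn_integral_norm_le[OF measurable_series(1)[OF order.refl], of 1 l 1] char_mom_le_1[of "{..<n}" l] unfolding char_mom_def by simp
have "(\<integral>\<^sup>+x. ?G x \<partial>MX) = (\<Sum>l. (\<integral>\<^sup>+x. ennreal (cmod (chs n {..<n} x $ l)) * ennreal (s ^ l) \<partial>MX))"
 by (rule nn_integral_suminf) (rule cm')
also have "... <= (\<Sum>l. ennreal (s ^ l))"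
proof (intro suminf_le)
 fix l
 have "(\<integral>\<^sup>+x. ennreal (cmod (chs n {..<n} x $ l)) * ennreal (s ^ l) \<partial>MX) =
  (NE x. cmod (chs n {..<n} x $ l)) * ennreal (s ^ l)" by (rule nn_integral_multc) (rule cm)
 also have "... <= 1 * ennreal (s ^ l)" by (intro mult_right_mono one) simp
 finally show "(\<integral>\<^sup>+x. ennreal (cmod (chs n {..<n} x $ l)) * ennreal (s ^ l) \<partial>MX) <= ennreal (s ^ l)" by simp
qed auto
also have "... = ennreal (1 / (1 - s))" using s by (subst suminf_ennreal2) (auto simp: suminf_geometric)
finally have I: "(\<integral>\<^sup>+x. ?G x \<partial>MX) <= ennreal (1 / (1 - s))" .
have "P.prob {x : space MX. \<exists>d. tnorm s d (chs n {..<n} x) > Q} <= P.prob {x : space MX. ?G x > ennreal Q}"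
proof (rule P.finite_measure_mono)
 show "{x : space MX. \<exists>d. tnorm s d (chs n {..<n} x) > Q} <= {x : space MX. ?G x > ennreal Q}"
 proof safe
  fix x d assume "Q < tnorm s d (chs n {..<n} x)"
  hence "ennreal Q < ennreal (tnorm s d (chs n {..<n} x))" using Q by (intro ennreal_lessI) auto
  also have "... = (SUM l<=d. ennreal (cmod (chs n {..<n} x $ l)) * ennreal (s ^ l))"
   unfolding tnorm_def using s by (subst sum_ennreal[symmetric]) (auto simp: ennreal_mult)
  also have "... <= ?G x" by (rule sum_le_suminf) auto
  finally show "ennreal Q < ?G x" .
 qed
 show "{x : space MX. ?G x > ennreal Q} : P.events" using Gm by measurable
qed
also have "... <= 1 / (1 - s) / Q" using s Q by (intro prob_gt_le Gm I) auto
finally show ?thesis by (simp add: field_simps)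
qed

lemma measurable_tnorm:
assumes "!!k. (%x. F x $ k) : bmeas M"
shows "(%x. tnorm r d (F x)) : bmeas M"
unfolding tnorm_def by (intro borel_measurable_sum borel_measurable_times borel_measurable_const measurable_compose[OF assms]) simp

text \<open>The traces of the truncated matrix are controlled only up to degree \<open>m\<close>,
  because of the factorial in \<open>small\<close>. The inverse of its series Q', cut at degree m,
  is then an approximate inverse of Q: up to degree m by comparison of coefficients, beyond m by the
  ratio r/s. The exceptional events are a large trace sum, a large Q and a large coefficient of Q -
  Q'.\<close>

lemma prob_ichs_large:
assumes r: "0 < r" "r < s" "s < 1" and L1: "L1 > 0" and Q: "Q > 0" and eta: "eta > 0"
 and tau: "tau >= 0" "2 * tau <= 1" and dl: "dl >= 0"
 and tail: "real n * (LINT y|mu. (if cmod y > tau then (cmod y)^2 else 0)) <= dl"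
 and small: "((2 * tau)^2 + 1 / real n) * fact (2 * m) <= 1"
 and half: "eta * exp L1 + (r / s) ^ Suc m * (Q * exp L1) <= 1 / 2"
shows "P.prob {x : space MX. \<exists>d. tnorm r d (ichs n {..<n} x) > 2 * exp L1} <=
  2 / ((1 - s) * L1) + 1 / ((1 - s) * Q) + (SUM l<=m. dl * compare_const l / (eta / (real m + 1))^2)"
proof -
let ?f = "truncate_law mu tau"
let ?q = "%x. chs n {..<n} x" and ?q' = "%x. chs n {..<n} (mape ?f x)"
let ?b' = "%x. ichs n {..<n} (mape ?f x)"
let ?T = "%x. trs n {..<n} (mape ?f x)"
let ?\<Omega> = "space MX"
note fp = truncate_law_props[OF tau(1) tail]

define t where "t x = (SUM j<m. ennreal (s ^ Suc j / real (Suc j)) * ennreal (cmod (?T x $ Suc j)))" for x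
define A1 where "A1 = {x : ?\<Omega>. t x > ennreal L1}"
define A2 where "A2 = {x : ?\<Omega>. \<exists>d. tnorm s d (?q x) > Q}"
define A3 where "A3 l = {x : ?\<Omega>. cmod ((?q x - ?q' x) $ l) > eta / (real m + 1)}" for l
have Tm: "(%x. ?T x $ k) : bmeas MX" for k by (rule measurable_series_mapf(4)[OF fp(1,2,3,4,6) dl order.refl])
have Tm': "(%x. ennreal (cmod (?T x $ k))) : bmeas MX" for k by (rule measurable_compose[OF Tm]) simp
have tm: "t : bmeas MX" unfolding t_def by (intro borel_measurable_sum borel_measurable_times_ennreal borel_measurable_const Tm')
have dm: "(%x. (?q x - ?q' x) $ l) : bmeas MX" for l unfolding fps_sub_nth
 by (intro borel_measurable_diff measurable_series(1) measurable_series_mapf(1)[OF fp(1,2,3,4,6) dl] order.refl)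
have A1m: "A1 : P.events" unfolding A1_def using tm by measurable
have A2m: "A2 : P.events" unfolding A2_def using measurable_tnorm[of ?q, OF measurable_series(1)[OF order.refl]] by measurable
have A3m: "A3 l : P.events" for l unfolding A3_def using dm by measurable
have Tint: "(NE x. cmod (?T x $ Suc j)) <= ennreal (2 * real (Suc j))" if "j < m" for j
proof -
 have "((2 * tau)^2 + 1 / real n) * fact (2 * Suc j) <= ((2 * tau)^2 + 1 / real n) * fact (2 * m)"
  using that by (intro mult_left_mono fact_mono) auto
 hence "real (Suc j) + 1 + ((2 * tau)^2 + 1 / real n) * fact (2 * Suc j) <= real (Suc j) + 2" using small by linarith
 hence "(NE x. (cmod (?T x $ Suc j))^2) <= ennreal (real (Suc j) + 2)"
  using order.trans[OF trace_second_moment[OF fp(1,3,4,5) tau(2), of "Suc j"] ennreal_leI] by blast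
 \<comment> \<open>The free weight of \<open>nn_integral_norm_le\<close> is j + 1. A bound linear in
   j is enough, because the logarithm of 1/Q carries the factor 1/(j + 1).\<close>
 hence "(NE x. cmod (?T x $ Suc j)) <= ennreal ((real (Suc j) + (real (Suc j) + 2) / real (Suc j)) / 2)"
  by (intro nn_integral_norm_le Tm) auto
 also have "... <= ennreal (2 * real (Suc j))" by (intro ennreal_leI) (simp add: field_simps)
 finally show ?thesis .
qed
have p1: "P.prob A1 <= 2 / (1 - s) / L1" unfolding A1_def
proof (rule prob_gt_le[OF tm _ L1])
 have "(\<integral>\<^sup>+x. t x \<partial>MX) = (SUM j<m. ennreal (s ^ Suc j / real (Suc j)) * (NE x. cmod (?T x $ Suc j)))"
  unfolding t_def by (simp only: nn_integral_sum[OF borel_measurable_times_ennreal[OF borel_measurable_const Tm']] nn_integral_cmult[OF Tm'])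
 also have "... <= (SUM j<m. ennreal (s ^ Suc j / real (Suc j)) * ennreal (2 * real (Suc j)))" by (intro sum_mono mult_left_mono Tint) auto
 also have "... = (SUM j<m. ennreal (2 * s ^ Suc j))"
 proof (intro sum.cong refl)
  fix j
  have "ennreal (s ^ Suc j / real (Suc j)) * ennreal (2 * real (Suc j)) = ennreal (s ^ Suc j / real (Suc j) * (2 * real (Suc j)))"
   using r by (subst ennreal_mult) auto
  also have "s ^ Suc j / real (Suc j) * (2 * real (Suc j)) = 2 * s ^ Suc j" by (simp del: of_nat_Suc)
  finally show "ennreal (s ^ Suc j / real (Suc j)) * ennreal (2 * real (Suc j)) = ennreal (2 * s ^ Suc j)" .
 qed
 also have "... = ennreal (SUM j<m. 2 * s ^ Suc j)" using r by (intro sum_ennreal) auto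
 also have "... <= ennreal (2 / (1 - s))"
 proof (rule ennreal_leI)
  have "(SUM j<m. s ^ Suc j) = s * (SUM j<m. s ^ j)" by (simp add: sum_distrib_left)
  also have "... <= 1 * (SUM j<m. s ^ j)" using r by (intro mult_right_mono sum_nonneg) auto
  also have "... = (1 - s ^ m) / (1 - s)" using r by (simp add: sum_gp_strict)
  also have "... <= 1 / (1 - s)" using r by (intro divide_right_mono) auto
  finally show "(SUM j<m. 2 * s ^ Suc j) <= 2 / (1 - s)" unfolding sum_distrib_left[symmetric] by simp
 qed
 finally show "(\<integral>\<^sup>+x. t x \<partial>MX) <= ennreal (2 / (1 - s))" .
qed (use r in auto)
have p2: "P.prob A2 <= 1 / ((1 - s) * Q)" unfolding A2_def using r Q by (intro prob_chs_large) auto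
have p3: "P.prob (A3 l) <= dl * compare_const l / (eta / (real m + 1))^2" for l unfolding A3_def
 using prob_norm_gt_le[OF dm char_compare_mom[OF fp(1,2,3,4,6) dl order.refl]] eta dl by simp
have sub: "{x : ?\<Omega>. \<exists>d. tnorm r d (ichs n {..<n} x) > 2 * exp L1} <= A1 \<union> A2 \<union> (\<Union>l\<in>{..m}. A3 l)"
proof (rule ccontr)
 assume "~ ?thesis"
 then obtain x d where x: "x : ?\<Omega>" "tnorm r d (ichs n {..<n} x) > 2 * exp L1"
  and nA: "x ~: A1" "x ~: A2" "!!l. l <= m ==> x ~: A3 l" by blast
 have "ennreal (SUM j<m. cmod (?T x $ Suc j) * s ^ Suc j / real (Suc j)) = t x"
 proof -
  have "ennreal (SUM j<m. cmod (?T x $ Suc j) * s ^ Suc j / real (Suc j)) =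
   (SUM j<m. ennreal (cmod (?T x $ Suc j) * s ^ Suc j / real (Suc j)))" using r by (intro sum_ennreal[symmetric]) auto
  also have "... = t x" unfolding t_def using r by (intro sum.cong refl) (subst ennreal_mult[symmetric], auto simp: mult_ac)
  finally show ?thesis .
 qed
 moreover have "t x <= ennreal L1" using nA(1) x(1) unfolding A1_def by (simp add: not_less)
 ultimately have "ennreal (SUM j<m. cmod (?T x $ Suc j) * s ^ Suc j / real (Suc j)) <= ennreal L1" by (simp only:)
 hence tb: "(SUM j<m. cmod (?T x $ Suc j) * s ^ Suc j / real (Suc j)) <= L1" by (subst (asm) ennreal_le_iff) (use L1 in auto)
 have "tnorm s m (?b' x) <= exp (SUM j<m. cmod (?T x $ Suc j) * s ^ Suc j / real (Suc j))" using r by (intro tnorm_ichs_le) auto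
 also have "... <= exp L1" using tb by simp
 finally have b: "tnorm s m (?b' x) <= exp L1" .
 have q: "tnorm s d (?q x) <= Q" for d using nA(2) x(1) unfolding A2_def by (auto simp: not_less)
 have "tnorm r m (?q x - ?q' x) <= (SUM l<=m. eta / (real m + 1))" unfolding tnorm_def
 proof (rule sum_mono)
  fix l assume "l : {..m}"
  hence "cmod ((?q x - ?q' x) $ l) <= eta / (real m + 1)" using nA(3)[of l] x(1) unfolding A3_def by (auto simp: not_less)
  hence "cmod ((?q x - ?q' x) $ l) * r ^ l <= eta / (real m + 1) * 1" using r eta by (intro mult_mono power_le_one) auto
  thus "cmod ((?q x - ?q' x) $ l) * r ^ l <= eta / (real m + 1)" by simp
 qed
 also have "... = eta" by (simp add: field_simps)
 finally have diff: "tnorm r m (?q x - ?q' x) <= eta" .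
 let ?g = "Abs_fps (%k. if k <= m then ?b' x $ k else 0)"
 have "tnorm r d (?q x * ?g - 1) <= eta * exp L1 + (r / s) ^ Suc m * (Q * exp L1)"
  by (rule tnorm_approx_inverse[OF r(1,2) chs_mult_inv b q diff])
 hence "tnorm r d (ichs n {..<n} x) <= 2 * tnorm r d ?g" using r by (intro tnorm_inverse_le[OF _ chs_mult_inv] order.trans[OF _ half]) auto
 also have "tnorm r d ?g <= tnorm s m (?b' x)"
 proof -
  have "tnorm r d ?g <= tnorm s d ?g" using r by (intro tnorm_mono_radius) auto
  also have "... <= tnorm s (max d m) ?g" using r by (intro tnorm_mono) auto
  also have "... = (SUM l<=m. cmod (?g $ l) * s ^ l)" unfolding tnorm_def by (rule sum.mono_neutral_right) auto
  also have "... = tnorm s m (?b' x)" unfolding tnorm_def by (intro sum.cong) auto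
  finally show ?thesis .
 qed
 finally show False using b x(2) by simp
qed
have "P.prob {x : ?\<Omega>. \<exists>d. tnorm r d (ichs n {..<n} x) > 2 * exp L1} <= P.prob (A1 \<union> A2 \<union> (\<Union>l\<in>{..m}. A3 l))"
 using sub by (rule P.finite_measure_mono) (use A1m A2m A3m in auto)
also have "... <= P.prob (A1 \<union> A2) + P.prob (\<Union>l\<in>{..m}. A3 l)" by (rule measure_Un_le) (use A1m A2m A3m in auto)
also have "... <= (P.prob A1 + P.prob A2) + (SUM l<=m. P.prob (A3 l))"
 by (intro add_mono measure_Un_le measure_UNION_le) (use A1m A2m A3m in auto)
also have "... <= (2 / (1 - s) / L1 + 1 / ((1 - s) * Q)) + (SUM l<=m. dl * compare_const l / (eta / (real m + 1))^2)"
 by (intro add_mono p1 p2 sum_mono p3)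
finally show ?thesis by simp
qed

end

context sparse_laws
begin

lemma ichs_bounded:
assumes r: "0 < r" "r < 1" and p: "p > 0"
shows "\<exists>L>0. eventually (%n. Pr n {x : Om n. \<exists>d. tnorm r d (ichs n {..<n} x) > L} <= p) sequentially"
proof -
define s where "s = (1 + r) / 2"
have s: "r < s" "s < 1" using r by (auto simp: s_def)
\<comment> \<open>The constants give each of the three exceptional events of
  \<open>prob_ichs_large\<close> probability at most p/3. The order of the choices is s, L1 and Q,
  eta, m, dl, A and finally n.\<close>
define L1 where "L1 = 6 / ((1 - s) * p)"
define Q where "Q = 3 / ((1 - s) * p)"
have L1: "L1 > 0" and Q: "Q > 0" using s p by (auto simp: L1_def Q_def)
have e1: "2 / ((1 - s) * L1) = p / 3" "1 / ((1 - s) * Q) = p / 3" using s p by (auto simp: L1_def Q_def field_simps)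
define eta where "eta = exp (- L1) / 4"
have eta: "eta > 0" "eta * exp L1 = 1 / 4" by (auto simp: eta_def exp_minus)
obtain m where m: "(r / s) ^ m * (Q * exp L1) < 1 / 4"
proof -
 have "(%m. (r / s) ^ m * (Q * exp L1)) \<longlonglongrightarrow> 0 * (Q * exp L1)"
  using r s by (intro tendsto_mult tendsto_const LIMSEQ_realpow_zero) auto
 hence "eventually (%m. (r / s) ^ m * (Q * exp L1) < 1 / 4) sequentially" by (rule order_tendstoD) simp
 thus ?thesis using that by (auto simp: eventually_sequentially)
qed
have m': "(r / s) ^ Suc m * (Q * exp L1) <= 1 / 4"
proof -
 have "(r / s) ^ Suc m <= (r / s) ^ m" using r s by (intro power_decreasing) auto
 hence "(r / s) ^ Suc m * (Q * exp L1) <= (r / s) ^ m * (Q * exp L1)" using Q by (intro mult_right_mono) auto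
 thus ?thesis using m by linarith
qed
define S where "S = (SUM l<=m. compare_const l / (eta / (real m + 1))^2)"
have S: "S >= 0" unfolding S_def by (intro sum_nonneg) auto
define dl where "dl = p / 3 / (S + 1)"
have dl: "dl > 0" "dl * S <= p / 3" using p S by (auto simp: dl_def field_simps)
obtain A where A: "A > 0" and tl: "!!n. n >= 1 ==>
  real n * (\<integral>y. (if cmod y > A / sqrt (real (K n)) then (cmod y)^2 else 0) \<partial>mu n) <= dl" using tail[OF dl(1)] by blast
have Kr: "filterlim (%n. real (K n)) at_top sequentially" by (rule filterlim_compose[OF filterlim_real_sequentially K_lim])
have lim1: "(%n. 2 * (A / sqrt (real (K n)))) \<longlonglongrightarrow> 0"
 by (intro tendsto_mult_right_zero tendsto_divide_0[OF tendsto_const] filterlim_at_top_imp_at_infinity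
   filterlim_compose[OF sqrt_at_top Kr])
have lim2: "(%n. ((2 * (A / sqrt (real (K n))))^2 + 1 / real n) * fact (2 * m)) \<longlonglongrightarrow> (0^2 + 0) * fact (2 * m)"
 by (intro tendsto_mult tendsto_add tendsto_power lim1 tendsto_const lim_1_over_n)
have "eventually (%n. Pr n {x : Om n. \<exists>d. tnorm r d (ichs n {..<n} x) > 2 * exp L1} <= p) sequentially"
 using eventually_ge_at_top[of 1] order_tendstoD(2)[OF lim1, of 1, simplified] order_tendstoD(2)[OF lim2, of 1, simplified]
proof eventually_elim
 case (elim n)
 interpret entry_law "mu n" n by (rule law[OF elim(1)])
 have "Pr n {x : Om n. \<exists>d. tnorm r d (ichs n {..<n} x) > 2 * exp L1} <=
  2 / ((1 - s) * L1) + 1 / ((1 - s) * Q) + (SUM l<=m. dl * compare_const l / (eta / (real m + 1))^2)"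
 proof (rule prob_ichs_large[OF r(1) s L1 Q eta(1) _ _ _ tl[OF elim(1)]])
  show "0 <= A / sqrt (real (K n))" using A by simp
  show "2 * (A / sqrt (real (K n))) <= 1" using elim(2) by simp
  show "0 <= dl" using dl by simp
  show "((2 * (A / sqrt (real (K n))))^2 + 1 / real n) * fact (2 * m) <= 1" using elim(3) by simp
  show "eta * exp L1 + (r / s) ^ Suc m * (Q * exp L1) <= 1 / 2" using eta(2) m' by linarith
 qed
 also have "(SUM l<=m. dl * compare_const l / (eta / (real m + 1))^2) = dl * S" unfolding S_def by (simp add: sum_distrib_left)
 finally show ?case using e1 dl(2) by linarith
qed
thus ?thesis by (intro exI[of _ "2 * exp L1"]) auto
qed

text \<open>The exceptional set is enclosed in a measurable one, since measurability of the spectral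
  radius is established only later.\<close>

lemma spectral_radius_upper:
assumes eps: "eps > 0" and p: "p > 0"
shows "eventually (%n. \<exists>A\<in>sets (matrix_law (mu n) n). Pr n A <= p &
 {x : Om n. spectral_radius (mat n n (%(i, j). x i j)) > 1 + eps} <= A) sequentially"
proof -
define r where "r = 1 / (1 + eps)"
have r: "0 < r" "r < 1" using eps by (auto simp: r_def)
obtain L where L: "eventually (%n. Pr n {x : Om n. \<exists>d. tnorm r d (ichs n {..<n} x) > L} <= p) sequentially"
 using ichs_bounded[OF r p] by blast
show ?thesis using L eventually_ge_at_top[of 1]
proof eventually_elim
 case (elim n)
 interpret entry_law "mu n" n by (rule law[OF elim(2)])
 let ?A = "{x : Om n. \<exists>d. tnorm r d (ichs n {..<n} x) > L}"
 have "?A : sets (matrix_law (mu n) n)"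
  using measurable_tnorm[of "%x. ichs n {..<n} x", OF measurable_series(2)[OF order.refl]] by measurable
 moreover have "{x : Om n. spectral_radius (mat n n (%(i, j). x i j)) > 1 + eps} <= ?A"
 proof (safe, rule ccontr)
  fix x assume x: "1 + eps < spectral_radius (mat n n (%(i, j). x i j))"
   and "\<nexists>d. L < tnorm r d (ichs n {..<n} x)"
  hence "spectral_radius (mat n n (%(i, j). x i j)) <= 1 / r"
   using elim(2) r by (intro spectral_radius_le_inverse[of r n x L]) (auto simp: not_less)
  thus False using x by (simp add: r_def)
 qed
 ultimately show ?case using elim(1) by blast
qed
qed

end

abbreviation gauss :: "real measure" where "gauss \<equiv> std_normal_distribution"

interpretation gauss: real_distribution gauss by (rule real_dist_normal_dist)

section \<open>Small balls for one row\<close>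

lemma gauss_cos: "(LINT g|gauss. cos (t * g)) = exp (- t\<^sup>2 / 2)"
proof -
have i: "integrable gauss (%g. iexp (t * g))" by (rule gauss.integrable_const_bound[where B = 1]) auto
have "(LINT g|gauss. cos (t * g)) = (LINT g|gauss. Re (iexp (t * g)))" by (simp add: Re_exp)
also have "... = Re (char gauss t)" unfolding char_def using i by (rule integral_Re)
finally show ?thesis by (simp add: char_std_normal_distribution)
qed

lemma gauss_integrable_bounded:
fixes f :: "real => real"
assumes "f : bmeas borel" "!!x. \<bar>f x\<bar> <= B"
shows "integrable gauss f" by (rule gauss.integrable_const_bound[where B = B]) (use assms in auto)

lemma gauss_integrable_cos: "integrable gauss (%g. cos (t * g))" by (rule gauss_integrable_bounded[where B = 1]) auto

text \<open>With s = E cos (t g), the term cos (2 t g) has mean s^4, and the resulting polynomial in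
  s has a double zero at s = 1. This allows the comparison with the squared mean.\<close>

lemma gauss_one_minus_cos_sq: "(LINT g|gauss. (1 - cos (t * g))^2) <= 3 * (1 - exp (- t\<^sup>2 / 2))^2"
proof -
define s where "s = exp (- t\<^sup>2 / 2)"
have s: "0 <= s" "s <= 1" by (auto simp: s_def)
have eq: "(1 - cos (t * g))^2 = 3 / 2 - 2 * cos (t * g) + cos (2 * t * g) / 2" for g
 using cos_double_cos[of "t * g"] by (simp add: power2_eq_square algebra_simps)
have "(LINT g|gauss. (1 - cos (t * g))^2) = 3 / 2 - 2 * s + exp (- (2 * t)\<^sup>2 / 2) / 2"
 unfolding eq using gauss_integrable_cos[of t] gauss_integrable_cos[of "2 * t"] by (simp add: gauss_cos s_def gauss.prob_space[simplified])
also have "exp (- (2 * t)\<^sup>2 / 2) = s ^ 4" by (simp add: s_def exp_of_nat_mult[symmetric] power_mult_distrib)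
also have "3 / 2 - 2 * s + s ^ 4 / 2 = (1 - s)^2 * (3 + 2 * s + s^2) / 2" by (simp add: power2_eq_square eval_nat_numeral algebra_simps)
also have "... <= (1 - s)^2 * 6 / 2"
proof -
 have "s^2 <= 1" using s by (simp add: power_le_one)
 thus ?thesis using s by (intro divide_right_mono mult_left_mono) auto
qed
finally show ?thesis by (simp add: s_def)
qed

lemma abs_one_minus_cos: "\<bar>1 - cos t\<bar> <= (2::real)" using cos_ge_minus_one[of t] cos_le_one[of t] by linarith

lemma gauss_one_minus_cos_prod:
"(LINT g|gauss. (1 - cos (a * g)) * (1 - cos (b * g))) <= 3 * (1 - exp (- a\<^sup>2 / 2)) * (1 - exp (- b\<^sup>2 / 2))"
proof (cases "a = 0 | b = 0")
case False
define ha hb where "ha = 1 - exp (- a\<^sup>2 / 2)" and "hb = 1 - exp (- b\<^sup>2 / 2)"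
have h: "ha > 0" "hb > 0" using False by (auto simp: ha_def hb_def)
have i: "integrable gauss (%g. (1 - cos (t * g))^2)" for t
proof (rule gauss_integrable_bounded[where B = 4])
 fix x
 have "(1 - cos (t * x))^2 <= 2^2" using power_mono[OF abs_one_minus_cos[of "t * x"], of 2] by simp
 thus "\<bar>(1 - cos (t * x))^2\<bar> <= 4" by simp
qed auto
have i2: "integrable gauss (%g. (1 - cos (a * g)) * (1 - cos (b * g)))"
proof (rule gauss_integrable_bounded[where B = "2 * 2"])
 fix x :: real
 show "\<bar>(1 - cos (a * x)) * (1 - cos (b * x))\<bar> <= 2 * 2" unfolding abs_mult by (intro mult_mono abs_one_minus_cos) auto
qed auto
\<comment> \<open>Weighted arithmetic-geometric means in place of Cauchy-Schwarz; with these weights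
  each term integrates to at most half of the bound 3 ha hb.\<close>
have le: "u * v <= (hb / (2 * ha)) * u^2 + (ha / (2 * hb)) * v^2" for u v
proof -
 have "0 <= (hb * u - ha * v)^2 / (2 * ha * hb)" using h by simp
 also have "... = (hb / (2 * ha)) * u^2 + (ha / (2 * hb)) * v^2 - u * v" using h by (simp add: field_simps power2_eq_square)
 finally show ?thesis by simp
qed
have "(LINT g|gauss. (1 - cos (a * g)) * (1 - cos (b * g))) <=
  (LINT g|gauss. (hb / (2 * ha)) * (1 - cos (a * g))^2 + (ha / (2 * hb)) * (1 - cos (b * g))^2)"
 using i i2 le by (intro integral_mono) auto
also have "... = (hb / (2 * ha)) * (LINT g|gauss. (1 - cos (a * g))^2) + (ha / (2 * hb)) * (LINT g|gauss. (1 - cos (b * g))^2)"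
 using i by simp
also have "... <= (hb / (2 * ha)) * (3 * ha^2) + (ha / (2 * hb)) * (3 * hb^2)"
 using h unfolding ha_def hb_def by (intro add_mono mult_left_mono gauss_one_minus_cos_sq) auto
also have "... = 3 * ha * hb" using h by (simp add: field_simps power2_eq_square)
finally show ?thesis by (simp add: ha_def hb_def)
qed auto

(* exp (- s^2 / 2) = E cos (s g) for a standard Gaussian g, so Gaussian weights of a row form are averages
   of characteristic functions, which are at most exp (- pexpo g) in absolute value. *)
locale phase_measure = finite_measure Q for Q :: "'q measure" +
fixes z :: "'q => real"
assumes z [measurable]: "z : bmeas Q"
begin

definition pexpo :: "real => real" where
"pexpo g = (LINT q|Q. 1 - cos (z q * g)) / 2"

definition phase_mean :: real where
"phase_mean = (LINT q|Q. 1 - exp (- (z q)\<^sup>2 / 2)) / 2"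

lemma integrable_phase: "integrable Q (%q. 1 - cos (z q * g))" by (rule integrable_const_bound[where B = 2]) (auto simp: abs_one_minus_cos)

lemma pexpo_nonneg: "pexpo g >= 0" unfolding pexpo_def by (intro divide_nonneg_nonneg integral_nonneg) auto

lemma phase_mean_nonneg: "phase_mean >= 0" unfolding phase_mean_def by (intro divide_nonneg_nonneg integral_nonneg) auto

lemma sigma_finite_Q: "sigma_finite_measure Q" by unfold_locales

lemma pair_sigma: "pair_sigma_finite gauss Q"
by (intro pair_sigma_finite.intro gauss.sigma_finite_measure_axioms sigma_finite_measure_axioms)

lemma finite_pair: "finite_measure (gauss \<Otimes>\<^sub>M Q)"
proof -
interpret pair_sigma_finite gauss Q by (rule pair_sigma)
have "emeasure (gauss \<Otimes>\<^sub>M Q) (space gauss \<times> space Q) = emeasure gauss (space gauss) * emeasure Q (space Q)"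
 by (rule sigma_finite_measure.emeasure_pair_measure_Times[OF sigma_finite_Q]) auto
hence "emeasure (gauss \<Otimes>\<^sub>M Q) (space (gauss \<Otimes>\<^sub>M Q)) ~= \<infinity>"
 by (simp add: space_pair_measure gauss.emeasure_space_1[simplified] emeasure_eq_measure)
thus ?thesis by (rule finite_measureI)
qed

lemma integrable_pair: "integrable (gauss \<Otimes>\<^sub>M Q) (%(g, q). 1 - cos (z q * g))"
by (rule finite_measure.integrable_const_bound[OF finite_pair, where B = 2]) (auto simp: abs_one_minus_cos)

lemma measurable_pexpo [measurable]: "pexpo : bmeas borel"
proof -
interpret pair_sigma_finite gauss Q by (rule pair_sigma)
have "(%g. (LINT q|Q. 1 - cos (z q * g))) : bmeas gauss"
 by (rule sigma_finite_measure.borel_measurable_lebesgue_integral[OF sigma_finite_Q]) simp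
thus ?thesis unfolding pexpo_def by simp
qed

lemma gauss_pexpo: "(LINT g|gauss. pexpo g) = phase_mean"
proof -
interpret pair_sigma_finite gauss Q by (rule pair_sigma)
have "(LINT g|gauss. (LINT q|Q. 1 - cos (z q * g))) = (LINT q|Q. (LINT g|gauss. 1 - cos (z q * g)))"
 by (rule Fubini_integral[symmetric]) (use integrable_pair in simp)
also have "... = (LINT q|Q. 1 - exp (- (z q)\<^sup>2 / 2))"
 using gauss_integrable_cos by (simp add: gauss_cos gauss.prob_space[simplified])
finally show ?thesis unfolding pexpo_def phase_mean_def by simp
qed

lemma pexpo_le: "pexpo g <= measure Q (space Q)"
proof -
have "(LINT q|Q. 1 - cos (z q * g)) <= (LINT q|Q. 2)" using integrable_phase abs_one_minus_cos abs_le_iff by (intro integral_mono) auto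
thus ?thesis unfolding pexpo_def by simp
qed

text \<open>The square is an integral over pairs of phases, and the Gaussian average of each pair is
  covered by \<open>gauss_one_minus_cos_prod\<close>. So the exponent has a second moment comparable
  with its squared mean.\<close>

lemma gauss_pexpo_sq: "(LINT g|gauss. (pexpo g)^2) <= 3 * phase_mean^2"
proof -
interpret QQ: pair_sigma_finite Q Q by (intro pair_sigma_finite.intro sigma_finite_measure_axioms)
let ?a = "Q \<Otimes>\<^sub>M Q"
have finQQ: "finite_measure ?a"
proof -
 have "emeasure ?a (space Q \<times> space Q) = emeasure Q (space Q) * emeasure Q (space Q)"
  by (rule sigma_finite_measure.emeasure_pair_measure_Times[OF sigma_finite_Q]) auto
 hence "emeasure ?a (space ?a) ~= \<infinity>"
  by (simp add: space_pair_measure emeasure_eq_measure ennreal_mult[symmetric])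
 thus ?thesis by (rule finite_measureI)
qed
interpret F: finite_measure "Q \<Otimes>\<^sub>M Q" by (rule finQQ)
interpret GQ: pair_sigma_finite gauss "Q \<Otimes>\<^sub>M Q" by unfold_locales
define f where "f g p = (1 - cos (z (fst p) * g)) * (1 - cos (z (snd p) * g))" for g p
define h where "h q = 1 - exp (- (z q)\<^sup>2 / 2)" for q
have fb: "\<bar>f g p\<bar> <= 4" for g p
proof -
 have "\<bar>f g p\<bar> <= 2 * 2" unfolding f_def abs_mult by (intro mult_mono abs_one_minus_cos) auto
 thus ?thesis by simp
qed
have sq: "(LINT q|Q. 1 - cos (z q * g))^2 = (LINT p|?a. f g p)" for g
proof -
 have i: "integrable ?a (%(q, q'). (1 - cos (z q * g)) * (1 - cos (z q' * g)))"
  by (rule F.integrable_const_bound[where B = 4]) (use fb[of g] in \<open>auto simp: f_def\<close>)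
 have "(LINT p|?a. f g p) = (LINT q|Q. (LINT q'|Q. (1 - cos (z q * g)) * (1 - cos (z q' * g))))"
  using QQ.integral_fst[OF i] by (simp add: f_def split_beta')
 also have "... = (LINT q|Q. 1 - cos (z q * g))^2" by (simp add: power2_eq_square)
 finally show ?thesis by simp
qed
let ?b = "gauss \<Otimes>\<^sub>M ?a"
have fm: "case_prod f : bmeas ?b" unfolding f_def by measurable
have fin3: "finite_measure ?b"
proof -
 have "emeasure ?b (space gauss \<times> space ?a) = emeasure gauss (space gauss) * emeasure ?a (space ?a)"
  by (rule sigma_finite_measure.emeasure_pair_measure_Times[OF finite_measure.sigma_finite_measure[OF finQQ]]) auto
 hence "emeasure ?b (space ?b) ~= \<infinity>"
  by (simp add: space_pair_measure[of gauss "Q \<Otimes>\<^sub>M Q"] gauss.emeasure_space_1[simplified] F.emeasure_eq_measure)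
 thus ?thesis by (rule finite_measureI)
qed
have fi: "integrable ?b (case_prod f)"
 by (rule finite_measure.integrable_const_bound[OF fin3 _ fm, where B = 4]) (use fb in auto)
have hi: "integrable ?a (%(q, q'). 3 * (h q * h q'))"
proof (rule F.integrable_const_bound[where B = 3])
 have "0 <= h q" "h q <= 1" for q by (auto simp: h_def)
 hence "\<bar>3 * (h q * h q')\<bar> <= 3" for q q' by (simp add: abs_mult mult_le_one)
 thus "AE p in Q \<Otimes>\<^sub>M Q. norm (case p of (q, q') => 3 * (h q * h q')) <= 3" by (auto simp: split_beta')
qed (simp add: h_def)
have "(LINT g|gauss. (LINT q|Q. 1 - cos (z q * g))^2) = (LINT g|gauss. (LINT p|?a. f g p))" unfolding sq ..
also have "... = (LINT p|?a. (LINT g|gauss. f g p))" by (rule GQ.Fubini_integral[symmetric]) (rule fi)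
also have "... <= (LINT p|?a. (case p of (q, q') => 3 * (h q * h q')))"
proof (rule integral_mono[OF _ hi])
 show "integrable ?a (%p. (LINT g|gauss. f g p))" using GQ.integrable_snd[OF fi] by simp
 fix p show "(LINT g|gauss. f g p) <= (case p of (q, q') => 3 * (h q * h q'))"
  using gauss_one_minus_cos_prod[of "z (fst p)" "z (snd p)"] by (simp only: f_def h_def split_beta' mult.assoc)
qed
also have "... = 3 * (LINT q|Q. h q)^2" using QQ.integral_fst[OF hi] by (simp add: power2_eq_square)
finally have "(LINT g|gauss. (LINT q|Q. 1 - cos (z q * g))^2) <= 3 * (LINT q|Q. h q)^2" .
thus ?thesis unfolding pexpo_def phase_mean_def h_def by (simp add: power_divide)
qed

text \<open>A second order expansion of exp is affordable only while the mean exponent is small. The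
  factor \<open>tau\<close> first reduces this mean to min H kap; the quadratic term is then at most
  3/2 kap times the linear one.\<close>

lemma gauss_exp_pexpo:
assumes kap: "0 < kap" "kap <= 1/2"
shows "(LINT g|gauss. exp (- pexpo g)) <= 1 - (1 - 3/2 * kap) * min phase_mean kap"
proof -
define H where "H = phase_mean"
have H: "H >= 0" unfolding H_def by (rule phase_mean_nonneg)
define tau where "tau = (if H <= kap then 1 else kap / H)"
have tau: "0 <= tau" "tau <= 1" "tau * H = min H kap" using kap H by (auto simp: tau_def field_simps)
let ?B = "measure Q (space Q)"
have i0: "integrable gauss (%g. exp (- pexpo g))" by (rule gauss_integrable_bounded[where B = 1]) (auto simp: pexpo_nonneg)
have i1: "integrable gauss pexpo" by (rule gauss_integrable_bounded[where B = ?B]) (auto simp: pexpo_nonneg pexpo_le)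
have i2: "integrable gauss (%g. (pexpo g)^2)" by (rule gauss_integrable_bounded[where B = "?B^2"])
  (auto intro!: power_mono simp: pexpo_nonneg pexpo_le)
have exp_le: "exp (- x) <= 1 - x + x^2 / 2" if "x >= 0" for x :: real
proof -
 have "1 - x + x^2 / 2 - exp (- x) >= 1 - 0 + 0^2 / 2 - exp (- 0)"
 proof (rule DERIV_nonneg_imp_nondecreasing[OF that])
  fix t :: real assume t: "0 <= t"
  have "((%x. 1 - x + x^2 / 2 - exp (- x)) has_real_derivative - 1 + t + exp (- t)) (at t)" by (auto intro!: derivative_eq_intros)
  moreover have "- 1 + t + exp (- t) >= 0" using exp_ge_add_one_self[of "- t"] by simp
  ultimately show "\<exists>y. ((%x. 1 - x + x^2 / 2 - exp (- x)) has_real_derivative y) (at t) & 0 <= y" by blast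
 qed
 thus ?thesis by simp
qed
have "(LINT g|gauss. exp (- pexpo g)) <= (LINT g|gauss. 1 - tau * pexpo g + tau^2 / 2 * (pexpo g)^2)"
proof (rule integral_mono[OF i0])
 show "integrable gauss (%g. 1 - tau * pexpo g + tau^2 / 2 * (pexpo g)^2)" using i1 i2 by simp
 fix g
 have "tau * pexpo g <= pexpo g" using tau pexpo_nonneg[of g] by (simp add: mult_left_le_one_le)
 hence "exp (- pexpo g) <= exp (- (tau * pexpo g))" by simp
 also have "... <= 1 - tau * pexpo g + (tau * pexpo g)^2 / 2" using tau pexpo_nonneg[of g] by (intro exp_le) simp
 finally show "exp (- pexpo g) <= 1 - tau * pexpo g + tau^2 / 2 * (pexpo g)^2" by (simp add: power_mult_distrib)
qed
also have "... = 1 - tau * H + tau^2 / 2 * (LINT g|gauss. (pexpo g)^2)"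
 using i1 i2 by (simp add: gauss_pexpo H_def gauss.prob_space[simplified])
also have "... <= 1 - tau * H + tau^2 / 2 * (3 * H^2)" using gauss_pexpo_sq unfolding H_def by (intro add_left_mono mult_left_mono) auto
also have "... = 1 - min H kap + 3/2 * (min H kap)^2" unfolding tau(3)[symmetric] by (simp add: power_mult_distrib)
also have "... <= 1 - min H kap + 3/2 * (min H kap * kap)"
 unfolding power2_eq_square using H kap by (intro add_left_mono mult_left_mono) auto
finally show ?thesis by (simp add: H_def algebra_simps)
qed

end

text \<open>The Fejer kernel scaled to the value 1 at 0; its mean over a period is 1/N.\<close>

definition fejer :: "nat => real => real" where
"fejer N t = (SUM k<N. SUM l<N. cos ((real k - real l) * t)) / (real N)^2"

lemma fejer_eq: "fejer N t = (cmod (SUM k<N. cis t ^ k))^2 / (real N)^2"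
proof -
let ?s = "SUM k<N. cis t ^ k"
have "(cmod ?s)^2 = Re (?s * cnj ?s)" by (metis complex_norm_square of_real_power Re_complex_of_real)
also have "?s * cnj ?s = (SUM k<N. SUM l<N. cis (real k * t) * cnj (cis (real l * t)))"
 by (simp only: Complex.DeMoivre cnj_sum sum_product)
also have "Re ... = (SUM k<N. SUM l<N. cos ((real k - real l) * t))" by (simp add: cos_diff left_diff_distrib)
finally show ?thesis by (simp add: fejer_def)
qed

lemma fejer_nonneg: "fejer N t >= 0" by (simp add: fejer_eq)

text \<open>Either t is within order 1/N of a multiple of 2 pi, where the kernel is at least 1/4, or
  1 - cos t is at least of order 1/N^2. The kernel thus detects the resonances at which 1 - cos
  gives no decay.\<close>

lemma fejer_lower:
assumes N: "N >= 1"
shows "1 <= 4 * fejer N t + 8 * (real N)^2 * (1 - cos t)"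
proof (cases "1 <= 8 * (real N)^2 * (1 - cos t)")
case False
have d: "(cmod (cis t - 1))^2 = 2 * (1 - cos t)"
 using sin_cos_squared_add[of t] unfolding cmod_power2 by (simp add: power2_eq_square algebra_simps)
have "(2 * real N * cmod (cis t - 1))^2 <= 1^2" unfolding power_mult_distrib d using False by (simp add: algebra_simps)
hence e: "real N * cmod (cis t - 1) <= 1 / 2" using power2_le_imp_le[of "2 * real N * cmod (cis t - 1)" 1] by simp
have "cmod (SUM k<N. cis t ^ k - 1) <= (SUM k<N. 1 / 2)"
proof (rule order.trans[OF norm_sum], rule sum_mono)
 fix k assume "k : {..<N}"
 have "cmod (cis t ^ k - 1 ^ k) <= real k * cmod (cis t - 1)" by (rule norm_power_diff) auto
 also have "... <= real N * cmod (cis t - 1)" using \<open>k : _\<close> by (intro mult_right_mono) auto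
 finally show "cmod (cis t ^ k - 1) <= 1 / 2" using e by simp
qed
hence "cmod ((SUM k<N. cis t ^ k) - of_nat N) <= real N / 2" by (simp add: sum_subtractf)
moreover have "cmod (of_nat N) <= cmod (SUM k<N. cis t ^ k) + cmod ((SUM k<N. cis t ^ k) - of_nat N)"
 by (metis norm_triangle_sub norm_minus_commute)
ultimately have "real N / 2 <= cmod (SUM k<N. cis t ^ k)" by simp
hence "(real N / 2)^2 <= (cmod (SUM k<N. cis t ^ k))^2" by (intro power_mono) auto
hence "1 <= 4 * fejer N t" using N by (simp add: fejer_eq field_simps power2_eq_square)
moreover have "0 <= 8 * (real N)^2 * (1 - cos t)" by simp
ultimately show ?thesis by linarith
qed (use fejer_nonneg[of N t] in linarith)

lemma measurable_fejer [measurable]: "fejer N : bmeas borel" unfolding fejer_def by measurable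

lemma fejer_le: "fejer N t <= 1"
proof -
have "(SUM k<N. SUM l<N. cos ((real k - real l) * t)) <= (SUM k<N. SUM l<N. 1)" by (intro sum_mono) auto
thus ?thesis by (cases "N = 0") (auto simp: fejer_def power2_eq_square divide_le_eq)
qed

lemma sum_geometric_distance_le:
fixes q :: real
assumes "0 <= q" "q < 1"
shows "(SUM l<N. q ^ nat \<bar>int k - int l\<bar>) <= 2 / (1 - q)"
proof -
have g: "(SUM l:S. q ^ h l) <= 1 / (1 - q)" if "inj_on h S" "finite S" for S and h :: "nat => nat"
proof -
 have "(SUM l:S. q ^ h l) = (SUM j:h ` S. q ^ j)" using that by (simp add: sum.reindex)
 also have "... <= 1 / (1 - q)" using assms that by (intro sum_geometric_le) auto
 finally show ?thesis .
qed
have "(SUM l<N. q ^ nat \<bar>int k - int l\<bar>) <=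
 (SUM l:{..<N} \<inter> {..k}. q ^ nat \<bar>int k - int l\<bar>) + (SUM l:{..<N} - {..k}. q ^ nat \<bar>int k - int l\<bar>)"
 by (subst sum.Int_Diff[of "{..<N}" _ "{..k}"]) auto
also have "... <= 1 / (1 - q) + 1 / (1 - q)" by (intro add_mono g) (auto simp: inj_on_def)
finally show ?thesis by simp
qed

lemma gauss_fejer:
assumes z: "0 < z0" "z0 <= \<bar>z\<bar>" and N: "N >= 1"
shows "(LINT g|gauss. fejer N (z * g)) <= (4 + 4 / z0) / real N"
proof -
define q where "q = exp (- z0)"
have q: "0 <= q" "q < 1" using z by (auto simp: q_def)
have e: "exp (- ((real k - real l) * z)\<^sup>2 / 2) <= 2 * q ^ nat \<bar>int k - int l\<bar>" for k l
proof -
 define j where "j = nat \<bar>int k - int l\<bar>"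
 have j: "\<bar>real k - real l\<bar> = real j" unfolding j_def by linarith
 have "(real j * z0)^2 <= (real j * \<bar>z\<bar>)^2" using z by (intro power_mono mult_left_mono) auto
 also have "... = ((real k - real l) * z)^2" unfolding j[symmetric] by (simp add: power_mult_distrib)
 finally have "- ((real k - real l) * z)\<^sup>2 / 2 <= - (real j * z0)\<^sup>2 / 2" by simp
 \<comment> \<open>Completing the square replaces Gaussian decay by geometric decay, whose sum is
   explicit.\<close>
 also have "... <= 1 / 2 - real j * z0" using zero_le_power2[of "real j * z0 - 1"] by (simp add: power2_eq_square algebra_simps)
 finally have "exp (- ((real k - real l) * z)\<^sup>2 / 2) <= exp (1 / 2 - real j * z0)" by simp
 also have "... = exp (1 / 2) * q ^ j"     proof -
  have "q ^ j = exp (- (real j * z0))" unfolding q_def using exp_of_nat_mult[of j "- z0", symmetric] by simp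
  thus ?thesis by (simp add: exp_add[symmetric])
 qed
 also have "... <= 2 * q ^ j" using exp_half_le2 q by (intro mult_right_mono) auto
 finally show ?thesis by (simp add: j_def)
qed
have "(LINT g|gauss. fejer N (z * g)) = (SUM k<N. SUM l<N. exp (- ((real k - real l) * z)\<^sup>2 / 2)) / (real N)^2"
 unfolding fejer_def using gauss_integrable_cos gauss_cos by (simp add: Bochner_Integration.integral_sum mult.assoc[symmetric])
also have "... <= (SUM k<N. SUM l<N. 2 * q ^ nat \<bar>int k - int l\<bar>) / (real N)^2" by (intro divide_right_mono sum_mono e) auto
also have "... <= (SUM k<N. 2 * (2 / (1 - q))) / (real N)^2" unfolding sum_distrib_left[symmetric]
 by (intro divide_right_mono mult_left_mono sum_mono sum_geometric_distance_le q) auto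
also have "... = 4 / (1 - q) / real N" using N by (simp add: power2_eq_square)
also have "... <= (4 + 4 / z0) / real N"
proof (rule divide_right_mono)
 have "(1 + z0) * q <= exp z0 * q" using q by (intro mult_right_mono exp_ge_add_one_self) auto
 also have "... = 1" by (simp add: q_def exp_minus)
 finally have "4 * z0 <= (4 * z0 + 4) * (1 - q)" by (simp add: algebra_simps)
 thus "4 / (1 - q) <= 4 + 4 / z0" using q z by (simp add: field_simps)
qed simp
finally show ?thesis .
qed

text \<open>\<open>gauss_exp_pexpo\<close> only yields a bound below 1; here phases of size at least
  z0 with total mass M must make the integral small. If the exponent is small, many of the phases
  times g are resonant, and by \<open>gauss_fejer\<close> this happens only for few g.\<close>

lemma (in phase_measure) gauss_exp_pexpo_mass:
assumes z0: "0 < z0" and N: "N >= 1" and M: "0 < M" "M <= measure Q {q : space Q. \<bar>z q\<bar> >= z0}"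
shows "(LINT g|gauss. exp (- pexpo g)) <= 8 * (4 + 4 / z0) / real N + exp (- M / (32 * (real N)^2))"
proof -
interpret pair_sigma_finite gauss Q by (rule pair_sigma)
define A where "A = {q : space Q. \<bar>z q\<bar> >= z0}"
have A [measurable]: "A : sets Q" unfolding A_def by measurable
define m where "m = measure Q A"
have m: "m > 0" "M <= m" using M by (auto simp: m_def A_def)
define f where "f g q = indicat_real A q * fejer N (z q * g)" for g q
have f01: "0 <= f g q" "f g q <= 1" for g q using fejer_nonneg fejer_le by (auto simp: f_def indicator_def)
have fm: "case_prod f : bmeas (gauss \<Otimes>\<^sub>M Q)" unfolding f_def by measurable
have fi: "integrable (gauss \<Otimes>\<^sub>M Q) (case_prod f)"
 by (rule finite_measure.integrable_const_bound[OF finite_pair _ fm, where B = 1]) (use f01 in auto)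
have fgi: "integrable Q (f g)" for g
proof (rule integrable_const_bound[where B = 1])
 show "f g : bmeas Q" unfolding f_def by measurable
qed (simp add: f01)
define B where "B g = (LINT q|Q. f g q)" for g
have Bi: "integrable gauss B" unfolding B_def using integrable_fst[OF fi] by simp
have pw: "exp (- pexpo g) <= 8 / m * B g + exp (- M / (32 * (real N)^2))" for g
proof -
 have "m = (LINT q|Q. indicat_real A q)" unfolding m_def by simp
 also have "... <= (LINT q|Q. 4 * f g q + 8 * (real N)^2 * (1 - cos (z q * g)))"
 proof (rule integral_mono)
  show "indicat_real A q <= 4 * f g q + 8 * (real N)^2 * (1 - cos (z q * g))" for q
   using fejer_lower[OF N, of "z q * g"] by (auto simp: f_def indicator_def)
 qed (use fgi integrable_phase in \<open>auto simp: emeasure_eq_measure\<close>)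
 also have "... = 4 * B g + 8 * (real N)^2 * (2 * pexpo g)" unfolding B_def pexpo_def using fgi integrable_phase by simp
 finally have le: "m <= 4 * B g + 16 * (real N)^2 * pexpo g" by simp
 have B0: "B g >= 0" unfolding B_def by (rule Bochner_Integration.integral_nonneg) (simp add: f01)
 show ?thesis
 proof (cases "m / 8 <= B g")
  case True
  hence "1 <= 8 / m * B g" using m by (simp add: field_simps)
  thus ?thesis using pexpo_nonneg[of g] by (smt (verit) exp_ge_zero exp_le_one_iff)
 next
  case False
  hence "M <= 32 * (real N)^2 * pexpo g" using le m by linarith
  hence "M / (32 * (real N)^2) <= pexpo g" using N by (simp add: field_simps)
  moreover have "0 <= 8 / m * B g" using m B0 by simp
  ultimately show ?thesis by (smt (verit) exp_le_cancel_iff minus_divide_left)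
 qed
qed
have i0: "integrable gauss (%g. exp (- pexpo g))" by (rule gauss_integrable_bounded[where B = 1]) (auto simp: pexpo_nonneg)
have "(LINT g|gauss. exp (- pexpo g)) <= (LINT g|gauss. 8 / m * B g + exp (- M / (32 * (real N)^2)))"
 using Bi i0 pw by (intro integral_mono) auto
also have "... = 8 / m * (LINT g|gauss. B g) + exp (- M / (32 * (real N)^2))" using Bi by (simp add: gauss.prob_space[simplified])
also have "(LINT g|gauss. B g) <= m * ((4 + 4 / z0) / real N)"
proof -
 have "(LINT g|gauss. B g) = (LINT q|Q. (LINT g|gauss. f g q))" unfolding B_def by (rule Fubini_integral[symmetric, OF fi])
 also have "... <= (LINT q|Q. indicat_real A q * ((4 + 4 / z0) / real N))"
 proof (rule integral_mono)
  show "integrable Q (%q. (LINT g|gauss. f g q))" using integrable_snd[OF fi] by simp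
  show "(LINT g|gauss. f g q) <= indicat_real A q * ((4 + 4 / z0) / real N)" for q
   using gauss_fejer[OF z0 _ N, of "z q"] by (auto simp: f_def A_def indicator_def)
 qed (auto simp: emeasure_eq_measure)
 finally show ?thesis by (simp add: m_def)
qed
hence "8 / m * (LINT g|gauss. B g) <= 8 / m * (m * ((4 + 4 / z0) / real N))" using m by (intro mult_left_mono) auto
also have "... = 8 * (4 + 4 / z0) / real N" using m by simp
finally show ?thesis by simp
qed

context entry_law
begin

text \<open>A point is a coordinate of the row together with two independent copies of its entry.
  The copies come from symmetrising the characteristic function, and integration sums over the
  coordinates.\<close>

definition epairs :: "(nat \<times> complex \<times> complex) measure" where
"epairs = count_space {..<n} \<Otimes>\<^sub>M MM"

lemma sigma_finite_mu: "sigma_finite_measure mu" by (rule prob_space_imp_sigma_finite[OF prob])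

lemma pair_mu: "pair_sigma_finite mu mu" by (intro pair_sigma_finite.intro sigma_finite_mu)

lemma prob_pair_mu: "prob_space MM"
proof -
have "emeasure MM (space mu \<times> space mu) = 1" by (subst mu.emeasure_pair_measure_Times) (auto simp: mu.emeasure_space_1)
thus ?thesis by (intro prob_spaceI) (simp add: space_pair_measure)
qed

sublocale D: prob_space MM by (rule prob_pair_mu)

lemma finite_epairs: "finite_measure epairs"
proof -
have "emeasure epairs ({..<n} \<times> space MM) = of_nat n" unfolding epairs_def
 by (subst D.emeasure_pair_measure_Times) (auto simp: D.emeasure_space_1)
thus ?thesis by (intro finite_measureI) (simp add: epairs_def space_pair_measure)
qed

lemma measurable_pair_mu_borel: "measurable MM N = measurable (borel \<Otimes>\<^sub>M borel) N"
by (rule measurable_cong_sets) (auto intro!: sets_pair_measure_cong simp: sets_mu)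

lemma measurable_epairs:
assumes "!!m. m < n ==> (%p. f (m, p)) : measurable (borel \<Otimes>\<^sub>M borel) N"
shows "f : measurable epairs N" unfolding epairs_def
by (rule measurable_pair_measure_countable1) (use assms in \<open>auto simp: measurable_pair_mu_borel\<close>)

lemma integral_epairs:
fixes f :: "nat \<times> complex \<times> complex => real"
assumes "f : bmeas epairs" "!!q. \<bar>f q\<bar> <= B"
shows "(LINT q|epairs. f q) = (SUM m<n. (LINT p|MM. f (m, p)))"
proof -
interpret pair_sigma_finite "count_space {..<n}" "MM"
 by (intro pair_sigma_finite.intro D.sigma_finite_measure_axioms sigma_finite_measure_count_space_finite) simp
have "integrable epairs f" by (rule finite_measure.integrable_const_bound[OF finite_epairs, where B = B]) (use assms in auto)
thus ?thesis using integral_fst[of "%m p. f (m, p)"] unfolding epairs_def by (simp add: lebesgue_integral_count_space_finite)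
qed

text \<open>The factor sqrt (2 / b) makes the Gaussian mean of the cosine of phase times g equal to
  exp (- (u - u')^2 / b).\<close>

definition phase :: "(nat => complex => real) => real => nat \<times> complex \<times> complex => real" where
"phase u b = (%(m, y, y'). sqrt (2 / b) * (u m y - u m y'))"

lemma phase_measure:
assumes "!!m. m < n ==> u m : bmeas borel"
shows "phase_measure epairs (phase u b)"
proof -
have "phase u b : bmeas epairs"
proof (rule measurable_epairs)
 fix m assume "m < n"
 from assms[OF this] have [measurable]: "u m : bmeas borel" .
 show "(%p. phase u b (m, p)) : bmeas (borel \<Otimes>\<^sub>M borel)" unfolding phase_def by simp
qed
thus ?thesis by (intro phase_measure.intro finite_epairs phase_measure_axioms.intro)
qed

text \<open>Symmetrisation: the squared modulus of the characteristic function is E cos (t (f y - f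
  y')), and 1 - x <= exp (- x).\<close>

lemma norm_char_le:
assumes [measurable]: "f : bmeas borel"
shows "cmod (LINT y|mu. cis (t * f y)) <= exp (- (LINT p|MM. 1 - cos (t * (f (fst p) - f (snd p)))) / 2)"
proof -
interpret pair_sigma_finite mu mu by (rule pair_mu)
define phi where "phi = (LINT y|mu. cis (t * f y))"
have fm [measurable]: "f : bmeas mu" by (simp add: measurable_mu_borel)
have cm: "(%y. cis (t * f y)) : bmeas mu" unfolding cis_conv_exp by simp
have ci: "integrable mu (%y. cis (t * f y))" by (rule mu.integrable_const_bound[where B = 1]) (use cm in auto)
have "Re (phi * cnj phi) = (LINT y|mu. (LINT y'|mu. cos (t * (f y - f y'))))"
proof -
 have ci': "integrable mu (%y. cnj (cis (t * f y)))" by (rule integrable_cnj[OF ci])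
 have "phi * cnj phi = (LINT y|mu. cis (t * f y) * cnj phi)" unfolding phi_def by (rule Bochner_Integration.integral_mult_left[OF ci, symmetric])
 moreover have "cnj phi = (LINT y'|mu. cnj (cis (t * f y')))" unfolding phi_def by (rule Bochner_Integration.integral_cnj[symmetric])
 ultimately have "Re (phi * cnj phi) = Re (LINT y|mu. cis (t * f y) * (LINT y'|mu. cnj (cis (t * f y'))))" by (simp only:)
 also have "... = (LINT y|mu. Re (cis (t * f y) * (LINT y'|mu. cnj (cis (t * f y')))))"
  by (rule integral_Re[symmetric]) (rule integrable_mult_left[OF ci])
 also have "... = (LINT y|mu. (LINT y'|mu. Re (cis (t * f y) * cnj (cis (t * f y')))))"
 proof (rule Bochner_Integration.integral_cong[OF refl])
  fix y
  have "(LINT y'|mu. Re (cis (t * f y) * cnj (cis (t * f y')))) = Re (LINT y'|mu. cis (t * f y) * cnj (cis (t * f y')))"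
   by (rule integral_Re) (rule integrable_mult_right[OF ci'])
  also have "(LINT y'|mu. cis (t * f y) * cnj (cis (t * f y'))) = cis (t * f y) * (LINT y'|mu. cnj (cis (t * f y')))"
   by (rule Bochner_Integration.integral_mult_right[OF ci'])
  finally show "Re (cis (t * f y) * (LINT y'|mu. cnj (cis (t * f y')))) = (LINT y'|mu. Re (cis (t * f y) * cnj (cis (t * f y'))))" by (rule sym)
 qed
 also have "... = (LINT y|mu. (LINT y'|mu. cos (t * (f y - f y'))))" by (simp add: cos_diff right_diff_distrib)
 finally show ?thesis .
qed
also have "... = (LINT p|MM. cos (t * (f (fst p) - f (snd p))))"
proof -
 have "integrable MM (%(y, y'). cos (t * (f y - f y')))" by (rule D.integrable_const_bound[where B = 1]) auto
 from integral_fst[OF this] show ?thesis by (simp add: split_beta')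
qed
also have "... = 1 - (LINT p|MM. 1 - cos (t * (f (fst p) - f (snd p))))"
proof -
 have "integrable MM (%p. cos (t * (f (fst p) - f (snd p))))" by (rule D.integrable_const_bound[where B = 1]) auto
 thus ?thesis by (simp add: D.prob_space)
qed
finally have "(cmod phi)^2 = 1 - (LINT p|MM. 1 - cos (t * (f (fst p) - f (snd p))))"
 by (metis complex_norm_square of_real_power Re_complex_of_real)
also have "... <= exp (- (LINT p|MM. 1 - cos (t * (f (fst p) - f (snd p)))))"
 using exp_ge_add_one_self[of "- (LINT p|MM. 1 - cos (t * (f (fst p) - f (snd p))))"] by simp
also have "... = (exp (- (LINT p|MM. 1 - cos (t * (f (fst p) - f (snd p)))) / 2))^2" by (simp add: power2_eq_square exp_add[symmetric])
finally show ?thesis unfolding phi_def by (rule power2_le_imp_le) simp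
qed

lemma measurable_row_law_component [measurable]: "m < n ==> f : bmeas borel ==> (%y. f (y m)) : bmeas RW"
using measurable_compose[OF measurable_row_component] by blast

lemma integral_gaussian_row_le:
fixes u :: "nat => complex => real"
assumes u: "!!m. m < n ==> u m : bmeas borel" and b: "b > 0"
shows "(LINT y|RW. exp (- ((SUM m<n. u m (y m)) - a)\<^sup>2 / b)) <= (LINT g|gauss. exp (- phase_measure.pexpo epairs (phase u b) g))"
proof -
interpret Q: phase_measure epairs "phase u b" by (rule phase_measure[OF u])
define c where "c = sqrt (2 / b)"
define Y where "Y y = (SUM m<n. u m (y m))" for y
have Ym: "Y : bmeas RW" unfolding Y_def by (intro borel_measurable_sum measurable_row_law_component u) auto
interpret GR: pair_sigma_finite gauss "RW"
 by (intro pair_sigma_finite.intro gauss.sigma_finite_measure_axioms R.sigma_finite_measure_axioms)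
let ?a = "gauss \<Otimes>\<^sub>M RW"
have finp: "finite_measure ?a"
proof -
 have "emeasure ?a (space gauss \<times> space RW) = 1"
  by (subst R.emeasure_pair_measure_Times) (auto simp: R.emeasure_space_1 gauss.emeasure_space_1[simplified])
 thus ?thesis by (intro finite_measureI) (simp only: space_pair_measure, simp)
qed
have fm: "(%(g, y). cos (c * g * (Y y - a))) : bmeas ?a" using Ym by measurable
have fi: "integrable ?a (%(g, y). cos (c * g * (Y y - a)))"
 by (rule finite_measure.integrable_const_bound[OF finp _ fm, where B = 1]) auto
have gint: "exp (- (Y y - a)\<^sup>2 / b) = (LINT g|gauss. cos (c * g * (Y y - a)))" for y
 using gauss_cos[of "c * (Y y - a)"] b by (simp add: c_def power_mult_distrib mult_ac)
have "(LINT y|RW. exp (- (Y y - a)\<^sup>2 / b)) = (LINT g|gauss. (LINT y|RW. cos (c * g * (Y y - a))))"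
 unfolding gint by (rule GR.Fubini_integral[OF fi])
also have "... <= (LINT g|gauss. exp (- Q.pexpo g))"
proof (rule integral_mono)
 show "integrable gauss (%g. (LINT y|RW. cos (c * g * (Y y - a))))" using GR.integrable_fst[OF fi] by simp
 show "integrable gauss (%g. exp (- Q.pexpo g))" by (rule gauss_integrable_bounded[where B = 1]) (auto simp: Q.pexpo_nonneg)
 fix g
 have ym: "(%y. cis (c * g * (Y y - a))) : bmeas RW" unfolding cis_conv_exp using Ym by measurable
 have "(LINT y|RW. cos (c * g * (Y y - a))) = (LINT y|RW. Re (cis (c * g * (Y y - a))))" by simp
 also have "... = Re (LINT y|RW. cis (c * g * (Y y - a)))"
  by (rule integral_Re, rule R.integrable_const_bound[where B = 1]) (use ym in auto)
 also have "... <= cmod (LINT y|RW. cis (c * g * (Y y - a)))" by (rule complex_Re_le_cmod)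
 also have "(LINT y|RW. cis (c * g * (Y y - a))) = cis (- (c * g * a)) * (LINT y|RW. (PROD m<n. cis (c * g * u m (y m))))"
 proof -
  have "cis (c * g * (Y y - a)) = cis (- (c * g * a)) * (PROD m<n. cis (c * g * u m (y m)))" for y
  proof -
   have "(PROD m<k. cis (c * g * u m (y m))) = cis (SUM m<k. c * g * u m (y m))" for k by (induction k) (auto simp: cis_mult)
   thus ?thesis by (simp add: cis_mult Y_def sum_distrib_left algebra_simps)
  qed
  thus ?thesis by simp
 qed
 also have "(LINT y|RW. (PROD m<n. cis (c * g * u m (y m)))) = (PROD m<n. (LINT y|mu. cis (c * g * u m y)))"
 proof -
  interpret product_sigma_finite "%_. mu" by (intro product_sigma_finite.intro sigma_finite_mu)
  show ?thesis unfolding row_law_def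
  proof (rule product_integral_prod)
   fix m assume "m : {..<n}"
   hence [measurable]: "u m : bmeas mu" unfolding measurable_mu_borel by (intro u) simp
   have "(%y. cis (c * g * u m y)) : bmeas mu" unfolding cis_conv_exp by measurable
   thus "integrable mu (%y. cis (c * g * u m y))" by (intro mu.integrable_const_bound[where B = 1]) auto
  qed simp
 qed
 also have "cmod (cis (- (c * g * a)) * (PROD m<n. (LINT y|mu. cis (c * g * u m y)))) =
  (PROD m<n. cmod (LINT y|mu. cis (c * g * u m y)))" by (simp only: norm_mult prod_norm norm_cis mult_1)
 also have "... <= (PROD m<n. exp (- (LINT p|MM. 1 - cos (c * g * (u m (fst p) - u m (snd p)))) / 2))"
  by (intro prod_mono conjI norm_char_le u) auto
 also have "... = exp (- Q.pexpo g)"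
 proof -
  have "2 * Q.pexpo g = (SUM m<n. (LINT p|MM. 1 - cos (phase u b (m, p) * g)))"
  proof -
   have "(LINT q|epairs. 1 - cos (phase u b q * g)) = (SUM m<n. (LINT p|MM. 1 - cos (phase u b (m, p) * g)))"
   proof (rule integral_epairs[where B = 2])
    note [measurable] = Q.z
    show "(%q. 1 - cos (phase u b q * g)) : bmeas epairs" by measurable
   qed (rule abs_one_minus_cos)
   thus ?thesis unfolding Q.pexpo_def by linarith
  qed
  also have "... = (SUM m<n. (LINT p|MM. 1 - cos (c * g * (u m (fst p) - u m (snd p)))))"
  proof -
   have "phase u b (m, p) * g = c * g * (u m (fst p) - u m (snd p))" for m p unfolding phase_def c_def by (cases p) simp
   thus ?thesis by (simp only:)
  qed
  finally have S: "- Q.pexpo g = (SUM m<n. - (LINT p|MM. 1 - cos (c * g * (u m (fst p) - u m (snd p)))) / 2)"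
   unfolding sum_divide_distrib[symmetric] sum_negf by linarith
  show ?thesis unfolding S by (rule exp_sum[symmetric]) simp
 qed
 finally show "(LINT y|RW. cos (c * g * (Y y - a))) <= exp (- Q.pexpo g)" .
qed
finally show ?thesis unfolding Y_def .
qed

end

text \<open>A smooth version of the minimum of |y|^2 and b. The exponential form is chosen because
  its mean over a row is governed by Gaussian small ball weights.\<close>

definition soft_sq :: "real => complex => real" where
"soft_sq b y = b * (1 - exp (- (cmod y)\<^sup>2 / b))"

definition snorm :: "nat => real => (nat => complex) => real" where
"snorm n b v = (SUM m<n. soft_sq b (v m))"

definition trunc_sq :: "real => complex => real" where
"trunc_sq B d = (if (cmod d)^2 <= B then (cmod d)^2 else 0)"

lemma one_minus_exp_scale:
fixes x c :: real
assumes "0 <= c" "c <= 1"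
shows "c * (1 - exp (- x)) <= 1 - exp (- (c * x))"
proof -
have "exp ((1 - c) *\<^sub>R 0 + c *\<^sub>R (- x)) <= (1 - c) * exp 0 + c * exp (- x)"
 by (rule convex_onD[OF exp_convex]) (use assms in auto)
thus ?thesis by (simp add: algebra_simps)
qed

context entry_law
begin

lemma integrable_trunc_sq: "B >= 0 ==> integrable MM (%p. trunc_sq B (fst p - snd p))"
proof -
assume "B >= 0"
have m: "(%p. trunc_sq B (fst p - snd p)) : bmeas MM" unfolding measurable_pair_mu_borel trunc_sq_def by measurable
show ?thesis by (rule D.integrable_const_bound[OF _ m, where B = B]) (use \<open>B >= 0\<close> in \<open>auto simp: trunc_sq_def\<close>)
qed

lemma min_phase_mean_le:
fixes u :: "nat => complex => real"
assumes u: "!!m. m < n ==> u m : bmeas borel" and b: "b > 0" and kap: "0 < kap" "kap <= 1/2"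
shows "(1 - 3/2 * kap) * min ((SUM m<n. (LINT p|MM. 1 - exp (- (u m (fst p) - u m (snd p))\<^sup>2 / b))) / 2) kap <=
 1 - (LINT y|RW. exp (- (SUM m<n. u m (y m))\<^sup>2 / b))"
proof -
interpret Q: phase_measure epairs "phase u b" by (rule phase_measure[OF u])
have "(LINT q|epairs. 1 - exp (- (phase u b q)\<^sup>2 / 2)) = (SUM m<n. (LINT p|MM. 1 - exp (- (phase u b (m, p))\<^sup>2 / 2)))"
proof (rule integral_epairs[where B = 1])
 note [measurable] = Q.z
 show "(%q. 1 - exp (- (phase u b q)\<^sup>2 / 2)) : bmeas epairs" by measurable
qed (auto simp: abs_le_iff intro: order.trans[of _ 0])
moreover have "(phase u b (m, p))^2 / 2 = (u m (fst p) - u m (snd p))^2 / b" for m p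
 unfolding phase_def using b by (cases p) (simp add: power_mult_distrib)
ultimately have eq: "Q.phase_mean = (SUM m<n. (LINT p|MM. 1 - exp (- (u m (fst p) - u m (snd p))\<^sup>2 / b))) / 2"
 unfolding Q.phase_mean_def by (simp only: minus_divide_left[symmetric])
have "(LINT y|RW. exp (- ((SUM m<n. u m (y m)) - 0)\<^sup>2 / b)) <= 1 - (1 - 3/2 * kap) * min Q.phase_mean kap"
 by (rule order.trans[OF integral_gaussian_row_le[OF u b] Q.gauss_exp_pexpo[OF kap]])
thus ?thesis unfolding eq diff_0_right by linarith
qed

text \<open>Real and imaginary part are separate sums over the row, and each is estimated at scale
  b'. With P and Q the two Gaussian weights at scale 2 b', (1 - P^2) + (1 - Q^2) <= 2 (1 - P Q), so
  both fit into one soft square at scale 2 b'.\<close>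

lemma soft_sq_row_integral:
assumes b: "b > 0" "b' > 0" and kap: "0 < kap" "kap <= 1/2"
 and pairs: "2 * (1 - eta) / real n <= (LINT p|MM. trunc_sq (b' / b) (fst p - snd p))"
shows "(1 - 3/2 * kap) * min ((1 - eta) * snorm n b v / real n) (kap * b') <= (LINT y|RW. soft_sq (2 * b') (SUM m<n. y m * v m))"
proof -
define u1 where "u1 m y = Re (y * v m)" for m y
define u2 where "u2 m y = Im (y * v m)" for m y
define Y where "Y y = (SUM m<n. y m * v m)" for y
have u1 [measurable]: "u1 m : bmeas borel" and u2 [measurable]: "u2 m : bmeas borel" for m unfolding u1_def u2_def by measurable
have Ym: "Y : bmeas RW"
 unfolding Y_def by (intro borel_measurable_sum borel_measurable_times measurable_row_component borel_measurable_const) auto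
have s1: "Re (Y y) = (SUM m<n. u1 m (y m))" and s2: "Im (Y y) = (SUM m<n. u2 m (y m))" for y
 unfolding Y_def u1_def u2_def by (simp_all only: Re_sum Im_sum)
define I where "I u m = (LINT p|MM. 1 - exp (- (u m (fst p) - u m (snd p))\<^sup>2 / b'))" for u :: "nat => complex => real" and m
define H where "H u = (SUM m<n. I u m) / 2" for u
have int: "integrable MM (%p. 1 - exp (- (u m (fst p) - u m (snd p))\<^sup>2 / b'))"
 if [measurable]: "u m : bmeas borel" for u :: "nat => complex => real" and m
proof (rule D.integrable_const_bound[where B = 1])
 show "(%p. 1 - exp (- (u m (fst p) - u m (snd p))\<^sup>2 / b')) : bmeas MM" unfolding measurable_pair_mu_borel by measurable
qed (use b in \<open>auto simp: abs_le_iff divide_nonpos_pos intro: order.trans[of _ 0]\<close>)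
have Ige: "soft_sq b (v m) / b' * (2 * (1 - eta) / real n) <= I u1 m + I u2 m" if "m < n" for m
proof -
 have "soft_sq b (v m) / b' * (2 * (1 - eta) / real n) <= soft_sq b (v m) / b' * (LINT p|MM. trunc_sq (b' / b) (fst p - snd p))"
  using b by (intro mult_left_mono pairs) (auto simp: soft_sq_def)
 also have "... = (LINT p|MM. soft_sq b (v m) / b' * trunc_sq (b' / b) (fst p - snd p))"
  by (rule integral_mult_right_zero[symmetric])
 also have "... <= (LINT p|MM. (1 - exp (- (u1 m (fst p) - u1 m (snd p))\<^sup>2 / b')) + (1 - exp (- (u2 m (fst p) - u2 m (snd p))\<^sup>2 / b')))"
 proof (rule integral_mono)
  show "integrable MM (%p. soft_sq b (v m) / b' * trunc_sq (b' / b) (fst p - snd p))"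
   using b by (intro integrable_mult_right integrable_trunc_sq) auto
  show "integrable MM (%p. (1 - exp (- (u1 m (fst p) - u1 m (snd p))\<^sup>2 / b')) + (1 - exp (- (u2 m (fst p) - u2 m (snd p))\<^sup>2 / b')))"
   by (intro Bochner_Integration.integrable_add int u1 u2)
  fix p :: "complex \<times> complex"
  define d where "d = fst p - snd p"
  have e1: "u1 m (fst p) - u1 m (snd p) = Re (d * v m)" and e2: "u2 m (fst p) - u2 m (snd p) = Im (d * v m)"
   by (simp_all add: u1_def u2_def d_def algebra_simps)
  define P where "P = exp (- (Re (d * v m))\<^sup>2 / b')"
  define Q where "Q = exp (- (Im (d * v m))\<^sup>2 / b')"
  have PQ: "0 <= P" "P <= 1" "0 <= Q" "Q <= 1" using b by (auto simp: P_def Q_def divide_nonpos_pos)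
  have "P * Q = exp (- ((cmod (d * v m))^2 / b'))"
   unfolding P_def Q_def cmod_power2 exp_add[symmetric] by (simp add: diff_divide_distrib add_divide_distrib)
  hence pq: "P * Q = exp (- ((cmod d)^2 * (cmod (v m))^2 / b'))" by (simp add: norm_mult power_mult_distrib)
  have "soft_sq b (v m) / b' * trunc_sq (b' / b) (fst p - snd p) <= 1 - P * Q"
  \<comment> \<open>Only differences with |d|^2 <= b'/b are used: then c <= 1, and concavity allows
    the change from scale b to scale b'. This is why the second moment is truncated.\<close>
  proof (cases "(cmod d)^2 <= b' / b")
   case True
   define c where "c = (cmod d)^2 * b / b'"
   have "0 <= c" "c <= 1" using True b by (auto simp: c_def field_simps)
   hence "c * (1 - exp (- ((cmod (v m))^2 / b))) <= 1 - exp (- (c * ((cmod (v m))^2 / b)))" by (rule one_minus_exp_scale)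
   moreover have "c * ((cmod (v m))^2 / b) = (cmod d)^2 * (cmod (v m))^2 / b'" using b by (simp add: c_def)
   moreover have "c * (1 - exp (- ((cmod (v m))^2 / b))) = soft_sq b (v m) / b' * trunc_sq (b' / b) (fst p - snd p)"
    using True by (simp add: c_def soft_sq_def d_def trunc_sq_def)
   ultimately show ?thesis unfolding pq by (simp only:)
  next
   case False
   thus ?thesis using b unfolding pq by (simp add: d_def trunc_sq_def)
  qed
  also have "1 - P * Q <= (1 - P) + (1 - Q)" using mult_nonneg_nonneg[of "1 - P" "1 - Q"] PQ by (simp add: algebra_simps)
  finally show "soft_sq b (v m) / b' * trunc_sq (b' / b) (fst p - snd p) <=
   (1 - exp (- (u1 m (fst p) - u1 m (snd p))\<^sup>2 / b')) + (1 - exp (- (u2 m (fst p) - u2 m (snd p))\<^sup>2 / b'))"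
   unfolding e1 e2 P_def Q_def .
 qed
 also have "... = I u1 m + I u2 m" unfolding I_def by (intro Bochner_Integration.integral_add int u1 u2)
 finally show ?thesis .
qed
have H: "(1 - eta) * snorm n b v / real n / b' <= H u1 + H u2"
proof -
 have "(SUM m<n. soft_sq b (v m) / b' * (2 * (1 - eta) / real n)) <= (SUM m<n. I u1 m + I u2 m)" by (intro sum_mono Ige) simp
 hence "snorm n b v / b' * (2 * (1 - eta) / real n) <= (SUM m<n. I u1 m) + (SUM m<n. I u2 m)"
  unfolding snorm_def sum.distrib sum_distrib_right sum_divide_distrib by simp
 thus ?thesis unfolding H_def by (simp add: field_simps)
qed
have I0: "I u m >= 0" for u m unfolding I_def using b by (intro Bochner_Integration.integral_nonneg) (auto simp: divide_nonpos_pos)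
have H0: "H u >= 0" for u unfolding H_def by (intro divide_nonneg_nonneg sum_nonneg I0) auto
define J1 where "J1 = (LINT y|RW. exp (- (Re (Y y))\<^sup>2 / b'))"
define J2 where "J2 = (LINT y|RW. exp (- (Im (Y y))\<^sup>2 / b'))"
let ?a = "1 - 3/2 * kap"
have J1: "?a * min (H u1) kap <= 1 - J1" unfolding J1_def s1 H_def I_def by (rule min_phase_mean_le[OF u1 b(2) kap])
have J2: "?a * min (H u2) kap <= 1 - J2" unfolding J2_def s2 H_def I_def by (rule min_phase_mean_le[OF u2 b(2) kap])
have "?a * min ((1 - eta) * snorm n b v / real n) (kap * b') =
 ?a * (b' * min ((1 - eta) * snorm n b v / real n / b') kap)" using b by (simp add: min_mult_distrib_left mult.commute)
also have "... <= ?a * (b' * (min (H u1) kap + min (H u2) kap))"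
 using H H0[of u1] H0[of u2] kap b by (intro mult_left_mono) auto
also have "... = b' * (?a * min (H u1) kap + ?a * min (H u2) kap)" by (simp add: algebra_simps)
also have "... <= b' * ((1 - J1) + (1 - J2))" using J1 J2 b by (intro mult_left_mono) auto
also have "... = (LINT y|RW. b' * ((1 - exp (- (Re (Y y))\<^sup>2 / b')) + (1 - exp (- (Im (Y y))\<^sup>2 / b'))))"
proof -
 have "integrable RW (%y. exp (- (Re (Y y))\<^sup>2 / b'))" "integrable RW (%y. exp (- (Im (Y y))\<^sup>2 / b'))"
  by (rule R.integrable_const_bound[where B = 1]; use Ym b in \<open>auto simp: divide_nonpos_pos\<close>)+
 thus ?thesis unfolding J1_def J2_def by (simp add: R.prob_space)
qed
also have "... <= (LINT y|RW. soft_sq (2 * b') (Y y))"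
proof (rule integral_mono)
 show "integrable RW (%y. b' * ((1 - exp (- (Re (Y y))\<^sup>2 / b')) + (1 - exp (- (Im (Y y))\<^sup>2 / b'))))"
 proof (intro integrable_mult_right Bochner_Integration.integrable_add)
  show "integrable RW (%y. 1 - exp (- (Re (Y y))\<^sup>2 / b'))" "integrable RW (%y. 1 - exp (- (Im (Y y))\<^sup>2 / b'))"
   by (rule R.integrable_const_bound[where B = 1]; use Ym b in \<open>auto simp: divide_nonpos_pos abs_le_iff intro: order.trans[of _ 0]\<close>)+
 qed
 show "integrable RW (%y. soft_sq (2 * b') (Y y))" unfolding soft_sq_def
  by (intro integrable_mult_right, rule R.integrable_const_bound[where B = 1])
   (use Ym b in \<open>auto simp: divide_nonpos_pos abs_le_iff intro: order.trans[of _ 0]\<close>)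
 fix y
 define P where "P = exp (- (Re (Y y))\<^sup>2 / (2 * b'))"
 define Q where "Q = exp (- (Im (Y y))\<^sup>2 / (2 * b'))"
 have "P^2 = exp (- (Re (Y y))\<^sup>2 / b')" "Q^2 = exp (- (Im (Y y))\<^sup>2 / b')"
  unfolding P_def Q_def by (simp_all add: power2_eq_square exp_add[symmetric])
 moreover have "P * Q = exp (- (cmod (Y y))\<^sup>2 / (2 * b'))"
  unfolding P_def Q_def cmod_power2 exp_add[symmetric] by (simp add: diff_divide_distrib add_divide_distrib)
 moreover have "(1 - P^2) + (1 - Q^2) <= 2 * (1 - P * Q)" using zero_le_power2[of "P - Q"] by (simp add: power2_diff)
 ultimately show "b' * ((1 - exp (- (Re (Y y))\<^sup>2 / b')) + (1 - exp (- (Im (Y y))\<^sup>2 / b'))) <= soft_sq (2 * b') (Y y)"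
  using b by (simp add: soft_sq_def)
qed
finally show ?thesis unfolding Y_def .
qed

text \<open>The indicator of the disc is at most e times a Gaussian weight of the real or of the
  imaginary part. Large coordinates and large differences of entries produce large phases, and one
  of the two parts carries at least half of their mass, whence c p / 2.\<close>

lemma small_ball_row:
assumes pos: "eps > 0" "t0 > 0" "dl > 0" "c > 0" "p > 0" and N: "N >= 1"
 and card: "c <= real (card {m. m < n & t0 <= (cmod (v m))^2})"
 and mass: "p <= measure MM {d : space MM. dl <= (cmod (fst d - snd d))^2}"
 and z0: "0 < z0" "z0^2 <= t0 * dl / eps^2"
shows "measure RW {y : space RW. cmod ((SUM m<n. y m * v m) - a) <= eps} <=
 exp 1 * (8 * (4 + 4 / z0) / real N + exp (- (c * p / 2) / (32 * (real N)^2)))"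
proof -
let ?B = "8 * (4 + 4 / z0) / real N + exp (- (c * p / 2) / (32 * (real N)^2))"
define Y where "Y y = (SUM m<n. y m * v m)" for y
have Ym: "Y : bmeas RW"
 unfolding Y_def by (intro borel_measurable_sum borel_measurable_times measurable_row_component borel_measurable_const) auto
define u1 where "u1 m y = Re (y * v m)" for m y
define u2 where "u2 m y = Im (y * v m)" for m y
have u1 [measurable]: "u1 m : bmeas borel" and u2 [measurable]: "u2 m : bmeas borel" for m unfolding u1_def u2_def by measurable
define G where "G = {m. m < n & t0 <= (cmod (v m))^2}"
define A where "A u m = {d : space MM. z0 <= \<bar>phase u (eps^2) (m, d)\<bar>}" for u m
have phm: "(%d. phase u b (m, d)) : bmeas MM" if [measurable]: "u m : bmeas borel" for u m b
 unfolding phase_def measurable_pair_mu_borel by simp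
have Am: "A u m : D.events" if "u m : bmeas borel" for u m unfolding A_def using phm[of u m "eps^2", OF that] by measurable
have tail: "R.prob {y : space RW. cmod (Y y - a) <= eps} <= exp 1 * ?B" if u: "!!m. u m : bmeas borel"
  and Yu: "!!y. \<bar>(SUM m<n. u m (y m)) - a'\<bar> <= cmod (Y y - a)"
  and big: "c * p / 2 <= (SUM m<n. D.prob (A u m))" for u :: "nat => complex => real" and a'
proof -
 interpret Q: phase_measure epairs "phase u (eps^2)" by (rule phase_measure[OF u])
 have meas: "measure epairs {q : space epairs. z0 <= \<bar>phase u (eps^2) q\<bar>} = (SUM m<n. D.prob (A u m))"
 proof -
  define S where "S = {q : space epairs. z0 <= \<bar>phase u (eps^2) q\<bar>}"
  have S: "S : sets epairs" unfolding S_def using Q.z by measurable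
  have "measure epairs S = (LINT q|epairs. indicat_real S q)" using S by simp
  also have "... = (SUM m<n. (LINT p|MM. indicat_real S (m, p)))"
   using S by (intro integral_epairs[where B = 1]) (auto simp: indicator_def)
  also have "... = (SUM m<n. (LINT p|MM. indicat_real (A u m) p))" by (intro sum.cong refl Bochner_Integration.integral_cong)
    (auto simp: S_def A_def epairs_def space_pair_measure indicator_def)
  also have "... = (SUM m<n. D.prob (A u m))" using Am[OF u] by simp
  finally show ?thesis unfolding S_def .
 qed
 have um: "(%y. SUM m<n. u m (y m)) : bmeas RW" by (intro borel_measurable_sum measurable_row_law_component u) auto
 have Em: "{y : space RW. cmod (Y y - a) <= eps} : R.events" using Ym by measurable
 have "R.prob {y : space RW. cmod (Y y - a) <= eps} = (LINT y|RW. indicat_real {y : space RW. cmod (Y y - a) <= eps} y)" using Em by simp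
 also have "... <= (LINT y|RW. exp 1 * exp (- ((SUM m<n. u m (y m)) - a')\<^sup>2 / eps^2))"
 proof (rule integral_mono)
  show "integrable RW (indicat_real {y : space RW. cmod (Y y - a) <= eps})" using Em by (simp add: R.emeasure_eq_measure)
  show "integrable RW (%y. exp 1 * exp (- ((SUM m<n. u m (y m)) - a')\<^sup>2 / eps^2))"
  proof (intro integrable_mult_right, rule R.integrable_const_bound[where B = 1])
   show "(%y. exp (- ((SUM m<n. u m (y m)) - a')\<^sup>2 / eps^2)) : bmeas RW"
    by (rule measurable_compose[OF um, where g = "%t. exp (- (t - a')\<^sup>2 / eps^2)"]) measurable
  qed (rule AE_I2, simp only: real_norm_def abs_exp_cancel exp_le_one_iff, simp add: divide_nonpos_nonneg)
  fix y :: "nat => complex"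
  show "indicat_real {y : space RW. cmod (Y y - a) <= eps} y <= exp 1 * exp (- ((SUM m<n. u m (y m)) - a')\<^sup>2 / eps^2)"
  proof (cases "cmod (Y y - a) <= eps")
   case True
   hence "((SUM m<n. u m (y m)) - a')^2 <= eps^2" using Yu[of y] pos by (intro abs_le_square_iff[THEN iffD1]) auto
   hence "((SUM m<n. u m (y m)) - a')^2 / eps^2 <= 1" using pos by simp
   hence "1 <= exp (1 - ((SUM m<n. u m (y m)) - a')^2 / eps^2)" by simp
   also have "... = exp 1 * exp (- ((SUM m<n. u m (y m)) - a')\<^sup>2 / eps^2)" by (simp add: exp_diff exp_minus divide_inverse)
   finally show ?thesis by (simp add: indicator_def)
  qed auto
 qed
 also have "... = exp 1 * (LINT y|RW. exp (- ((SUM m<n. u m (y m)) - a')\<^sup>2 / eps^2))" by simp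
 also have "... <= exp 1 * ?B"
 proof (intro mult_left_mono order.trans[OF integral_gaussian_row_le[OF u] Q.gauss_exp_pexpo_mass[OF z0(1) N]])
  show "c * p / 2 <= measure epairs {q : space epairs. z0 <= \<bar>phase u (eps^2) q\<bar>}" unfolding meas by (rule big)
 qed (use pos in auto)
 finally show ?thesis .
qed
have "c * p <= real (card G) * p" using card pos unfolding G_def by (intro mult_right_mono) auto
also have "... <= (SUM m:G. D.prob (A u1 m) + D.prob (A u2 m))"
proof -
 have "p <= D.prob (A u1 m) + D.prob (A u2 m)" if m: "m : G" for m
 proof -
  have "{d : space MM. dl <= (cmod (fst d - snd d))^2} <= A u1 m \<union> A u2 m"
  proof
   fix d :: "complex \<times> complex" assume d: "d : {d : space MM. dl <= (cmod (fst d - snd d))^2}"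
   define e where "e = (fst d - snd d) * v m"
   have ph: "(phase u1 (eps^2) (m, d))^2 = 2 / eps^2 * (Re e)^2" "(phase u2 (eps^2) (m, d))^2 = 2 / eps^2 * (Im e)^2"
   proof -
    have eq: "(phase u (eps^2) (m, d))^2 = 2 / eps^2 * (u m (fst d) - u m (snd d))^2" for u
    proof -
     have "phase u (eps^2) (m, d) = sqrt (2 / eps^2) * (u m (fst d) - u m (snd d))" unfolding phase_def by (cases d) simp
     moreover have "(sqrt (2 / eps^2))^2 = 2 / eps^2" by (rule real_sqrt_pow2) simp
     ultimately show ?thesis by (simp only: power_mult_distrib)
    qed
    have "u1 m (fst d) - u1 m (snd d) = Re e" "u2 m (fst d) - u2 m (snd d) = Im e"
     unfolding u1_def u2_def e_def left_diff_distrib minus_complex.sel by (rule refl)+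
    thus "(phase u1 (eps^2) (m, d))^2 = 2 / eps^2 * (Re e)^2" "(phase u2 (eps^2) (m, d))^2 = 2 / eps^2 * (Im e)^2" by (simp_all only: eq)
   qed
   have "dl * t0 <= (cmod (fst d - snd d))^2 * (cmod (v m))^2" using d m pos unfolding G_def by (intro mult_mono) auto
   also have "... = (Re e)^2 + (Im e)^2" unfolding e_def cmod_power2[symmetric] by (simp add: norm_mult power_mult_distrib)
   finally have "2 / eps^2 * (dl * t0) <= 2 / eps^2 * ((Re e)^2 + (Im e)^2)" by (rule mult_left_mono) simp
   hence "2 * (t0 * dl / eps^2) <= 2 / eps^2 * (Re e)^2 + 2 / eps^2 * (Im e)^2" by (simp only: distrib_left) (simp add: mult.commute)
   hence "z0^2 <= (phase u1 (eps^2) (m, d))^2 | z0^2 <= (phase u2 (eps^2) (m, d))^2" unfolding ph using z0(2) by linarith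
   hence "z0 <= \<bar>phase u1 (eps^2) (m, d)\<bar> | z0 <= \<bar>phase u2 (eps^2) (m, d)\<bar>"
    using z0(1) by (auto simp: abs_le_square_iff[symmetric])
   thus "d : A u1 m \<union> A u2 m" using d by (auto simp: A_def)
  qed
  hence "D.prob {d : space MM. dl <= (cmod (fst d - snd d))^2} <= D.prob (A u1 m \<union> A u2 m)"
   by (rule D.finite_measure_mono) (intro sets.Un Am u1 u2)
  also have "... <= D.prob (A u1 m) + D.prob (A u2 m)" by (intro measure_Un_le Am u1 u2)
  finally show ?thesis using mass by linarith
 qed
 hence "(SUM m:G. p) <= (SUM m:G. D.prob (A u1 m) + D.prob (A u2 m))" by (intro sum_mono)
 thus ?thesis by simp
qed
also have "... <= (SUM m<n. D.prob (A u1 m) + D.prob (A u2 m))" by (rule sum_mono2) (auto simp: G_def)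
also have "... = (SUM m<n. D.prob (A u1 m)) + (SUM m<n. D.prob (A u2 m))" by (rule sum.distrib)
finally have big: "c * p / 2 <= (SUM m<n. D.prob (A u1 m)) | c * p / 2 <= (SUM m<n. D.prob (A u2 m))" by linarith
have Ya: "\<bar>(SUM m<n. u1 m (y m)) - Re a\<bar> <= cmod (Y y - a)" "\<bar>(SUM m<n. u2 m (y m)) - Im a\<bar> <= cmod (Y y - a)" for y
 using abs_Re_le_cmod[of "Y y - a"] abs_Im_le_cmod[of "Y y - a"] by (simp_all add: Y_def u1_def u2_def Re_sum Im_sum)
from big have "R.prob {y : space RW. cmod (Y y - a) <= eps} <= exp 1 * ?B"
 by (rule disjE) (rule tail[OF u1 Ya(1)], assumption, rule tail[OF u2 Ya(2)], assumption)
thus ?thesis unfolding Y_def .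
qed

lemma trunc_sq_nested:
assumes "B >= 0"
shows "(LINT p|MM. trunc_sq B (fst p - snd p)) = (LINT y|mu. (LINT y'|mu. trunc_sq B (y - y')))"
 and "integrable mu (%y. (LINT y'|mu. trunc_sq B (y - y')))"
 and "integrable mu (%y'. trunc_sq B (y - y'))"
proof -
interpret pair_sigma_finite mu mu by (rule pair_mu)
have i: "integrable MM (case_prod (%y y'. trunc_sq B (y - y')))" using integrable_trunc_sq[OF assms] by (simp add: split_beta')
show "(LINT p|MM. trunc_sq B (fst p - snd p)) = (LINT y|mu. (LINT y'|mu. trunc_sq B (y - y')))"
 using integral_fst[OF i] by (simp add: split_beta')
show "integrable mu (%y. (LINT y'|mu. trunc_sq B (y - y')))" using integrable_fst[OF i] by simp
have "(%y'. trunc_sq B (y - y')) : bmeas mu" unfolding measurable_mu_borel trunc_sq_def by measurable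
thus "integrable mu (%y'. trunc_sq B (y - y'))"
 by (rule mu.integrable_const_bound[where B = B, rotated]) (use assms in \<open>auto simp: trunc_sq_def\<close>)
qed

text \<open>If |y - y'| > 2 a, one of the two entries exceeds a in modulus, and then |y - y'|^2 is
  at most four times the sum of their tail terms. Without truncation the mean of |y - y'|^2 is
  2/n.\<close>

lemma trunc_sq_integral_ge:
assumes tail: "real n * (LINT y|mu. (if cmod y > a then (cmod y)^2 else 0)) <= dl" and a: "a >= 0" "4 * a^2 <= B"
shows "2 * (1 - 4 * dl) / real n <= (LINT p|MM. trunc_sq B (fst p - snd p))"
proof -
have B: "B >= 0" using a(2) zero_le_power2[of a] by linarith
define t where "t y = (if cmod y > a then (cmod y)^2 else 0)" for y
have ti: "integrable mu t"
proof (rule Bochner_Integration.integrable_bound[OF int_sq])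
 show "t : bmeas mu" unfolding measurable_mu_borel t_def by measurable
qed (simp add: t_def)
define tau where "tau = (LINT y|mu. t y)"
have tau: "tau <= dl / real n" using tail n_pos by (simp add: tau_def t_def field_simps)
have pw: "(cmod (y - y'))^2 - 4 * t y - 4 * t y' <= trunc_sq B (y - y')" for y y'
proof (cases "(cmod (y - y'))^2 <= B")
 case False
 define M where "M = max (cmod y) (cmod y')"
 have d: "cmod (y - y') <= 2 * M" using norm_triangle_ineq4[of y y'] by (simp add: M_def)
 have "(2 * a)^2 < (cmod (y - y'))^2" using False a by (simp add: power_mult_distrib)
 hence "2 * a < cmod (y - y')" by (rule power2_less_imp_less) simp
 hence "M > a" using d by linarith
 hence "M^2 <= t y + t y'" unfolding M_def t_def by (auto simp: max_def)
 moreover have "(cmod (y - y'))^2 <= (2 * M)^2" using d by (intro power_mono) auto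
 ultimately show ?thesis using False by (simp add: power_mult_distrib trunc_sq_def)
qed (auto simp: t_def trunc_sq_def)
have sq: "(cmod (y - y'))^2 = (cmod y)^2 + (cmod y')^2 - 2 * Re (cnj y * y')" for y y'
 unfolding cmod_power2 by (simp add: power2_eq_square algebra_simps)
have inner: "(cmod y)^2 + 1 / real n - 4 * t y - 4 * tau <= (LINT y'|mu. trunc_sq B (y - y'))" for y
proof -
 have cr: "integrable mu (%y'. Re (cnj y * y'))" using integrable_mu by (intro integrable_Re integrable_mult_right) auto
 have "(LINT y'|mu. Re (cnj y * y')) = Re (LINT y'|mu. cnj y * y')" by (rule integral_Re) (rule integrable_mult_right[OF integrable_mu])
 also have "... = 0" using integrable_mu mean by simp
 finally have c0: "(LINT y'|mu. Re (cnj y * y')) = 0" .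
 have "(LINT y'|mu. (cmod y)^2 + (cmod y')^2 - 2 * Re (cnj y * y') - 4 * t y - 4 * t y') = (cmod y)^2 + 1 / real n - 4 * t y - 4 * tau"
  using cr ti int_sq c0 second by (simp add: mu.prob_space tau_def del: times_complex.sel)
 moreover have "(LINT y'|mu. (cmod y)^2 + (cmod y')^2 - 2 * Re (cnj y * y') - 4 * t y - 4 * t y') <= (LINT y'|mu. trunc_sq B (y - y'))"
 proof (rule integral_mono)
  show "integrable mu (%y'. (cmod y)^2 + (cmod y')^2 - 2 * Re (cnj y * y') - 4 * t y - 4 * t y')"
   using cr ti int_sq by (simp del: times_complex.sel)
  show "integrable mu (%y'. trunc_sq B (y - y'))" by (rule trunc_sq_nested(3)[OF B])
  fix y'
  show "(cmod y)^2 + (cmod y')^2 - 2 * Re (cnj y * y') - 4 * t y - 4 * t y' <= trunc_sq B (y - y')"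
   using pw[of y y'] sq[of y y'] by linarith
 qed
 ultimately show ?thesis by linarith
qed
have "(LINT y|mu. (cmod y)^2 + 1 / real n - 4 * t y - 4 * tau) = 1 / real n + 1 / real n - 4 * tau - 4 * tau"
 using ti int_sq second by (simp add: mu.prob_space tau_def)
moreover have "(LINT y|mu. (cmod y)^2 + 1 / real n - 4 * t y - 4 * tau) <= (LINT y|mu. (LINT y'|mu. trunc_sq B (y - y')))"
 using ti int_sq inner trunc_sq_nested(2)[OF B] by (intro integral_mono) auto
ultimately have "2 / real n - 8 * tau <= (LINT p|MM. trunc_sq B (fst p - snd p))" unfolding trunc_sq_nested(1)[OF B] by linarith
moreover have "2 * (1 - 4 * dl) / real n = 2 / real n - 8 * (dl / real n)" by (simp add: right_diff_distrib diff_divide_distrib)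
ultimately show ?thesis using tau by linarith
qed

text \<open>A difference below the threshold counts only if one of the two entries is nonzero.
  Combined with \<open>trunc_sq_integral_ge\<close> this bounds the probability of a large
  difference from below; here sparsity enters.\<close>

lemma trunc_sq_integral_le:
assumes "B >= 0" "be >= 0"
shows "(LINT p|MM. trunc_sq B (fst p - snd p)) <= 2 * be * measure mu {y : space mu. y ~= 0} +
 B * measure MM {d : space MM. be <= (cmod (fst d - snd d))^2}"
proof -
interpret pair_sigma_finite mu mu by (rule pair_mu)
define Z where "Z = {y : space mu. y ~= 0}"
define S where "S = {d : space MM. be <= (cmod (fst d - snd d))^2}"
have id: "(%y. y) : bmeas mu" unfolding measurable_mu_borel by measurable
have Z: "Z : mu.events" unfolding Z_def using id by measurable
have "(%d. (cmod (fst d - snd d))^2) : bmeas MM" unfolding measurable_pair_mu_borel by measurable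
hence S: "S : D.events" unfolding S_def by measurable
have E1: "Z \<times> space mu : D.events" and E2: "space mu \<times> Z : D.events" using Z by auto
have p1: "D.prob (Z \<times> space mu) = mu.prob Z" "D.prob (space mu \<times> Z) = mu.prob Z"
 using Z by (auto simp: measure_def mu.emeasure_pair_measure_Times mu.emeasure_space_1)
have "(LINT p|MM. trunc_sq B (fst p - snd p)) <=
 (LINT p|MM. be * indicat_real (Z \<times> space mu) p + be * indicat_real (space mu \<times> Z) p + B * indicat_real S p)"
proof (rule integral_mono[OF integrable_trunc_sq[OF assms(1)]])
 show "integrable MM (%p. be * indicat_real (Z \<times> space mu) p + be * indicat_real (space mu \<times> Z) p + B * indicat_real S p)"
  using E1 E2 S by (intro Bochner_Integration.integrable_add integrable_mult_right) (auto simp: D.emeasure_eq_measure)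
 fix p :: "complex \<times> complex" assume p: "p : space MM"
 show "trunc_sq B (fst p - snd p) <= be * indicat_real (Z \<times> space mu) p + be * indicat_real (space mu \<times> Z) p + B * indicat_real S p"
 proof (cases "p : S | fst p = snd p")
  case True
  thus ?thesis using assms by (auto simp: indicator_def trunc_sq_def)
 next
  case False
  hence "(cmod (fst p - snd p))^2 <= be" using p by (auto simp: S_def)
  moreover have "p : Z \<times> space mu | p : space mu \<times> Z" using False p by (auto simp: Z_def space_pair_measure)
  ultimately show ?thesis using assms by (auto simp: indicator_def trunc_sq_def)
 qed
qed
also have "... = be * mu.prob Z + be * mu.prob Z + B * D.prob S" using E1 E2 S by (simp add: D.emeasure_eq_measure p1)
finally show ?thesis unfolding Z_def S_def by simp
qed

end

lemma soft_sq_nonneg: "b > 0 ==> soft_sq b y >= 0" by (simp add: soft_sq_def divide_nonpos_pos)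

lemma soft_sq_le: "b > 0 ==> soft_sq b y <= b" by (simp add: soft_sq_def mult_le_cancel_left1)

lemma soft_sq_le_sq: "b > 0 ==> soft_sq b y <= (cmod y)^2"
using exp_ge_add_one_self[of "- (cmod y)\<^sup>2 / b"] by (simp add: soft_sq_def field_simps)

lemma snorm_nonneg: "b > 0 ==> snorm n b v >= 0" unfolding snorm_def by (intro sum_nonneg soft_sq_nonneg)

lemma measurable_soft_sq [measurable]: "soft_sq b : bmeas borel" unfolding soft_sq_def by measurable

lemma norm_square_le_add:
assumes "eta > 0"
shows "(cmod y)^2 <= (1 + eta) * (cmod y')^2 + (1 + 1 / eta) * (cmod (y - y'))^2"
proof -
define s t where "s = cmod y'" and "t = cmod (y - y')"
have "cmod y <= s + t" using norm_triangle_ineq[of y' "y - y'"] by (simp add: s_def t_def)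
hence "(cmod y)^2 <= (s + t)^2" by (intro power_mono) auto
also have "... = (1 + eta) * s^2 + (1 + 1 / eta) * t^2 - (eta * s - t)^2 / eta" using assms by (simp add: power2_eq_square field_simps)
also have "... <= (1 + eta) * s^2 + (1 + 1 / eta) * t^2" using assms by simp
finally show ?thesis by (simp add: s_def t_def)
qed

text \<open>The error term is quadratic, so mean square bounds apply to it, while the main term
  keeps a factor as close to 1 as wanted.\<close>

lemma soft_sq_perturb:
assumes b: "b > 0" and eta: "eta > 0"
shows "soft_sq b y <= (1 + eta) * soft_sq b y' + (1 + 1 / eta) * (cmod (y - y'))^2"
proof -
define s t where "s = (cmod y')^2 / b" and "t = (1 + 1 / eta) * (cmod (y - y'))^2 / b"
have st: "s >= 0" "t >= 0" using b eta by (auto simp: s_def t_def)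
have "(cmod y)^2 / b <= ((1 + eta) * (cmod y')^2 + (1 + 1 / eta) * (cmod (y - y'))^2) / b"
 using norm_square_le_add[OF eta] b by (intro divide_right_mono) auto
also have "... = (1 + eta) * s + t" by (simp add: s_def t_def add_divide_distrib)
finally have le: "(cmod y)^2 / b <= (1 + eta) * s + t" .
define P where "P = exp (- ((1 + eta) * s))"
have P: "0 <= P" "P <= 1" using st eta by (auto simp: P_def)
have "1 - exp (- ((cmod y)^2 / b)) <= 1 - exp (- ((1 + eta) * s + t))" using le by simp
also have "... = 1 - P * exp (- t)" by (simp add: P_def exp_add[symmetric])
also have "... <= 1 - P * (1 - t)" using exp_ge_add_one_self[of "- t"] P by (intro diff_left_mono mult_left_mono) auto
also have "... <= (1 - P) + t" using mult_right_mono[OF P(2) st(2)] by (simp add: algebra_simps)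
also have "1 - P <= (1 + eta) * (1 - exp (- s))"
proof -
 have "(1 / (1 + eta)) * (1 - P) <= 1 - exp (- ((1 / (1 + eta)) * ((1 + eta) * s)))"
  unfolding P_def by (rule one_minus_exp_scale) (use eta in auto)
 also have "(1 / (1 + eta)) * ((1 + eta) * s) = s" using eta by simp
 finally show ?thesis using eta by (simp add: pos_divide_le_eq mult.commute)
qed
finally have "1 - exp (- ((cmod y)^2 / b)) <= (1 + eta) * (1 - exp (- s)) + t" by simp
hence "b * (1 - exp (- ((cmod y)^2 / b))) <= b * ((1 + eta) * (1 - exp (- s)) + t)" using b by (intro mult_left_mono) auto
also have "... = (1 + eta) * (b * (1 - exp (- s))) + b * t" by (simp add: algebra_simps)
finally show ?thesis using b by (simp add: soft_sq_def s_def t_def)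
qed

lemma snorm_perturb:
assumes "b > 0" "eta > 0"
shows "snorm n b v <= (1 + eta) * snorm n b v' + (1 + 1 / eta) * sqnorm n (%m. v m - v' m)"
proof -
have "snorm n b v <= (SUM m<n. (1 + eta) * soft_sq b (v' m) + (1 + 1 / eta) * (cmod (v m - v' m))^2)"
 unfolding snorm_def by (intro sum_mono soft_sq_perturb assms)
thus ?thesis by (simp add: sum.distrib sum_distrib_left snorm_def sqnorm_def)
qed

text \<open>The derivative 2 t exp (- t^2 / b) is at most sqrt b, since 2 u <= 1 + u^2 <= exp (u^2).
  The Lipschitz constant becomes small with b, which is the source of the concentration.\<close>

lemma soft_sq_lipschitz:
assumes b: "b > 0"
shows "(soft_sq b y - soft_sq b y')^2 <= b * (cmod (y - y'))^2"
proof -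
define f where "f t = b * (1 - exp (- t\<^sup>2 / b))" for t :: real
have "norm (f (cmod y) - f (cmod y')) <= sqrt b * norm (cmod y - cmod y')"
proof (rule field_differentiable_bound[of UNIV])
 fix t :: real
 have "(f has_field_derivative b * (- (exp (- t\<^sup>2 / b) * (- (2 * t) / b)))) (at t within UNIV)"
  unfolding f_def using b by (auto intro!: derivative_eq_intros)
 thus "(f has_field_derivative 2 * t * exp (- t\<^sup>2 / b)) (at t within UNIV)" using b by (simp add: mult_ac)
 define u where "u = \<bar>t\<bar> / sqrt b"
 have t: "\<bar>t\<bar> = u * sqrt b" "t^2 / b = u^2" using b by (auto simp: u_def power_divide)
 have "2 * u <= 1 + u^2" using zero_le_power2[of "u - 1"] by (simp add: power2_diff)
 also have "... <= exp (u^2)" by (rule exp_ge_add_one_self)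
 finally have "2 * u * exp (- u\<^sup>2) <= 1" by (simp add: exp_minus divide_inverse[symmetric])
 hence "2 * u * exp (- u\<^sup>2) * sqrt b <= 1 * sqrt b" using b by (intro mult_right_mono) auto
 moreover have "norm (2 * t * exp (- t\<^sup>2 / b)) = 2 * \<bar>t\<bar> * exp (- (t^2 / b))" by (simp add: abs_mult)
 ultimately show "norm (2 * t * exp (- t\<^sup>2 / b)) <= sqrt b" unfolding t by (simp add: mult_ac)
qed auto
also have "norm (cmod y - cmod y') <= cmod (y - y')" using norm_triangle_ineq3[of y y'] by simp
finally have "\<bar>soft_sq b y - soft_sq b y'\<bar> <= sqrt b * cmod (y - y')" using b by (simp add: f_def soft_sq_def mult_left_mono)
hence "\<bar>soft_sq b y - soft_sq b y'\<bar>^2 <= (sqrt b * cmod (y - y'))^2" by (intro power_mono) auto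
thus ?thesis using b by (simp add: power_mult_distrib)
qed

section \<open>Norms of vectors of series and Lipschitz cutoffs\<close>

definition vnorm :: "nat => (nat => complex) => real" where
"vnorm n v = sqrt (sqnorm n v)"

lemma vnorm_L2_set: "vnorm n v = L2_set (%m. cmod (v m)) {..<n}" by (simp add: vnorm_def sqnorm_def L2_set_def)

lemma vnorm_nonneg [simp]: "vnorm n v >= 0" by (simp add: vnorm_def)

lemma vnorm_sq [simp]: "(vnorm n v)^2 = sqnorm n v" by (simp add: vnorm_def)

lemma vnorm_add: "vnorm n (%m. u m + v m) <= vnorm n u + vnorm n v"
proof -
have "L2_set (%m. cmod (u m + v m)) {..<n} <= L2_set (%m. cmod (u m) + cmod (v m)) {..<n}" by (intro L2_set_mono norm_triangle_ineq) auto
also have "... <= L2_set (%m. cmod (u m)) {..<n} + L2_set (%m. cmod (v m)) {..<n}" by (rule L2_set_triangle_ineq)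
finally show ?thesis by (simp add: vnorm_L2_set)
qed

lemma vnorm_scale: "vnorm n (%m. c * v m) = cmod c * vnorm n v"
by (simp add: vnorm_def sqnorm_def norm_mult power_mult_distrib sum_distrib_left[symmetric] real_sqrt_mult)

lemma vnorm_sum: "finite A ==> vnorm n (%m. SUM l:A. v l m) <= (SUM l:A. vnorm n (v l))"
proof (induction A rule: finite_induct)
case (insert l A)
thus ?case using vnorm_add[of n "v l" "%m. SUM l:A. v l m"] by simp
qed (simp add: vnorm_def sqnorm_def)

text \<open>An l^2 norm in position and degree, matched to the mean square bounds on the adjugate;
  it pairs with the l^1 type norm \<open>tnorm\<close> in
  \<open>vnorm_product_coeff_le\<close>.\<close>

definition anorm :: "real => nat => nat => (nat => complex fps) => real" where
"anorm r d n F = sqrt (SUM l<=d. r ^ l * sqnorm n (%m. F m $ l))"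

lemma anorm_L2_set:
assumes "r >= 0"
shows "anorm r d n F = L2_set (%l. sqrt (r ^ l) * vnorm n (%m. F m $ l)) {..d}"
using assms by (simp add: anorm_def L2_set_def power_mult_distrib)

lemma anorm_nonneg [simp]: "r >= 0 ==> anorm r d n F >= 0" by (simp add: anorm_L2_set)

lemma anorm_sq: "r >= 0 ==> (anorm r d n F)^2 = (SUM l<=d. r ^ l * sqnorm n (%m. F m $ l))" by (simp add: anorm_def sum_nonneg)

lemma anorm_add:
assumes "r >= 0"
shows "anorm r d n (%m. F m + G m) <= anorm r d n F + anorm r d n G"
proof -
have "L2_set (%l. sqrt (r ^ l) * vnorm n (%m. F m $ l + G m $ l)) {..d} <=
 L2_set (%l. sqrt (r ^ l) * vnorm n (%m. F m $ l) + sqrt (r ^ l) * vnorm n (%m. G m $ l)) {..d}"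
 unfolding distrib_left[symmetric] using assms by (intro L2_set_mono mult_left_mono vnorm_add) auto
also have "... <= L2_set (%l. sqrt (r ^ l) * vnorm n (%m. F m $ l)) {..d} + L2_set (%l. sqrt (r ^ l) * vnorm n (%m. G m $ l)) {..d}"
 by (rule L2_set_triangle_ineq)
finally show ?thesis using assms by (simp add: anorm_L2_set)
qed

lemma anorm_scale:
assumes "r >= 0"
shows "anorm r d n (%m. fps_const c * F m) = cmod c * anorm r d n F"
proof -
have "anorm r d n (%m. fps_const c * F m) = L2_set (%l. cmod c * (sqrt (r ^ l) * vnorm n (%m. F m $ l))) {..d}"
 using assms by (simp add: anorm_L2_set vnorm_scale mult_ac)
thus ?thesis using assms by (simp add: anorm_L2_set L2_set_right_distrib)
qed

lemma anorm_minus_commute: "anorm r d n (%m. F m - G m) = anorm r d n (%m. G m - F m)"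
by (simp add: anorm_def sqnorm_def norm_minus_commute)

lemma anorm_triangle_sub:
assumes "r >= 0"
shows "anorm r d n F <= anorm r d n G + anorm r d n (%m. F m - G m)" using anorm_add[OF assms, of d n G "%m. F m - G m"] by simp

lemma vnorm_coeff_le:
assumes r: "0 < r" "r <= 1" and "l <= d"
shows "r ^ l * vnorm n (%m. F m $ l) <= anorm r d n F"
proof -
have "r ^ l <= sqrt (r ^ l)" using r by (intro real_le_rsqrt) (auto simp: power2_eq_square mult_le_one power_le_one intro: mult_left_le)
hence "r ^ l * vnorm n (%m. F m $ l) <= sqrt (r ^ l) * vnorm n (%m. F m $ l)" by (intro mult_right_mono) auto
also have "... <= anorm r d n F" unfolding anorm_L2_set[OF less_imp_le[OF r(1)]] using assms by (intro member_le_L2_set) auto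
finally show ?thesis .
qed

lemma vnorm_product_coeff_le:
assumes r: "0 < r" "r <= 1" and k: "k <= d"
shows "r ^ k * vnorm n (%m. (f * F m) $ k) <= tnorm r d f * anorm r d n F"
proof -
have "vnorm n (%m. (f * F m) $ k) <= (SUM l=0..k. vnorm n (%m. f $ l * F m $ (k - l)))" unfolding fps_mult_nth by (rule vnorm_sum) simp
hence "r ^ k * vnorm n (%m. (f * F m) $ k) <= r ^ k * (SUM l=0..k. cmod (f $ l) * vnorm n (%m. F m $ (k - l)))"
 using r unfolding vnorm_scale by (intro mult_left_mono) auto
also have "... = (SUM l=0..k. cmod (f $ l) * r ^ l * (r ^ (k - l) * vnorm n (%m. F m $ (k - l))))" unfolding sum_distrib_left
proof (intro sum.cong refl)
 fix l assume "l : {0..k}"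
 hence "r ^ k = r ^ l * r ^ (k - l)" by (simp add: power_add[symmetric])
 thus "r ^ k * (cmod (f $ l) * vnorm n (%m. F m $ (k - l))) = cmod (f $ l) * r ^ l * (r ^ (k - l) * vnorm n (%m. F m $ (k - l)))" by simp
qed
also have "... <= (SUM l=0..k. cmod (f $ l) * r ^ l * anorm r d n F)" using r k by (intro sum_mono mult_left_mono vnorm_coeff_le) auto
also have "... <= (SUM l<=d. cmod (f $ l) * r ^ l * anorm r d n F)" using r k by (intro sum_mono2) auto
finally show ?thesis unfolding tnorm_def sum_distrib_right .
qed

definition cutoff :: "real => real" where
"cutoff t = max 0 (min 1 (2 - t))"

lemma cutoff_bounds: "0 <= cutoff t" "cutoff t <= 1" by (auto simp: cutoff_def)

lemma cutoff_eq_1: "t <= 1 ==> cutoff t = 1" by (simp add: cutoff_def)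

lemma cutoff_eq_0: "t >= 2 ==> cutoff t = 0" by (simp add: cutoff_def)

lemma cutoff_diff: "\<bar>cutoff s - cutoff t\<bar> <= \<bar>s - t\<bar>" by (auto simp: cutoff_def)

lemma measurable_cutoff [measurable]: "cutoff : bmeas borel" unfolding cutoff_def by measurable

lemma cutoff_mult_le: "L > 0 ==> a >= 0 ==> cutoff (a / L) * a <= 2 * L"
proof (cases "a <= 2 * L")
case True
assume "L > 0" "a >= 0"
hence "cutoff (a / L) * a <= 1 * a" by (intro mult_right_mono cutoff_bounds)
thus ?thesis using True by simp
qed (simp add: cutoff_eq_0 field_simps)

lemma cutoff_diff_mult:
assumes L: "L > 0" and a: "0 <= a'" "a' <= a" "a - a' <= e"
shows "\<bar>cutoff (a / L) - cutoff (a' / L)\<bar> * a' <= 2 * e"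
proof (cases "a' >= 2 * L")
case True
thus ?thesis using assms by (simp add: cutoff_eq_0 field_simps)
next
case False
have "\<bar>cutoff (a / L) - cutoff (a' / L)\<bar> <= \<bar>a / L - a' / L\<bar>" by (rule cutoff_diff)
also have "... = (a - a') / L" using assms by (simp add: diff_divide_distrib[symmetric])
also have "... <= e / L" using assms by (intro divide_right_mono) auto
finally have "\<bar>cutoff (a / L) - cutoff (a' / L)\<bar> * a' <= e / L * (2 * L)" using assms False by (intro mult_mono) auto
thus ?thesis using L by simp
qed

text \<open>The difference is written so that the change of the cutoff multiplies the smaller
  vector. Where this change is nonzero, that vector has norm below 2 L, and the constant becomes
  independent of L.\<close>

lemma anorm_cutoff_diff:
assumes r: "r >= 0" and L: "L > 0"
shows "anorm r d n (%m. fps_const (of_real (cutoff (anorm r d n F / L))) * F m -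
  fps_const (of_real (cutoff (anorm r d n G / L))) * G m) <= 3 * anorm r d n (%m. F m - G m)"
proof -
have one: "anorm r d n (%m. fps_const (of_real (cutoff (anorm r d n F / L))) * F m -
  fps_const (of_real (cutoff (anorm r d n G / L))) * G m) <= 3 * anorm r d n (%m. F m - G m)"
 if le: "anorm r d n G <= anorm r d n F" for F G
proof -
 define c c' where "c = cutoff (anorm r d n F / L)" and "c' = cutoff (anorm r d n G / L)"
 have "anorm r d n (%m. fps_const (of_real c) * F m - fps_const (of_real c') * G m) =
  anorm r d n (%m. fps_const (of_real c) * (F m - G m) + fps_const (of_real (c - c')) * G m)"
  by (rule arg_cong[where f = "anorm r d n"], rule ext, rule fps_ext) (simp add: algebra_simps)
 also have "... <= \<bar>c\<bar> * anorm r d n (%m. F m - G m) + \<bar>c - c'\<bar> * anorm r d n G"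
  by (rule order.trans[OF anorm_add[OF r]]) (simp add: anorm_scale[OF r] del: of_real_diff)
 also have "... <= 1 * anorm r d n (%m. F m - G m) + 2 * anorm r d n (%m. F m - G m)"
 proof (intro add_mono mult_right_mono)
  show "\<bar>c\<bar> <= 1" using cutoff_bounds by (simp add: c_def abs_of_nonneg)
  show "\<bar>c - c'\<bar> * anorm r d n G <= 2 * anorm r d n (%m. F m - G m)"
   unfolding c_def c'_def using le anorm_triangle_sub[OF r, of d n F G] r by (intro cutoff_diff_mult[OF L]) auto
 qed (use r in auto)
 finally show ?thesis by (simp add: c_def c'_def)
qed
show ?thesis
proof (cases "anorm r d n G <= anorm r d n F")
 case False
 hence "anorm r d n F <= anorm r d n G" by simp
 from one[OF this] show ?thesis by (subst anorm_minus_commute, subst (2) anorm_minus_commute)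
qed (rule one)
qed

lemma tnorm_scale: "tnorm r d (fps_const c * f) = cmod c * tnorm r d f" by (simp add: tnorm_def norm_mult sum_distrib_left mult_ac)

text \<open>Inversion is not Lipschitz, but its cutoff is. By b - b' = b b' (q' - q) the difference
  is controlled while both norms are of order L. If one norm is above 4 L and the other below 2 L,
  \<open>tnorm_inverse_le\<close> shows that q - q' is itself large.\<close>

lemma tnorm_cutoff_inverse_diff:
assumes r: "r >= 0" and L: "L > 0" and inv: "q * b = 1" "q' * b' = 1"
shows "tnorm r d (fps_const (of_real (cutoff (tnorm r d b / L))) * b -
  fps_const (of_real (cutoff (tnorm r d b' / L))) * b') <= 20 * L^2 * tnorm r d (q - q')"
proof -
have one: "tnorm r d (fps_const (of_real (cutoff (tnorm r d b / L))) * b -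
  fps_const (of_real (cutoff (tnorm r d b' / L))) * b') <= 20 * L^2 * tnorm r d (q - q')"
 if le: "tnorm r d b' <= tnorm r d b" and inv: "q * b = 1" "q' * b' = 1" for q q' b b'
proof -
 define a a' e where "a = tnorm r d b" and "a' = tnorm r d b'" and "e = tnorm r d (q - q')"
 have a: "0 <= a'" "a' <= a" "0 <= e" using r le by (auto simp: a_def a'_def e_def)
 define c c' where "c = cutoff (a / L)" and "c' = cutoff (a' / L)"
 have "b - b' = b * (q' * b') - (q * b) * b'" using inv by simp
 also have "... = b * (b' * (q' - q))" by (simp add: algebra_simps)
 finally have "tnorm r d (b - b') <= a * tnorm r d (b' * (q' - q))" using tnorm_mult[OF r, of d b "b' * (q' - q)"] by (simp add: a_def)
 also have "... <= a * (a' * e)" using tnorm_mult[OF r, of d b' "q' - q"] a tnorm_diff_commute[of r d q' q]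
  by (intro mult_left_mono) (auto simp: a'_def e_def)
 finally have bb: "tnorm r d (b - b') <= a * a' * e" by simp
 have aa: "a - a' <= tnorm r d (b - b')" using tnorm_triangle[OF r, of d b' "b - b'"] by (simp add: a_def a'_def)
 have T1: "c * tnorm r d (b - b') <= 4 * L^2 * e"
 proof (cases "a >= 2 * L")
  case True
  hence "c = 0" unfolding c_def using L by (intro cutoff_eq_0) (simp add: field_simps)
  thus ?thesis using a by simp
 next
  case False
  have "c * tnorm r d (b - b') <= 1 * (a * a' * e)" using bb r by (intro mult_mono) (auto simp: c_def cutoff_bounds)
  also have "... <= 1 * ((2 * L) * (2 * L) * e)" using a False by (intro mult_left_mono mult_right_mono mult_mono) auto
  finally show ?thesis by (simp add: power2_eq_square)
 qed
 have T2: "\<bar>c - c'\<bar> * a' <= 16 * L^2 * e"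
 proof (cases "a' >= 2 * L")
  case True
  hence "c = 0" "c' = 0" unfolding c_def c'_def using L a by (intro cutoff_eq_0; simp add: field_simps)+
  thus ?thesis using a by simp
 next
  case False
  show ?thesis
  proof (cases "a <= 4 * L")
   case True
   have "a * a' * e <= (4 * L) * (2 * L) * e" using a True False by (intro mult_right_mono mult_mono) auto
   hence "a - a' <= 8 * L^2 * e" using aa bb by (simp add: power2_eq_square)
   hence "\<bar>c - c'\<bar> * a' <= 2 * (8 * L^2 * e)" unfolding c_def c'_def using a by (intro cutoff_diff_mult[OF L])
   thus ?thesis by simp
  next
   case False2: False
   have "1/2 < a' * e"
   proof (rule ccontr)
    assume "~ 1/2 < a' * e"
    moreover have "q * b' - 1 = (q - q') * b'" using inv by (simp add: algebra_simps)
    hence "tnorm r d (q * b' - 1) <= a' * e" using tnorm_mult[OF r, of d "q - q'" b'] by (simp add: a'_def e_def mult.commute)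
    ultimately have "tnorm r d b <= 2 * tnorm r d b'" by (intro tnorm_inverse_le[OF r inv(1)]) linarith
    thus False using False False2 by (simp add: a_def a'_def)
   qed
   have "\<bar>c - c'\<bar> <= 1" using cutoff_bounds[of "a / L"] cutoff_bounds[of "a' / L"] by (simp add: c_def c'_def)
   hence "\<bar>c - c'\<bar> * a' <= 1 * a'" using a by (intro mult_right_mono) auto
   also have "... <= (2 * (a' * e)) * a'" using \<open>1/2 < a' * e\<close> a by (intro mult_right_mono) auto
   also have "... = 2 * (a' * a') * e" by simp
   also have "... <= 2 * ((2 * L) * (2 * L)) * e" using a False by (intro mult_right_mono mult_left_mono mult_mono) auto
   also have "... = 8 * (L^2 * e)" by (simp add: power2_eq_square)
   also have "... <= 16 * (L^2 * e)" using a by (intro mult_right_mono) auto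
   also have "... = 16 * L^2 * e" by simp
   finally show ?thesis .
  qed
 qed
 have "fps_const (of_real c) * b - fps_const (of_real c') * b' = fps_const (of_real c) * (b - b') + fps_const (of_real (c - c')) * b'"
  by (rule fps_ext) (simp add: algebra_simps)
 hence "tnorm r d (fps_const (of_real c) * b - fps_const (of_real c') * b') <=
  tnorm r d (fps_const (of_real c) * (b - b')) + tnorm r d (fps_const (of_real (c - c')) * b')" using tnorm_triangle[OF r] by simp
 also have "... = \<bar>c\<bar> * tnorm r d (b - b') + \<bar>c - c'\<bar> * a'" by (simp add: tnorm_scale a'_def del: of_real_diff)
 also have "\<bar>c\<bar> = c" by (simp add: c_def cutoff_bounds)
 finally show ?thesis using T1 T2 by (simp add: c_def c'_def a_def a'_def e_def)
qed
show ?thesis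
proof (cases "tnorm r d b' <= tnorm r d b")
 case False
 hence "tnorm r d b <= tnorm r d b'" by simp
 from one[OF this inv(2,1)] show ?thesis by (subst tnorm_diff_commute, subst (2) tnorm_diff_commute)
qed (rule one[OF _ inv])
qed

(* The weight is 1 where both norms are at most L, and elsewhere keeps the moments of the cut row finite;
   being Lipschitz, it changes little when one row is removed. *)
definition cut_weight :: "real => nat => real => nat => nat set => entries => nat => real" where
"cut_weight r d L n S x i = cutoff (tnorm r d (ichs n S x) / L) * cutoff (anorm r d n (adj n S x i) / L)"

definition cut_row :: "real => nat => real => nat => nat set => entries => nat => nat => nat => complex" where
"cut_row r d L n S x i k m = of_real (cut_weight r d L n S x i) * rpow n S x i k m"

lemma rpow_eq: "rpow n S x i k m = (ichs n S x * adj n S x i m) $ k"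
proof -
have "ichs n S x * adj n S x i m = (chs n S x * ichs n S x) * resv n S x i m" unfolding adj_def by (simp only: mult_ac)
thus ?thesis by (simp add: resv_def)
qed

lemma cut_row_eq: "cut_row r d L n S x i k m = ((fps_const (of_real (cutoff (tnorm r d (ichs n S x) / L))) * ichs n S x) *
  (fps_const (of_real (cutoff (anorm r d n (adj n S x i) / L))) * adj n S x i m)) $ k"
proof -
have "(fps_const a * f) * (fps_const c * g) = fps_const (a * c) * (f * g)" for a c :: complex and f g
 by (simp add: fps_const_mult[symmetric] mult_ac del: fps_const_mult)
note e = this
show ?thesis unfolding cut_row_def cut_weight_def rpow_eq e by simp
qed

lemma vnorm_cut_row_le:
assumes r: "0 < r" "r <= 1" and k: "k <= d" and L: "L > 0"
shows "r ^ k * vnorm n (cut_row r d L n S x i k) <= 4 * L^2"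
proof -
let ?a = "tnorm r d (ichs n S x)" and ?v = "anorm r d n (adj n S x i)"
have "r ^ k * vnorm n (cut_row r d L n S x i k) <= \<bar>cutoff (?a / L)\<bar> * ?a * (\<bar>cutoff (?v / L)\<bar> * ?v)"
 unfolding cut_row_eq[abs_def] using r by (intro order.trans[OF vnorm_product_coeff_le[OF r k]]) (simp add: tnorm_scale anorm_scale)
also have "... = (cutoff (?a / L) * ?a) * (cutoff (?v / L) * ?v)" by (simp add: cutoff_bounds)
also have "... <= (2 * L) * (2 * L)" using r L by (intro mult_mono cutoff_mult_le) (auto simp: cutoff_bounds)
finally show ?thesis by (simp add: power2_eq_square)
qed

text \<open>The product rule for two cut factors of norm at most 2 L each: 2 L times 3, plus 20 L^2
  times 2 L, and L <= L^3.\<close>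

lemma vnorm_cut_row_diff_le:
assumes r: "0 < r" "r <= 1" and k: "k <= d" and L: "L >= 1"
shows "r ^ k * vnorm n (%m. cut_row r d L n S x i k m - cut_row r d L n S' x i k m) <= 46 * L ^ 3 * (tnorm r d (chs n S x - chs n S' x) +
  anorm r d n (%m. adj n S x i m - adj n S' x i m))"
proof -
define X where "X S = fps_const (of_real (cutoff (tnorm r d (ichs n S x) / L))) * ichs n S x" for S
define Z where "Z S m = fps_const (of_real (cutoff (anorm r d n (adj n S x i) / L))) * adj n S x i m" for S m
let ?e = "tnorm r d (chs n S x - chs n S' x)"
let ?f = "anorm r d n (%m. adj n S x i m - adj n S' x i m)"
have r0: "r >= 0" and L0: "L > 0" using r L by auto
have X: "tnorm r d (X S) <= 2 * L" unfolding X_def tnorm_scale using cutoff_mult_le[OF L0, of "tnorm r d (ichs n S x)"] r0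
 by (simp add: cutoff_bounds)
have Z: "anorm r d n (Z S') <= 2 * L" unfolding Z_def anorm_scale[OF r0] using cutoff_mult_le[OF L0, of "anorm r d n (adj n S' x i)"] r0
 by (simp add: cutoff_bounds)
have eq: "cut_row r d L n S x i k m - cut_row r d L n S' x i k m = (X S * (Z S m - Z S' m)) $ k + ((X S - X S') * Z S' m) $ k" for m
proof -
 have "(X S * (Z S m - Z S' m)) $ k + ((X S - X S') * Z S' m) $ k = (X S * Z S m - X S' * Z S' m) $ k"
  unfolding fps_add_nth[symmetric] by (simp add: algebra_simps)
 thus ?thesis unfolding cut_row_eq X_def[symmetric] Z_def[symmetric] by simp
qed
have "r ^ k * vnorm n (%m. cut_row r d L n S x i k m - cut_row r d L n S' x i k m) <=
 r ^ k * vnorm n (%m. (X S * (Z S m - Z S' m)) $ k) + r ^ k * vnorm n (%m. ((X S - X S') * Z S' m) $ k)"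
 unfolding eq distrib_left[symmetric] using r by (intro mult_left_mono vnorm_add) auto
also have "... <= tnorm r d (X S) * anorm r d n (%m. Z S m - Z S' m) + tnorm r d (X S - X S') * anorm r d n (Z S')"
 by (intro add_mono vnorm_product_coeff_le r k)
also have "... <= (2 * L) * (3 * ?f) + (20 * L^2 * ?e) * (2 * L)"
proof (intro add_mono mult_mono X Z)
 show "anorm r d n (%m. Z S m - Z S' m) <= 3 * ?f" unfolding Z_def by (rule anorm_cutoff_diff[OF r0 L0])
 show "tnorm r d (X S - X S') <= 20 * L^2 * ?e" unfolding X_def by (rule tnorm_cutoff_inverse_diff[OF r0 L0]) auto
qed (use r L in auto)
also have "... <= 46 * L ^ 3 * (?e + ?f)"
proof -
 have "L <= L ^ 3" using L by (intro self_le_power) auto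
 hence "L * ?f <= L ^ 3 * ?f" using r0 by (intro mult_right_mono) auto
 moreover have "L^2 * ?e * L = L ^ 3 * ?e" by (simp add: power2_eq_square power3_eq_cube)
 moreover have "L ^ 3 * ?e >= 0" "L ^ 3 * ?f >= 0" using L r0 by auto
 ultimately have "6 * (L * ?f) + 40 * (L^2 * ?e * L) <= 46 * (L ^ 3 * ?e) + 46 * (L ^ 3 * ?f)" by linarith
 thus ?thesis by (simp add: algebra_simps)
qed
finally show ?thesis .
qed

section \<open>Growth of the soft norm along powers\<close>

lemma sum_power_square_le:
fixes r :: real
assumes r: "0 <= r" "r < 1"
shows "(SUM l<=d. r ^ l * (real l * (real l + 1))) <= 2 / (1 - r) ^ 3"
proof -
have g: "(SUM l<=d. r ^ l) <= 1 / (1 - r)" using r by (intro sum_geometric_le) auto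
have c: "(SUM k<=d. SUM i<=k. (c i * r ^ i) * r ^ (k - i)) = (SUM k<=d. (SUM i<=k. c i) * r ^ k)" for c :: "nat => real"
 unfolding sum_distrib_right by (intro sum.cong refl) (simp add: mult.assoc power_add[symmetric])
have s1: "(SUM k<=d. (real k + 1) * r ^ k) <= (1 / (1 - r))^2"
proof -
 have "(SUM k<=d. (SUM i<=k. 1) * r ^ k) <= (SUM i<=d. 1 * r ^ i) * (SUM j<=d. r ^ j)"
  unfolding c[symmetric] using r by (intro sum_convolution_le) auto
 also have "... <= (1 / (1 - r)) * (1 / (1 - r))" using g r by (intro mult_mono) (auto intro!: sum_nonneg)
 finally show ?thesis by (simp add: power2_eq_square algebra_simps)
qed
have tri: "(SUM i<=k. 2 * (real i + 1)) = (real k + 1) * (real k + 2)" for k by (induction k) (auto simp: algebra_simps)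
have "(SUM l<=d. r ^ l * (real l * (real l + 1))) <= (SUM k<=d. (SUM i<=k. 2 * (real i + 1)) * r ^ k)"
 unfolding tri mult.commute[of _ "r ^ _"] using r by (intro sum_mono mult_left_mono) (auto simp: algebra_simps)
also have "... <= (SUM i<=d. 2 * (real i + 1) * r ^ i) * (SUM j<=d. r ^ j)"
 unfolding c[symmetric] using r by (intro sum_convolution_le) auto
also have "(SUM i<=d. 2 * (real i + 1) * r ^ i) = 2 * (SUM i<=d. (real i + 1) * r ^ i)" by (simp only: sum_distrib_left mult.assoc)
also have "2 * (SUM i<=d. (real i + 1) * r ^ i) * (SUM j<=d. r ^ j) <= 2 * (1 / (1 - r))^2 * (1 / (1 - r))"
 using s1 g r by (intro mult_mono) (auto intro!: sum_nonneg)
finally show ?thesis by (simp add: power_divide power2_eq_square power3_eq_cube)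
qed

lemma tnorm_sq_le:
assumes r: "0 <= r" "r < 1"
shows "(tnorm r d f)^2 <= (1 / (1 - r)) * (SUM l<=d. r ^ l * (cmod (f $ l))^2)"
proof -
have "(tnorm r d f)^2 = (SUM l<=d. sqrt (r ^ l) * (sqrt (r ^ l) * cmod (f $ l)))^2"
 unfolding tnorm_def using r by (simp add: mult.assoc[symmetric] mult.commute)
also have "... <= (SUM l<=d. (sqrt (r ^ l))^2) * (SUM l<=d. (sqrt (r ^ l) * cmod (f $ l))^2)" by (rule Cauchy_Schwarz_ineq_sum)
also have "... = (SUM l<=d. r ^ l) * (SUM l<=d. r ^ l * (cmod (f $ l))^2)" using r by (simp add: power_mult_distrib)
also have "... <= (1 / (1 - r)) * (SUM l<=d. r ^ l * (cmod (f $ l))^2)"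
proof (rule mult_right_mono)
 show "(SUM l<=d. r ^ l) <= 1 / (1 - r)" using r by (intro sum_geometric_le) auto
qed (use r in \<open>auto intro!: sum_nonneg\<close>)
finally show ?thesis .
qed

text \<open>The square of 46 L^3, with one factor 2 from squaring a sum and one from adding the
  moments of Q and of the adjugate, times their common bound 2 / (1 - r)^4.\<close>

definition cut_const :: "real => real => real" where
"cut_const r L = 4 * (46 * L ^ 3)^2 * (2 / (1 - r) ^ 4)"

context entry_law
begin

lemma nn_integral_weighted_sum_le:
assumes m: "!!l. X l : bmeas MX" and X0: "!!l x. X l x >= 0"
 and le: "!!l. (NE x. X l x) <= ennreal (a l)" and a: "!!l. a l >= 0" and w: "!!l. w l >= 0"
shows "(NE x. SUM l<=d. w l * X l x) <= ennreal (SUM l<=d. w l * a l)"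
proof -
have mX: "(%x. ennreal (X l x)) : bmeas MX" for l by (rule measurable_compose[OF m]) simp
have "(NE x. SUM l<=d. w l * X l x) = (\<integral>\<^sup>+x. (SUM l<=d. ennreal (w l) * ennreal (X l x)) \<partial>MX)"
 using X0 w by (intro nn_integral_cong) (simp add: sum_ennreal[symmetric] ennreal_mult)
also have "... = (SUM l<=d. ennreal (w l) * (NE x. X l x))"
 by (simp only: nn_integral_sum[OF borel_measurable_times_ennreal[OF borel_measurable_const mX]] nn_integral_cmult[OF mX])
also have "... <= (SUM l<=d. ennreal (w l) * ennreal (a l))" by (intro sum_mono mult_left_mono le) auto
also have "... = ennreal (SUM l<=d. w l * a l)" using a w by (simp add: sum_ennreal[symmetric] ennreal_mult)
finally show ?thesis .
qed

lemma char_diff_norm_mom: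
assumes r: "0 < r" "r < 1" and R: "R <= {..<n}" and j: "j : R"
shows "(NE x. (tnorm r d (chs n R x - chs n (R - {j}) x))^2) <= ennreal (2 / (1 - r) ^ 4 / real n)"
proof -
have m: "(%x. (chs n R x - chs n (R - {j}) x) $ l) : bmeas MX" for l
 unfolding fps_sub_nth using R by (intro borel_measurable_diff measurable_series) auto
have m2: "(%x. (cmod ((chs n R x - chs n (R - {j}) x) $ l))^2) : bmeas MX" for l by (rule measurable_compose[OF m]) simp
have "(NE x. (tnorm r d (chs n R x - chs n (R - {j}) x))^2) <=
 (NE x. SUM l<=d. (1 / (1 - r) * r ^ l) * (cmod ((chs n R x - chs n (R - {j}) x) $ l))^2)"
proof (intro nn_integral_mono ennreal_leI)
 fix x
 show "(tnorm r d (chs n R x - chs n (R - {j}) x))^2 <= (SUM l<=d. (1 / (1 - r) * r ^ l) * (cmod ((chs n R x - chs n (R - {j}) x) $ l))^2)"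
  unfolding mult.assoc sum_distrib_left[symmetric] using r by (intro tnorm_sq_le) auto
qed
also have "... <= ennreal (SUM l<=d. (1 / (1 - r) * r ^ l) * (real l / real n))"
 using r by (intro nn_integral_weighted_sum_le m2 char_diff_mom R j) auto
also have "... <= ennreal (2 / (1 - r) ^ 4 / real n)"
proof (rule ennreal_leI)
 have "(SUM l<=d. (1 / (1 - r) * r ^ l) * (real l / real n)) = (1 / (1 - r) / real n) * (SUM l<=d. r ^ l * real l)"
  by (simp add: sum_distrib_left mult_ac)
 also have "... <= (1 / (1 - r) / real n) * (SUM l<=d. r ^ l * (real l * (real l + 1)))"
 proof (intro mult_left_mono sum_mono)
  show "real l <= real l * (real l + 1)" for l by (simp add: algebra_simps)
 qed (use r in auto)
 also have "... <= (1 / (1 - r) / real n) * (2 / (1 - r) ^ 3)"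
  using r by (intro mult_left_mono sum_power_square_le divide_nonneg_nonneg) auto
 also have "... = 2 / (1 - r) ^ 4 / real n" by (simp add: eval_nat_numeral)
 finally show "(SUM l<=d. (1 / (1 - r) * r ^ l) * (real l / real n)) <= 2 / (1 - r) ^ 4 / real n" .
qed
finally show ?thesis .
qed

lemma adj_diff_norm_mom:
assumes r: "0 < r" "r < 1" and R: "R <= {..<n}" and i: "i ~: R" "i < n" and j: "j : R"
shows "(NE x. (anorm r d n (%m. adj n R x i m - adj n (R - {j}) x i m))^2) <= ennreal (2 / (1 - r) ^ 4 / real n)"
proof -
have m2: "(%x. sqnorm n (%m. (adj n R x i m - adj n (R - {j}) x i m) $ l)) : bmeas MX" for l
 unfolding fps_sub_nth by (intro measurable_sqnorm borel_measurable_diff measurable_series) (use R in auto)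
have "(NE x. (anorm r d n (%m. adj n R x i m - adj n (R - {j}) x i m))^2) =
 (NE x. SUM l<=d. r ^ l * sqnorm n (%m. (adj n R x i m - adj n (R - {j}) x i m) $ l))"
 using r by (simp only: anorm_sq[OF less_imp_le[OF r(1)]])
also have "... <= ennreal (SUM l<=d. r ^ l * (real l * (real l + 1) / real n))"
 using r by (intro nn_integral_weighted_sum_le m2 adj_diff_mom R i j) auto
also have "... <= ennreal (2 / (1 - r) ^ 4 / real n)"
proof (rule ennreal_leI)
 have "(SUM l<=d. r ^ l * (real l * (real l + 1) / real n)) = (SUM l<=d. r ^ l * (real l * (real l + 1))) / real n"
  by (simp add: sum_divide_distrib)
 also have "... <= 2 / (1 - r) ^ 3 / real n" using r by (intro divide_right_mono sum_power_square_le) auto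
 also have "... <= 2 / (1 - r) ^ 4 / real n" using r by (intro divide_right_mono divide_left_mono power_decreasing) auto
 finally show "(SUM l<=d. r ^ l * (real l * (real l + 1) / real n)) <= 2 / (1 - r) ^ 4 / real n" .
qed
finally show ?thesis .
qed

lemma measurable_anorm:
assumes "!!l m. m < n ==> (%x. F x m $ l) : bmeas M"
shows "(%x. anorm r d n (F x)) : bmeas M" unfolding anorm_def
by (intro measurable_compose[OF _ borel_measurable_sqrt] borel_measurable_sum borel_measurable_times borel_measurable_const measurable_sqnorm assms)

lemma measurable_cut_row:
assumes S: "S <= {..<n}"
shows "(%x. cut_row r d L n S x i k m) : bmeas MX"
proof -
have rp: "(%x. rpow n S x i k m) : bmeas MX" using measurable_series(5)[OF S, of i m k] by (simp add: resv_def)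
show ?thesis unfolding cut_row_def cut_weight_def
 by (intro borel_measurable_times measurable_compose[OF _ borel_measurable_of_real] measurable_compose[OF _ measurable_cutoff] borel_measurable_divide
   borel_measurable_const measurable_tnorm measurable_anorm measurable_series S rp)
qed

text \<open>Coefficient k is read off from norms with weight r^k, which costs r^(-2 k) in the
  square; the factor 1/n comes from the removal of a single row.\<close>

lemma cut_row_diff_mom:
assumes r: "0 < r" "r < 1" and S: "S <= {..<n}" and i: "i ~: S" "i < n" and j: "j : S" and k: "k <= d" and L: "L >= 1"
shows "(NE x. sqnorm n (%m. cut_row r d L n S x i k m - cut_row r d L n (S - {j}) x i k m)) <=
 ennreal (cut_const r L / r ^ (2 * k) / real n)"
proof -
define C where "C = 2 * (46 * L ^ 3)^2 / r ^ (2 * k)"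
have C: "C >= 0" using r by (simp add: C_def)
let ?e = "%x. tnorm r d (chs n S x - chs n (S - {j}) x)"
let ?f = "%x. anorm r d n (%m. adj n S x i m - adj n (S - {j}) x i m)"
have me: "(%x. ennreal ((?e x)^2)) : bmeas MX"
proof (rule measurable_compose[where g = "%t. ennreal (t^2)"])
 show "?e : bmeas MX" by (rule measurable_tnorm) (unfold fps_sub_nth, intro borel_measurable_diff measurable_series, use S in auto)
qed simp
have mf: "(%x. ennreal ((?f x)^2)) : bmeas MX"
proof (rule measurable_compose[where g = "%t. ennreal (t^2)"])
 show "?f : bmeas MX" by (rule measurable_anorm) (unfold fps_sub_nth, intro borel_measurable_diff measurable_series, use S in auto)
qed simp
have pw: "sqnorm n (%m. cut_row r d L n S x i k m - cut_row r d L n (S - {j}) x i k m) <= C * (?e x)^2 + C * (?f x)^2" for x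
proof -
 define v where "v = vnorm n (%m. cut_row r d L n S x i k m - cut_row r d L n (S - {j}) x i k m)"
 have "(r ^ k * v)^2 <= (46 * L ^ 3 * (?e x + ?f x))^2" unfolding v_def using r by (intro power_mono vnorm_cut_row_diff_le k L) auto
 also have "... = (46 * L ^ 3)^2 * (?e x + ?f x)^2" by (rule power_mult_distrib)
 also have "... <= (46 * L ^ 3)^2 * (2 * (?e x)^2 + 2 * (?f x)^2)"
  using zero_le_power2[of "?e x - ?f x"] by (intro mult_left_mono) (auto simp: power2_eq_square algebra_simps)
 finally have "r ^ (2 * k) * v^2 <= (46 * L ^ 3)^2 * (2 * (?e x)^2 + 2 * (?f x)^2)"
  by (simp add: power_mult_distrib power_mult[symmetric] mult.commute)
 hence "v^2 <= (46 * L ^ 3)^2 * (2 * (?e x)^2 + 2 * (?f x)^2) / r ^ (2 * k)" using r by (simp add: pos_le_divide_eq mult.commute)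
 also have "... = C * (?e x)^2 + C * (?f x)^2" by (simp add: C_def add_divide_distrib distrib_left)
 finally show ?thesis by (simp add: v_def)
qed
let ?a = "2 / (1 - r) ^ 4 / real n"
let ?b = "ennreal C"
have "(NE x. sqnorm n (%m. cut_row r d L n S x i k m - cut_row r d L n (S - {j}) x i k m)) <=
 (\<integral>\<^sup>+x. ?b * ennreal ((?e x)^2) + ?b * ennreal ((?f x)^2) \<partial>MX)"
proof (rule nn_integral_mono)
 fix x
 have "?b * ennreal ((?e x)^2) + ?b * ennreal ((?f x)^2) = ennreal (C * (?e x)^2 + C * (?f x)^2)"
  using C by (simp add: ennreal_mult ennreal_plus)
 thus "ennreal (sqnorm n (%m. cut_row r d L n S x i k m - cut_row r d L n (S - {j}) x i k m)) <=
  ?b * ennreal ((?e x)^2) + ?b * ennreal ((?f x)^2)" using ennreal_leI[OF pw[of x]] by simp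
qed
also have "... = ?b * (NE x. (?e x)^2) + ?b * (NE x. (?f x)^2)"
 using me mf by (subst nn_integral_add) (auto simp: nn_integral_cmult)
also have "... <= ?b * ennreal ?a + ?b * ennreal ?a"
 by (intro add_mono mult_left_mono char_diff_norm_mom adj_diff_norm_mom r S i j) auto
also have "... = ennreal (C * ?a + C * ?a)"
proof -
 have "?b * ennreal c + ?b * ennreal c = ennreal (C * c + C * c)" if "c >= 0" for c
  using C that by (simp add: ennreal_mult[symmetric] ennreal_plus[symmetric] del: ennreal_plus)
 from this[of "2 / (1 - r) ^ 4 / real n"] show ?thesis by simp
qed
also have "C * ?a + C * ?a = cut_const r L / r ^ (2 * k) / real n"
 by (simp add: C_def cut_const_def)
finally show ?thesis .
qed

context
fixes j :: nat and g :: "entries => (nat => complex) => real" and B :: real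
assumes j: "j < n" and g: "case_prod g : bmeas (MX \<Otimes>\<^sub>M RW)"
 and bound: "!!x y. \<bar>g x y\<bar> <= B" and inv: "!!x y. g (x(j := y)) = g x"
begin

lemma row_measurable: "x : space MX ==> g x : bmeas RW" using measurable_compose[OF measurable_Pair1' g] by simp

lemma row_integrable: "x : space MX ==> integrable RW (g x)"
proof -
assume x: "x : space MX"
show ?thesis by (rule R.integrable_const_bound[where B = B]) (use row_measurable[OF x] bound in auto)
qed

lemma measurable_row_diag: "(%x. g x (x j)) : bmeas MX"
proof -
have "(%x. (x, x j)) : measurable MX (MX \<Otimes>\<^sub>M RW)" by (intro measurable_Pair measurable_ident_sets[OF refl] measurable_row j)
from measurable_compose[OF this g] show ?thesis by simp
qed

lemma measurable_row_mean: "(%x. (LINT y|RW. g x y)) : bmeas MX"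
proof -
show ?thesis by (rule R.borel_measurable_lebesgue_integral[OF g])
qed

lemma row_mean_bound: "\<bar>(LINT y|RW. g x y)\<bar> <= B"
proof (cases "integrable RW (g x)")
case True
have "\<bar>(LINT y|RW. g x y)\<bar> <= (LINT y|RW. \<bar>g x y\<bar>)" by (rule integral_abs_bound)
also have "... <= (LINT y|RW. B)" using True bound by (intro integral_mono) auto
finally show ?thesis by (simp add: R.prob_space)
next
case False
thus ?thesis using bound[of x undefined] by (simp add: not_integrable_integral_eq)
qed

definition centred where "centred x = g x (x j) - (LINT y|RW. g x y)"

lemma measurable_centred: "centred : bmeas MX"
unfolding centred_def[abs_def] by (intro borel_measurable_diff measurable_row_diag measurable_row_mean)

lemma centred_bound: "\<bar>centred x\<bar> <= 2 * B" unfolding centred_def using bound[of x "x j"] row_mean_bound[of x] by linarith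

lemma integral_resample:
fixes F :: "_ => real"
assumes "integrable MX F"
shows "(LINT x|MX. F x) = (LINT x|MX. (LINT y|RW. F (x(j := y))))"
using assms prob_row j unfolding matrix_law_def by (intro integral_PiM_resample) auto

text \<open>Resampling row \<open>j\<close> leaves \<open>G\<close> alone and averages
  \<open>centred\<close> to zero.\<close>

lemma integral_centred_mult:
assumes G: "G : bmeas MX" "!!x. \<bar>G x\<bar> <= C" and Ginv: "!!x y. G (x(j := y)) = G x"
shows "(LINT x|MX. centred x * G x) = 0"
proof -
have i: "integrable MX (%x. centred x * G x)"
proof (rule P.integrable_const_bound[where B = "2 * B * C"])
 have "\<bar>centred x * G x\<bar> <= 2 * B * C" for x
  unfolding abs_mult by (intro mult_mono centred_bound G(2) abs_ge_zero order.trans[OF abs_ge_zero centred_bound])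
 thus "AE x in MX. norm (centred x * G x) <= 2 * B * C" by simp
qed (intro borel_measurable_times measurable_centred G)
have "(LINT x|MX. centred x * G x) = (LINT x|MX. (LINT y|RW. (g x y - (LINT y|RW. g x y)) * G x))"
 by (subst integral_resample[OF i]) (simp add: centred_def inv Ginv)
also have "... = (LINT x|MX. 0)" by (rule Bochner_Integration.integral_cong[OF refl]) (simp add: row_integrable R.prob_space)
finally show ?thesis by simp
qed

lemma integral_centred_sq_le: "(LINT x|MX. (centred x)^2) <= (LINT x|MX. (g x (x j))^2)"
proof -
let ?m = "%x. (LINT y|RW. g x y)"
have m_inv: "?m (x(j := y)) = ?m x" for x y by (simp add: inv)
have i1: "integrable MX (%x. (centred x)^2)"
proof (rule P.integrable_const_bound[where B = "(2 * B)^2"])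
 show "AE x in MX. norm ((centred x)^2) <= (2 * B)^2" using power_mono[OF centred_bound abs_ge_zero, of _ 2] by simp
qed (intro borel_measurable_power measurable_centred)
have i2: "integrable MX (%x. (g x (x j))^2)"
proof (rule P.integrable_const_bound[where B = "B^2"])
 show "AE x in MX. norm ((g x (x j))^2) <= B^2" using power_mono[OF bound abs_ge_zero, of _ _ 2] by simp
qed (intro borel_measurable_power measurable_row_diag)
have i3: "integrable MX (%x. centred x * ?m x)"
proof (rule P.integrable_const_bound[where B = "2 * B * B"])
 have "\<bar>centred x * ?m x\<bar> <= 2 * B * B" for x
  unfolding abs_mult by (intro mult_mono centred_bound row_mean_bound abs_ge_zero order.trans[OF abs_ge_zero centred_bound])
 thus "AE x in MX. norm (centred x * ?m x) <= 2 * B * B" by simp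
qed (intro borel_measurable_times measurable_centred measurable_row_mean)
have "(centred x)^2 <= (g x (x j))^2 - 2 * (centred x * ?m x)" for x unfolding centred_def by (simp add: power2_eq_square algebra_simps)
hence "(LINT x|MX. (centred x)^2) <= (LINT x|MX. (g x (x j))^2 - 2 * (centred x * ?m x))" using i1 i2 i3 by (intro integral_mono) auto
also have "... = (LINT x|MX. (g x (x j))^2) - 2 * (LINT x|MX. centred x * ?m x)" using i2 i3 by simp
also have "(LINT x|MX. centred x * ?m x) = 0" by (rule integral_centred_mult[OF measurable_row_mean row_mean_bound m_inv])
finally show ?thesis by simp
qed

end

text \<open>A bound of Efron-Stein type. The summands for rows j and j' are not orthogonal, because
  the vector used for row j still contains row j'. Removing row j' as well restores orthogonality
  and costs b Cd / n per pair; with Cd of order 1/n the n^2 pairs contribute no more than the order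
  of the diagonal.\<close>

lemma variance_sum_centred:
fixes V :: "nat set => entries => nat => complex"
assumes R: "R <= {..<n}" and b: "b > 0"
 and V: "!!S m. S <= R ==> m < n ==> (%x. V S x m) : bmeas MX"
 and inv: "!!S j x y. S <= R ==> j ~: S ==> V S (x(j := y)) = V S x"
 and Cv: "!!j. j : R ==> (NE x. sqnorm n (V (R - {j}) x)) <= ennreal Cv" "Cv >= 0"
 and Cd: "!!j j'. j : R ==> j' : R ==> j ~= j' ==> (NE x. sqnorm n (%m. V (R - {j}) x m - V (R - {j} - {j'}) x m)) <= ennreal Cd" "Cd >= 0"
defines "D \<equiv> (%j x. soft_sq b (SUM m<n. x j m * V (R - {j}) x m) - (LINT y|RW. soft_sq b (SUM m<n. y m * V (R - {j}) x m)))"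
shows "(%x. SUM j:R. D j x) : bmeas MX"
 and "(LINT x|MX. (SUM j:R. D j x)^2) <= b * (Cv + real n * Cd)"
proof -
define f where "f S x y = soft_sq b (SUM m<n. y m * V S x m)" for S x y
have fb: "0 <= f S x y" "f S x y <= b" for S x y unfolding f_def using b by (auto intro: soft_sq_nonneg soft_sq_le)
have fabs: "\<bar>f S x y\<bar> <= b" for S x y using fb[of S x y] by simp
have fd: "\<bar>f S x y - f S' x y\<bar> <= b" for S S' x y using fb[of S x y] fb[of S' x y] by linarith
have fm: "case_prod (f S) : bmeas (MX \<Otimes>\<^sub>M RW)" if "S <= R" for S
proof -
 have "(%p. SUM m<n. snd p m * V S (fst p) m) : bmeas (MX \<Otimes>\<^sub>M RW)"
  by (intro borel_measurable_sum borel_measurable_times measurable_compose[OF measurable_snd measurable_row_component]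
    measurable_compose[OF measurable_fst V] that) auto
 moreover have "case_prod (f S) = (%p. soft_sq b (SUM m<n. snd p m * V S (fst p) m))" by (rule ext) (simp only: f_def case_prod_beta)
 ultimately show ?thesis using measurable_compose[OF _ measurable_soft_sq] by (simp only:)
qed
have finv: "f S (x(j := y)) = f S x" if "S <= R" "j ~: S" for S j x y unfolding f_def using inv[OF that] by simp
have fmd: "case_prod (%x y. f S x y - f S' x y) : bmeas (MX \<Otimes>\<^sub>M RW)" if "S <= R" "S' <= R" for S S'
 using borel_measurable_diff[OF fm[OF that(1)] fm[OF that(2)]] by (simp add: split_beta')
have finvd: "(%z. f S (x(j := y)) z - f S' (x(j := y)) z) = (%z. f S x z - f S' x z)"
 if "S <= R" "S' <= R" "j ~: S" "j ~: S'" for S S' j x y by (simp add: finv that)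
define E where "E j S = centred j (f S)" for j S
have Rn: "j < n" if "j : R" for j using R that by auto
have sub: "R - {j} <= R" "R - {j} - {j'} <= R" for j j' by auto
have DE: "D j = E j (R - {j})" if "j : R" for j
proof (rule ext)
 fix x
 have nj: "j ~: R - {j}" by simp
 show "D j x = E j (R - {j}) x"
  unfolding E_def centred_def[OF Rn[OF that] fm[OF sub(1)] fabs finv[OF sub(1) nj]] D_def f_def by (rule refl)
qed
have Em: "E j S : bmeas MX" if "j : R" "S <= R" "j ~: S" for j S
 unfolding E_def by (rule measurable_centred[OF Rn[OF that(1)] fm[OF that(2)] fabs finv[OF that(2,3)]])
have Eb: "\<bar>E j S x\<bar> <= 2 * b" if "j : R" "S <= R" "j ~: S" for j S x
 unfolding E_def by (rule centred_bound[OF Rn[OF that(1)] fm[OF that(2)] fabs finv[OF that(2,3)]])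
have Einv: "E j S (x(j' := y)) = E j S x" if "j : R" "S <= R" "j ~: S" "j' ~: S" "j' ~= j" for j S x j' y
 unfolding E_def centred_def[OF Rn[OF that(1)] fm[OF that(2)] fabs finv[OF that(2,3)]] using that by (simp add: finv)
show "(%x. SUM j:R. D j x) : bmeas MX" by (intro borel_measurable_sum) (simp add: DE Em)
have Ei: "integrable MX (%x. E j S x * E j' S' x)" if "j : R" "S <= R" "j ~: S" "j' : R" "S' <= R" "j' ~: S'" for j S j' S'
proof (rule P.integrable_const_bound[where B = "2 * b * (2 * b)"])
 have "\<bar>E j S x * E j' S' x\<bar> <= 2 * b * (2 * b)" for x unfolding abs_mult using b by (intro mult_mono Eb that) auto
 thus "AE x in MX. norm (E j S x * E j' S' x) <= 2 * b * (2 * b)" by simp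
qed (intro borel_measurable_times Em that)
have E0: "(LINT x|MX. E j S x * E j' S' x) = 0"
 if "j : R" "S <= R" "j ~: S" "j' : R" "S' <= R" "j' ~: S'" "j ~: S'" "j ~= j'" for j S j' S' unfolding E_def[of j S]
 by (rule integral_centred_mult[OF Rn[OF that(1)] fm[OF that(2)] fabs finv[OF that(2,3)] Em[OF that(4-6)] Eb[OF that(4-6)] Einv[OF that(4-7)]])
   (use that in auto)
have row: "(LINT x|MX. (h x (x j))^2) <= b * (C / real n)"
 if jR: "j : R" and U: "!!m. m < n ==> (%x. U x m) : bmeas MX" and Ui: "!!x y. U (x(j := y)) = U x"
  and h: "!!x. (h x (x j))^2 <= b * (cmod (SUM m<n. x j m * U x m))^2"
  and UC: "(NE x. sqnorm n (U x)) <= ennreal C" "C >= 0" for j h U C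
proof (rule integral_real_bounded)
 have m: "(%x. ennreal ((cmod (SUM m<n. x j m * U x m))^2)) : bmeas MX"
 proof (rule measurable_compose[where g = "%u. ennreal ((cmod u)^2)"])
  show "(%x. SUM m<n. x j m * U x m) : bmeas MX"
   by (intro borel_measurable_sum borel_measurable_times measurable_entry[OF Rn[OF jR]] U) auto
 qed simp
 have "(NE x. (h x (x j))^2) <= (\<integral>\<^sup>+x. ennreal b * ennreal ((cmod (SUM m<n. x j m * U x m))^2) \<partial>MX)"
  using ennreal_leI[OF h] b by (intro nn_integral_mono) (simp add: ennreal_mult)
 also have "... = ennreal b * (NE x. (cmod (SUM m<n. x j m * U x m))^2)" by (rule nn_integral_cmult[OF m])
 also have "(NE x. (cmod (SUM m<n. x j m * U x m))^2) = ennreal (1 / real n) * (NE x. sqnorm n (U x))"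
  by (rule nn_integral_row_form_exposed[OF Rn[OF jR] U Ui])
 also have "ennreal b * (ennreal (1 / real n) * (NE x. sqnorm n (U x))) <=
  ennreal b * (ennreal (1 / real n) * ennreal C)" by (intro mult_left_mono UC) auto
 also have "... = ennreal (b * (C / real n))" using b UC(2) by (simp add: ennreal_mult[symmetric])
 finally show "(NE x. (h x (x j))^2) <= ennreal (b * (C / real n))" .
qed (use b UC in auto)
have diag: "(LINT x|MX. E j (R - {j}) x * E j (R - {j}) x) <= b * (Cv / real n)" if j: "j : R" for j
proof -
 have nj: "j ~: R - {j}" by simp
 have "(LINT x|MX. (E j (R - {j}) x)^2) <= (LINT x|MX. (f (R - {j}) x (x j))^2)"
  unfolding E_def by (rule integral_centred_sq_le[OF Rn[OF j] fm[OF sub(1)] fabs finv[OF sub(1) nj]])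
 also have "... <= b * (Cv / real n)"
 proof (rule row[OF j V[OF sub(1)] inv[OF sub(1) nj] _ Cv(1)[OF j] Cv(2)])
  fix x
  have "(f (R - {j}) x (x j))^2 <= f (R - {j}) x (x j) * b" unfolding power2_eq_square by (intro mult_left_mono fb)
  also have "... <= (cmod (SUM m<n. x j m * V (R - {j}) x m))^2 * b" unfolding f_def using b by (intro mult_right_mono soft_sq_le_sq) auto
  finally show "(f (R - {j}) x (x j))^2 <= b * (cmod (SUM m<n. x j m * V (R - {j}) x m))^2" by (simp add: mult.commute)
 qed
 finally show ?thesis by (simp add: power2_eq_square)
qed
have diff: "(LINT x|MX. (E j (R - {j}) x - E j (R - {j} - {j'}) x)^2) <= b * (Cd / real n)" if j: "j : R" "j' : R" "j ~= j'" for j j'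
proof -
 let ?g = "%x y. f (R - {j}) x y - f (R - {j} - {j'}) x y"
 have nj: "j ~: R - {j}" "j ~: R - {j} - {j'}" by auto
 note c = Rn[OF j(1)] fmd[OF sub, of j j j'] fd finvd[OF sub nj]
 have eq: "E j (R - {j}) x - E j (R - {j} - {j'}) x = centred j ?g x" if x: "x : space MX" for x
  unfolding E_def centred_def[OF Rn[OF j(1)] fm[OF sub(1)] fabs finv[OF sub(1) nj(1)]]
   centred_def[OF Rn[OF j(1)] fm[OF sub(2)] fabs finv[OF sub(2) nj(2)]] centred_def[OF c]
  using row_integrable[OF Rn[OF j(1)] fm[OF sub(1)] fabs finv[OF sub(1) nj(1)] x]
   row_integrable[OF Rn[OF j(1)] fm[OF sub(2)] fabs finv[OF sub(2) nj(2)] x] by simp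
 have "(LINT x|MX. (E j (R - {j}) x - E j (R - {j} - {j'}) x)^2) = (LINT x|MX. (centred j ?g x)^2)"
  by (rule Bochner_Integration.integral_cong[OF refl]) (simp add: eq)
 also have "... <= (LINT x|MX. (?g x (x j))^2)" by (rule integral_centred_sq_le[OF c])
 also have "... <= b * (Cd / real n)"
 proof (rule row[OF j(1) _ _ _ Cd(1)[OF j] Cd(2)])
  show "(%x. V (R - {j}) x m - V (R - {j} - {j'}) x m) : bmeas MX" if "m < n" for m by (intro borel_measurable_diff V sub that)
  show "(%m. V (R - {j}) (x(j := y)) m - V (R - {j} - {j'}) (x(j := y)) m) = (%m. V (R - {j}) x m - V (R - {j} - {j'}) x m)" for x y
   using inv[OF sub(1) nj(1)] inv[OF sub(2) nj(2)] by simp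
  fix x
  have "(SUM m<n. x j m * V (R - {j}) x m) - (SUM m<n. x j m * V (R - {j} - {j'}) x m) =
   (SUM m<n. x j m * (V (R - {j}) x m - V (R - {j} - {j'}) x m))" by (simp add: right_diff_distrib sum_subtractf)
  thus "(?g x (x j))^2 <= b * (cmod (SUM m<n. x j m * (V (R - {j}) x m - V (R - {j} - {j'}) x m)))^2"
   unfolding f_def using soft_sq_lipschitz[OF b, of "SUM m<n. x j m * V (R - {j}) x m" "SUM m<n. x j m * V (R - {j} - {j'}) x m"] by simp
 qed
 finally show ?thesis .
qed
have off: "(LINT x|MX. E j (R - {j}) x * E j' (R - {j'}) x) <= b * (Cd / real n)" if j: "j : R" "j' : R" "j ~= j'" for j j'
proof -
 have half: "1/2 * t + 1/2 * t = t" for t :: real by simp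
 let ?S = "R - {j} - {j'}"
 have S': "R - {j'} - {j} = ?S" by auto
 define a a' e e' where "a = E j (R - {j})" and "a' = E j' (R - {j'})" and "e = E j ?S" and "e' = E j' ?S"
 have nj: "j ~: R - {j}" "j ~: ?S" "j' ~: R - {j'}" "j' ~: ?S" by auto
 define F where "F = {u. \<exists>p S. p : R & S <= R & p ~: S & u = E p S}"
 have i: "integrable MX (%x. u x * v x)" if "u : F" "v : F" for u v
 proof -
  from that(1) obtain p S where 1: "p : R" "S <= R" "p ~: S" "u = E p S" unfolding F_def by auto
  from that(2) obtain q T where 2: "q : R" "T <= R" "q ~: T" "v = E q T" unfolding F_def by auto
  show ?thesis unfolding 1(4) 2(4) by (rule Ei[OF 1(1-3) 2(1-3)])
 qed
 have FI: "E p S : F" if "p : R" "S <= R" "p ~: S" for p S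
  unfolding F_def mem_Collect_eq using that by (intro exI conjI) (assumption | rule refl)+
 have F: "a : F" "a' : F" "e : F" "e' : F" unfolding a_def a'_def e_def e'_def
  by (rule FI[OF j(1) sub(1) nj(1)], rule FI[OF j(2) sub(1) nj(3)], rule FI[OF j(1) sub(2) nj(2)], rule FI[OF j(2) sub(2) nj(4)])
 have z: "(LINT x|MX. a x * e' x) = 0" "(LINT x|MX. a' x * e x) = 0" "(LINT x|MX. e x * e' x) = 0" unfolding a_def a'_def e_def e'_def
  by (rule E0[OF j(1) sub(1) nj(1) j(2) sub(2) nj(4) nj(2) j(3)], rule E0[OF j(2) sub(1) nj(3) j(1) sub(2) nj(2) nj(4) j(3)[symmetric]],
   rule E0[OF j(1) sub(2) nj(2) j(2) sub(2) nj(4) nj(2) j(3)])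
 \<comment> \<open>In each of the last three products one factor is centred in a row that the other
   factor does not contain.\<close>
 have eq: "a x * a' x = (a x - e x) * (a' x - e' x) + a x * e' x + a' x * e x - e x * e' x" for x by (simp add: algebra_simps)
 have le: "(a x - e x) * (a' x - e' x) <= (1/2) * (a x - e x)^2 + (1/2) * (a' x - e' x)^2" for x
  using zero_le_power2[of "(a x - e x) - (a' x - e' x)"] by (simp add: power2_eq_square algebra_simps)
 have pw: "a x * a' x <= (1/2) * (a x - e x)^2 + (1/2) * (a' x - e' x)^2 + a x * e' x + a' x * e x - e x * e' x" for x
  by (subst eq) (use le[of x] in linarith)
 have isq: "integrable MX (%x. (a x - e x)^2)" "integrable MX (%x. (a' x - e' x)^2)"
  unfolding power2_eq_square left_diff_distrib right_diff_distrib by (intro Bochner_Integration.integrable_diff i F)+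
 note ints = isq i[OF F(1) F(4)] i[OF F(2) F(3)] i[OF F(3) F(4)]
 have "(LINT x|MX. a x * a' x) <= (LINT x|MX. (1/2) * (a x - e x)^2 + (1/2) * (a' x - e' x)^2 + a x * e' x + a' x * e x - e x * e' x)"
 proof (rule integral_mono[OF i[OF F(1,2)] _ pw])
  show "integrable MX (%x. (1/2) * (a x - e x)^2 + (1/2) * (a' x - e' x)^2 + a x * e' x + a' x * e x - e x * e' x)"
   by (intro Bochner_Integration.integrable_diff Bochner_Integration.integrable_add integrable_mult_right ints)
 qed
 also have "... = (1/2) * (LINT x|MX. (a x - e x)^2) + (1/2) * (LINT x|MX. (a' x - e' x)^2)" using ints by (simp add: z)
 also have "... <= (1/2) * (b * (Cd / real n)) + (1/2) * (b * (Cd / real n))" unfolding a_def a'_def e_def e'_def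
  using diff[OF j] diff[OF j(2,1)] j unfolding S' by (intro add_mono mult_left_mono) auto
 finally show ?thesis unfolding a_def a'_def half .
qed
have fin: "finite R" using R finite_subset by blast
have card: "real (card R) <= real n" using card_mono[OF _ R] by simp
have "(LINT x|MX. (SUM j:R. D j x)^2) = (LINT x|MX. (SUM j:R. SUM j':R. E j (R - {j}) x * E j' (R - {j'}) x))"
 unfolding power2_eq_square sum_product by (intro Bochner_Integration.integral_cong refl sum.cong) (simp add: DE)
also have "... = (SUM j:R. SUM j':R. (LINT x|MX. E j (R - {j}) x * E j' (R - {j'}) x))"
 by (subst Bochner_Integration.integral_sum, intro Bochner_Integration.integrable_sum Ei, auto)
   (intro sum.cong refl Bochner_Integration.integral_sum Ei, auto)
also have "... <= (SUM j:R. SUM j':R. (if j = j' then b * (Cv / real n) else 0) + b * (Cd / real n))"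
proof (intro sum_mono)
 fix j j' assume "j : R" "j' : R"
 moreover have "0 <= b * (Cd / real n)" using b Cd(2) by simp
 ultimately show "(LINT x|MX. E j (R - {j}) x * E j' (R - {j'}) x) <= (if j = j' then b * (Cv / real n) else 0) + b * (Cd / real n)"
  using diag[of j] off[of j j'] by auto
qed
also have "... = real (card R) * (b * (Cv / real n)) + real (card R) * (real (card R) * (b * (Cd / real n)))"
 using fin by (simp add: sum.distrib distrib_left)
also have "... <= real n * (b * (Cv / real n)) + real n * (real n * (b * (Cd / real n)))"
 using card b Cv(2) Cd(2) by (intro add_mono mult_mono mult_right_mono) auto
also have "... = b * (Cv + real n * Cd)" using n_pos by (simp add: algebra_simps)
finally show "(LINT x|MX. (SUM j:R. D j x)^2) <= b * (Cv + real n * Cd)" .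
qed

end

lemma integral_soft_sq_bounds:
assumes "prob_space M" "b > 0"
shows "0 <= (LINT y|M. soft_sq b (f y))" "(LINT y|M. soft_sq b (f y)) <= b"
proof -
interpret prob_space M by fact
show "0 <= (LINT y|M. soft_sq b (f y))" using assms by (intro Bochner_Integration.integral_nonneg soft_sq_nonneg)
show "(LINT y|M. soft_sq b (f y)) <= b"
proof (cases "integrable M (%y. soft_sq b (f y))")
 case True
 hence "(LINT y|M. soft_sq b (f y)) <= (LINT y|M. b)" using assms by (intro integral_mono soft_sq_le) auto
 thus ?thesis by (simp add: prob_space)
qed (use assms in \<open>simp add: not_integrable_integral_eq\<close>)
qed

text \<open>To be compared with \<open>row_form_rpow\<close> for R without \<open>j\<close>: both
  are coefficients of an inverse of Q times the same row form, so only the inverses for R and for R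
  without \<open>j\<close> differ.\<close>

lemma rpow_Suc_row:
assumes "j : R" "j < n" "i ~= j"
shows "rpow n R x i (Suc k) j = (ichs n R x * lin_form n (x j) (adj n (R - {j}) x i)) $ k"
proof -
have eq: "ichs n R x * adj n R x i j = fps_X * (ichs n R x * lin_form n (x j) (adj n (R - {j}) x i))"
 unfolding adj_row[OF assms] by (simp only: mult_ac)
show ?thesis unfolding rpow_eq eq by simp
qed

lemma row_form_rpow: "(SUM m<n. a m * rpow n S x i k m) = (ichs n S x * lin_form n a (adj n S x i)) $ k"
unfolding lin_form_mult[symmetric] lin_form_nth rpow_eq by simp

lemma cut_row_eq_rpow:
assumes "L > 0" "tnorm r d (ichs n S x) <= L" "anorm r d n (adj n S x i) <= L"
shows "cut_row r d L n S x i k = rpow n S x i k" using assms by (intro ext) (simp add: cut_row_def cut_weight_def cutoff_eq_1)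

text \<open>Rows whose removal changes Q or column \<open>i\<close> noticeably. The threshold L/2
  for the column keeps its norm below L after the removal of any other row, so that the cutoff is
  inactive there.\<close>

abbreviation bad_rows :: "nat => real => nat => real => nat => nat set => entries => real => nat set" where
"bad_rows n r d L i R x t == {j : R. t < tnorm r d (chs n R x - chs n (R - {j}) x) |
 L / 2 < anorm r d n (%m. adj n R x i m - adj n (R - {j}) x i m)}"

context
fixes r L tau :: real and d n i :: nat and R :: "nat set" and x :: "entries"
assumes r: "0 < r" "r < 1" and L: "L >= 1" and R: "R <= {..<n}" "i ~: R" and tau: "tau >= 0" "tau * L <= 1"
 and G: "tnorm r d (ichs n R x) <= L / 2" "anorm r d n (adj n R x i) <= L / 2"
begin

text \<open>Both terms are coefficient k of an inverse of Q times \<open>h\<close>, and the inverses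
  differ by order tau L^2. The series \<open>h\<close> is bounded by entry \<open>j\<close> of the
  column over R, so the errors can be summed over j.\<close>

lemma step_row_error:
assumes j: "j : R" and k: "Suc k <= d"
 and good: "tnorm r d (chs n R x - chs n (R - {j}) x) <= tau" "anorm r d n (%m. adj n R x i m - adj n (R - {j}) x i m) <= L / 2"
shows "(cmod ((SUM m<n. x j m * cut_row r d L n (R - {j}) x i k m) - rpow n R x i (Suc k) j))^2 <=
 tau^2 * L ^ 4 / (4 * (1 - r) * r ^ (2 * Suc k)) * (SUM l<=d. r ^ l * (cmod (adj n R x i j $ l))^2)"
proof -
let ?S = "R - {j}"
define b b' q q' where "b = ichs n R x" and "b' = ichs n ?S x"
 and "q = chs n R x" and "q' = chs n ?S x"
define h where "h = lin_form n (x j) (adj n ?S x i)"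
have inv: "q * b = 1" "q' * b' = 1" by (simp_all add: q_def q'_def b_def b'_def)
have jn: "j < n" "i ~= j" using j R by auto
have r0: "r >= 0" using r by simp
have e: "tnorm r d (q' - q) <= tau" using good(1) by (subst tnorm_diff_commute) (simp add: q_def q'_def)
have b'L: "tnorm r d b' <= L"
proof -
 have "q' * b - 1 = (q' - q) * b" using inv by (simp add: algebra_simps)
 hence "tnorm r d (q' * b - 1) <= tnorm r d (q' - q) * tnorm r d b" using tnorm_mult[OF r0, of d "q' - q" b] by simp
 also have "... <= tau * (L / 2)" using e G tau r0 by (intro mult_mono) (auto simp: b_def)
 also have "... <= 1 / 2" using tau by simp
 finally have "tnorm r d b' <= 2 * tnorm r d b" by (rule tnorm_inverse_le[OF r0 inv(2)])
 thus ?thesis using G by (simp add: b_def)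
qed
have "anorm r d n (adj n ?S x i) <= L" using anorm_triangle_sub[OF r0, of d n "adj n ?S x i" "adj n R x i"] good(2) G(2)
  anorm_minus_commute[of r d n "adj n ?S x i" "adj n R x i"] by linarith
hence cut: "cut_row r d L n ?S x i k = rpow n ?S x i k" using b'L L by (intro cut_row_eq_rpow) (auto simp: b'_def)
have diff: "(SUM m<n. x j m * cut_row r d L n ?S x i k m) - rpow n R x i (Suc k) j = ((b' - b) * h) $ k"
 unfolding cut row_form_rpow rpow_Suc_row[OF j jn] by (simp add: b_def b'_def h_def left_diff_distrib)
have bb: "tnorm r d (b' - b) <= tau * L^2 / 2"
proof -
 have "b' - b = b' * (q * b) - (q' * b') * b" using inv by simp
 also have "... = b' * ((q - q') * b)" by (simp add: algebra_simps)
 finally have "tnorm r d (b' - b) <= tnorm r d b' * tnorm r d ((q - q') * b)" using tnorm_mult[OF r0] by simp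
 also have "... <= L * (tau * (L / 2))"
  using b'L L tau r0 e G by (intro mult_mono order.trans[OF tnorm_mult[OF r0]]) (auto simp: tnorm_diff_commute b_def)
 finally show ?thesis by (simp add: power2_eq_square mult_ac)
qed
have hh: "r * tnorm r k h <= tnorm r d (adj n R x i j)"
proof -
 have "adj n R x i j = fps_X * h" unfolding h_def by (rule adj_row[OF j jn])
 hence "tnorm r (Suc k) (adj n R x i j) = r * tnorm r k h"
  unfolding tnorm_def by (subst sum.atMost_Suc_shift) (simp add: sum_distrib_left mult_ac)
 thus ?thesis using tnorm_mono[OF r0 k, of "adj n R x i j"] by linarith
qed
let ?a = "cmod (((b' - b) * h) $ k)"
let ?b = "(1 / (1 - r)) * (SUM l<=d. r ^ l * (cmod (adj n R x i j $ l))^2)"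
have "r ^ Suc k * ?a = r * (?a * r ^ k)" by simp
also have "... <= r * (tnorm r k (b' - b) * tnorm r k h)"
 using r0 by (intro mult_left_mono order.trans[OF tnorm_nth[OF r0 order.refl] tnorm_mult[OF r0]])
also have "... = tnorm r k (b' - b) * (r * tnorm r k h)" by simp
also have "... <= (tau * L^2 / 2) * tnorm r d (adj n R x i j)"
proof (intro mult_mono hh)
 show "tnorm r k (b' - b) <= tau * L^2 / 2" using tnorm_mono[OF r0, of k d "b' - b"] k bb by simp
qed (use r0 tau in auto)
finally have "(r ^ Suc k * ?a)^2 <= ((tau * L^2 / 2) * tnorm r d (adj n R x i j))^2"
 using r0 by (intro power_mono) auto
also have "... = tau^2 * L ^ 4 / 4 * (tnorm r d (adj n R x i j))^2" by (simp add: power_mult_distrib power_divide flip: power_mult)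
also have "... <= tau^2 * L ^ 4 / 4 * ?b"
 using r by (intro mult_left_mono tnorm_sq_le) auto
finally have "r ^ (2 * Suc k) * ?a^2 <=
 tau^2 * L ^ 4 / 4 * ?b"
proof -
 have "(r ^ Suc k)^2 = r ^ (2 * Suc k)" by (simp only: power_mult[symmetric] mult.commute)
 hence "(r ^ Suc k * t)^2 = r ^ (2 * Suc k) * t^2" for t by (simp only: power_mult_distrib)
 thus "(r ^ Suc k * ?a)^2 <= z ==> r ^ (2 * Suc k) * ?a^2 <= z" for z by (simp only:)
qed
hence "?a^2 <=
 tau^2 * L ^ 4 / 4 * ?b / r ^ (2 * Suc k)"
 using r by (simp only: pos_le_divide_eq zero_less_power mult.commute)
thus ?thesis unfolding diff by simp
qed

text \<open>The losses in units of eta: 7/2 from the mean growth and the perturbation, 1 from the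
  number of rows, 1 from \<open>h1\<close>, 1 from \<open>h2\<close>, 1 from the bad rows, 1 from
  the errors on the good rows. The final division by 1 + eta leads to 12.\<close>

lemma step_lower_bound:
assumes k: "Suc k <= d" and b: "b > 0" "b' > 0" and eta: "0 < eta" "eta <= 1/12" and card: "(1 - eta) * real n <= real (card R)" and n: "n > 0"
 and start: "s <= snorm n b (rpow n R x i k)" "0 <= s" "s <= eta * b' * real n / 2"
 and E: "!!v. (1 - 3/2 * eta) * min ((1 - eta) * snorm n b v / real n) (eta * (b' / 2)) <= E v"
 and h1: "(SUM j:R. sqnorm n (%m. cut_row r d L n R x i k m - cut_row r d L n (R - {j}) x i k m)) <= eta^2 * real n * s / 2"
 and h2: "\<bar>SUM j:R. soft_sq b' (SUM m<n. x j m * cut_row r d L n (R - {j}) x i k m) - E (cut_row r d L n (R - {j}) x i k)\<bar> <= eta * s"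
 and h3: "real (card (bad_rows n r d L i R x tau)) * b' <= eta * s"
 and h4: "tau^2 * L ^ 6 / (16 * (1 - r) * r ^ (2 * Suc k)) <= eta^2 * s / 2"
shows "(1 - 12 * eta) * s <= snorm n b' (rpow n R x i (Suc k))"
proof -
have r0: "r >= 0" using r by simp
have fin: "finite R" using R finite_subset by blast
define V where "V j = cut_row r d L n (R - {j}) x i k" for j
define dl where "dl j = sqnorm n (%m. cut_row r d L n R x i k m - V j m)" for j
define X where "X j = (SUM m<n. x j m * V j m)" for j
define w where "w j = rpow n R x i (Suc k) j" for j
have w: "w = rpow n R x i (Suc k)" by (rule ext) (simp only: w_def)
define Bad where "Bad = bad_rows n r d L i R x tau"
have e1: "1 + 1 / eta <= 2 / eta" using eta by (simp add: field_simps)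
have cutR: "cut_row r d L n R x i k = rpow n R x i k" using G L by (intro cut_row_eq_rpow) auto
let ?a = "1 - 7/2 * eta"
have Elow: "(?a * s - 2 / eta * dl j) / real n <= E (V j)" for j
proof -
 have dl0: "dl j >= 0" by (simp add: dl_def)
 have "s <= (1 + eta) * snorm n b (V j) + (1 + 1 / eta) * dl j"
  using start(1) snorm_perturb[OF b(1) eta(1), of n "cut_row r d L n R x i k" "V j"] unfolding cutR dl_def by linarith
 also have "... <= (1 + eta) * snorm n b (V j) + 2 / eta * dl j" using e1 dl0 by (intro add_left_mono mult_right_mono) auto
 finally have "(1 - eta) * (s - 2 / eta * dl j) <= (1 - eta) * ((1 + eta) * snorm n b (V j))" using eta by (intro mult_left_mono) auto
 also have "... = (1 - eta^2) * snorm n b (V j)" by (simp add: power2_eq_square algebra_simps)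
 also have "... <= 1 * snorm n b (V j)" by (intro mult_right_mono snorm_nonneg b) auto
 finally have f1: "(1 - eta) * ((1 - eta) * (s - 2 / eta * dl j)) <= (1 - eta) * snorm n b (V j)" using eta by (intro mult_left_mono) auto
 define t where "t = (1 - eta) * ((1 - eta) * (s - 2 / eta * dl j)) / real n"
 have t1: "t <= (1 - eta) * snorm n b (V j) / real n" unfolding t_def by (intro divide_right_mono f1) auto
 have d0: "2 / eta * dl j >= 0" using eta dl0 by simp
 \<comment> \<open>The other branch of the minimum: the upper bound on s in \<open>start\<close>
   keeps the wanted growth below saturation.\<close>
 have t2: "t <= eta * (b' / 2)"
 proof -
  have "(1 - eta) * ((1 - eta) * (s - 2 / eta * dl j)) <= (1 - eta) * ((1 - eta) * s)" using eta d0 by (intro mult_left_mono) auto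
  also have "... <= 1 * (1 * s)" using eta start(2) by (intro mult_mono) auto
  also have "... <= eta * (b' / 2) * real n" using start(3) by simp
  finally show ?thesis unfolding t_def using n by (simp add: pos_divide_le_eq)
 qed
 have "(?a * s - 2 / eta * dl j) / real n <= (1 - 3/2 * eta) * t"
 proof -
  define c where "c = (1 - 3/2 * eta) * ((1 - eta) * (1 - eta))"
  have "(1 - 3/2 * eta) * ((1 - eta) * (1 - eta)) - ?a = eta^2 * (4 - 3/2 * eta)"
   by (simp add: power2_eq_square algebra_simps)
  moreover have "eta^2 * (4 - 3/2 * eta) >= 0" using eta by (intro mult_nonneg_nonneg) auto
  ultimately have c1: "1 - 7/2 * eta <= c" by (simp add: c_def)
  have c2: "c <= 1" unfolding c_def using eta by (intro mult_le_one mult_nonneg_nonneg) auto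
  have "?a * s - 2 / eta * dl j <= c * s - c * (2 / eta * dl j)"
   using mult_right_mono[OF c1 start(2)] mult_right_mono[OF c2 d0] by linarith
  also have "... = c * (s - 2 / eta * dl j)" by (simp add: right_diff_distrib)
  also have "... = (1 - 3/2 * eta) * ((1 - eta) * ((1 - eta) * (s - 2 / eta * dl j)))" by (simp add: c_def mult_ac)
  finally show ?thesis unfolding t_def times_divide_eq_right by (intro divide_right_mono) auto
 qed
 also have "... <= (1 - 3/2 * eta) * min ((1 - eta) * snorm n b (V j) / real n) (eta * (b' / 2))"
  using t1 t2 eta by (intro mult_left_mono) auto
 also have "... <= E (V j)" by (rule E)
 finally show ?thesis .
qed
have sumE: "(1 - 11/2 * eta) * s <= (SUM j:R. E (V j))"
proof -
 have "(SUM j:R. (?a * s - 2 / eta * dl j) / real n) <= (SUM j:R. E (V j))" by (intro sum_mono Elow)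
 moreover have "(SUM j:R. (?a * s - 2 / eta * dl j) / real n) =
  (real (card R) * (?a * s) - 2 / eta * (SUM j:R. dl j)) / real n"
  by (simp add: sum_divide_distrib[symmetric] sum_subtractf sum_distrib_left)
 moreover have "real n * ((1 - 11/2 * eta) * s) <= real (card R) * (?a * s) - 2 / eta * (SUM j:R. dl j)"
 proof -
  have "2 / eta * (SUM j:R. dl j) <= 2 / eta * (eta^2 * real n * s / 2)" using h1 eta unfolding dl_def V_def by (intro mult_left_mono) auto
  also have "... = eta * real n * s" using eta by (simp add: power2_eq_square)
  finally have a: "2 / eta * (SUM j:R. dl j) <= eta * real n * s" .
  have c: "(1 - eta) * real n * (?a * s) <= real (card R) * (?a * s)"
   using card eta start(2) by (intro mult_right_mono) auto
  define N where "N = real n * s"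
  have N: "N >= 0" using start(2) by (simp add: N_def)
  have "(1 - eta) * ?a - (1 - 9/2 * eta) = 7/2 * eta^2"
   by (simp add: power2_eq_square left_diff_distrib right_diff_distrib diff_divide_distrib)
  hence "1 - 9/2 * eta <= (1 - eta) * ?a" using zero_le_power2[of eta] by linarith
  hence "(1 - 9/2 * eta) * N <= (1 - eta) * ?a * N" using N by (rule mult_right_mono)
  also have "... = (1 - eta) * real n * (?a * s)" by (simp add: N_def)
  finally have "N - 9/2 * (eta * N) <= real (card R) * (?a * s)" using c by (simp add: left_diff_distrib)
  moreover have "2 / eta * (SUM j:R. dl j) <= eta * N" using a by (simp add: N_def)
  moreover have "real n * ((1 - 11/2 * eta) * s) = N - 11/2 * (eta * N)" by (simp add: N_def left_diff_distrib right_diff_distrib)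
  ultimately show ?thesis by linarith
 qed
 ultimately show ?thesis using n by (simp add: pos_le_divide_eq mult.commute) (smt (verit) divide_le_cancel nonzero_mult_div_cancel_left of_nat_0_less_iff)
qed
have X: "(1 - 13/2 * eta) * s <= (SUM j:R. soft_sq b' (X j))"
proof -
 have "(SUM j:R. E (V j)) - (SUM j:R. soft_sq b' (X j)) <= eta * s" using h2 unfolding X_def V_def sum_subtractf by (simp add: abs_le_iff)
 thus ?thesis using sumE by (simp add: algebra_simps)
qed
have "(SUM j:R. soft_sq b' (X j)) = (SUM j:Bad. soft_sq b' (X j)) + (SUM j:R - Bad. soft_sq b' (X j))"
 by (subst sum.subset_diff[of Bad R]) (auto simp: Bad_def fin)
also have "(SUM j:Bad. soft_sq b' (X j)) <= eta * s"
proof -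
 have "(SUM j:Bad. soft_sq b' (X j)) <= (SUM j:Bad. b')" by (intro sum_mono soft_sq_le b)
 thus ?thesis using h3 by (simp add: Bad_def)
qed
also have "(SUM j:R - Bad. soft_sq b' (X j)) <= (1 + eta) * snorm n b' w + eta * s"
proof -
 have "(SUM j:R - Bad. soft_sq b' (X j)) <= (SUM j:R - Bad. (1 + eta) * soft_sq b' (w j) + (1 + 1 / eta) * (cmod (X j - w j))^2)"
  by (intro sum_mono soft_sq_perturb b eta)
 also have "... = (1 + eta) * (SUM j:R - Bad. soft_sq b' (w j)) + (1 + 1 / eta) * (SUM j:R - Bad. (cmod (X j - w j))^2)"
  by (simp add: sum.distrib sum_distrib_left)
 also have "... <= (1 + eta) * snorm n b' w + 2 / eta * (eta^2 * s / 2)"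
 proof (intro add_mono mult_mono e1)
  show "(SUM j:R - Bad. soft_sq b' (w j)) <= snorm n b' w" unfolding snorm_def using R b by (intro sum_mono2) (auto intro: soft_sq_nonneg)
  define c where "c = tau^2 * L ^ 4 / (4 * (1 - r) * r ^ (2 * Suc k))"
  have c: "c >= 0" unfolding c_def using r L by (intro divide_nonneg_nonneg mult_nonneg_nonneg) auto
  have "(SUM j:R - Bad. (cmod (X j - w j))^2) <= (SUM j:R - Bad. c * (SUM l<=d. r ^ l * (cmod (adj n R x i j $ l))^2))"
   unfolding X_def V_def w_def c_def by (intro sum_mono step_row_error k) (auto simp: Bad_def not_less)
  also have "... <= (SUM j<n. c * (SUM l<=d. r ^ l * (cmod (adj n R x i j $ l))^2))"
   using R c r0 by (intro sum_mono2 mult_nonneg_nonneg sum_nonneg) auto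
  also have "... = c * (anorm r d n (adj n R x i))^2" unfolding anorm_sq[OF r0] sqnorm_def sum_distrib_left[symmetric]
   by (subst sum.swap) (simp only: sum_distrib_left)
  also have "... <= c * (L / 2)^2" using c G r0 by (intro mult_left_mono power_mono) auto
  also have "... = tau^2 * L ^ 6 / (16 * (1 - r) * r ^ (2 * Suc k))"       proof -
   have "L ^ 4 * L^2 = L ^ 6" by (simp flip: power_add)
   moreover have "4 * (1 - r) * P * 2^2 = 16 * (1 - r) * P" for P by (simp add: algebra_simps)
   ultimately show ?thesis unfolding c_def power_divide times_divide_times_eq by (simp only: mult.assoc)
  qed
  finally show "(SUM j:R - Bad. (cmod (X j - w j))^2) <= eta^2 * s / 2" using h4 by linarith
 qed (use eta b in \<open>auto intro!: sum_nonneg soft_sq_nonneg\<close>)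
 also have "2 / eta * (eta^2 * s / 2) = eta * s" using eta by (simp add: power2_eq_square)
 finally show ?thesis .
qed
finally have "(1 - 17/2 * eta) * s <= (1 + eta) * snorm n b' w" using X by (simp add: algebra_simps)
moreover have "(1 + eta) * ((1 - 12 * eta) * s) <= (1 - 17/2 * eta) * s"
proof -
 have "(1 - 17/2 * eta) - (1 + eta) * (1 - 12 * eta) = eta * (5/2 + 12 * eta)" by (simp add: algebra_simps)
 moreover have "0 <= eta * (5/2 + 12 * eta)" using eta by simp
 ultimately have "(1 + eta) * (1 - 12 * eta) <= 1 - 17/2 * eta" by linarith
 hence "(1 + eta) * (1 - 12 * eta) * s <= (1 - 17/2 * eta) * s" using start(2) by (rule mult_right_mono)
 thus ?thesis by (simp only: mult.assoc)
qed
ultimately have "(1 + eta) * ((1 - 12 * eta) * s) <= (1 + eta) * snorm n b' w" by linarith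
thus ?thesis using eta by (simp add: w)
qed

end

text \<open>With eta = (1 - r)/12 one has (1 - r)^2 = 144 eta^2, and 1000/144 exceeds the factors 4
  and 4 + 2 collected in \<open>step_prob\<close>.\<close>

definition step_const :: "real => real => real" where
"step_const r L = 1000 * (cut_const r L + 16 * L ^ 4 + 10 / (1 - r) ^ 4) / (1 - r)^2"

section \<open>The probability of one step and the iteration of steps\<close>

context entry_law
begin

lemma prob_sum_gt_le:
assumes fin: "finite R" and m: "!!j. j : R ==> X j : bmeas MX"
 and X0: "!!j x. X j x >= 0" and le: "!!j. j : R ==> (NE x. X j x) <= ennreal C"
 and C: "C >= 0" and a: "a > 0"
shows "{x : space MX. (SUM j:R. X j x) > a} : P.events"
 and "P.prob {x : space MX. (SUM j:R. X j x) > a} <= real (card R) * C / a"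
proof -
have sm: "(%x. SUM j:R. X j x) : bmeas MX" by (intro borel_measurable_sum m)
show "{x : space MX. (SUM j:R. X j x) > a} : P.events" using sm by measurable
have eX: "(%x. ennreal (X j x)) : bmeas MX" if "j : R" for j by (rule measurable_compose[OF m[OF that]]) simp
have "{x : space MX. (SUM j:R. X j x) > a} = {x : space MX. ennreal (SUM j:R. X j x) > ennreal a}" using a by (auto simp: ennreal_less_iff)
also have "P.prob ... <= real (card R) * C / a"
proof (rule prob_gt_le)
 show "(%x. ennreal (SUM j:R. X j x)) : bmeas MX" by (rule measurable_compose[OF sm]) simp
 have "(NE x. SUM j:R. X j x) = (\<integral>\<^sup>+x. (SUM j:R. ennreal (X j x)) \<partial>MX)"
  by (intro nn_integral_cong sum_ennreal[symmetric] X0)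
 also have "... = (SUM j:R. (NE x. X j x))" by (rule nn_integral_sum) (rule eX)
 also have "... <= (SUM j:R. ennreal C)" by (intro sum_mono le)
 also have "... = ennreal (real (card R) * C)" using C by (subst sum_ennreal) auto
 finally show "(NE x. SUM j:R. X j x) <= ennreal (real (card R) * C)" .
qed (use a C in auto)
finally show "P.prob {x : space MX. (SUM j:R. X j x) > a} <= real (card R) * C / a" .
qed

lemma sqnorm_cut_row_le:
assumes "0 < r" "r <= 1" "k <= d" "L > 0"
shows "sqnorm n (cut_row r d L n S x i k) <= 16 * L ^ 4 / r ^ (2 * k)"
proof -
have p: "(r ^ k)^2 = r ^ (2 * k)" by (simp only: power_mult[symmetric] mult.commute)
have "(r ^ k * vnorm n (cut_row r d L n S x i k))^2 <= (4 * L^2)^2" using assms by (intro power_mono vnorm_cut_row_le) auto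
hence "r ^ (2 * k) * sqnorm n (cut_row r d L n S x i k) <= 16 * L ^ 4" unfolding power_mult_distrib p vnorm_sq by (simp flip: power_mult)
thus ?thesis using assms by (simp add: pos_le_divide_eq mult.commute)
qed

lemma prob_step_variance:
fixes r L :: real and i k d :: nat
assumes r: "0 < r" "r < 1" and L: "L >= 1" and i: "i < n" and k: "k <= d" and b: "b > 0" and a: "a > 0"
defines "R \<equiv> {..<n} - {i}"
defines "Y \<equiv> %x. SUM j:R. soft_sq b (SUM m<n. x j m * cut_row r d L n (R - {j}) x i k m) -
 (LINT y|RW. soft_sq b (SUM m<n. y m * cut_row r d L n (R - {j}) x i k m))"
shows "{x : space MX. \<bar>Y x\<bar> > a} : P.events"
 and "P.prob {x : space MX. \<bar>Y x\<bar> > a} <= b * (16 * L ^ 4 + cut_const r L) / r ^ (2 * k) / a^2"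
proof -
have R: "R <= {..<n}" "i ~: R" "finite R" by (auto simp: R_def)
define Cv where "Cv = 16 * L ^ 4 / r ^ (2 * k)"
define Cd where "Cd = cut_const r L / r ^ (2 * k) / real n"
have cc: "cut_const r L >= 0" using r L by (simp add: cut_const_def)
have C0: "Cv >= 0" "Cd >= 0" using r L cc by (auto simp: Cv_def Cd_def)
have Vm: "(%x. cut_row r d L n S x i k m) : bmeas MX" if "S <= R" for S m using that R by (intro measurable_cut_row) auto
have inv: "cut_row r d L n S (x(j := y)) i k = cut_row r d L n S x i k" if "j ~: S" for S j x y
proof -
 have "rpow n S (x(j := y)) i k m = rpow n S x i k m" for m unfolding rpow_eq using that by simp
 thus ?thesis using that by (intro ext) (simp add: cut_row_def cut_weight_def)
qed
have cv: "(NE x. sqnorm n (cut_row r d L n (R - {j}) x i k)) <= ennreal Cv" for j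
proof -
 have "(NE x. sqnorm n (cut_row r d L n (R - {j}) x i k)) <= (\<integral>\<^sup>+x. ennreal Cv \<partial>MX)"
  unfolding Cv_def using r k L by (intro nn_integral_mono ennreal_leI sqnorm_cut_row_le) auto
 thus ?thesis by (simp add: P.emeasure_space_1)
qed
have cd: "(NE x. sqnorm n (%m. cut_row r d L n (R - {j}) x i k m - cut_row r d L n (R - {j} - {j'}) x i k m)) <= ennreal Cd"
 if "j : R" "j' : R" "j ~= j'" for j j' unfolding Cd_def using that R by (intro cut_row_diff_mom r i k L) auto
note var = variance_sum_centred[where V = "%S x. cut_row r d L n S x i k", OF R(1) b Vm inv cv C0(1) cd C0(2)]
have Ym: "Y : bmeas MX" unfolding Y_def by (rule var(1))
show "{x : space MX. \<bar>Y x\<bar> > a} : P.events" using Ym by measurable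
have Yb: "\<bar>Y x\<bar> <= real (card R) * b" for x
proof -
 have "\<bar>Y x\<bar> <= (SUM j:R. \<bar>soft_sq b (SUM m<n. x j m * cut_row r d L n (R - {j}) x i k m) -
  (LINT y|RW. soft_sq b (SUM m<n. y m * cut_row r d L n (R - {j}) x i k m))\<bar>)" unfolding Y_def by (rule sum_abs)
 also have "... <= (SUM j:R. b)"
 proof (rule sum_mono)
  fix j
  show "\<bar>soft_sq b (SUM m<n. x j m * cut_row r d L n (R - {j}) x i k m) -
   (LINT y|RW. soft_sq b (SUM m<n. y m * cut_row r d L n (R - {j}) x i k m))\<bar> <= b"
   using soft_sq_nonneg[OF b, of "SUM m<n. x j m * cut_row r d L n (R - {j}) x i k m"]
    soft_sq_le[OF b, of "SUM m<n. x j m * cut_row r d L n (R - {j}) x i k m"]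
    integral_soft_sq_bounds[OF prob_row b, of "%y. SUM m<n. y m * cut_row r d L n (R - {j}) x i k m"] by linarith
 qed
 finally show ?thesis by simp
qed
have Yi: "integrable MX (%x. (Y x)^2)"
proof (rule P.integrable_const_bound[where B = "(real (card R) * b)^2"])
 show "AE x in MX. norm ((Y x)^2) <= (real (card R) * b)^2" using power_mono[OF Yb abs_ge_zero, of _ 2] by simp
qed (intro borel_measurable_power Ym)
have "(NE x. (cmod (complex_of_real (Y x)))^2) = ennreal (LINT x|MX. (Y x)^2)" using Yi by (subst nn_integral_eq_integral[symmetric]) auto
also have "... <= ennreal (b * (Cv + real n * Cd))" unfolding Y_def by (rule ennreal_leI) (rule var(2)[unfolded Y_def])
finally have "P.prob {x : space MX. cmod (complex_of_real (Y x)) > a} <= b * (Cv + real n * Cd) / a^2"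
 using b C0 a by (intro prob_norm_gt_le measurable_compose[OF Ym borel_measurable_of_real]) auto
also have "b * (Cv + real n * Cd) = b * (16 * L ^ 4 + cut_const r L) / r ^ (2 * k)"
 using n_pos by (simp add: Cv_def Cd_def add_divide_distrib distrib_left)
finally show "P.prob {x : space MX. \<bar>Y x\<bar> > a} <= b * (16 * L ^ 4 + cut_const r L) / r ^ (2 * k) / a^2" by simp
qed

text \<open>Removing one of n rows has an effect of order 1/n in mean square, so the expected number
  of bad rows is bounded in n.\<close>

lemma prob_bad_rows:
fixes r L tau :: real and i d :: nat
assumes r: "0 < r" "r < 1" and L: "L >= 1" and i: "i < n" and tau: "0 < tau" "tau <= 1" and a: "a > 0"
defines "R \<equiv> {..<n} - {i}"
defines "Bad \<equiv> %x. bad_rows n r d L i R x tau"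
shows "{x : space MX. real (card (Bad x)) > a} : P.events"
 and "P.prob {x : space MX. real (card (Bad x)) > a} <= 10 / (1 - r) ^ 4 / tau^2 / a"
proof -
have R: "R <= {..<n}" "i ~: R" "finite R" by (auto simp: R_def)
define C where "C = 2 / (1 - r) ^ 4 / real n"
have C: "C >= 0" using r by (simp add: C_def)
let ?e = "%j x. tnorm r d (chs n R x - chs n (R - {j}) x)"
let ?f = "%j x. anorm r d n (%m. adj n R x i m - adj n (R - {j}) x i m)"
have me: "?e j : bmeas MX" for j
 by (rule measurable_tnorm) (unfold fps_sub_nth, intro borel_measurable_diff measurable_series, use R in auto)
have mf: "?f j : bmeas MX" for j
 by (rule measurable_anorm) (unfold fps_sub_nth, intro borel_measurable_diff measurable_series, use R in auto)
define X where "X j x = (if tau < ?e j x | L / 2 < ?f j x then 1 else 0 :: real)" for j x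
have Xm: "X j : bmeas MX" for j unfolding X_def using me[of j] mf[of j] by measurable
have X0: "X j x >= 0" for j x by (simp add: X_def)
have cardX: "real (card (Bad x)) = (SUM j:R. X j x)" for x unfolding Bad_def X_def using R(3) by (simp add: sum.If_cases Int_def)
have "(NE x. X j x) <= ennreal (5 / tau^2 * C)" if j: "j : R" for j
proof -
 have m: "(%x. ennreal ((?e j x)^2)) : bmeas MX" "(%x. ennreal ((?f j x)^2)) : bmeas MX"
  by (rule measurable_compose[OF me], simp) (rule measurable_compose[OF mf], simp)
 have pw: "ennreal (X j x) <= ennreal (1 / tau^2) * ennreal ((?e j x)^2) + ennreal (4 / tau^2) * ennreal ((?f j x)^2)" for x
 proof -
  have "X j x <= 1 / tau^2 * (?e j x)^2 + 4 / tau^2 * (?f j x)^2"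
  proof (cases "tau < ?e j x")
   case True
   hence "tau^2 <= (?e j x)^2" using tau by (intro power_mono) auto
   hence "1 <= 1 / tau^2 * (?e j x)^2" using tau by (simp add: field_simps)
   moreover have "0 <= 4 / tau^2 * (?f j x)^2" by simp
   moreover have "X j x <= 1" by (simp add: X_def)
   ultimately show ?thesis by linarith
  next
   case F: False
   show ?thesis
   proof (cases "L / 2 < ?f j x")
    case True
    hence "1 / 2 <= ?f j x" using L by linarith
    hence "(tau / 2)^2 <= (?f j x)^2" using tau by (intro power_mono) auto
    hence "1 <= 4 / tau^2 * (?f j x)^2" using tau by (simp add: field_simps power_divide)
    moreover have "0 <= 1 / tau^2 * (?e j x)^2" by simp
    moreover have "X j x <= 1" by (simp add: X_def)
    ultimately show ?thesis by linarith
   qed (use F in \<open>simp add: X_def\<close>)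
  qed
  hence "ennreal (X j x) <= ennreal (1 / tau^2 * (?e j x)^2 + 4 / tau^2 * (?f j x)^2)" by (rule ennreal_leI)
  also have "... = ennreal (1 / tau^2) * ennreal ((?e j x)^2) + ennreal (4 / tau^2) * ennreal ((?f j x)^2)"
   by (subst ennreal_plus) (auto simp: ennreal_mult simp del: times_divide_eq_left)
  finally show ?thesis .
 qed
 have "(NE x. X j x) <=
  (\<integral>\<^sup>+x. ennreal (1 / tau^2) * ennreal ((?e j x)^2) + ennreal (4 / tau^2) * ennreal ((?f j x)^2) \<partial>MX)"
  by (intro nn_integral_mono pw)
 also have "... = ennreal (1 / tau^2) * (NE x. (?e j x)^2) + ennreal (4 / tau^2) * (NE x. (?f j x)^2)"
  using m by (subst nn_integral_add) (auto simp: nn_integral_cmult)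
 also have "... <= ennreal (1 / tau^2) * ennreal C + ennreal (4 / tau^2) * ennreal C"
  unfolding C_def using R by (intro add_mono mult_left_mono char_diff_norm_mom adj_diff_norm_mom r i j) auto
 also have "... = ennreal (1 / tau^2 * C + 4 / tau^2 * C)"
  using C by (subst ennreal_plus) (auto simp: ennreal_mult simp del: times_divide_eq_left)
 also have "1 / tau^2 * C + 4 / tau^2 * C = 5 / tau^2 * C" by (simp add: add_divide_distrib[symmetric])
 finally show ?thesis .
qed
note ps = prob_sum_gt_le[OF R(3) Xm X0 this _ a]
have C5: "0 <= 5 / tau^2 * C" using C by simp
show "{x : space MX. real (card (Bad x)) > a} : P.events" unfolding cardX by (rule ps(1)[OF _ C5])
have "P.prob {x : space MX. real (card (Bad x)) > a} <= real (card R) * (5 / tau^2 * C) / a" unfolding cardX by (rule ps(2)[OF _ C5])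
also have "... <= real n * (5 / tau^2 * C) / a" using card_mono[OF _ R(1)] C5 a by (intro divide_right_mono mult_right_mono) auto
also have "... = 10 / (1 - r) ^ 4 / tau^2 / a" using n_pos by (simp add: C_def)
finally show "P.prob {x : space MX. real (card (Bad x)) > a} <= 10 / (1 - r) ^ 4 / tau^2 / a" .
qed

lemma prob_step_moment:
fixes r L :: real and i k d :: nat
assumes r: "0 < r" "r < 1" and L: "L >= 1" and i: "i < n" and k: "k <= d" and a: "a > 0"
defines "R \<equiv> {..<n} - {i}"
defines "Y \<equiv> %x. SUM j:R. sqnorm n (%m. cut_row r d L n R x i k m - cut_row r d L n (R - {j}) x i k m)"
shows "{x : space MX. Y x > a} : P.events"
 and "P.prob {x : space MX. Y x > a} <= cut_const r L / r ^ (2 * k) / a"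
proof -
have R: "R <= {..<n}" "i ~: R" "finite R" by (auto simp: R_def)
define Cd where "Cd = cut_const r L / r ^ (2 * k) / real n"
have Cd: "Cd >= 0" using r L by (simp add: Cd_def cut_const_def)
have m: "(%x. sqnorm n (%m. cut_row r d L n R x i k m - cut_row r d L n (R - {j}) x i k m)) : bmeas MX" for j
 using R by (intro measurable_sqnorm borel_measurable_diff measurable_cut_row) auto
have cd: "(NE x. sqnorm n (%m. cut_row r d L n R x i k m - cut_row r d L n (R - {j}) x i k m)) <= ennreal Cd" if "j : R" for j
 unfolding Cd_def by (rule cut_row_diff_mom[OF r R(1,2) i that k L])
show "{x : space MX. Y x > a} : P.events" unfolding Y_def by (rule prob_sum_gt_le(1)[OF R(3) m sqnorm_nonneg cd Cd a])
have "P.prob {x : space MX. Y x > a} <= real (card R) * Cd / a"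
 unfolding Y_def by (rule prob_sum_gt_le(2)[OF R(3) m sqnorm_nonneg cd Cd a])
also have "... <= real n * Cd / a" using card_mono[OF _ R(1)] Cd a by (intro divide_right_mono mult_right_mono) auto
also have "... = cut_const r L / r ^ (2 * k) / a" using n_pos by (simp add: Cd_def)
finally show "P.prob {x : space MX. Y x > a} <= cut_const r L / r ^ (2 * k) / a" .
qed

abbreviation good_event where "good_event r d L i x \<equiv> tnorm r d (ichs n ({..<n} - {i}) x) <= L / 2 &
  anorm r d n (adj n ({..<n} - {i}) x i) <= L / 2"

text \<open>The threshold for bad rows is t = b'^(1/4). Their number is of order 1/t^2 and each
  costs at most b', while the good rows cost errors of order t^2; this choice makes both of order
  sqrt b'.\<close>

lemma step_prob:
fixes r L :: real and i k d :: nat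
assumes r: "0 < r" "r < 1" and L: "L >= 1" and i: "i < n" and k: "Suc k <= d" and b: "b > 0" "0 < b'" "b' <= 1"
 and n: "1 <= (1 - r) / 12 * real n" and s: "r ^ k <= (1 - r) / 12 * b' * real n"
 and h4: "sqrt b' * L ^ 6 <= ((1 - r) / 12) ^ 3 * r ^ (3 * Suc k)" and tau: "sqrt (sqrt b') * L <= 1"
 and pairs: "2 * (1 - (1 - r) / 12) / real n <= (LINT p|MM. trunc_sq (b' / 2 / b) (fst p - snd p))"
shows "\<exists>A\<in>P.events. P.prob A <= step_const r L * (sqrt b' + 1 / real n) / r ^ (4 * k) &
 (\<forall>x\<in>space MX - A. good_event r d L i x --> r ^ k / 2 <= snorm n b (rpow n ({..<n} - {i}) x i k) -->
  r ^ Suc k / 2 <= snorm n b' (rpow n ({..<n} - {i}) x i (Suc k)))"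
proof -
define eta where "eta = (1 - r) / 12"
define t where "t = sqrt (sqrt b')"
define s where "s = r ^ k / 2"
define R where "R = {..<n} - {i}"
have R: "R <= {..<n}" "i ~: R" by (auto simp: R_def)
have "12 * eta = 1 - r" by (simp add: eta_def)
hence eta: "0 < eta" "eta <= 1/12" "1 - 12 * eta = r" using r by linarith+
have eta2: "eta^2 <= eta" using eta by (simp add: power2_eq_square mult_left_le)
have s0: "s > 0" using r by (simp add: s_def)
have t: "0 < t" "t <= 1" "t^2 = sqrt b'" using b by (auto simp: t_def)
have k': "k <= d" using k by simp
define A1 where "A1 = {x : space MX. (SUM j:R. sqnorm n (%m. cut_row r d L n R x i k m - cut_row r d L n (R - {j}) x i k m)) > eta^2 * real n * s / 2}"
define A2 where "A2 = {x : space MX. \<bar>SUM j:R. soft_sq b' (SUM m<n. x j m * cut_row r d L n (R - {j}) x i k m) -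
 (LINT y|RW. soft_sq b' (SUM m<n. y m * cut_row r d L n (R - {j}) x i k m))\<bar> > eta * s}"
define A3 where "A3 = {x : space MX. real (card (bad_rows n r d L i R x t)) > eta * s / b'}"
have a1: "0 < eta^2 * real n * s / 2" using eta s0 n_pos by simp
have a2: "0 < eta * s" using eta s0 by simp
have a3: "0 < eta * s / b'" using eta s0 b by simp
note p1 = prob_step_moment[OF r L i k' a1, folded R_def, folded A1_def]
note p2 = prob_step_variance[OF r L i k' b(2) a2, folded R_def, folded A2_def]
note p3 = prob_bad_rows[OF r L i t(1,2) a3, of d, folded R_def, folded A3_def]
let ?A = "A1 \<union> A2 \<union> A3"
have Am: "?A : P.events" by (intro sets.Un p1 p2 p3)
have rp: "r ^ (2 * k) > 0" using r by simp
define C where "C = cut_const r L + 16 * L ^ 4 + 10 / (1 - r) ^ 4"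
have C: "cut_const r L <= C" "16 * L ^ 4 + cut_const r L <= C" "10 / (1 - r) ^ 4 <= C" "0 <= C" "0 <= cut_const r L"
 using r L by (auto simp: C_def cut_const_def)
have rk: "r ^ (2 * k) = r ^ k * r ^ k" "r ^ (4 * k) = r ^ k * r ^ k * (r ^ k * r ^ k)"
 unfolding power_add[symmetric] by (rule arg_cong[where f = "power r"], simp)+
define rho where "rho = r ^ k"
have rho: "0 < rho" "rho <= 1" using r by (auto simp: rho_def power_le_one)
have sb: "b' <= sqrt b'" using b by (intro real_le_rsqrt) (simp add: power2_eq_square mult_left_le)
have "P.prob A1 <= 4 * C / eta^2 * (1 / real n) / r ^ (4 * k)"
proof -
 have "P.prob A1 <= cut_const r L / r ^ (2 * k) / (eta^2 * real n * s / 2)" by (rule p1(2))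
 also have "... <= C / r ^ (2 * k) / (eta^2 * real n * s / 2)" using C a1 rp by (intro divide_right_mono) auto
 also have "... = 4 * C / eta^2 * (1 / real n) / (rho * rho * rho)" unfolding s_def rk rho_def[symmetric] using rho by (simp add: mult_ac)
 also have "... <= 4 * C / eta^2 * (1 / real n) / (rho * rho * (rho * rho))"
  using rho C by (intro divide_left_mono mult_nonneg_nonneg) (auto simp: mult_le_cancel_left1)
 finally show ?thesis by (simp add: rk rho_def)
qed
moreover have "P.prob A2 <= 4 * C / eta^2 * sqrt b' / r ^ (4 * k)"
proof -
 have "P.prob A2 <= b' * (16 * L ^ 4 + cut_const r L) / r ^ (2 * k) / (eta * s)^2" by (rule p2(2))
 also have "... <= sqrt b' * C / r ^ (2 * k) / (eta * s)^2" using C sb b L rp by (intro divide_right_mono mult_mono) auto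
 also have "... = 4 * C / eta^2 * sqrt b' / r ^ (4 * k)"
  unfolding rk s_def rho_def[symmetric] using rho by (simp add: power2_eq_square mult_ac)
 finally show ?thesis .
qed
moreover have "P.prob A3 <= 2 * C / eta^2 * sqrt b' / r ^ (4 * k)"
proof -
 have "P.prob A3 <= 10 / (1 - r) ^ 4 / t^2 / (eta * s / b')" by (rule p3(2))
 also have "... <= C / t^2 / (eta * s / b')" using C a3 by (intro divide_right_mono) auto
 also have "... = 2 * C / eta * (b' / sqrt b') / rho" using rho by (simp add: t s_def rho_def mult_ac)
 also have "b' / sqrt b' = sqrt b'" using b by (simp add: real_div_sqrt)
 also have "2 * C / eta * sqrt b' / rho <= 2 * C / eta^2 * sqrt b' / (rho * rho * (rho * rho))"
 proof (rule frac_le)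
  show "2 * C / eta * sqrt b' <= 2 * C / eta^2 * sqrt b'" using C eta eta2 b by (intro mult_right_mono divide_left_mono) auto
  have "rho * rho * (rho * rho) <= 1 * 1 * (1 * rho)" using rho by (intro mult_mono) auto
  thus "rho * rho * (rho * rho) <= rho" by simp
 qed (use C eta rho b in auto)
 finally show ?thesis by (simp add: rk rho_def)
qed
moreover have "P.prob ?A <= P.prob A1 + P.prob A2 + P.prob A3"
 using measure_Un_le[of "A1 \<union> A2" "MX" A3] measure_Un_le[of A1 "MX" A2] p1(1) p2(1) p3(1) by auto
ultimately have "P.prob ?A <= 4 * C / eta^2 * (1 / real n) / r ^ (4 * k) + 4 * C / eta^2 * sqrt b' / r ^ (4 * k) + 2 * C / eta^2 * sqrt b' / r ^ (4 * k)"
 by linarith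
also have "... <= step_const r L * (sqrt b' + 1 / real n) / r ^ (4 * k)"
proof -
 define D where "D = C / eta^2"
 have D: "D >= 0" using C by (simp add: D_def)
 have e: "step_const r L = 1000 / 144 * D" unfolding step_const_def D_def C_def[symmetric] eta_def power_divide by simp
 have "4 * D * (1 / real n) + 4 * D * sqrt b' + 2 * D * sqrt b' <= 1000 / 144 * D * (sqrt b' + 1 / real n)"
 proof -
  have "0 <= D * (1 / real n)" "0 <= D * sqrt b'" using D b by auto
  thus ?thesis unfolding distrib_left mult.assoc by linarith
 qed
 hence "(4 * D * (1 / real n) + 4 * D * sqrt b' + 2 * D * sqrt b') / r ^ (4 * k) <= step_const r L * (sqrt b' + 1 / real n) / r ^ (4 * k)"
  unfolding e using r by (intro divide_right_mono) auto
 thus ?thesis by (simp add: D_def add_divide_distrib)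
qed
finally have pA: "P.prob ?A <= step_const r L * (sqrt b' + 1 / real n) / r ^ (4 * k)" .
have "r ^ Suc k / 2 <= snorm n b' (rpow n R x i (Suc k))"
 if x: "x : space MX - ?A" and G: "tnorm r d (ichs n R x) <= L / 2" "anorm r d n (adj n R x i) <= L / 2"
  and st: "r ^ k / 2 <= snorm n b (rpow n R x i k)" for x
proof -
 have "(1 - 12 * eta) * s <= snorm n b' (rpow n R x i (Suc k))"
 proof (rule step_lower_bound[OF r L R _ _ G k b(1,2) eta(1,2) _ n_pos, where tau = t and
   E = "%v. (LINT y|RW. soft_sq b' (SUM m<n. y m * v m))"])
  show "0 <= t" "t * L <= 1" using t tau by (auto simp: t_def)
  have "card R = n - 1" using i by (simp add: R_def)
  thus "(1 - eta) * real n <= real (card R)" using n n_pos by (simp add: eta_def left_diff_distrib of_nat_diff)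
  show "s <= snorm n b (rpow n R x i k)" using st by (simp add: s_def)
  show "0 <= s" using s0 by simp
  show "s <= eta * b' * real n / 2" using assms(10) by (simp add: s_def eta_def)
  show "(1 - 3 / 2 * eta) * min ((1 - eta) * snorm n b v / real n) (eta * (b' / 2)) <= (LINT y|RW. soft_sq b' (SUM m<n. y m * v m))" for v
   using soft_sq_row_integral[of b "b' / 2" eta eta v] b eta pairs by (simp add: eta_def)
  show "(SUM j:R. sqnorm n (%m. cut_row r d L n R x i k m - cut_row r d L n (R - {j}) x i k m)) <= eta^2 * real n * s / 2"
   using x by (auto simp: A1_def not_less)
  show "\<bar>SUM j:R. soft_sq b' (SUM m<n. x j m * cut_row r d L n (R - {j}) x i k m) -
   (LINT y|RW. soft_sq b' (SUM m<n. y m * cut_row r d L n (R - {j}) x i k m))\<bar> <= eta * s" using x by (auto simp: A2_def not_less)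
  have "real (card (bad_rows n r d L i R x t)) <= eta * s / b'" using x by (auto simp: A3_def not_less)
  thus "real (card (bad_rows n r d L i R x t)) * b' <= eta * s" using b by (simp add: pos_le_divide_eq)
  have p3k: "r ^ (3 * Suc k) = r ^ (2 * Suc k) * r ^ Suc k" unfolding power_add[symmetric] by (rule arg_cong[where f = "power r"]) simp
  have "t^2 * L ^ 6 <= eta ^ 3 * (r ^ (2 * Suc k) * r ^ Suc k)" using h4 unfolding t(3) eta_def p3k .
  also have "... <= eta ^ 3 * (r ^ (2 * Suc k) * r ^ k)" using r eta by (intro mult_left_mono) (auto simp: mult_le_cancel_right1)
  also have "... <= (eta^2 * s / 2) * (16 * (1 - r) * r ^ (2 * Suc k))"
  proof -
   have "(eta^2 * s / 2) * (16 * (1 - r) * r ^ (2 * Suc k)) = 48 * (eta ^ 3 * (r ^ (2 * Suc k) * r ^ k))"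
    unfolding s_def eta_def by (simp add: power2_eq_square power3_eq_cube)
   moreover have "0 <= eta ^ 3 * (r ^ (2 * Suc k) * r ^ k)" using eta r by simp
   ultimately show ?thesis by linarith
  qed
  finally show "t^2 * L ^ 6 / (16 * (1 - r) * r ^ (2 * Suc k)) <= eta^2 * s / 2"
   using r by (simp only: pos_divide_le_eq mult_pos_pos zero_less_power diff_gt_0_iff_gt zero_less_numeral)
 qed
 thus ?thesis by (simp add: eta(3) s_def)
qed
thus ?thesis using pA Am unfolding R_def by (intro bexI[of _ ?A]) auto
qed

end

lemma soft_sq_one_ge: "b >= 1 ==> 1 / 2 <= soft_sq b 1"
proof -
assume b: "b >= 1"
have "2 <= exp (1 :: real)" using exp_ge_add_one_self[of 1] by simp
hence e: "1 / 2 <= 1 - exp (- 1 :: real)" by (simp add: exp_minus field_simps)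
have "1 / b * (1 - exp (- 1)) <= 1 - exp (- (1 / b * 1))" by (rule one_minus_exp_scale) (use b in auto)
hence "b * (1 / b * (1 - exp (- 1))) <= b * (1 - exp (- (1 / b * 1)))" using b by (intro mult_left_mono) auto
thus ?thesis using b e by (simp add: soft_sq_def)
qed

context entry_law
begin

text \<open>The scale falls by the factor u^2 per step, so the failure probabilities, of order
  u^(k+1) r^(-4 k), form a geometric series of total order u. It must not fall below order r^k / n,
  since n coordinates at scale b cannot carry a soft norm above n b; this is the second term of the
  scale.\<close>

lemma iterate_steps:
fixes r L u :: real and i d m :: nat
defines "eta \<equiv> (1 - r) / 12"
defines "C \<equiv> 1 / (eta * r)"
defines "b \<equiv> %k. (u^2) ^ k + C * r ^ k / real n"
assumes r: "0 < r" "r < 1" and L: "L >= 1" and i: "i < n"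
 and u: "0 < u" "u <= r ^ 4 / 2" "u * (2 * L ^ 6) <= eta ^ 3 * r ^ 3"
 and n: "1 <= eta * real n" "sqrt (C / real n) * (2 * L ^ 6) <= eta ^ 3 * r ^ (3 * d)"
 and pairs: "!!B. u^2 / 2 <= B ==> 2 * (1 - eta) / real n <= (LINT p|MM. trunc_sq B (fst p - snd p))"
 and m: "m <= d"
shows "\<exists>A\<in>P.events. P.prob A <= step_const r L * (2 * u + real d * ((sqrt (C / real n) + 1 / real n) / r ^ (4 * d))) &
 (\<forall>x\<in>space MX - A. good_event r d L i x --> r ^ m / 2 <= snorm n (b m) (rpow n ({..<n} - {i}) x i m))"
proof -
define be where "be = sqrt (C / real n)"
have eta: "0 < eta" "eta <= 1/12" using r by (auto simp: eta_def)
have C: "C > 0" using eta r by (simp add: C_def)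
let ?b = "step_const r L"
have sc: "?b >= 0" using r L by (simp add: step_const_def cut_const_def)
have be: "be >= 0" "be^2 = C / real n" using C by (auto simp: be_def)
have bpos: "b k > 0" for k unfolding b_def using u C r n_pos by (intro add_pos_pos) auto
have sqb: "sqrt (b k) <= u ^ k + be" for k
proof (rule real_le_lsqrt)
 have "b k <= (u ^ k)^2 + be^2" unfolding b_def be(2) power_mult[symmetric] mult.commute[of k 2] power_mult[of u k 2, symmetric]
  using C r by (intro add_mono) (auto simp: mult.commute power_le_one divide_right_mono mult_left_le)
 also have "... <= (u ^ k + be)^2" using u be by (simp add: power2_sum)
 finally show "b k <= (u ^ k + be)^2" .
qed (use u be bpos[of k] in auto)
have h4: "sqrt (b (Suc k)) * L ^ 6 <= eta ^ 3 * r ^ (3 * Suc k)" if k: "Suc k <= d" for k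
proof -
 have L6: "L ^ 6 > 0" using L by simp
 \<comment> \<open>By hypothesis u <= c r^3 with c <= 1, so the powers of u stay below c r^(3 (k +
   1)); one condition on u serves all steps.\<close>
 define c where "c = eta ^ 3 / (2 * L ^ 6)"
 have "eta ^ 3 <= 1" using eta by (intro power_le_one) auto
 moreover have "1 <= L ^ 6" using L by simp
 ultimately have c: "0 <= c" "c <= 1" using eta L6 by (auto simp: c_def divide_le_eq)
 have uc: "u <= c * r ^ 3" using u(3) L6 by (simp add: c_def field_simps)
 have "u ^ Suc k <= (c * r ^ 3) ^ Suc k" using u uc by (intro power_mono) auto
 also have "... = c ^ Suc k * r ^ (3 * Suc k)" by (simp only: power_mult_distrib power_mult)
 also have "... <= c * r ^ (3 * Suc k)" using c r power_decreasing[of 1 "Suc k" c] by (intro mult_right_mono) auto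
 finally have "u ^ Suc k * L ^ 6 <= c * r ^ (3 * Suc k) * L ^ 6" using L6 by (intro mult_right_mono) auto
 also have "... = eta ^ 3 * r ^ (3 * Suc k) / 2" using L6 by (simp add: c_def)
 finally have 1: "u ^ Suc k * L ^ 6 <= eta ^ 3 * r ^ (3 * Suc k) / 2" .
 have "r ^ (3 * d) <= r ^ (3 * Suc k)" using r k by (intro power_decreasing) auto
 hence "eta ^ 3 * r ^ (3 * d) <= eta ^ 3 * r ^ (3 * Suc k)" using eta by (intro mult_left_mono) auto
 hence 2: "be * L ^ 6 <= eta ^ 3 * r ^ (3 * Suc k) / 2" using n(2) unfolding be_def by linarith
 have "sqrt (b (Suc k)) * L ^ 6 <= (u ^ Suc k + be) * L ^ 6" by (rule mult_right_mono[OF sqb]) (use L6 in simp)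
 also have "... = u ^ Suc k * L ^ 6 + be * L ^ 6" by (rule distrib_right)
 finally show ?thesis using 1 2 by linarith
qed
have sq_le: "sqrt (b (Suc k)) <= 1 / L^2" if k: "Suc k <= d" for k
proof -
 have "eta ^ 3 * r ^ (3 * Suc k) <= 1" using eta r by (intro mult_le_one power_le_one) auto
 hence "sqrt (b (Suc k)) * L ^ 6 <= 1" using h4[OF k] by linarith
 moreover have "L^2 <= L ^ 6" using L by (intro power_increasing) auto
 hence "sqrt (b (Suc k)) * L^2 <= sqrt (b (Suc k)) * L ^ 6" using bpos[of "Suc k"] by (intro mult_left_mono) auto
 ultimately have "sqrt (b (Suc k)) * L^2 <= 1" by linarith
 thus ?thesis using L by (simp add: pos_le_divide_eq)
qed
have step: "\<exists>A\<in>P.events. P.prob A <= ?b * (sqrt (b (Suc k)) + 1 / real n) / r ^ (4 * k) &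
 (\<forall>x\<in>space MX - A. good_event r d L i x --> r ^ k / 2 <= snorm n (b k) (rpow n ({..<n} - {i}) x i k) -->
  r ^ Suc k / 2 <= snorm n (b (Suc k)) (rpow n ({..<n} - {i}) x i (Suc k)))" if k: "Suc k <= d" for k
proof (rule step_prob[OF r L i k bpos bpos])
 have "sqrt (b (Suc k)) <= 1" using sq_le[OF k] L by (smt (verit) divide_le_eq_1 one_le_power zero_le_power2)
 thus "b (Suc k) <= 1" by simp
 show "1 <= (1 - r) / 12 * real n" using n(1) by (simp add: eta_def)
 have "r ^ k = eta * (C * r ^ Suc k / real n) * real n" using eta r n_pos by (simp add: C_def)
 also have "... <= eta * b (Suc k) * real n" unfolding b_def using eta u by (intro mult_right_mono mult_left_mono) auto
 finally show "r ^ k <= (1 - r) / 12 * b (Suc k) * real n" by (simp add: eta_def)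
 show "sqrt (b (Suc k)) * L ^ 6 <= ((1 - r) / 12) ^ 3 * r ^ (3 * Suc k)" using h4[OF k] by (simp add: eta_def)
 have "sqrt (sqrt (b (Suc k))) <= sqrt (1 / L^2)" using sq_le[OF k] by simp
 also have "... = 1 / L" using L by (simp add: real_sqrt_divide)
 finally show "sqrt (sqrt (b (Suc k))) * L <= 1" using L by (simp add: pos_le_divide_eq)
 have "u^2 <= r"
 proof -
  have "u <= r" using u r power_decreasing[of 1 4 r] by simp
  hence "u * u <= r * 1" using u r by (intro mult_mono) auto
  thus ?thesis by (simp add: power2_eq_square)
 qed
 hence "u^2 * b k <= b (Suc k)" unfolding b_def distrib_left using C r
  by (intro add_mono) (auto simp: mult_ac intro!: divide_right_mono mult_right_mono mult_left_mono)
 hence "u^2 / 2 <= b (Suc k) / 2 / b k" using bpos[of k] by (simp add: pos_le_divide_eq)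
 thus "2 * (1 - (1 - r) / 12) / real n <= (LINT p|MM. trunc_sq (b (Suc k) / 2 / b k) (fst p - snd p))" using pairs by (simp add: eta_def)
qed
let ?a = "be + 1 / real n"
have "\<exists>A\<in>P.events. P.prob A <= (SUM k<m. ?b * (sqrt (b (Suc k)) + 1 / real n) / r ^ (4 * k)) &
 (\<forall>x\<in>space MX - A. good_event r d L i x --> r ^ m / 2 <= snorm n (b m) (rpow n ({..<n} - {i}) x i m))" using m
proof (induction m)
 case 0
 have "1 / 2 <= snorm n (b 0) (rpow n ({..<n} - {i}) x i 0)" for x
 proof -
  have "1 <= b 0" unfolding b_def using C by simp
  hence "1 / 2 <= soft_sq (b 0) (rpow n ({..<n} - {i}) x i 0 i)" using soft_sq_one_ge by simp
  also have "... <= snorm n (b 0) (rpow n ({..<n} - {i}) x i 0)"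
   unfolding snorm_def using i bpos[of 0] by (intro member_le_sum) (auto intro: soft_sq_nonneg)
  finally show ?thesis .
 qed
 thus ?case by (intro bexI[of _ "{}"] conjI ballI impI) (simp_all only: power_0 sets.empty_sets measure_empty lessThan_0 sum.empty order.refl)
next
 case (Suc k)
 then obtain A where A: "A : P.events" "P.prob A <= (SUM k<k. ?b * (sqrt (b (Suc k)) + 1 / real n) / r ^ (4 * k))"
  "!!x. x : space MX - A ==> good_event r d L i x ==> r ^ k / 2 <= snorm n (b k) (rpow n ({..<n} - {i}) x i k)" by auto
 obtain A' where A': "A' : P.events" "P.prob A' <= ?b * (sqrt (b (Suc k)) + 1 / real n) / r ^ (4 * k)"
  "!!x. x : space MX - A' ==> good_event r d L i x ==> r ^ k / 2 <= snorm n (b k) (rpow n ({..<n} - {i}) x i k) ==>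
  r ^ Suc k / 2 <= snorm n (b (Suc k)) (rpow n ({..<n} - {i}) x i (Suc k))" using step[OF Suc.prems] by blast
 have "P.prob (A \<union> A') <= P.prob A + P.prob A'" by (rule measure_Un_le[OF A(1) A'(1)])
 hence "P.prob (A \<union> A') <= (SUM k<Suc k. ?b * (sqrt (b (Suc k)) + 1 / real n) / r ^ (4 * k))"
  unfolding sum.lessThan_Suc using A(2) A'(2) by linarith
 moreover have "r ^ Suc k / 2 <= snorm n (b (Suc k)) (rpow n ({..<n} - {i}) x i (Suc k))"
  if x: "x : space MX - (A \<union> A')" and g: "good_event r d L i x" for x
 proof (rule A'(3)[OF _ g A(3)[OF _ g]])
  show "x : space MX - A'" "x : space MX - A" using x by auto
 qed
 ultimately show ?case using sets.Un[OF A(1) A'(1)] by blast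
qed
moreover have "(SUM k<m. ?b * (sqrt (b (Suc k)) + 1 / real n) / r ^ (4 * k)) <=
 ?b * (2 * u + real d * (?a / r ^ (4 * d)))"
proof -
 have "(SUM k<m. (sqrt (b (Suc k)) + 1 / real n) / r ^ (4 * k)) <= (SUM k<m. u * (1/2) ^ k + ?a / r ^ (4 * d))"
 proof (rule sum_mono)
  fix k assume "k : {..<m}"
  hence kd: "4 * k <= 4 * d" using m by auto
  have "(sqrt (b (Suc k)) + 1 / real n) / r ^ (4 * k) <= (u ^ Suc k + ?a) / r ^ (4 * k)"
   using sqb[of "Suc k"] r by (intro divide_right_mono) auto
  also have "... = u ^ Suc k / r ^ (4 * k) + ?a / r ^ (4 * k)" by (rule add_divide_distrib)
  also have "u ^ Suc k / r ^ (4 * k) = u * (u / r ^ 4) ^ k" by (simp add: power_divide power_mult)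
  also have "... <= u * (1/2) ^ k" using u r by (intro mult_left_mono power_mono) (auto simp: pos_divide_le_eq)
  also have "?a / r ^ (4 * k) <= ?a / r ^ (4 * d)"
   using be r kd by (intro divide_left_mono power_decreasing) auto
  finally show "(sqrt (b (Suc k)) + 1 / real n) / r ^ (4 * k) <= u * (1/2) ^ k + ?a / r ^ (4 * d)" by simp
 qed
 also have "... = u * (SUM k<m. (1/2) ^ k) + real m * (?a / r ^ (4 * d))" by (simp add: sum.distrib sum_distrib_left)
 also have "... <= u * 2 + real d * (?a / r ^ (4 * d))"
 proof (intro add_mono mult_left_mono mult_right_mono)
  have "(SUM k<m. (1/2::real) ^ k) = 2 * (1 - (1/2) ^ m)" by (simp add: sum_gp_strict)
  thus "(SUM k<m. (1/2::real) ^ k) <= 2" by simp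
 qed (use m u be r in auto)
 finally have "?b * (SUM k<m. (sqrt (b (Suc k)) + 1 / real n) / r ^ (4 * k)) <=
  ?b * (u * 2 + real d * (?a / r ^ (4 * d)))" using sc by (intro mult_left_mono) auto
 thus ?thesis by (simp add: sum_distrib_left mult.commute)
qed
ultimately show ?thesis unfolding be_def by (meson order.trans)
qed

text \<open>Coordinates below the threshold contribute at most s/2 altogether, and every other one
  at most b.\<close>

lemma card_large_ge:
assumes b: "b > 0" and s: "s > 0" and le: "s <= snorm n b v"
shows "s / (2 * b) <= real (card {m. m < n & s / (2 * real n) <= (cmod (v m))^2})"
proof -
define G where "G = {m. m < n & s / (2 * real n) <= (cmod (v m))^2}"
have "snorm n b v <= (SUM m<n. (if m : G then b else 0) + s / (2 * real n))" unfolding snorm_def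
proof (rule sum_mono)
 fix m assume "m : {..<n}"
 show "soft_sq b (v m) <= (if m : G then b else 0) + s / (2 * real n)"
 proof (cases "m : G")
  case True
  thus ?thesis using soft_sq_le[OF b, of "v m"] s by (simp add: add_increasing2)
 next
  case False
  hence "(cmod (v m))^2 <= s / (2 * real n)" using \<open>m : {..<n}\<close> by (auto simp: G_def)
  thus ?thesis using soft_sq_le_sq[OF b, of "v m"] False by simp
 qed
qed
also have "... = real (card G) * b + s / 2"
proof -
 have "{..<n} \<inter> {m. m : G} = G" by (auto simp: G_def)
 thus ?thesis using n_pos by (simp add: sum.distrib sum.If_cases)
qed
finally have "s / 2 <= real (card G) * b" using le by linarith
thus ?thesis unfolding G_def[symmetric] using b by (simp add: field_simps)
qed

end

text \<open>With h = z g one has Q = Q_R (1 - h), and the traces change by D = z h' / (1 - h), so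
  that z h' = D - D h. Coefficient m + 1 of z h' is m + 1 times the wanted form, while D h is
  quadratic in the small series h = (Q_R - Q) / Q_R.\<close>

lemma row_form_near_trace:
fixes x :: "entries" and n i m :: nat
defines "R \<equiv> {..<n} - {i}"
assumes i: "i < n" and r: "0 < r" "r <= 1"
 and L: "tnorm r (Suc m) (ichs n R x) <= L"
 and e: "tnorm r (Suc m) (chs n {..<n} x - chs n R x) <= e" "e * L <= 1 / 2"
 and T: "cmod (trs n {..<n} x $ Suc m) <= t"
shows "cmod ((SUM l<n. x i l * rpow n R x i m l) - (- trs n R x $ Suc m / of_nat (Suc m))) <= t + 2 * (e * L)^2 / r ^ Suc m"
proof -
define d where "d = Suc m"
have r0: "r >= 0" using r by simp
have iR: "i ~: R" "insert i R = {..<n}" using i by (auto simp: R_def)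
define g where "g = lin_form n (x i) (resv n R x i)"
define h where "h = fps_X * g"
let ?b = "fps_X * fps_deriv h"
have XD: "?b $ l = of_nat l * h $ l" for l by (cases l) auto
define q q' be be' where "q = chs n R x" and "q' = chs n {..<n} x"
 and "be = ichs n R x" and "be' = ichs n {..<n} x"
have inv: "q * be = 1" "q' * be' = 1" by (simp_all add: q_def q'_def be_def be'_def)
have q': "q' = q * (1 - h)" unfolding q_def q'_def h_def g_def using chs_insert_factor[OF iR(1) i] by (simp add: iR)
define D where "D = trs n {..<n} x - trs n R x"
have D: "D * (1 - h) = fps_X * fps_deriv (h)" unfolding D_def h_def g_def using trs_insert[OF iR(1) i] by (simp add: iR)
have Xg: "h = - ((q' - q) * be)"
proof -
 have "(q' - q) * be = (q * be) * (- (h))" unfolding q' by (simp add: algebra_simps)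
 thus ?thesis using inv by simp
qed
have L0: "L >= 0" "e >= 0" using order.trans[OF tnorm_nonneg[OF r0] L] order.trans[OF tnorm_nonneg[OF r0] e(1)] by auto
have nXg: "tnorm r d (h) <= e * L" unfolding Xg tnorm_minus
 using e(1) L L0 r0 by (intro order.trans[OF tnorm_mult[OF r0]] mult_mono) (auto simp: q_def q'_def be_def d_def)
define w where "w = q * be'"
have w: "(1 - h) * w = 1"
proof -
 have "(1 - h) * w = q' * be'" unfolding w_def q' by (simp only: mult_ac)
 thus ?thesis using inv(2) by (rule trans)
qed
have nw: "tnorm r d w <= 2"
proof -
 have "(1 - h) * 1 - 1 = - h" by simp
 hence "tnorm r d ((1 - h) * 1 - 1) = tnorm r d h" by (simp only: tnorm_minus)
 hence "tnorm r d ((1 - h) * 1 - 1) <= 1 / 2" using nXg e(2) by linarith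
 from tnorm_inverse_le[OF r0 w this] show ?thesis by simp
qed
have "D = D * ((1 - h) * w)" using w by simp
also have "... = (D * (1 - h)) * w" by (simp only: mult.assoc)
also have "... = fps_X * fps_deriv (h) * w" unfolding D ..
finally have Dw: "D = fps_X * fps_deriv (h) * w" .
have "?b $ d = of_nat d * g $ m" unfolding XD by (simp add: d_def h_def)
moreover have "fps_X * fps_deriv (h) = D - D * (h)" unfolding D[symmetric] by (simp add: algebra_simps)
ultimately have gm: "of_nat d * g $ m = D $ d - (D * h) $ d" by (metis fps_sub_nth)
have nd: "tnorm r d (fps_X * fps_deriv (h)) <= real d * tnorm r d (h)" unfolding tnorm_def sum_distrib_left
proof (rule sum_mono)
 fix l assume "l : {..d}"
 have "cmod ((fps_X * fps_deriv (h)) $ l) * r ^ l = real l * (cmod ((h) $ l) * r ^ l)" unfolding XD by (simp add: norm_mult)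
 also have "... <= real d * (cmod ((h) $ l) * r ^ l)" using \<open>l : {..d}\<close> r0 by (intro mult_right_mono) auto
 finally show "cmod ((fps_X * fps_deriv (h)) $ l) * r ^ l <= real d * (cmod ((h) $ l) * r ^ l)" .
qed
let ?a = "g $ m - (- trs n R x $ d / of_nat d)"
have "cmod ((D * (h)) $ d) * r ^ d <= tnorm r d (D * (h))" by (rule tnorm_nth[OF r0 order.refl])
also have "... <= tnorm r d D * tnorm r d (h)" by (rule tnorm_mult[OF r0])
also have "tnorm r d D <= (real d * (e * L)) * 2"
proof -
 have "tnorm r d ?b <= real d * (e * L)" using nXg by (intro order.trans[OF nd] mult_left_mono) auto
 moreover have "tnorm r d D <= tnorm r d ?b * tnorm r d w" by (subst Dw) (rule tnorm_mult[OF r0])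
 moreover have "tnorm r d ?b * tnorm r d w <= (real d * (e * L)) * 2"
  using calculation(1) nw L0 r0 by (intro mult_mono) auto
 ultimately show ?thesis by linarith
qed
hence "tnorm r d D * tnorm r d (h) <= (real d * (e * L)) * 2 * (e * L)" using nXg r0 L0 by (intro mult_mono) auto
finally have "cmod ((D * (h)) $ d) <= real d * (2 * (e * L)^2 / r ^ d)" using r by (simp add: pos_le_divide_eq power2_eq_square mult_ac)
moreover have "of_nat d * ?a = trs n {..<n} x $ d - (D * (h)) $ d"
  proof -
 have "of_nat d * ?a = of_nat d * g $ m + trs n R x $ d"
  by (simp add: distrib_left d_def del: of_nat_Suc)
 thus ?thesis unfolding gm by (simp add: D_def)
qed
hence "real d * cmod ?a = cmod (trs n {..<n} x $ d - (D * (h)) $ d)" by (metis norm_mult norm_of_nat)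
ultimately have "real d * cmod ?a <= t + real d * (2 * (e * L)^2 / r ^ d)"
 using T norm_triangle_ineq4[of "trs n {..<n} x $ d" "(D * (h)) $ d"] unfolding d_def by linarith
also have "t <= real d * t" using order.trans[OF norm_ge_zero T] by (simp add: d_def algebra_simps)
finally have "real d * cmod ?a <= real d * (t + 2 * (e * L)^2 / r ^ d)" by (simp only: distrib_left)
hence "cmod ?a <= t + 2 * (e * L)^2 / r ^ d" by (simp add: d_def del: of_nat_Suc)
moreover have "g $ m = (SUM l<n. x i l * rpow n R x i m l)" unfolding g_def by (simp add: lin_form_nth resv_def)
ultimately show ?thesis by (simp add: d_def)
qed

context entry_law
begin

lemma anorm_mom:
assumes r: "0 < r" "r < 1" and R: "R <= {..<n}" and i: "i ~: R" "i < n"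
shows "(NE x. (anorm r d n (adj n R x i))^2) <= ennreal (3 / (1 - r) ^ 3)"
proof -
have m2: "(%x. sqnorm n (%m. adj n R x i m $ l)) : bmeas MX" for l by (intro measurable_sqnorm measurable_series R)
have "(NE x. (anorm r d n (adj n R x i))^2) = (NE x. SUM l<=d. r ^ l * sqnorm n (%m. adj n R x i m $ l))"
 by (simp only: anorm_sq[OF less_imp_le[OF r(1)]])
also have "... <= ennreal (SUM l<=d. r ^ l * (real l + 1))"
 using r by (intro nn_integral_weighted_sum_le m2 adj_mom_le[OF R i, unfolded adj_mom_def]) auto
also have "... <= ennreal (3 / (1 - r) ^ 3)"
proof (rule ennreal_leI)
 have "(SUM l<=d. r ^ l * (real l + 1)) <= (SUM l<=d. r ^ l + r ^ l * (real l * (real l + 1)))"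
  using r by (intro sum_mono) (auto simp: algebra_simps)
 also have "... <= 1 / (1 - r) + 2 / (1 - r) ^ 3" unfolding sum.distrib
 proof (rule add_mono)
  show "(SUM l<=d. r ^ l) <= 1 / (1 - r)" using r by (intro sum_geometric_le) auto
 qed (use r in \<open>intro sum_power_square_le, auto\<close>)
 also have "1 / (1 - r) <= 1 / (1 - r) ^ 3" using r power_decreasing[of 1 3 "1 - r"] by (intro divide_left_mono) auto
 finally show "(SUM l<=d. r ^ l * (real l + 1)) <= 3 / (1 - r) ^ 3" by simp
qed
finally show ?thesis .
qed

lemma prob_real_gt_le:
assumes X: "X : bmeas MX" and X0: "!!x. X x >= 0"
 and le: "(NE x. (X x)^2) <= ennreal C" and a: "a > 0" "C >= 0"
shows "{x : space MX. X x > a} : P.events"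
 and "P.prob {x : space MX. X x > a} <= C / a^2"
proof -
show "{x : space MX. X x > a} : P.events" using X by measurable
have "P.prob {x : space MX. cmod (complex_of_real (X x)) > a} <= C / a^2"
 using a le by (intro prob_norm_gt_le measurable_compose[OF X borel_measurable_of_real]) auto
thus "P.prob {x : space MX. X x > a} <= C / a^2" using X0 by simp
qed

lemma measurable_char_diff_norm:
assumes "R <= {..<n}" "S <= {..<n}"
shows "(%x. tnorm r d (chs n R x - chs n S x)) : bmeas MX"
by (rule measurable_tnorm) (unfold fps_sub_nth, intro borel_measurable_diff measurable_series assms)

text \<open>Conditionally on all rows but \<open>i\<close>, the vector \<open>W\<close> and the
  centre \<open>a\<close> are constants, so the bound for one row integrates.\<close>

lemma prob_small_ball:
assumes i: "i < n" and W: "!!m. m < n ==> (%x. W x m) : bmeas MX"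
 and Wi: "!!x y. W (x(i := y)) = W x"
 and a: "a : bmeas MX" "!!x y. a (x(i := y)) = a x"
 and bound: "!!v c. s <= snorm n b v ==> measure RW {y : space RW. cmod ((SUM m<n. y m * v m) - c) <= eps} <= B" and B: "B >= 0"
defines "F \<equiv> {x : space MX. s <= snorm n b (W x) & cmod ((SUM m<n. x i m * W x m) - a x) <= eps}"
shows "F : P.events" and "P.prob F <= B"
proof -
have sm: "(%x. snorm n b (W x)) : bmeas MX"
 unfolding snorm_def by (intro borel_measurable_sum measurable_compose[OF W measurable_soft_sq]) auto
have lm: "(%x. (SUM m<n. x i m * W x m) - a x) : bmeas MX"
 by (intro borel_measurable_diff borel_measurable_sum borel_measurable_times measurable_entry[OF i] W a) auto
show F: "F : P.events" unfolding F_def using sm lm by measurable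
have "emeasure MX F = (\<integral>\<^sup>+x. indicator F x \<partial>MX)" using F by simp
also have "... = (\<integral>\<^sup>+x. \<integral>\<^sup>+y. indicator F (x(i := y)) \<partial>RW \<partial>MX)"
 by (rule nn_integral_resample[OF i]) (use F in simp)
also have "... <= (\<integral>\<^sup>+x. ennreal B \<partial>MX)"
proof (rule nn_integral_mono)
 fix x
 show "(\<integral>\<^sup>+y. indicator F (x(i := y)) \<partial>RW) <= ennreal B"
 proof (cases "s <= snorm n b (W x)")
  case True
  define S where "S = {y : space RW. cmod ((SUM m<n. y m * W x m) - a x) <= eps}"
  have "(%y. (SUM m<n. y m * W x m) - a x) : bmeas RW"
   by (intro borel_measurable_diff borel_measurable_sum borel_measurable_times measurable_row_component borel_measurable_const) auto
  hence S: "S : R.events" unfolding S_def by measurable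
  have "(\<integral>\<^sup>+y. indicator F (x(i := y)) \<partial>RW) <= (\<integral>\<^sup>+y. indicator S y \<partial>RW)"
   by (rule nn_integral_mono) (auto simp: F_def S_def Wi a(2) indicator_def)
  also have "... = ennreal (R.prob S)" using S by (simp add: R.emeasure_eq_measure)
  also have "... <= ennreal B" unfolding S_def by (intro ennreal_leI bound True)
  finally show ?thesis .
 next
  case False
  hence "indicator F (x(i := y)) = (0 :: ennreal)" for y by (simp add: F_def Wi indicator_def)
  thus ?thesis by simp
 qed
qed
also have "... = ennreal B" by (simp add: P.emeasure_space_1)
finally show "P.prob F <= B" using B by (simp add: P.emeasure_eq_measure)
qed

end

section \<open>Lower bound for the spectral radius\<close>

context sparse_laws
begin

text \<open>Q and its version without row 0 differ so little that a bounded inverse of the one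
  bounds the inverse of the other. \<open>L\<close> does not depend on \<open>d\<close>, which will
  grow like log n; only the exceptional set does.\<close>

lemma good_event_prob:
assumes r: "0 < r" "r < 1" and p: "p > 0"
shows "\<exists>L\<ge>1. eventually (%n. \<forall>d. \<exists>A\<in>sets (matrix_law (mu n) n). Pr n A <= p &
 (\<forall>x\<in>Om n - A. tnorm r d (ichs n ({..<n} - {0}) x) <= L / 2 & anorm r d n (adj n ({..<n} - {0}) x 0) <= L / 2)) sequentially"
proof -
obtain L0 where L0: "L0 > 0" and ev: "eventually (%n. Pr n {x : Om n. \<exists>d. tnorm r d (ichs n {..<n} x) > L0} <= p / 3) sequentially"
 using ichs_bounded[OF r, of "p / 3"] p by auto
define c1 where "c1 = 2 / (1 - r) ^ 4"
define c2 where "c2 = 3 / (1 - r) ^ 3"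
have c: "c1 > 0" "c2 > 0" using r by (auto simp: c1_def c2_def)
define L where "L = max 1 (max (4 * L0) (sqrt (12 * c2 / p)))"
have L: "1 <= L" "4 * L0 <= L" "sqrt (12 * c2 / p) <= L" by (auto simp: L_def)
have Lsq: "12 * c2 / p <= L^2" using L(3) sqrt_le_D by blast
have ev2: "eventually (%n. real n >= 12 * L0^2 * c1 / p) sequentially" using filterlim_real_sequentially by (auto simp: filterlim_at_top)
have "eventually (%n. \<forall>d. \<exists>A\<in>sets (matrix_law (mu n) n). Pr n A <= p &
 (\<forall>x\<in>Om n - A. tnorm r d (ichs n ({..<n} - {0}) x) <= L / 2 & anorm r d n (adj n ({..<n} - {0}) x 0) <= L / 2)) sequentially"
 using ev ev2 eventually_ge_at_top[of 1]
proof eventually_elim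
 case (elim n)
 interpret entry_law "mu n" n by (rule law[OF elim(3)])
 show ?case
 proof (rule allI)
  fix d
  let ?R = "{..<n} - {0}"
  have R: "?R <= {..<n}" "0 ~: ?R" "0 < n" "0 : {..<n}" using n_pos by auto
  define A1 where "A1 = {x : Om n. \<exists>d. tnorm r d (ichs n {..<n} x) > L0}"
  define A2 where "A2 = {x : Om n. tnorm r d (chs n {..<n} x - chs n ?R x) > 1 / (2 * L0)}"
  define A3 where "A3 = {x : Om n. anorm r d n (adj n ?R x 0) > L / 2}"
  have A1: "A1 : P.events" unfolding A1_def
   using measurable_tnorm[of "%x. ichs n {..<n} x", OF measurable_series(2)[OF order.refl]] by measurable
  have r0: "r >= 0" using r by simp
  have a2: "0 < 1 / (2 * L0)" using L0 by simp
  have a3: "0 < L / 2" using L by simp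
  note m2 = measurable_char_diff_norm[OF order.refl R(1), of r d]
  have m3: "(%x. anorm r d n (adj n ?R x 0)) : bmeas (matrix_law (mu n) n)" by (intro measurable_anorm measurable_series R)
  have c10: "0 <= c1 / real n" using c by simp
  note p2 = prob_real_gt_le[OF m2 tnorm_nonneg[OF r0] char_diff_norm_mom[OF r order.refl R(4), of d, folded c1_def] a2 c10, folded A2_def]
  note p3 = prob_real_gt_le[OF m3 anorm_nonneg[OF r0] anorm_mom[OF r R(1-3), of d, folded c2_def] a3 less_imp_le[OF c(2)], folded A3_def]
  have "P.prob A2 <= p / 3"
  proof -
   have "c1 / real n / (1 / (2 * L0))^2 = 4 * L0^2 * c1 / real n" by (simp add: power2_eq_square)
   also have "... <= p / 3" using elim(2) p n_pos by (simp add: field_simps)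
   finally show ?thesis using p2(2) by linarith
  qed
  moreover have "P.prob A3 <= p / 3"
  proof -
   have "c2 / (L / 2)^2 = 4 * c2 / L^2" by (simp add: power_divide)
   also have "... <= p / 3" using Lsq p L(1) by (simp add: field_simps)
   finally show ?thesis using p3(2) by linarith
  qed
  moreover have "P.prob (A1 \<union> A2 \<union> A3) <= P.prob A1 + P.prob A2 + P.prob A3"
   using measure_Un_le[OF sets.Un[OF A1 p2(1)] p3(1)] measure_Un_le[OF A1 p2(1)] by linarith
  ultimately have pr: "P.prob (A1 \<union> A2 \<union> A3) <= p" using elim(1) unfolding A1_def by linarith
  have "tnorm r d (ichs n ?R x) <= L / 2 & anorm r d n (adj n ?R x 0) <= L / 2" if x: "x : Om n - (A1 \<union> A2 \<union> A3)" for x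
  proof
   show "anorm r d n (adj n ?R x 0) <= L / 2" using x by (auto simp: A3_def not_less)
   have b: "tnorm r d (ichs n {..<n} x) <= L0" using x by (auto simp: A1_def not_less)
   have e: "tnorm r d (chs n ?R x - chs n {..<n} x) <= 1 / (2 * L0)" using x by (subst tnorm_diff_commute) (auto simp: A2_def not_less)
   have eq: "chs n ?R x * ichs n {..<n} x - 1 = (chs n ?R x - chs n {..<n} x) * ichs n {..<n} x" by (simp add: left_diff_distrib)
   have "tnorm r d (chs n ?R x * ichs n {..<n} x - 1) <= 1 / (2 * L0) * L0"
    unfolding eq using r0 L0 by (intro order.trans[OF tnorm_mult[OF r0]] mult_mono e b) auto
   hence "tnorm r d (chs n ?R x * ichs n {..<n} x - 1) <= 1 / 2" using L0 by simp
   from tnorm_inverse_le[OF r0 chs_mult_inv this] show "tnorm r d (ichs n ?R x) <= L / 2" using b L(2) by linarith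
  qed
  thus "\<exists>A\<in>sets (matrix_law (mu n) n). Pr n A <= p &
   (\<forall>x\<in>Om n - A. tnorm r d (ichs n ?R x) <= L / 2 & anorm r d n (adj n ?R x 0) <= L / 2)"
   using pr sets.Un[OF sets.Un[OF A1 p2(1)] p3(1)] by blast
 qed
qed
thus ?thesis using L(1) by blast
qed

text \<open>The resolution N of the Fejer kernel is of order y sqrt K_n. One error term then
  vanishes as K_n grows, and the other two are made small through y and through the radius parameter
  Z.\<close>

lemma small_ball_bound:
assumes al: "al > 0" and p: "p > 0"
shows "\<exists>Z>0. eventually (%n. \<forall>rho>0. \<forall>v a. al * real n <= real (card {m. m < n & rho / (4 * real n) <= (cmod (v m))^2}) -->
 measure (row_law (mu n) n) {y : space (row_law (mu n) n). cmod ((SUM m<n. y m * v m) - a) <= sqrt (rho / (16 * real n * Z^2))} <= p) sequentially"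
proof -
obtain A where A: "A > 0" and tl: "!!n. n >= 1 ==>
  real n * (\<integral>y. (if cmod y > A / sqrt (real (K n)) then (cmod y)^2 else 0) \<partial>mu n) <= 1 / 8"
 using tail[of "1 / 8"] by auto
\<comment> \<open>This value makes the exponent in \<open>small_ball_row\<close> at least 9 / p, as
  18432 = 9 * 16 * 32 * 4, and Z below then gives 32 / (y Z) = p / 9.\<close>
define y where "y = sqrt (p * al / (18432 * A^2))"
have y: "y > 0" "y^2 = p * al / (18432 * A^2)" using al p A by (auto simp: y_def)
define Z where "Z = 288 / (p * y)"
have Z: "Z > 0" using p y by (simp add: Z_def)
have Kr: "filterlim (%n. sqrt (real (K n))) at_top sequentially"
 by (rule filterlim_compose[OF sqrt_at_top filterlim_compose[OF filterlim_real_sequentially K_lim]])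
hence evK: "eventually (%n. sqrt (real (K n)) >= 288 / (p * y)) sequentially" "eventually (%n. sqrt (real (K n)) >= 1 / y) sequentially"
 by (auto simp: filterlim_at_top)
have "eventually (%n. \<forall>rho>0. \<forall>v a. al * real n <= real (card {m. m < n & rho / (4 * real n) <= (cmod (v m))^2}) -->
 measure (row_law (mu n) n) {y : space (row_law (mu n) n). cmod ((SUM m<n. y m * v m) - a) <= sqrt (rho / (16 * real n * Z^2))} <= p) sequentially"
 using evK eventually_ge_at_top[of 1]
proof eventually_elim
 case (elim n)
 interpret entry_law "mu n" n by (rule law[OF elim(3)])
 interpret D: prob_space "mu n \<Otimes>\<^sub>M mu n" by (rule prob_pair_mu)
 define k where "k = real (K n)"
 define q where "q = sqrt k"
 have k: "k > 0" using K_pos[OF elim(3)] by (simp add: k_def)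
 have q: "q > 0" "q^2 = k" using k by (auto simp: q_def)
 have nr: "real n > 0" using n_pos by simp
 \<comment> \<open>The truncated second moment of a difference is at least 1/n, while differences
   with square below 1/(4 k) contribute at most half of that because of sparsity. The rest comes
   from larger differences, each contributing at most 4 A^2 / k.\<close>
 have mass: "k / (8 * A^2 * real n) <= D.prob {d : space (mu n \<Otimes>\<^sub>M mu n). 1 / (4 * k) <= (cmod (fst d - snd d))^2}" (is "_ <= ?P")
 proof -
  have a0: "0 <= A / sqrt (real (K n))" using A by simp
  have a4: "4 * (A / sqrt (real (K n)))^2 <= 4 * A^2 / k" using k by (simp add: k_def power_divide)
  have "2 * (1 - 4 * (1 / 8)) / real n <= (LINT p|(mu n \<Otimes>\<^sub>M mu n). trunc_sq (4 * A^2 / k) (fst p - snd p))"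
   by (rule trunc_sq_integral_ge[OF tl[OF elim(3)] a0 a4])
  also have "... <= 2 * (1 / (4 * k)) * measure (mu n) {y : space (mu n). y ~= 0} + 4 * A^2 / k * ?P"
   using k by (intro trunc_sq_integral_le) auto
  also have "measure (mu n) {y : space (mu n). y ~= 0} <= k / real n"
  proof -
   have "space (mu n) = UNIV" using sets_eq_imp_space_eq[OF sets_mu] by simp
   thus ?thesis using support[OF elim(3)] by (simp add: k_def)
  qed
  hence "2 * (1 / (4 * k)) * measure (mu n) {y : space (mu n). y ~= 0} <= 2 * (1 / (4 * k)) * (k / real n)"
   using k by (intro mult_left_mono) auto
  also have "2 * (1 / (4 * k)) * (k / real n) = 1 / (2 * real n)" using k by simp
  finally have "1 / (2 * real n) <= 4 * A^2 / k * ?P" by (simp add: field_simps)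
  hence "1 / (2 * real n) * (k / (4 * A^2)) <= 4 * A^2 / k * ?P * (k / (4 * A^2))" using k A by (intro mult_right_mono) auto
  thus ?thesis using k A by (simp add: mult_ac)
 qed
 define N where "N = nat \<lceil>y * q\<rceil>"
 have yq: "1 <= y * q" using elim(2) y by (simp add: q_def k_def field_simps)
 have N: "N >= 1" "y * q <= real N" "real N <= 2 * (y * q)" unfolding N_def using yq by linarith+
 show ?case
 proof (intro allI impI)
  fix rho :: real and v :: "nat => complex" and a :: complex
  assume rho: "rho > 0" and card: "al * real n <= real (card {m. m < n & rho / (4 * real n) <= (cmod (v m))^2})"
  define eps where "eps = sqrt (rho / (16 * real n * Z^2))"
  have eps: "eps > 0" "eps^2 = rho / (16 * real n * Z^2)" using rho nr Z by (auto simp: eps_def)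
  have z0: "0 < Z / q" "(Z / q)^2 <= rho / (4 * real n) * (1 / (4 * k)) / eps^2"
   using Z q rho nr k unfolding eps(2) by (auto simp: power_divide field_simps)
  have "measure (row_law (mu n) n) {y : space (row_law (mu n) n). cmod ((SUM m<n. y m * v m) - a) <= eps} <=
   exp 1 * (8 * (4 + 4 / (Z / q)) / real N + exp (- (al * real n * (k / (8 * A^2 * real n)) / 2) / (32 * (real N)^2)))"
   by (rule small_ball_row[OF eps(1) _ _ _ _ N(1) card mass z0]) (use rho nr k al A in auto)
  also have "... <= 3 * (p / 9 + p / 9 + p / 9)"
  proof (intro mult_mono)
   show "exp 1 <= (3::real)" using e_less_272 by simp
   have "8 * (4 + 4 / (Z / q)) / real N <= 8 * (4 + 4 / (Z / q)) / (y * q)" using N yq Z q by (intro divide_left_mono) auto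
   also have "... = 32 / (y * q) + 32 / (y * Z)" using y q Z by (simp add: field_simps)
   also have "32 / (y * Z) = p / 9" using y p by (simp add: Z_def)
   also have "32 / (y * q) <= p / 9" using elim(1) y p q by (simp add: q_def k_def field_simps)
   finally have 1: "8 * (4 + 4 / (Z / q)) / real N <= p / 9 + p / 9" by simp
   define t where "t = (al * real n * (k / (8 * A^2 * real n)) / 2) / (32 * (real N)^2)"
   have "9 / p <= t"
   proof -
    have "(real N)^2 <= (2 * (y * q))^2" using N by (intro power_mono) auto
    also have "... = 4 * (y^2 * k)" by (simp add: power_mult_distrib q)
    finally have N2: "(real N)^2 <= 4 * (y^2 * k)" .
    have "9 / p = (al * k / (16 * A^2)) / (32 * (4 * (y^2 * k)))" unfolding y(2) using p al A k by (simp add: field_simps)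
    also have "... <= (al * k / (16 * A^2)) / (32 * (real N)^2)"
    proof (intro divide_left_mono mult_left_mono mult_pos_pos N2)
     show "0 < (real N)^2" "0 < y^2" using N(1) y(1) by auto
    qed (use al A k in auto)
    also have "... = t" unfolding t_def using nr by simp
    finally show ?thesis .
   qed
   moreover have "t + 1 <= exp t" using exp_ge_add_one_self[of t] by linarith
   ultimately have "9 / p <= exp t" by linarith
   hence "exp (- t) <= p / 9" using p by (simp add: exp_minus field_simps)
   thus "8 * (4 + 4 / (Z / q)) / real N + exp (- (al * real n * (k / (8 * A^2 * real n)) / 2) / (32 * (real N)^2)) <= p / 9 + p / 9 + p / 9"
    using 1 unfolding t_def by (simp only: minus_divide_left)
  qed (use Z q in \<open>auto intro!: add_nonneg_nonneg divide_nonneg_nonneg\<close>)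
  finally show "measure (row_law (mu n) n) {y : space (row_law (mu n) n). cmod ((SUM m<n. y m * v m) - a) <= sqrt (rho / (16 * real n * Z^2))} <= p"
   by (simp add: eps_def)
 qed
qed
thus ?thesis using Z by blast
qed

text \<open>In terms of h = n^(1/64): the m steps cost rho = r^m >= r / h^2, so the coordinates of W
  have size sqrt (rho / n), at least of order h^(-33). The deviation of the row form from its centre
  is of order h^(-54), far below. Every constant is absorbed into a spare power of h.\<close>

lemma spectral_radius_lower:
assumes eps: "0 < eps" "eps < 1" and p: "p > 0"
shows "eventually (%n. \<exists>A\<in>sets (matrix_law (mu n) n). Pr n A <= p &
 {x : Om n. spectral_radius (mat n n (%(i, j). x i j)) <= 1 - eps} <= A) sequentially"
proof -
\<comment> \<open>The 64th root keeps the loss a small power of n: (1 - eps)^m is about n^(-2), so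
  r^m is about n^(-1/32).\<close>
define r where "r = root 64 (1 - eps)"
have r: "0 < r" "r < 1" "r ^ 64 = 1 - eps" using eps by (auto simp: r_def)
obtain L where L: "L >= 1" and evG: "eventually (%n. \<forall>d. \<exists>A\<in>sets (matrix_law (mu n) n). Pr n A <= p / 4 &
 (\<forall>x\<in>Om n - A. tnorm r d (ichs n ({..<n} - {0}) x) <= L / 2 & anorm r d n (adj n ({..<n} - {0}) x 0) <= L / 2)) sequentially"
 using good_event_prob[OF r(1,2), of "p / 4"] p by auto
define eta where "eta = (1 - r) / 12"
define C where "C = 1 / (eta * r)"
have eta: "0 < eta" "eta <= 1/12" using r by (auto simp: eta_def)
have C: "C > 0" using eta r by (simp add: C_def)
define SC where "SC = step_const r L"
have SC: "SC >= 0" using r L by (simp add: SC_def step_const_def cut_const_def)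
obtain Z where Z: "Z > 0" and evZ: "eventually (%n. \<forall>rho>0. \<forall>v a. 1 / (4 * (C + 1)) * real n <= real (card {m. m < n & rho / (4 * real n) <= (cmod (v m))^2}) -->
 measure (row_law (mu n) n) {y : space (row_law (mu n) n). cmod ((SUM m<n. y m * v m) - a) <= sqrt (rho / (16 * real n * Z^2))} <= p / 4) sequentially"
 using small_ball_bound[of "1 / (4 * (C + 1))" "p / 4"] p C by auto
\<comment> \<open>The first two terms serve the hypotheses of \<open>iterate_steps\<close>, the
  third the probability p/8. The last one makes u^(2 m) at most rho / n^2, so that the final scale b
  is of order rho / n.\<close>
define u where "u = min (r ^ 4 / 2) (min (eta ^ 3 * r ^ 3 / (2 * L ^ 6)) (min (p / (16 * (SC + 1))) (r * (1 - eps))))"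
have u: "0 < u" "u <= r ^ 4 / 2" "u * (2 * L ^ 6) <= eta ^ 3 * r ^ 3" "SC * (2 * u) <= p / 8" "u^2 <= r * (1 - eps)"
proof -
 show u0: "0 < u" using r eta L p SC eps by (auto simp: u_def)
 show "u <= r ^ 4 / 2" unfolding u_def by (rule min.cobounded1)
 have "u <= eta ^ 3 * r ^ 3 / (2 * L ^ 6)" by (simp add: u_def)
 thus "u * (2 * L ^ 6) <= eta ^ 3 * r ^ 3" using L by (subst (asm) pos_le_divide_eq) auto
 have "u <= p / (16 * (SC + 1))" by (simp add: u_def)
 hence "(SC + 1) * (16 * u) <= p" using SC by (subst (asm) pos_le_divide_eq) (auto simp: mult_ac)
 thus "SC * (2 * u) <= p / 8" using u0 by (simp add: distrib_right)
 have "u <= r * (1 - eps)" by (simp add: u_def)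
 moreover have "u <= 1" using \<open>u <= r ^ 4 / 2\<close> r power_le_one[of r 4] by linarith
 hence "u * u <= u * 1" using u0 by (intro mult_left_mono) auto
 ultimately show "u^2 <= r * (1 - eps)" unfolding power2_eq_square by linarith
qed
obtain A where A: "A > 0" and tl: "!!n. n >= 1 ==>
  real n * (\<integral>y. (if cmod y > A / sqrt (real (K n)) then (cmod y)^2 else 0) \<partial>mu n) <= eta / 4"
 using tail[of "eta / 4"] eta by auto
define c1 where "c1 = 2 / (1 - r) ^ 4"
have c1: "c1 > 0" using r by (simp add: c1_def)
\<comment> \<open>Each of H1 to H4 is the constant of one estimate below. Once h is at least H, a
  spare power of h absorbs it.\<close>
define H1 where "H1 = 2 * sqrt C * L ^ 6 / (eta ^ 3 * r ^ 6)"
define H2 where "H2 = 8 * SC * (sqrt C + 1) / (p * (1 - r) * r ^ 10)"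
define H3 where "H3 = 8 * c1 / p"
define H4 where "H4 = (1 + L^2 / r^2) * (4 * Z) / r"
define H where "H = max 1 (max L (max H1 (max H2 (max H3 H4))))"
have H: "1 <= H" "L <= H" "H1 <= H" "H2 <= H" "H3 <= H" "H4 <= H" by (auto simp: H_def)
have evn: "eventually (%n. real n >= H ^ 64) sequentially" "eventually (%n. real n >= 1 / eta) sequentially"
 using filterlim_real_sequentially by (auto simp: filterlim_at_top)
have evK: "eventually (%n. real (K n) >= 8 * A^2 / u^2) sequentially"
 using filterlim_compose[OF filterlim_real_sequentially K_lim] by (auto simp: filterlim_at_top)
show ?thesis using evG evZ evn evK eventually_ge_at_top[of 2]
proof eventually_elim
 case (elim n)
 have n1: "n >= 1" using elim(6) by simp
 interpret entry_law "mu n" n by (rule law[OF n1])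
 let ?R = "{..<n} - {0}"
 have R: "?R <= {..<n}" "0 ~: ?R" "0 < n" "0 : {..<n}" "{..<n} - {0} = ?R" using n_pos by auto
 (* The scales below are integral powers of h. *)
 define h where "h = root 64 (real n)"
 have hn: "real n = h ^ 64" by (simp add: h_def)
 have hH: "H <= h"
 proof -
  have "root 64 (H ^ 64) <= root 64 (real n)" using elim(3) by simp
  thus ?thesis using H(1) by (simp add: h_def real_root_power_cancel)
 qed
 hence h1: "1 <= h" using H(1) by linarith
 have h0: "h > 0" using h1 by simp
 have hq: "h ^ a * X / h ^ (a + b) = X / h ^ b" for a b and X :: real using h0 by (simp add: power_add)
 have hpow: "X <= h ^ k" if "X <= H" "k >= 1" for X k using that hH h1 power_increasing[of 1 k h] by simp
 define m where "m = (LEAST m. (1 - eps) ^ m <= 1 / (real n)^2)"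
 have ex: "\<exists>m. (1 - eps) ^ m <= 1 / (real n)^2"
 proof -
  have "\<exists>m. (1 - eps) ^ m < 1 / (real n)^2" by (rule real_arch_pow_inv) (use eps n_pos in auto)
  thus ?thesis by (auto intro: less_imp_le)
 qed
 have m: "(1 - eps) ^ m <= 1 / (real n)^2" unfolding m_def by (rule LeastI_ex[OF ex])
 have "m ~= 0"
 proof
  assume "m = 0"
  hence "1 <= 1 / (real n)^2" using m by simp
  hence "(real n)^2 <= 1" using n_pos by (simp add: pos_le_divide_eq)
  moreover have "2^2 <= (real n)^2" using elim(6) by (intro power_mono) auto
  ultimately show False by simp
 qed
 then obtain m' where m': "m = Suc m'" by (cases m) auto
 \<comment> \<open>Minimality of m bounds (1 - eps)^(m - 1), and with it rho, from below.\<close>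
 have "~ (1 - eps) ^ m' <= 1 / (real n)^2" using not_less_Least[of m' "%m. (1 - eps) ^ m <= 1 / (real n)^2"] m' unfolding m_def by simp
 hence m'2: "1 / (real n)^2 < (1 - eps) ^ m'" by simp
 define rho where "rho = r ^ m"
 define d where "d = Suc m"
 have rho: "0 < rho" "rho <= 1" using r by (auto simp: rho_def power_le_one)
 have rhoh: "r / h^2 <= rho"
 proof -
  have "(r / h^2) ^ 64 = (1 - eps) * (1 / (real n)^2)" unfolding hn power_divide r(3) by (simp flip: power_mult)
  also have "... <= (1 - eps) * (1 - eps) ^ m'" using m'2 eps by (intro mult_left_mono) auto
  also have "... = (1 - eps) ^ m" unfolding m' by (rule power_Suc[symmetric])
  also have "... = rho ^ 64" unfolding rho_def r(3)[symmetric] by (simp only: power_mult[symmetric] mult.commute)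
  finally show ?thesis using rho power_mono_iff[of "r / h^2" rho 64] r h0 by simp
 qed
 have dh: "r^2 / h^2 <= r ^ d" using mult_left_mono[OF rhoh, of r] r by (simp add: d_def rho_def power2_eq_square)
 have nn: "sqrt (C / real n) = sqrt C / h ^ 32"
 proof -
  have "sqrt (h ^ 64) = h ^ 32" using h0 by (intro real_sqrt_unique) (auto simp flip: power_mult)
  thus ?thesis by (simp add: real_sqrt_divide hn)
 qed
 have cb: "sqrt (C / real n) * (2 * L ^ 6) <= eta ^ 3 * r ^ (3 * d)"
 proof -
  have "sqrt C * (2 * L ^ 6) <= H1 * (eta ^ 3 * r ^ 6)" using eta r by (simp add: H1_def)
  also have "... <= h ^ 26 * (eta ^ 3 * r ^ 6)" using eta r by (intro mult_right_mono hpow[OF H(3)]) auto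
  finally have "sqrt C * (2 * L ^ 6) / h ^ 32 <= h ^ 26 * (eta ^ 3 * r ^ 6) / h ^ 32" using h0 by (intro divide_right_mono) auto
  also have "... = eta ^ 3 * (r^2 / h^2) ^ 3"
  proof -
   have "h ^ 26 * (eta ^ 3 * r ^ 6) / h ^ 32 = eta ^ 3 * r ^ 6 / h ^ 6" using hq[of 26 "eta ^ 3 * r ^ 6" 6] by simp
   thus ?thesis by (simp add: power_divide flip: power_mult)
  qed
  also have "... <= eta ^ 3 * (r ^ d) ^ 3" using eta r h0 dh by (intro mult_left_mono power_mono) auto
  also have "(r ^ d) ^ 3 = r ^ (3 * d)" by (simp add: mult.commute flip: power_mult)
  finally show ?thesis by (simp add: nn)
 qed
 have cc: "SC * (real d * ((sqrt (C / real n) + 1 / real n) / r ^ (4 * d))) <= p / 8"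
 proof -
  have "real d * r ^ d <= (SUM k<d. r ^ k)"
  proof -
   have "(SUM k<d. r ^ d) <= (SUM k<d. r ^ k)" using r by (intro sum_mono power_decreasing) auto
   thus ?thesis by simp
  qed
  also have "... <= 1 / (1 - r)" using r by (intro sum_geometric_le) auto
  finally have d1: "real d * r ^ d <= 1 / (1 - r)" .
  have s1: "sqrt (C / real n) + 1 / real n <= (sqrt C + 1) / h ^ 32"
  proof -
   have "1 / h ^ 64 <= 1 / h ^ 32" using h1 by (intro divide_left_mono power_increasing) auto
   thus ?thesis unfolding nn by (simp add: hn add_divide_distrib)
  qed
  have r5: "r ^ (4 * d) * r ^ d = (r ^ d) ^ 5" by (simp add: mult.commute flip: power_mult power_add)
  have lo: "r ^ 10 / h ^ 10 <= (r ^ d) ^ 5"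
  proof -
   have "r ^ 10 / h ^ 10 = (r^2 / h^2) ^ 5" by (simp add: power_divide flip: power_mult)
   also have "... <= (r ^ d) ^ 5" using dh r by (intro power_mono) auto
   finally show ?thesis .
  qed
  have "SC * (real d * ((sqrt (C / real n) + 1 / real n) / r ^ (4 * d))) =
   SC * (sqrt (C / real n) + 1 / real n) * (real d * r ^ d) / (r ^ d) ^ 5" unfolding r5[symmetric] using r by simp
  also have "... <= SC * ((sqrt C + 1) / h ^ 32) * (1 / (1 - r)) / (r ^ 10 / h ^ 10)"
   using s1 d1 lo SC C r h0 by (intro frac_le mult_mono mult_left_mono mult_nonneg_nonneg) auto
  also have "... = SC * (sqrt C + 1) / ((1 - r) * r ^ 10) / h ^ 22"
  proof -
   define G where "G = SC * (sqrt C + 1) / ((1 - r) * r ^ 10)"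
   have "SC * ((sqrt C + 1) / h ^ 32) * (1 / (1 - r)) / (r ^ 10 / h ^ 10) = h ^ 10 * G / h ^ 32" by (simp add: G_def mult_ac)
   also have "... = G / h ^ 22" using hq[of 10 G 22] by simp
   finally show ?thesis by (simp only: G_def)
  qed
  also have "... = H2 * (p / 8) / h ^ 22" using p by (simp add: H2_def)
  also have "... <= h ^ 22 * (p / 8) / h ^ 22" using p h0 by (intro divide_right_mono mult_right_mono hpow[OF H(4)]) auto
  also have "... = p / 8" using h0 by simp
  finally show ?thesis .
 qed
 define b where "b = (u^2) ^ m + C * r ^ m / real n"
 have b: "b > 0" using u(1) C r n_pos by (auto simp: b_def intro!: add_pos_pos)
 have bC: "b <= (C + 1) * rho / real n"
 proof -
  have "(u^2) ^ m <= (r * (1 - eps)) ^ m" using u by (intro power_mono) auto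
  also have "... = rho * (1 - eps) ^ m" by (simp add: power_mult_distrib rho_def)
  also have "... <= rho * (1 / (real n)^2)" using m rho by (intro mult_left_mono) auto
  also have "... <= rho * (1 / real n)" using rho n1 by (intro mult_left_mono divide_left_mono) (auto simp: power2_eq_square)
  finally show ?thesis by (simp add: b_def rho_def add_divide_distrib distrib_right)
 qed
 have "\<exists>A\<in>P.events. P.prob A <= step_const r L * (2 * u + real d * ((sqrt (C / real n) + 1 / real n) / r ^ (4 * d))) &
  (\<forall>x\<in>Om n - A. tnorm r d (ichs n ?R x) <= L / 2 & anorm r d n (adj n ?R x 0) <= L / 2 -->
   r ^ m / 2 <= snorm n b (rpow n ?R x 0 m))" unfolding b_def C_def eta_def
 proof (rule iterate_steps[OF r(1,2) L R(3) u(1,2)])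
  show "u * (2 * L ^ 6) <= ((1 - r) / 12) ^ 3 * r ^ 3" using u(3) by (simp add: eta_def)
  have "1 / eta <= real n" by (rule elim(4))
  thus "1 <= (1 - r) / 12 * real n" using eta unfolding eta_def[symmetric] by (simp add: pos_divide_le_eq mult.commute)
  show "sqrt (1 / ((1 - r) / 12 * r) / real n) * (2 * L ^ 6) <= ((1 - r) / 12) ^ 3 * r ^ (3 * d)" using cb unfolding C_def eta_def .
  show "m <= d" by (simp add: d_def)
  fix B assume B: "u^2 / 2 <= B"
  have k: "real (K n) > 0" using K_pos[OF n1] by simp
  have "4 * (A / sqrt (real (K n)))^2 = 4 * A^2 / real (K n)" using k by (simp add: power_divide)
  also have "... <= u^2 / 2"
  proof -
   have "8 * A^2 <= real (K n) * u^2" using elim(5) u(1) by (simp add: pos_divide_le_eq)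
   thus ?thesis using k by (simp add: pos_divide_le_eq mult.commute)
  qed
  finally have B4: "4 * (A / sqrt (real (K n)))^2 <= B" using B by linarith
  have "2 * (1 - 4 * (eta / 4)) / real n <= (LINT p|(mu n \<Otimes>\<^sub>M mu n). trunc_sq B (fst p - snd p))"
   by (rule trunc_sq_integral_ge[OF tl[OF n1] _ B4]) (use A in simp)
  moreover have "4 * (eta / 4) = eta" by simp
  ultimately show "2 * (1 - (1 - r) / 12) / real n <= (LINT p|(mu n \<Otimes>\<^sub>M mu n). trunc_sq B (fst p - snd p))" by (simp only: eta_def)
 qed
 then obtain A2 where A2: "A2 : P.events" "P.prob A2 <= SC * (2 * u + real d * ((sqrt (C / real n) + 1 / real n) / r ^ (4 * d)))"
  and A2': "!!x. x : Om n - A2 ==> tnorm r d (ichs n ?R x) <= L / 2 ==> anorm r d n (adj n ?R x 0) <= L / 2 ==>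
   rho / 2 <= snorm n b (rpow n ?R x 0 m)" unfolding SC_def rho_def by blast
 have pA2: "P.prob A2 <= p / 4" using A2(2) u(4) cc unfolding distrib_left by linarith
 obtain A1 where A1: "A1 : P.events" "P.prob A1 <= p / 4"
  and A1': "!!x. x : Om n - A1 ==> tnorm r d (ichs n ?R x) <= L / 2 & anorm r d n (adj n ?R x 0) <= L / 2" using elim(1) by blast
 \<comment> \<open>Q and Q_R typically differ by n^(-1/2) = h^(-32). The larger value e = h^(-28)
   makes a violation improbable, of order h^(-8), and its square is still far below sqrt (rho /
   n).\<close>
 define e where "e = 1 / h ^ 28"
 have e: "e > 0" using h0 by (simp add: e_def)
 define A3 where "A3 = {x : Om n. tnorm r d (chs n {..<n} x - chs n ?R x) > e}"
 have r0: "r >= 0" using r by simp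
 have c10: "0 <= c1 / real n" using c1 by simp
 note p3 = prob_real_gt_le[OF measurable_char_diff_norm[OF order.refl R(1), of r d] tnorm_nonneg[OF r0]
   char_diff_norm_mom[OF r(1,2) order.refl R(4), of d, folded c1_def] e c10, folded A3_def]
 have pA3: "P.prob A3 <= p / 8"
 proof -
  have "c1 / real n / e^2 = c1 / h ^ 8"
  proof -
   have "c1 / real n / e^2 = h ^ 56 * c1 / h ^ 64" by (simp add: e_def hn power_divide flip: power_mult)
   thus ?thesis using hq[of 56 c1 8] by simp
  qed
  also have "... = H3 * (p / 8) / h ^ 8" using p by (simp add: H3_def)
  also have "... <= h ^ 8 * (p / 8) / h ^ 8" using p h0 by (intro divide_right_mono mult_right_mono hpow[OF H(5)]) auto
  also have "... = p / 8" using h0 by simp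
  finally show ?thesis using p3(2) by linarith
 qed
 define W where "W x l = rpow n ?R x 0 m l" for x l
 define a where "a x = - trs n ?R x $ Suc m / of_nat (Suc m)" for x
 define dl where "dl = sqrt (rho / (16 * real n * Z^2))"
 define F where "F = {x : Om n. rho / 2 <= snorm n b (W x) & cmod ((SUM l<n. x 0 l * W x l) - a x) <= dl}"
 have F: "F : P.events" "P.prob F <= p / 4"
 proof -
  have Wm: "(%x. W x l) : bmeas (matrix_law (mu n) n)" for l using measurable_series(5)[OF R(1), of 0 l m] by (simp add: W_def resv_def)
  have Wi: "W (x(0 := y)) = W x" for x y
  proof -
   have "rpow n ?R (x(0 := y)) 0 m l = rpow n ?R x 0 m l" for l unfolding rpow_eq by simp
   thus ?thesis unfolding W_def by (intro ext)
  qed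
  have am: "a : bmeas (matrix_law (mu n) n)"
   unfolding a_def fps_neg_nth by (intro borel_measurable_divide borel_measurable_uminus borel_measurable_const measurable_series(4)[OF R(1)])
  have ai: "a (x(0 := y)) = a x" for x y unfolding a_def by simp
  have bd: "measure (row_law (mu n) n) {y : space (row_law (mu n) n). cmod ((SUM m<n. y m * v m) - c) <= dl} <= p / 4"
   if v: "rho / 2 <= snorm n b v" for v c
  proof -
   have "1 / (4 * (C + 1)) * real n = rho / 2 / (2 * ((C + 1) * rho / real n))" using rho C n_pos by simp
   also have "... <= rho / 2 / (2 * b)" using bC b rho C n_pos by (intro divide_left_mono) auto
   also have "... <= real (card {m. m < n & rho / 2 / (2 * real n) <= (cmod (v m))^2})" by (rule card_large_ge[OF b _ v]) (use rho in simp)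
   finally have "1 / (4 * (C + 1)) * real n <= real (card {m. m < n & rho / (4 * real n) <= (cmod (v m))^2})" by simp
   thus ?thesis using elim(2) rho(1) unfolding dl_def by blast
  qed
  have p0: "0 <= p / 4" using p by simp
  show "F : P.events" unfolding F_def by (rule prob_small_ball(1)[OF R(3) Wm Wi am ai bd p0])
  show "P.prob F <= p / 4" unfolding F_def by (rule prob_small_ball(2)[OF R(3) Wm Wi am ai bd p0])
 qed
 let ?A = "A1 \<union> A2 \<union> A3 \<union> F"
 have Am: "?A : P.events" by (intro sets.Un A1 A2 p3 F)
 have "P.prob ?A <= P.prob A1 + P.prob A2 + P.prob A3 + P.prob F"
  using measure_Un_le[OF sets.Un[OF sets.Un[OF A1(1) A2(1)] p3(1)] F(1)] measure_Un_le[OF sets.Un[OF A1(1) A2(1)] p3(1)]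
   measure_Un_le[OF A1(1) A2(1)] by linarith
 hence pA: "P.prob ?A <= p" using A1(2) pA2 pA3 F(2) p by linarith
 have "x : ?A" if x: "x : Om n" and sr: "spectral_radius (mat n n (%(i, j). x i j)) <= 1 - eps" for x
 proof (rule ccontr)
  assume nx: "x ~: ?A"
  have g: "tnorm r d (ichs n ?R x) <= L / 2" "anorm r d n (adj n ?R x 0) <= L / 2" using A1'[of x] x nx by auto
  have sp: "rho / 2 <= snorm n b (rpow n ?R x 0 m)" using A2'[of x] x nx g by auto
  have e1: "tnorm r d (chs n {..<n} x - chs n ?R x) <= e" using x nx by (auto simp: A3_def not_less)
  have e2: "e * (L / 2) <= 1 / 2"
  proof -
   have "L <= h ^ 28" by (rule hpow[OF H(2)]) simp
   thus ?thesis using h0 by (simp add: e_def)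
  qed
  have T: "cmod (trs n {..<n} x $ Suc m) <= 1 / real n"
  proof -
   have "cmod (trs n {..<n} x $ Suc m) <= real n * (1 - eps) ^ Suc m" by (rule norm_trs_le[OF sr n_pos])
   also have "... <= real n * (1 - eps) ^ m" using eps by (intro mult_left_mono power_decreasing) auto
   also have "... <= real n * (1 / (real n)^2)" using m by (intro mult_left_mono) auto
   also have "... = 1 / real n" by (simp add: power2_eq_square)
   finally show ?thesis .
  qed
  have "cmod ((SUM l<n. x 0 l * W x l) - a x) <= 1 / real n + 2 * (e * (L / 2))^2 / r ^ Suc m"
   unfolding W_def a_def using r g e1 unfolding d_def by (intro row_form_near_trace[OF R(3) _ _ _ _ e2 T]) auto
  also have "... <= dl"
  proof -
   have "1 / real n <= 1 / h ^ 54" unfolding hn using h1 by (intro divide_left_mono power_increasing) auto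
   moreover have "2 * (e * (L / 2))^2 / r ^ Suc m <= L^2 / r^2 / h ^ 54"
   proof -
    have "2 * (e * (L / 2))^2 / r ^ d <= 2 * (e * (L / 2))^2 / (r^2 / h^2)" using dh r h0 by (intro divide_left_mono) auto
    also have "... = (L^2 / r^2 / h ^ 54) / 2"
    proof -
     have "2 * (e * (L / 2))^2 / (r^2 / h^2) = h^2 * (L^2 / r^2 / 2) / h ^ 56"
      by (simp add: e_def power_mult_distrib power_divide mult_ac flip: power_mult)
     thus ?thesis using hq[of 2 "L^2 / r^2 / 2" 54] by simp
    qed
    also have "(L^2 / r^2 / h ^ 54) / 2 <= L^2 / r^2 / h ^ 54"
    proof -
     have half: "t / 2 <= t" if "0 <= t" for t :: real using that by simp
     show ?thesis by (rule half) (use h0 in simp)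
    qed
    finally show ?thesis by (simp add: d_def)
   qed
   ultimately have "1 / real n + 2 * (e * (L / 2))^2 / r ^ Suc m <= (1 + L^2 / r^2) / h ^ 54" unfolding add_divide_distrib by linarith
   also have "... = H4 * (r / (4 * Z)) / h ^ 54" using Z r by (simp add: H4_def)
   also have "... <= h ^ 21 * (r / (4 * Z)) / h ^ 54" using Z r h0 by (intro divide_right_mono mult_right_mono hpow[OF H(6)]) auto
   also have "... = r / (4 * Z * h ^ 33)" using hq[of 21 "r / (4 * Z)" 33] by simp
   also have "... <= dl" unfolding dl_def
   proof (rule real_le_rsqrt)
    have "(r / (4 * Z * h ^ 33))^2 = (r^2 / h^2) / (16 * real n * Z^2)"
    proof -
     have e66: "(h ^ 33)^2 = h^2 * h ^ 64" by (simp flip: power_mult power_add)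
     show ?thesis unfolding hn power_divide power_mult_distrib e66 by (simp add: mult_ac)
    qed
    also have "... <= rho / (16 * real n * Z^2)"
    proof (rule divide_right_mono)
     have "r^2 / h^2 <= r / h^2" using r by (intro divide_right_mono) (auto simp: power2_eq_square mult_left_le)
     thus "r^2 / h^2 <= rho" using rhoh by linarith
    qed simp
    finally show "(r / (4 * Z * h ^ 33))^2 <= rho / (16 * real n * Z^2)" .
   qed
   finally show ?thesis .
  qed
  finally have "x : F" using sp x unfolding F_def W_def by simp
  thus False using nx by simp
 qed
 thus ?case using pA Am by (intro bexI[of _ ?A]) auto
qed
qed

end

section \<open>From independent entries to the product law\<close>

text \<open>Each family is i.i.d. and the two are independent of each other, so their joint law is a
  product of products; on a box the integral then factorises over the index set by Tonelli.\<close>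

lemma (in prob_space) distr_products:
fixes X Y :: "'i => 'a => complex" and h :: "complex \<times> complex => complex"
assumes I: "finite I" "I ~= {}"
 and indX: "indep_vars (%_. borel) X I" and indY: "indep_vars (%_. borel) Y I"
 and dX: "!!i. i : I ==> distr M borel (X i) = al" and dY: "!!i. i : I ==> distr M borel (Y i) = be"
 and ind: "indep_var (PiM I (%_. borel)) (%om. \<lambda>i\<in>I. X i om) (PiM I (%_. borel)) (%om. \<lambda>i\<in>I. Y i om)"
 and h: "h : bmeas (borel \<Otimes>\<^sub>M borel)"
defines "mu \<equiv> distr (al \<Otimes>\<^sub>M be) borel h"
shows "distr M (PiM I (%_. mu)) (%om. \<lambda>i\<in>I. h (X i om, Y i om)) = PiM I (%_. mu)"
proof -
obtain i0 where i0: "i0 : I" using I by blast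
have rvX: "random_variable borel (X i)" if "i : I" for i using indX that by (auto simp: indep_vars_def)
have rvY: "random_variable borel (Y i)" if "i : I" for i using indY that by (auto simp: indep_vars_def)
have al: "prob_space al" "sets al = sets borel" unfolding dX[OF i0, symmetric] by (rule prob_space_distr[OF rvX[OF i0]]) simp
have be: "prob_space be" "sets be = sets borel" unfolding dY[OF i0, symmetric] by (rule prob_space_distr[OF rvY[OF i0]]) simp
interpret be: prob_space be by (rule be)
let ?b = "al \<Otimes>\<^sub>M be"
have sp: "sets ?b = sets (borel \<Otimes>\<^sub>M borel)" by (rule sets_pair_measure_cong[OF al(2) be(2)])
have hm: "h : bmeas ?b" using h measurable_cong_sets[OF sp refl] by blast
have spaces: "space al = UNIV" "space be = UNIV" using sets_eq_imp_space_eq[OF al(2)] sets_eq_imp_space_eq[OF be(2)] by simp_all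
have albe1: "emeasure ?b (space al \<times> space be) = 1"
 using prob_space.emeasure_space_1[OF al(1)] be.emeasure_space_1 by (subst be.emeasure_pair_measure_Times) auto
have palbe: "prob_space ?b" by (intro prob_spaceI) (use albe1 in \<open>simp add: space_pair_measure\<close>)
have mu: "prob_space mu" "sets mu = sets borel" unfolding mu_def by (rule prob_space.prob_space_distr[OF palbe hm]) simp
interpret PA: product_sigma_finite "%_. al" by (intro product_sigma_finite.intro prob_space_imp_sigma_finite al)
interpret PB: product_sigma_finite "%_. be" by (intro product_sigma_finite.intro prob_space_imp_sigma_finite be)
interpret PM: product_sigma_finite "%_. mu" by (intro product_sigma_finite.intro prob_space_imp_sigma_finite mu)
let ?c = "PiM I (%_. be)"
have sb: "prob_space ?c" by (rule prob_space_PiM) (rule be)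
define B where "B = PiM I (%_. borel :: complex measure)"
let ?a = "B \<Otimes>\<^sub>M B"
let ?d = "PiM I (%_. al)"
have law: "?d \<Otimes>\<^sub>M PiM I (%_. be) = distr M ?a (%om. (\<lambda>i\<in>I. X i om, \<lambda>i\<in>I. Y i om))"
proof -
 have "distr M B (%om. \<lambda>i\<in>I. X i om) = PiM I (%i. distr M borel (X i))"
  using indX indep_vars_iff_distr_eq_PiM'[where M' = "%_. borel" and X = X, OF I(2) rvX] unfolding B_def by blast
 also have "... = ?d" by (intro PiM_cong) (auto simp: dX)
 finally have 1: "distr M B (%om. \<lambda>i\<in>I. X i om) = ?d" .
 have "distr M B (%om. \<lambda>i\<in>I. Y i om) = PiM I (%i. distr M borel (Y i))"
  using indY indep_vars_iff_distr_eq_PiM'[where M' = "%_. borel" and X = Y, OF I(2) rvY] unfolding B_def by blast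
 also have "... = ?c" by (intro PiM_cong) (auto simp: dY)
 finally have 2: "distr M B (%om. \<lambda>i\<in>I. Y i om) = ?c" .
 show ?thesis using ind unfolding indep_var_distribution_eq B_def[symmetric] 1 2 by simp
qed
have fm: "(%om. (\<lambda>i\<in>I. X i om, \<lambda>i\<in>I. Y i om)) : measurable M ?a"
 unfolding B_def by (intro measurable_Pair measurable_restrict rvX rvY)
have hXY: "(%om. h (X i om, Y i om)) : bmeas M" if "i : I" for i
 by (rule measurable_compose[OF measurable_Pair[OF rvX[OF that] rvY[OF that]] h])
have hXYmu: "(%om. h (X i om, Y i om)) : measurable M mu" if "i : I" for i using hXY[OF that] measurable_cong_sets[OF refl mu(2)] by blast
show ?thesis
proof (rule PM.PiM_eqI[OF I(1)])
 fix E assume E: "!!i. i : I ==> E i : sets mu"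
 have E': "E i : sets borel" if "i : I" for i using E[OF that] mu(2) by simp
 define S where "S = {p : space ?a. \<forall>i\<in>I. h (fst p i, snd p i) : E i}"
 have cm: "(%p. h (fst p i, snd p i)) : bmeas ?a" if "i : I" for i unfolding B_def using that
  by (intro measurable_compose[OF measurable_Pair h] measurable_compose[OF measurable_fst measurable_component_singleton]
    measurable_compose[OF measurable_snd measurable_component_singleton])
 have S: "S : sets ?a"
 proof -
  have "S = (\<Inter>i\<in>I. {p : space ?a. h (fst p i, snd p i) : E i})" unfolding S_def using I by auto
  also have "... : sets ?a"
  proof (rule sets.finite_INT[OF I])
   fix i assume i: "i : I"
   have "(%p. h (fst p i, snd p i)) -` E i \<inter> space ?a : sets ?a"
    by (rule measurable_sets[OF cm[OF i] E'[OF i]])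
   also have "(%p. h (fst p i, snd p i)) -` E i \<inter> space ?a = {p : space ?a. h (fst p i, snd p i) : E i}" by auto
   finally show "{p : space ?a. h (fst p i, snd p i) : E i} : sets ?a" .
  qed
  finally show ?thesis .
 qed
 have sB: "sets (?d \<Otimes>\<^sub>M PiM I (%_. be)) = sets ?a"
  unfolding B_def by (intro sets_pair_measure_cong sets_PiM_cong) (auto simp: al be)
 have box: "Pi\<^sub>E I E : sets (PiM I (%_. mu))" using E I by (intro sets_PiM_I_finite) auto
 have rm: "(%om. \<lambda>i\<in>I. h (X i om, Y i om)) : measurable M (PiM I (%_. mu))" by (intro measurable_restrict hXYmu)
 have "emeasure (distr M (PiM I (%_. mu)) (%om. \<lambda>i\<in>I. h (X i om, Y i om))) (Pi\<^sub>E I E) =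
  emeasure M ((%om. (\<lambda>i\<in>I. X i om, \<lambda>i\<in>I. Y i om)) -` S \<inter> space M)"
 proof -
  have "(%om. \<lambda>i\<in>I. h (X i om, Y i om)) -` Pi\<^sub>E I E \<inter> space M = (%om. (\<lambda>i\<in>I. X i om, \<lambda>i\<in>I. Y i om)) -` S \<inter> space M"
   using measurable_space[OF fm] by (auto simp: S_def PiE_iff)
  thus ?thesis unfolding emeasure_distr[OF rm box] by (rule arg_cong)
 qed
 also have "... = emeasure (?d \<Otimes>\<^sub>M PiM I (%_. be)) S" unfolding law by (rule emeasure_distr[OF fm S, symmetric])
 also have "... = (\<integral>\<^sup>+a. \<integral>\<^sup>+b. indicator S (a, b) \<partial>?c \<partial>?d)"
  using S sB by (intro sigma_finite_measure.emeasure_pair_measure prob_space_imp_sigma_finite[OF sb]) simp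
 also have "... = (\<integral>\<^sup>+a. (PROD i:I. \<integral>\<^sup>+y. indicator (E i) (h (a i, y)) \<partial>be) \<partial>?d)"
 proof (rule nn_integral_cong)
  fix a assume a: "a : space ?d"
  have "(\<integral>\<^sup>+b. indicator S (a, b) \<partial>?c) = (\<integral>\<^sup>+b. (PROD i:I. indicator (E i) (h (a i, b i))) \<partial>?c)"
  proof (rule nn_integral_cong)
   fix b assume b: "b : space ?c"
   have "(a, b) : space ?a" using a b by (simp add: B_def space_pair_measure space_PiM spaces)
   hence "(a, b) : S \<longleftrightarrow> (\<forall>i\<in>I. h (a i, b i) : E i)" by (simp add: S_def)
   thus "(indicator S (a, b) :: ennreal) = (PROD i:I. indicator (E i) (h (a i, b i)))"
    using I(1) by (auto simp: indicator_def intro!: prod_zero[symmetric])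
  qed
  also have "... = (PROD i:I. \<integral>\<^sup>+y. indicator (E i) (h (a i, y)) \<partial>be)"
  proof (rule PB.product_nn_integral_prod[OF I(1)])
   fix i assume i: "i : I"
   have "(%y. h (a i, y)) : bmeas be" by (rule measurable_compose[OF measurable_Pair1' hm]) (simp add: spaces)
   thus "(%y. indicator (E i) (h (a i, y)) :: ennreal) : bmeas be" by (rule measurable_compose) (use E'[OF i] in simp)
  qed
  finally show "(\<integral>\<^sup>+b. indicator S (a, b) \<partial>?c) = (PROD i:I. \<integral>\<^sup>+y. indicator (E i) (h (a i, y)) \<partial>be)" .
 qed
 also have "... = (PROD i:I. \<integral>\<^sup>+x. \<integral>\<^sup>+y. indicator (E i) (h (x, y)) \<partial>be \<partial>al)"
 proof (rule PA.product_nn_integral_prod[OF I(1)])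
  fix i assume i: "i : I"
  have "(%p. indicator (E i) (h p) :: ennreal) : bmeas ?b"
   by (rule measurable_compose[OF hm]) (use E'[OF i] in simp)
  thus "(%x. \<integral>\<^sup>+y. indicator (E i) (h (x, y)) \<partial>be) : bmeas al"
   by (intro be.borel_measurable_nn_integral) (simp add: split_beta')
 qed
 also have "... = (PROD i:I. emeasure mu (E i))"
 proof (rule prod.cong[OF refl])
  fix i assume i: "i : I"
  have m: "(%p. indicator (E i) (h p) :: ennreal) : bmeas ?b"
   by (rule measurable_compose[OF hm]) (use E'[OF i] in simp)
  have "emeasure mu (E i) = (\<integral>\<^sup>+y. indicator (E i) y \<partial>mu)" using E[OF i] by simp
  also have "... = (\<integral>\<^sup>+p. indicator (E i) (h p) \<partial>?b)"
   unfolding mu_def by (rule nn_integral_distr[OF hm]) (use E'[OF i] in simp)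
  also have "... = (\<integral>\<^sup>+x. \<integral>\<^sup>+y. indicator (E i) (h (x, y)) \<partial>be \<partial>al)"
   by (rule be.nn_integral_fst[OF m, symmetric])
  finally show "(\<integral>\<^sup>+x. \<integral>\<^sup>+y. indicator (E i) (h (x, y)) \<partial>be \<partial>al) = emeasure mu (E i)" by simp
 qed
 finally show "emeasure (distr M (PiM I (%_. mu)) (%om. \<lambda>i\<in>I. h (X i om, Y i om))) (Pi\<^sub>E I E) = (PROD i:I. emeasure mu (E i))" .
qed simp
qed

definition nest :: "nat => (nat \<times> nat => complex) => nat => nat => complex" where
"nest n f = (\<lambda>i\<in>{..<n}. \<lambda>j\<in>{..<n}. f (i, j))"

text \<open>The coordinates are independent, and independence survives grouping them by rows. This
  is the passage from a product over positions to the nested product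
  \<open>matrix_law\<close>.\<close>

lemma distr_nest:
assumes mu: "prob_space mu" and n: "n > 0"
shows "nest n : measurable (PiM (positions n) (%_. mu)) (matrix_law mu n)"
 and "distr (PiM (positions n) (%_. mu)) (matrix_law mu n) (nest n) = matrix_law mu n"
proof -
let ?P = "PiM (positions n) (%_. mu)"
interpret P: prob_space ?P by (rule prob_space_PiM) (rule mu)
let ?a = "row_law mu n"
have rm: "(%f. \<lambda>j\<in>{..<n}. f (i, j)) : measurable ?P ?a" if "i < n" for i
 unfolding row_law_def using that by (intro measurable_restrict measurable_component_singleton) (auto simp: positions_def)
show nm: "nest n : measurable ?P (matrix_law mu n)" unfolding nest_def matrix_law_def by (intro measurable_restrict rm) auto
have dr: "distr ?P ?a (%f. \<lambda>j\<in>{..<n}. f (i, j)) = ?a" if "i < n" for i unfolding row_law_def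
 by (rule distr_PiM_reindex[of "positions n" "%_. mu" "Pair i" "{..<n}", OF mu]) (use that in \<open>auto simp: positions_def inj_on_def\<close>)
have "P.indep_vars (%_. mu) (%p f. f p) (positions n)"
proof -
 have "distr ?P ?P (%f. \<lambda>p\<in>positions n. f p) = distr ?P ?P (%f. f)"
  by (rule distr_cong) (auto simp: space_PiM PiE_def extensional_restrict)
 also have "... = ?P" by (rule distr_id2) simp
 also have "... = PiM (positions n) (%p. distr ?P mu (%f. f p))"
  by (intro PiM_cong) (auto simp: distr_PiM_component[of "positions n" "%_. mu", OF mu])
 finally have "distr ?P ?P (%f. \<lambda>p\<in>positions n. f p) = PiM (positions n) (%p. distr ?P mu (%f. f p))" .
 moreover have "positions n ~= {}" using n by (auto simp: positions_def)
 ultimately show ?thesis by (subst P.indep_vars_iff_distr_eq_PiM') (auto intro: measurable_component_singleton)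
qed
hence "P.indep_vars (%i. PiM ({i} \<times> {..<n}) (%_. mu)) (%i f. restrict (%p. f p) ({i} \<times> {..<n})) {..<n}"
 by (rule P.indep_vars_restrict) (auto simp: positions_def disjoint_family_on_def)
hence "P.indep_vars (%_. ?a) (%i f. (%g. \<lambda>j\<in>{..<n}. g (i, j)) (restrict (%p. f p) ({i} \<times> {..<n}))) {..<n}"
proof (rule P.indep_vars_compose2)
 fix i
 show "(%g. \<lambda>j\<in>{..<n}. g (i, j)) : measurable (PiM ({i} \<times> {..<n}) (%_. mu)) ?a"
  unfolding row_law_def by (intro measurable_restrict measurable_component_singleton) auto
qed
also have "(%i f. (%g. \<lambda>j\<in>{..<n}. g (i, j)) (restrict (%p. f p) ({i} \<times> {..<n}))) = (%i (f :: nat \<times> nat => complex). \<lambda>j\<in>{..<n}. f (i, j))"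
 by (intro ext) (simp add: restrict_def)
finally have "distr ?P (PiM {..<n} (%_. ?a)) (%f. \<lambda>i\<in>{..<n}. \<lambda>j\<in>{..<n}. f (i, j)) =
 PiM {..<n} (%i. distr ?P ?a (%f. \<lambda>j\<in>{..<n}. f (i, j)))"
 using P.indep_vars_iff_distr_eq_PiM'[where I = "{..<n}" and M' = "%_. ?a" and X = "%i f. \<lambda>j\<in>{..<n}. f (i, j)", OF _ rm] n by blast
also have "... = PiM {..<n} (%_. ?a)" by (intro PiM_cong) (auto simp: dr)
finally show "distr ?P (matrix_law mu n) (nest n) = matrix_law mu n" unfolding matrix_law_def nest_def .
qed

section \<open>Measurability of the spectral radius\<close>

lemma spectral_radius_mat_nonneg:
assumes "n > 0"
shows "spectral_radius (mat n n f :: complex mat) >= 0" using spectral_radius_mem_max(1)[of "mat n n f" n] assms by auto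

text \<open>The spectral radius is the inverse of the largest radius of discs on which 1/Q is
  bounded. Rational radii and integer bounds turn this into countably many conditions on the
  coefficients of 1/Q, which are measurable.\<close>

lemma spectral_radius_le_iff:
assumes n: "n > 0" and s: "s >= 0"
shows "spectral_radius (mat n n (%(i, j). x i j)) <= s \<longleftrightarrow>
 (\<forall>t::rat. s < real_of_rat t --> (\<exists>l::nat. \<forall>d. tnorm (1 / real_of_rat t) d (ichs n {..<n} x) <= real l))"
 (is "?rho <= s \<longleftrightarrow> _")
proof safe
fix t :: rat assume le: "?rho <= s" and t: "s < real_of_rat t"
define r where "r = 1 / real_of_rat t"
have t0: "real_of_rat t > 0" using s t by linarith
hence r: "r > 0" by (simp add: r_def)
have sr: "s * r < 1" using t t0 by (simp add: r_def)
have "tnorm r d (ichs n {..<n} x) <= exp (real n / (1 - s * r))" for d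
proof (rule order.trans[OF tnorm_ichs_le])
 have "(SUM j<d. cmod (trs n {..<n} x $ Suc j) * r ^ Suc j / real (Suc j)) <= (SUM j<d. real n * (s * r) ^ j)"
 proof (rule sum_mono)
  fix j
  have "cmod (trs n {..<n} x $ Suc j) * r ^ Suc j / real (Suc j) <= cmod (trs n {..<n} x $ Suc j) * r ^ Suc j / 1"
   using r by (intro divide_left_mono) auto
  also have "... <= real n * s ^ Suc j * r ^ Suc j / 1" using r by (intro divide_right_mono mult_right_mono norm_trs_le le n) auto
  also have "... = real n * (s * r) ^ Suc j" by (simp add: power_mult_distrib)
  also have "... <= real n * (s * r) ^ j" using s r sr by (intro mult_left_mono power_decreasing) auto
  finally show "cmod (trs n {..<n} x $ Suc j) * r ^ Suc j / real (Suc j) <= real n * (s * r) ^ j" .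
 qed
 also have "... = real n * (SUM j<d. (s * r) ^ j)" by (simp add: sum_distrib_left)
 also have "... <= real n * (1 / (1 - s * r))"
 proof (rule mult_left_mono)
  show "(SUM j<d. (s * r) ^ j) <= 1 / (1 - s * r)" using s r sr by (intro sum_geometric_le) auto
 qed simp
 finally show "exp (SUM j<d. cmod (trs n {..<n} x $ Suc j) * r ^ Suc j / real (Suc j)) <= exp (real n / (1 - s * r))" by simp
qed (use r in simp)
moreover obtain l :: nat where "exp (real n / (1 - s * r)) <= real l" using real_arch_simple by blast
ultimately show "\<exists>l::nat. \<forall>d. tnorm (1 / real_of_rat t) d (ichs n {..<n} x) <= real l"
 unfolding r_def[symmetric] by (intro exI[of _ l]) (meson order.trans)
next
assume H: "\<forall>t::rat. s < real_of_rat t --> (\<exists>l::nat. \<forall>d. tnorm (1 / real_of_rat t) d (ichs n {..<n} x) <= real l)"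
show "?rho <= s"
proof (rule ccontr)
 assume "~ ?rho <= s"
 then obtain q where q: "s < real_of_rat q" "real_of_rat q < ?rho" using of_rat_dense[of s ?rho] by auto
 from H q(1) obtain l :: nat where "\<forall>d. tnorm (1 / real_of_rat q) d (ichs n {..<n} x) <= real l" by blast
 moreover have q0: "real_of_rat q > 0" using s q by linarith
 ultimately have "?rho <= 1 / (1 / real_of_rat q)" using n by (intro spectral_radius_le_inverse[where L = "real l"]) auto
 thus False using q by simp
qed
qed

lemma measurable_spectral_radius:
assumes n: "n > 0" and g: "!!l m. l < n ==> m < n ==> (%w. g w l m) : bmeas M"
shows "(%w. spectral_radius (mat n n (%(i, j). g w i j))) : bmeas M"
proof (rule borel_measurableI_le)
fix s
have m: "(%w. tnorm r d (ichs n {..<n} (g w))) : bmeas M" for r d unfolding tnorm_def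
 by (intro borel_measurable_sum borel_measurable_times borel_measurable_const
   measurable_compose[OF measurable_ichs borel_measurable_norm]) (use g in auto)
show "{w : space M. spectral_radius (mat n n (%(i, j). g w i j)) <= s} : sets M"
proof (cases "s >= 0")
 case True
 have "{w : space M. \<forall>t::rat. s < real_of_rat t --> (\<exists>l::nat. \<forall>d. tnorm (1 / real_of_rat t) d (ichs n {..<n} (g w)) <= real l)} : sets M"
  using m by measurable
 thus ?thesis unfolding spectral_radius_le_iff[OF n True] .
next
 case False
 hence "{w : space M. spectral_radius (mat n n (%(i, j). g w i j)) <= s} = {}"
  using spectral_radius_mat_nonneg[OF n] by (auto simp: not_le intro: less_le_trans)
 thus ?thesis by (simp only: sets.empty_sets)
qed
qed

section \<open>The law of one sparse entry\<close>

definition sparse_law :: "complex measure => real => real => complex measure" where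
"sparse_law al p c = distr (al \<Otimes>\<^sub>M distr (measure_pmf (bernoulli_pmf p)) borel of_bool) borel
  (%(a, b). complex_of_real c * b * a)"

lemma integral_of_bool_bernoulli:
fixes F :: "complex => 'd :: {banach, second_countable_topology}"
assumes p: "0 <= p" "p <= 1" and F: "F : bmeas borel"
shows "(\<integral>b. F b \<partial>distr (measure_pmf (bernoulli_pmf p)) borel of_bool) = p *\<^sub>R F 1 + (1 - p) *\<^sub>R F 0"
proof -
have "(\<integral>b. F b \<partial>distr (measure_pmf (bernoulli_pmf p)) borel of_bool) = (\<integral>b. F (of_bool b) \<partial>measure_pmf (bernoulli_pmf p))"
 by (rule integral_distr[OF _ F]) simp
also have "... = (SUM b:UNIV. pmf (bernoulli_pmf p) b *\<^sub>R F (of_bool b))" by (rule integral_measure_pmf) auto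
also have "... = p *\<^sub>R F 1 + (1 - p) *\<^sub>R F 0" using p by (simp add: UNIV_bool)
finally show ?thesis .
qed

context
fixes al :: "complex measure" and p c :: real
assumes al: "prob_space al" "sets al = sets borel" and p: "0 <= p" "p <= 1"
begin

lemma prob_sparse_law: "prob_space (sparse_law al p c)" "sets (sparse_law al p c) = sets borel"
and sparse_law_integral: "!!f :: complex => 'c :: {banach, second_countable_topology}. f : bmeas borel ==>
  integrable al (%a. f (complex_of_real c * a)) ==> integrable (sparse_law al p c) f &
  integral\<^sup>L (sparse_law al p c) f = p *\<^sub>R (LINT a|al. f (complex_of_real c * a)) + (1 - p) *\<^sub>R f 0"
proof -
define be where "be = distr (measure_pmf (bernoulli_pmf p)) borel (of_bool :: bool => complex)"
have om: "(of_bool :: bool => complex) : bmeas (measure_pmf (bernoulli_pmf p))" by simp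
have be: "prob_space be" unfolding be_def by (rule measure_pmf.prob_space_distr[OF om])
have sbe: "sets be = sets borel" by (simp add: be_def)
interpret al: prob_space al by (rule al)
interpret be: prob_space be by (rule be)
interpret pair_prob_space al be ..
let ?c = "complex_of_real c"
define h where "h = (%(a, b). ?c * b * a)"
let ?b = "al \<Otimes>\<^sub>M be"
have sp: "sets ?b = sets (borel \<Otimes>\<^sub>M borel)" by (rule sets_pair_measure_cong[OF al(2) sbe])
have "h : bmeas (borel \<Otimes>\<^sub>M borel)" unfolding h_def by measurable
hence h: "h : bmeas ?b" using measurable_cong_sets[OF sp refl] by blast
let ?a = "sparse_law al p c"
have law: "?a = distr ?b borel h" by (simp add: sparse_law_def be_def h_def)
show "prob_space ?a" unfolding law by (rule prob_space_distr[OF h])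
show "sets ?a = sets borel" by (simp add: law)
fix f :: "complex => 'c"
assume fm: "f : bmeas borel" and fi: "integrable al (%a. f (?c * a))"
have fh: "(%x. f (h x)) : bmeas ?b" by (rule measurable_compose[OF h fm])
have fb: "(%b. f (h (a, b))) : bmeas borel" for a unfolding h_def split by (rule measurable_compose[OF _ fm]) simp
have inner: "(LINT b|be. F b) = p *\<^sub>R F 1 + (1 - p) *\<^sub>R F 0" if "F : bmeas borel"
 for F :: "complex => 'd :: {banach, second_countable_topology}" unfolding be_def by (rule integral_of_bool_bernoulli[OF p that])
have ib: "integrable be (%b. f (h (a, b)))" for a
 unfolding be_def using fb by (subst integrable_distr_eq[OF om]) (auto intro: integrable_measure_pmf_finite)
have "integrable ?b (%x. f (h x))"
proof (rule Fubini_integrable[OF fh])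
 have "(LINT b|be. norm (f (h (a, b)))) = p *\<^sub>R norm (f (?c * a)) + (1 - p) *\<^sub>R norm (f 0)" for a
  using inner[OF measurable_compose[OF fb[of a] borel_measurable_norm]] by (simp add: h_def)
 thus "integrable al (%a. (LINT b|be. norm (f (h (a, b)))))" using fi by simp
 show "AE a in al. integrable be (%b. f (h (a, b)))" using ib by simp
qed
note int = this
have "integrable ?a f" unfolding law using int by (subst integrable_distr_eq[OF h fm])
moreover have "integral\<^sup>L ?a f = p *\<^sub>R (LINT a|al. f (?c * a)) + (1 - p) *\<^sub>R f 0"
proof -
 have "integral\<^sup>L ?a f = (LINT x|?b. f (h x))" unfolding law by (rule integral_distr[OF h fm])
 also have "... = (LINT a|al. (LINT b|be. f (h (a, b))))" by (rule integral_fst'[OF int, symmetric])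
 also have "... = (LINT a|al. p *\<^sub>R f (?c * a) + (1 - p) *\<^sub>R f 0)" using inner[OF fb] by (simp add: h_def)
 also have "... = p *\<^sub>R (LINT a|al. f (?c * a)) + (1 - p) *\<^sub>R f 0" using fi by (simp add: al.prob_space)
 finally show ?thesis .
qed
ultimately show "integrable ?a f &
  integral\<^sup>L ?a f = p *\<^sub>R (LINT a|al. f (?c * a)) + (1 - p) *\<^sub>R f 0" by blast
qed

end

lemma integral_tail_small:
fixes al :: "complex measure"
assumes s: "sets al = sets borel" and i: "integrable al (%y. (cmod y)^2)" and dl: "dl > 0"
shows "\<exists>A>0. (LINT y|al. (if cmod y > A then (cmod y)^2 else 0)) <= dl"
proof -
have m: "f : bmeas al" if "f : bmeas borel" for f :: "complex => real" using that measurable_cong_sets[OF s refl] by blast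
have "(%k::nat. (LINT y|al. (if cmod y > real k then (cmod y)^2 else 0))) \<longlonglongrightarrow> (LINT y|al. 0)"
proof (rule integral_dominated_convergence[where w = "%y. (cmod y)^2"])
 show "(%y. if cmod y > real k then (cmod y)^2 else 0) : bmeas al" for k by (rule m) measurable
 show "AE y in al. (%k. if cmod y > real k then (cmod y)^2 else 0) \<longlonglongrightarrow> 0"
 proof (intro AE_I2 tendsto_eventually)
  fix y :: complex
  obtain k0 :: nat where "cmod y <= real k0" using real_arch_simple by blast
  thus "\<forall>\<^sub>F k in sequentially. (if cmod y > real k then (cmod y)^2 else 0) = 0"
   by (intro eventually_sequentiallyI[of k0]) auto
 qed
qed (use i in auto)
hence "\<forall>\<^sub>F k in sequentially. (LINT y|al. (if cmod y > real k then (cmod y)^2 else 0)) < dl & k > 0"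
 using dl by (intro eventually_conj order_tendstoD(2) eventually_gt_at_top) auto
then obtain k :: nat where "k > 0" "(LINT y|al. (if cmod y > real k then (cmod y)^2 else 0)) < dl"
 using eventually_happens'[OF sequentially_bot] by blast
thus ?thesis by (intro exI[of _ "real k"]) auto
qed

text \<open>The scaling gives the variance p c^2 = 1/n. An entry above A / sqrt K_n corresponds to a
  value of \<open>al\<close> above A, so the tail condition reduces to one tail integral of
  \<open>al\<close> that does not involve n.\<close>

lemma sparse_laws_sparse_law:
fixes al :: "complex measure" and K :: "nat => nat"
assumes al: "prob_space al" "sets al = sets borel"
 and m1: "integrable al (%y. y)" "(LINT y|al. y) = 0"
 and m2: "integrable al (%y. (cmod y)^2)" "(LINT y|al. (cmod y)^2) = 1"
 and K: "!!n. n >= 1 ==> 1 <= K n & K n <= n" and K_lim: "filterlim K at_top sequentially"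
shows "sparse_laws (%n. sparse_law al (real (K n) / real n) (1 / sqrt (real (K n)))) K"
proof -
interpret al: prob_space al by (rule al)
define p where "p n = real (K n) / real n" for n
define c where "c n = 1 / sqrt (real (K n))" for n
have p: "0 <= p n" "p n <= 1" if "n >= 1" for n using K[OF that] that by (auto simp: p_def)
have pc: "p n * (c n)^2 = 1 / real n" if "n >= 1" for n using K[OF that] by (simp add: p_def c_def power_divide)
have sq: "(cmod (complex_of_real (c n) * a))^2 = (c n)^2 * (cmod a)^2" for n a by (simp add: norm_mult power_mult_distrib)
note law = prob_sparse_law[OF al p] sparse_law_integral[OF al p]
have "sparse_laws (%n. sparse_law al (p n) (c n)) K"
proof (rule sparse_laws.intro)
 fix n :: nat assume n: "n >= 1"
 have id: "integrable (sparse_law al (p n) (c n)) (%y. (cmod y)^2) &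
  (\<integral>y. (cmod y)^2 \<partial>sparse_law al (p n) (c n)) = p n *\<^sub>R (LINT a|al. (cmod (complex_of_real (c n) * a))^2) + (1 - p n) *\<^sub>R (cmod 0)^2"
  by (rule law(3)[OF n n, where f = "%y. (cmod y)^2"]) (use m2(1) in \<open>simp_all add: sq\<close>)
 show "entry_law (sparse_law al (p n) (c n)) n"
 proof (rule entry_law.intro)
  show "prob_space (sparse_law al (p n) (c n))" by (rule law(1)[OF n n])
  show "sets (sparse_law al (p n) (c n)) = sets borel" by (rule law(2)[OF n n])
  show "n > 0" using n by simp
  show "integrable (sparse_law al (p n) (c n)) (%y. (cmod y)^2)" using id by blast
  show "(\<integral>y. (cmod y)^2 \<partial>sparse_law al (p n) (c n)) = 1 / real n" using id pc[OF n] by (simp add: sq m2)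
  have i: "integrable al (%a. complex_of_real (c n) * a)" by (rule integrable_mult_right) (rule m1(1))
  have "(LINT a|al. complex_of_real (c n) * a) = complex_of_real (c n) * (LINT a|al. a)"
   by (rule integral_mult_right_zero)
  hence 0: "(LINT a|al. complex_of_real (c n) * a) = 0" unfolding m1(2) mult_zero_right .
  show "(\<integral>y. y \<partial>sparse_law al (p n) (c n)) = 0"
   using conjunct2[OF law(3)[OF n n, where f = "%y. y", OF measurable_ident_sets[OF refl] i]] unfolding 0 scaleR_zero_right add_0_right .
 qed
 show "K n >= 1" using K[OF n] by blast
 have "integrable (sparse_law al (p n) (c n)) (indicator {y. y ~= 0} :: _ => real) &
  (\<integral>y. indicator {y. y ~= 0} y \<partial>sparse_law al (p n) (c n)) =
   p n *\<^sub>R (LINT a|al. indicator {y. y ~= 0} (complex_of_real (c n) * a)) + (1 - p n) *\<^sub>R (indicator {y. y ~= 0} (0::complex) :: real)"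
 proof (rule law(3)[OF n n, where f = "indicator {y. y ~= 0}"])
  have m: "(%a. indicator {y. y ~= 0} (complex_of_real (c n) * a) :: real) : bmeas borel" by measurable
  show "integrable al (%a. indicator {y. y ~= 0} (complex_of_real (c n) * a) :: real)"
  proof (rule al.integrable_const_bound[where B = 1])
   show "(%a. indicator {y. y ~= 0} (complex_of_real (c n) * a) :: real) : bmeas al" using m measurable_cong_sets[OF al(2) refl] by blast
  qed (auto split: split_indicator)
 qed measurable
 hence "measure (sparse_law al (p n) (c n)) {y. y ~= 0} = p n * (LINT a|al. indicator {y. y ~= 0} (complex_of_real (c n) * a))"
  using sets_eq_imp_space_eq[OF law(2)[OF n n]] by simp
 also have "... <= p n * 1"
 proof (rule mult_left_mono)
  have "(LINT a|al. indicator {y. y ~= 0} (complex_of_real (c n) * a)) <= (LINT a|al. (1::real))"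
   by (rule integral_mono') (auto split: split_indicator)
  thus "(LINT a|al. indicator {y. y ~= 0} (complex_of_real (c n) * a)) <= (1::real)" by (simp add: al.prob_space)
 qed (use p[OF n] in simp)
 finally show "measure (sparse_law al (p n) (c n)) {y. y ~= 0} <= real (K n) / real n" by (simp add: p_def)
next
 fix dl :: real assume "dl > 0"
 then obtain A where A: "A > 0" "(LINT y|al. (if cmod y > A then (cmod y)^2 else 0)) <= dl"
  using integral_tail_small[OF al(2) m2(1)] by blast
 have "real n * (\<integral>y. (if cmod y > A / sqrt (real (K n)) then (cmod y)^2 else 0) \<partial>sparse_law al (p n) (c n)) <= dl" if n: "n >= 1" for n
 proof -
  define f where "f = (%y. if cmod y > A / sqrt (real (K n)) then (cmod y)^2 else 0)"
  have fa: "f (complex_of_real (c n) * a) = (c n)^2 * (if cmod a > A then (cmod a)^2 else 0)" for a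
  proof -
   have "cmod (complex_of_real (c n) * a) = cmod a / sqrt (real (K n))" by (simp add: c_def norm_mult norm_divide)
   hence "A / sqrt (real (K n)) < cmod (complex_of_real (c n) * a) \<longleftrightarrow> A < cmod a"
    using K[OF n] by (simp add: divide_less_cancel)
   thus ?thesis unfolding f_def sq by simp
  qed
  have m: "(%y. if cmod y > A then (cmod y)^2 else 0) : bmeas al"
  proof -
   have "(%y. if cmod y > A then (cmod y)^2 else 0) : bmeas borel" by measurable
   thus ?thesis using measurable_cong_sets[OF al(2) refl] by blast
  qed
  have "integrable (sparse_law al (p n) (c n)) f &
   integral\<^sup>L (sparse_law al (p n) (c n)) f = p n *\<^sub>R (LINT a|al. f (complex_of_real (c n) * a)) + (1 - p n) *\<^sub>R f 0"
  proof (rule law(3)[OF n n, where f = f])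
   show "f : bmeas borel" unfolding f_def by measurable
   have "integrable al (%y. if cmod y > A then (cmod y)^2 else 0)" by (rule Bochner_Integration.integrable_bound[OF m2(1) m]) auto
   thus "integrable al (%a. f (complex_of_real (c n) * a))" unfolding fa by simp
  qed
  hence "integral\<^sup>L (sparse_law al (p n) (c n)) f = p n * (c n)^2 * (LINT y|al. (if cmod y > A then (cmod y)^2 else 0))"
   unfolding fa by (simp add: f_def)
  hence "real n * integral\<^sup>L (sparse_law al (p n) (c n)) f = (LINT y|al. (if cmod y > A then (cmod y)^2 else 0))"
   using n by (simp add: pc[OF n])
  thus ?thesis using A(2) unfolding f_def by simp
 qed
 thus "\<exists>A>0. \<forall>n\<ge>1. real n * (\<integral>y. (if cmod y > A / sqrt (real (K n)) then (cmod y)^2 else 0) \<partial>sparse_law al (p n) (c n)) <= dl"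
  using A(1) by blast
qed (rule K_lim)
thus ?thesis unfolding p_def c_def .
qed

section \<open>Convergence in probability\<close>

lemma (in sparse_laws) spectral_radius_tendsto:
fixes Y :: "nat => 'w => real" and M :: "nat => 'w measure"
assumes Y: "!!n. Y n : bmeas (M n)"
 and f: "!!n. n >= 1 ==> f n : measurable (M n) (matrix_law (mu n) n)"
 and d: "!!n. n >= 1 ==> distr (M n) (matrix_law (mu n) n) (f n) = matrix_law (mu n) n"
 and eq: "!!n w. n >= 1 ==> Y n w = spectral_radius (mat n n (%(i, j). f n w i j))"
 and M: "!!n. prob_space (M n)"
shows "tendsto_in_probability M Y 1" unfolding tendsto_in_probability_def
proof (intro conjI allI impI Y)
fix eps :: real assume eps: "eps > 0"
show "(%n. measure (M n) {om : space (M n). \<bar>Y n om - 1\<bar> > eps}) \<longlonglongrightarrow> 0"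
proof (rule order_tendstoI)
 fix dl :: real assume dl: "0 < dl"
 \<comment> \<open>\<open>spectral_radius_lower\<close> needs a deviation below 1; a smaller
   deviation only enlarges the exceptional event.\<close>
 let ?e = "min eps (1 / 2)"
 have e: "0 < ?e" "?e < 1" using eps by auto
 have p: "dl / 3 > 0" using dl by simp
 show "\<forall>\<^sub>F n in sequentially. measure (M n) {om : space (M n). \<bar>Y n om - 1\<bar> > eps} < dl"
  using spectral_radius_upper[OF eps p] spectral_radius_lower[OF e p] eventually_ge_at_top[of 1]
 proof eventually_elim
  case (elim n)
  interpret M: prob_space "M n" by (rule M)
  obtain A where A: "A : sets (matrix_law (mu n) n)" "Pr n A <= dl / 3"
   "{x : Om n. spectral_radius (mat n n (%(i, j). x i j)) > 1 + eps} <= A" using elim(1) by blast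
  obtain B where B: "B : sets (matrix_law (mu n) n)" "Pr n B <= dl / 3"
   "{x : Om n. spectral_radius (mat n n (%(i, j). x i j)) <= 1 - ?e} <= B" using elim(2) by blast
  have pull: "f n -` C \<inter> space (M n) : M.events" "M.prob (f n -` C \<inter> space (M n)) = Pr n C"
   if C: "C : sets (matrix_law (mu n) n)" for C
   using measurable_sets[OF f[OF elim(3)] C] measure_distr[OF f[OF elim(3)] C] unfolding d[OF elim(3)] by auto
  have "{om : space (M n). \<bar>Y n om - 1\<bar> > eps} <= (f n -` A \<inter> space (M n)) \<union> (f n -` B \<inter> space (M n))"
  proof
   fix w assume w: "w : {om : space (M n). \<bar>Y n om - 1\<bar> > eps}"
   have "f n w : Om n" using w measurable_space[OF f[OF elim(3)]] by blast
   moreover have "Y n w > 1 + eps | Y n w <= 1 - ?e" using w by auto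
   ultimately have "f n w : A \<union> B" using A(3) B(3) unfolding eq[OF elim(3)] by blast
   thus "w : (f n -` A \<inter> space (M n)) \<union> (f n -` B \<inter> space (M n))" using w by blast
  qed
  hence "M.prob {om : space (M n). \<bar>Y n om - 1\<bar> > eps} <= M.prob ((f n -` A \<inter> space (M n)) \<union> (f n -` B \<inter> space (M n)))"
   by (rule M.finite_measure_mono) (intro sets.Un pull A B)
  also have "... <= Pr n A + Pr n B"
   using measure_Un_le[OF pull(1)[OF A(1)] pull(1)[OF B(1)]] unfolding pull(2)[OF A(1)] pull(2)[OF B(1)] .
  finally show ?case using A(2) B(2) dl by linarith
 qed
next
 fix a :: real assume "a < 0"
 thus "\<forall>\<^sub>F n in sequentially. a < measure (M n) {om : space (M n). \<bar>Y n om - 1\<bar> > eps}"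
  by (intro always_eventually allI less_le_trans[OF _ measure_nonneg])
qed
qed

theorem theorem1p4:
  fixes N :: "'b measure" and chi :: "'b \<Rightarrow> complex"
    and M :: "nat \<Rightarrow> 'a measure"
    and A B :: "nat \<Rightarrow> nat \<Rightarrow> nat \<Rightarrow> 'a \<Rightarrow> complex"
    and K :: "nat \<Rightarrow> nat"
  assumes "prob_space N"
    and "integrable N chi" and "integral\<^sup>L N chi = 0"
    and "integrable N (\<lambda>x. (cmod (chi x))\<^sup>2)" and "(\<integral>x. (cmod (chi x))\<^sup>2 \<partial>N) = 1"
    and "\<And>n. prob_space (M n)"
    and "\<And>n. n \<ge> 1 \<Longrightarrow> 1 \<le> K n \<and> K n \<le> n"
    and "\<And>n. n \<ge> 1 \<Longrightarrow>
           prob_space.indep_vars (M n) (\<lambda>_. borel) (\<lambda>(i, j). A n i j) (positions n)"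
    and "\<And>n i j. n \<ge> 1 \<Longrightarrow> i < n \<Longrightarrow> j < n \<Longrightarrow>
           distr (M n) borel (A n i j) = distr N borel chi"
    and "\<And>n. n \<ge> 1 \<Longrightarrow>
           prob_space.indep_vars (M n) (\<lambda>_. borel) (\<lambda>(i, j). B n i j) (positions n)"
    and "\<And>n i j. n \<ge> 1 \<Longrightarrow> i < n \<Longrightarrow> j < n \<Longrightarrow>
           distr (M n) borel (B n i j)
             = distr (measure_pmf (bernoulli_pmf (real (K n) / real n))) borel of_bool"
    and "\<And>n. n \<ge> 1 \<Longrightarrow>
           prob_space.indep_var (M n)
             (PiM (positions n) (\<lambda>_. borel)) (\<lambda>\<omega>. \<lambda>(i, j)\<in>positions n. A n i j \<omega>)
             (PiM (positions n) (\<lambda>_. borel)) (\<lambda>\<omega>. \<lambda>(i, j)\<in>positions n. B n i j \<omega>)"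
    and "filterlim K at_top sequentially"
  shows "tendsto_in_probability M
           (\<lambda>n \<omega>. spectral_radius
              (sparse_matrix n (K n) (\<lambda>i j. A n i j \<omega>) (\<lambda>i j. B n i j \<omega>))) 1"
proof -
note chi = assms(2-5) and M = assms(6) and K = assms(7) and A = assms(8, 9) and B = assms(10, 11) and AB = assms(12)
have chim: "chi : bmeas N" using chi(1) by (rule borel_measurable_integrable)
define al where "al = distr N borel chi"
define h where "h n = (%(a, b). complex_of_real (1 / sqrt (real (K n))) * b * a)" for n
define mu where "mu n = sparse_law al (real (K n) / real n) (1 / sqrt (real (K n)))" for n
define X where "X n = (%(i, j). A n i j)" for n
define Y where "Y n = (%(i, j). B n i j)" for n
have al: "prob_space al" "sets al = sets borel" unfolding al_def by (rule prob_space.prob_space_distr[OF assms(1) chim]) simp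
have "sparse_laws (%n. sparse_law al (real (K n) / real n) (1 / sqrt (real (K n)))) K"
proof (rule sparse_laws_sparse_law[OF al])
 show "integrable al (%y. y)" unfolding al_def using chi(1) by (subst integrable_distr_eq[OF chim]) auto
 show "(LINT y|al. y) = 0" unfolding al_def using chi(2) by (subst integral_distr[OF chim]) auto
 show "integrable al (%y. (cmod y)^2)" unfolding al_def using chi(3) by (subst integrable_distr_eq[OF chim]) auto
 show "(LINT y|al. (cmod y)^2) = 1" unfolding al_def using chi(4) by (subst integral_distr[OF chim]) auto
 show "1 <= K n & K n <= n" if "n >= 1" for n using K[OF that] .
 show "filterlim K at_top sequentially" by (rule assms(13))
qed
hence laws: "sparse_laws mu K" unfolding mu_def .
interpret sparse_laws mu K by (rule laws)
have am: "A n i j : bmeas (M n)" and bm: "B n i j : bmeas (M n)" if "n >= 1" "i < n" "j < n" for n i j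
proof -
 interpret M: prob_space "M n" by (rule M)
 have "(i, j) : positions n" using that by (simp add: positions_def)
 hence "(%(i, j). A n i j) (i, j) : bmeas (M n)" "(%(i, j). B n i j) (i, j) : bmeas (M n)"
  using A(1)[OF that(1)] B(1)[OF that(1)] unfolding M.indep_vars_def by blast+
 thus "A n i j : bmeas (M n)" "B n i j : bmeas (M n)" by simp_all
qed
define g where "g n om = (\<lambda>p\<in>positions n. h n (X n p om, Y n p om))" for n om
define f where "f n om = nest n (g n om)" for n om
have flat: "g n : measurable (M n) (PiM (positions n) (%_. mu n)) &
 distr (M n) (PiM (positions n) (%_. mu n)) (g n) = PiM (positions n) (%_. mu n)" if n: "n >= 1" for n
proof
 interpret M: prob_space "M n" by (rule M)
 interpret law: entry_law "mu n" n by (rule law[OF n])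
 have mun: "mu n = distr (al \<Otimes>\<^sub>M distr (measure_pmf (bernoulli_pmf (real (K n) / real n))) borel of_bool) borel (h n)"
  by (simp add: mu_def sparse_law_def h_def)
 have hm: "h n : bmeas (borel \<Otimes>\<^sub>M borel)" unfolding h_def by measurable
 show "distr (M n) (PiM (positions n) (%_. mu n)) (g n) = PiM (positions n) (%_. mu n)" unfolding mun g_def
 proof (rule M.distr_products)
  show "finite (positions n)" by (simp add: positions_def)
  have "(0, 0) : positions n" using n by (simp add: positions_def)
  thus "positions n ~= {}" by blast
  show "M.indep_vars (%_. borel) (X n) (positions n)" "M.indep_vars (%_. borel) (Y n) (positions n)"
   unfolding X_def Y_def by (rule A(1)[OF n] B(1)[OF n])+
  show "distr (M n) borel (X n q) = al" if "q : positions n" for q using that A(2)[OF n] by (auto simp: positions_def X_def al_def)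
  show "distr (M n) borel (Y n q) = distr (measure_pmf (bernoulli_pmf (real (K n) / real n))) borel of_bool" if "q : positions n" for q
   using that B(2)[OF n] by (auto simp: positions_def Y_def)
  have "(%om. \<lambda>q\<in>positions n. X n q om) = (%om. \<lambda>(i, j)\<in>positions n. A n i j om)"
   "(%om. \<lambda>q\<in>positions n. Y n q om) = (%om. \<lambda>(i, j)\<in>positions n. B n i j om)"
   by (auto simp: X_def Y_def split_beta' restrict_def)
  thus "M.indep_var (PiM (positions n) (%_. borel)) (%om. \<lambda>q\<in>positions n. X n q om)
   (PiM (positions n) (%_. borel)) (%om. \<lambda>q\<in>positions n. Y n q om)" using AB[OF n] by simp
 qed (rule hm)
 show "g n : measurable (M n) (PiM (positions n) (%_. mu n))" unfolding g_def
 proof (rule measurable_restrict)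
  fix q assume q: "q : positions n"
  obtain i j where ij: "q = (i, j)" "i < n" "j < n" using q by (auto simp: positions_def)
  have "(%om. h n (X n q om, Y n q om)) : bmeas (M n)"
   unfolding ij X_def Y_def split by (rule measurable_compose[OF measurable_Pair[OF am[OF n ij(2,3)] bm[OF n ij(2,3)]] hm])
  thus "(%om. h n (X n q om, Y n q om)) : measurable (M n) (mu n)" using measurable_cong_sets[OF refl law.sets_mu] by blast
 qed
qed
show ?thesis
proof (rule spectral_radius_tendsto[where f = f])
 fix n :: nat assume n: "n >= 1"
 interpret law: entry_law "mu n" n by (rule law[OF n])
 note nest = distr_nest[OF law.prob law.n_pos]
 show "f n : measurable (M n) (matrix_law (mu n) n)" unfolding f_def by (rule measurable_compose[OF conjunct1[OF flat[OF n]] nest(1)])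
 have fn: "f n = nest n \<circ> g n" by (rule ext) (simp add: f_def)
 have "distr (M n) (matrix_law (mu n) n) (f n) = distr (distr (M n) (PiM (positions n) (%_. mu n)) (g n)) (matrix_law (mu n) n) (nest n)"
  unfolding fn by (rule distr_distr[OF nest(1) conjunct1[OF flat[OF n]], symmetric])
 thus "distr (M n) (matrix_law (mu n) n) (f n) = matrix_law (mu n) n" unfolding conjunct2[OF flat[OF n]] nest(2) .
 fix om
 show "spectral_radius (sparse_matrix n (K n) (%i j. A n i j om) (%i j. B n i j om)) = spectral_radius (mat n n (%(i, j). f n om i j))"
  unfolding sparse_matrix_def
  by (rule arg_cong[where f = spectral_radius], rule cong_mat) (auto simp: f_def nest_def g_def positions_def h_def X_def Y_def)
next
 fix n
 show "(%om. spectral_radius (sparse_matrix n (K n) (%i j. A n i j om) (%i j. B n i j om))) : bmeas (M n)"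
 proof (cases "n = 0")
  case True
  \<comment> \<open>For n = 0 the hypotheses say nothing about the entries, but there is only one
    matrix of size 0, so the function is constant.\<close>
  have "mat 0 0 u = mat 0 0 (%_. 0)" for u :: "nat \<times> nat => complex" by (rule eq_matI) auto
  hence "(%om. spectral_radius (sparse_matrix n (K n) (%i j. A n i j om) (%i j. B n i j om))) = (%_. spectral_radius (mat 0 0 (%_. 0)))"
   unfolding True sparse_matrix_def by (intro ext arg_cong[where f = spectral_radius])
  thus ?thesis by (simp only: borel_measurable_const)
 next
  case False
  thus ?thesis unfolding sparse_matrix_def by (intro measurable_spectral_radius borel_measurable_times borel_measurable_const am bm) auto
 qed
qed (rule M)
qed

end
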